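(* Let $\mathbb{K}$ be a field, $R_n=\mathbb{K}[x_1,\dots,x_n]$, let $(C_n,\Pi)$ be any parcycle with $\Pi=\{V_1,\dots,V_k\}$, and let $M_\Pi$ be any $G$-parking function ideal of $(C_n,\Pi)$, say with sink $V_k$. Then there exists a Gröbner degeneration $R_n[t]/I_{\Pi,t}$ of $R_n/I_\Pi$ to $R_n/M_\Pi$, with respect to some weight vector $\lambda\in\mathbb{N}^n$ satisfying $\lambda\cdot b_{V_i}>0$ for all $V_i\ne V_k$, such that the complex $\mathcal{F}_{t,\Pi}$ (built from $\lambda$) is a minimal free resolution of $R_n[t]/I_{\Pi,t}$ over $R_n[t]$.
   Context: $\mathbb{N}$ contains $0$. **Parcycles and ideals.** For $n\ge3$, $C_n$ is the cycle with vertices $1,\dots,n$ and edges $\{i,i+1\}$ ($1\le i\le n-1$), $\{1,n\}$. A parcycle $(C_n,\Pi)$ is $C_n$ with a partition $\Pi=\{V_1,\dots,V_k\}$ of its vertex set such that every $V_i$ induces a connected subgraph; the $V_i$ are the main vertices. A connected-parset is a nonempty union of main vertices inducing a connected subgraph. For a union $S$ of main vertices with complement $\overline S$, $\mathbf{x}^{S\to\overline S}=\prod_{i\in S}x_i^{d_i}$, $d_i$ being the number of edges from $i$ to $\overline S$. Let $b_j\in\mathbb{Z}^n$ be the $j$-th row of the Laplacian matrix of $C_n$ (degree matrix minus adjacency matrix), $b_{V_i}=\sum_{j\in V_i}b_j$, and $L_\Pi\subset\mathbb{Z}^n$ the lattice generated by $b_{V_1},\dots,b_{V_k}$. The toppling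 ideal is $I_\Pi=\langle\mathbf{x}^{\mathbf{u}}-\mathbf{x}^{\mathbf{v}}:\mathbf{u},\mathbf{v}\in\mathbb{N}^n,\mathbf{u}-\mathbf{v}\in L_\Pi\rangle$. The $G$-parking function ideal with sink $V_k$ is $M_\Pi=\langle\mathbf{x}^{S\to\overline S}: S\text{ a connected-parset not containing }V_k\rangle$. **Acyclic partitions.** A connected $j$-partition of $(C_n,\Pi)$ is a partition $\tilde\Pi=\{W_1,\dots,W_j\}$ of $V(C_n)$ into connected-parsets. The multigraph $(C_n)_{\tilde\Pi}$ has vertex set $\tilde\Pi$, the number of edges between $W_s\neq W_l$ being the number of edges of $C_n$ between them. An acyclic $j$-partition is a pair $\mathcal{C}=(\tilde\Pi,\mathcal{O})$ with $\mathcal{O}$ an acyclic orientation of $(C_n)_{\tilde\Pi}$; parallel edges have the same direction and are treated as one directed edge. It is $V_k$-acyclic if $\mathcal{O}$ has a unique sink, namely the block containing $V_k$. For $i\in W_s$, $\mathrm{out}_{\mathcal{C}}(i)$ is the number of edges of $C_n$ from $i$ to blocks $W_l$ with $(W_s,W_l)$ a directed edge of $\mathcal{C}$; $D(\mathcal{C})=(\mathrm{out}_{\mathcal{C}}(i))_i\in\mathbb{Z}^n$. A directed edge $f=(U,W)$ of $\mathcal{C}$ is contractible if merging $U$ and $W$ (keeping the other orientations) gives an acyclic partition, denoted $\mathcal{C}/f$. **Classes and signs.** Two acyclic $j$-partitions are chip firing equivalent if they have the same underlying $\tilde\Pi$ and their outdegree vectors in $\mathbb{Z}^{\tilde\Pi}$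 (as orientations of the multigraph $(C_n)_{\tilde\Pi}$) differ by an element of the Laplacian lattice of $(C_n)_{\tilde\Pi}$. Every class $\mathbf{c}$ contains a unique $V_k$-acyclic element. A contractible edge of $\mathbf{c}$ is a directed edge $f=(U,W)$ contractible in some $\mathcal{C}\in\mathbf{c}$; the class $\mathbf{c}/f:=[\mathcal{C}/f]$ and the monomial $m_{\mathbf{c}}(f)=\mathbf{x}^{D(\mathcal{C})-D(\mathcal{C}/f)}=\prod_{i\in U}x_i^{\#\{\text{edges from }i\text{ to }W\}}$ do not depend on $\mathcal{C}$. Fix signs $\mathrm{sign}_{\mathbf{c}}(f)\in\{1,-1\}$ for all $\mathbf{c}$ and contractible $f$ with: (i) $\mathrm{sign}_{\mathbf{c}}(f_1)\mathrm{sign}_{\mathbf{c}/f_1}(f_2)=-\mathrm{sign}_{\mathbf{c}}(f_2)\mathrm{sign}_{\mathbf{c}/f_2}(f_1)$ for distinct contractible edges $f_1,f_2$ of $\mathbf{c}$ (whenever $f_2$ is contractible in $\mathbf{c}/f_1$ and $f_1$ in $\mathbf{c}/f_2$); (ii) $\mathrm{sign}_{\mathbf{c}}((U,W))=-\mathrm{sign}_{\mathbf{c}}((W,U))$ if both are contractible in $\mathbf{c}$. Such signs exist. **The complex $\mathcal{F}_{t,\Pi}$.** Given $\lambda\in\mathbb{N}^n$ with $\lambda\cdot b_{V_i}>0$ for $V_i\neq V_k$, set $\epsilon_{\mathbf{c}}=\lambda\cdot D(\mathcal{C})$ where $\mathcal{C}$ is the $V_k$-acyclic element of $\mathbf{c}$.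 In homological degree $j$ ($0\le j\le k-1$), $\mathcal{F}_{t,\Pi}$ is the free $R_n[t]$-module with basis $\tilde e_{\mathbf{c}}$ indexed by the chip firing classes of acyclic $(j+1)$-partitions of $(C_n,\Pi)$, with differential $$\delta_{t,j}(\tilde e_{\mathbf{c}})=\sum_f\mathrm{sign}_{\mathbf{c}}(f)\,t^{\,\epsilon_{\mathbf{c}}-\epsilon_{\mathbf{c}/f}-w(f)}\,m_{\mathbf{c}}(f)\,\tilde e_{\mathbf{c}/f},$$ the sum over contractible edges $f$ of $\mathbf{c}$, with $w(f)$ the $\lambda$-weight of the monomial $m_{\mathbf{c}}(f)$. **Gröbner degeneration.** For $g=\sum a_{\mathbf{u}}\mathbf{x}^{\mathbf{u}}$ let $g^h=t^mg(t^{-\lambda_1}x_1,\dots,t^{-\lambda_n}x_n)$, $m=\max\{\mathbf{u}\cdot\lambda:a_{\mathbf{u}}\neq0\}$; $I_{\Pi,t}=\langle g^h:g\in I_\Pi\rangle\subset R_n[t]$. It is a Gröbner degeneration of $R_n/I_\Pi$ to $R_n/M_\Pi$ if $M_\Pi$ is the initial ideal of $I_\Pi$ with respect to $\lambda$, i.e. $R_n[t]/(I_{\Pi,t}+\langle t\rangle)=R_n/M_\Pi$. Minimal means that all entries of the differentials lie in $\langle x_1,\dots,x_n,t\rangle$. *)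

theory Defs
  imports
    "HOL-Library.Disjoint_Sets"
    "HOL-Library.Poly_Mapping"
    "HOL-Computational_Algebra.Polynomial"
    "HOL-Algebra.QuotRing"
    "HOL-Algebra.Module"
begin

section \<open>Integer lattices and Laplacians\<close>

text \<open>The subgroup generated by a finite set \<open>B\<close> of integer vectors indexed by \<^typ>\<open>'v\<close>.\<close>

definition int_span :: "('v \<Rightarrow> int) set \<Rightarrow> ('v \<Rightarrow> int) set" where
  "int_span B = {u. \<exists>c :: ('v \<Rightarrow> int) \<Rightarrow> int. u = (\<lambda>x. \<Sum>b\<in>B. c b * b x)}"

text \<open>Row \<open>v\<close> of the Laplacian matrix of the loopless multigraph on the finite vertex set \<open>V\<close>
  with \<open>mu v w\<close> edges between \<open>v \<noteq> w\<close> (the diagonal values of \<open>mu\<close> are ignored).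
  Vectors are extended by zero outside \<open>V\<close>.\<close>

definition laplacian :: "'v set \<Rightarrow> ('v \<Rightarrow> 'v \<Rightarrow> nat) \<Rightarrow> 'v \<Rightarrow> 'v \<Rightarrow> int" where
  "laplacian V mu v w =
    (if v \<notin> V \<or> w \<notin> V then 0
     else if v = w then (\<Sum>u\<in>V - {v}. int (mu v u))
     else - int (mu v w))"


section \<open>Parcycles\<close>

definition cycle_edges :: "nat \<Rightarrow> nat set set" where
  "cycle_edges n = {{i, i + 1} | i. 1 \<le> i \<and> i \<le> n - 1} \<union> {{1, n}}"

definition induces_connected :: "nat \<Rightarrow> nat set \<Rightarrow> bool" where
  "induces_connected n S \<longleftrightarrow>
    (\<forall>u\<in>S. \<forall>v\<in>S. (u, v) \<in> {(a, b). a \<in> S \<and> b \<in> S \<and> {a, b} \<in> cycle_edges n}\<^sup>*)"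

text \<open>The number of edges of the cycle from the vertex \<open>i\<close> to the vertex set \<open>S\<close>.\<close>

definition edges_to :: "nat \<Rightarrow> nat \<Rightarrow> nat set \<Rightarrow> nat" where
  "edges_to n i S = card {j \<in> S. {i, j} \<in> cycle_edges n}"

text \<open>The number of edges of the cycle between two disjoint vertex sets.\<close>

definition edges_between :: "nat \<Rightarrow> nat set \<Rightarrow> nat set \<Rightarrow> nat" where
  "edges_between n U W = card {e \<in> cycle_edges n. \<exists>i\<in>U. \<exists>j\<in>W. e = {i, j}}"

definition parcycle :: "nat \<Rightarrow> nat set set \<Rightarrow> bool" where
  "parcycle n \<P> \<longleftrightarrow> n \<ge> 3 \<and> partition_on {1..n} \<P> \<and> (\<forall>V\<in>\<P>. induces_connected n V)"

definition connected_parset :: "nat \<Rightarrow> nat set set \<Rightarrow> nat set \<Rightarrow> bool" where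
  "connected_parset n \<P> S \<longleftrightarrow> S \<noteq> {} \<and> (\<exists>A\<subseteq>\<P>. S = \<Union>A) \<and> induces_connected n S"

definition brow :: "nat \<Rightarrow> nat \<Rightarrow> nat \<Rightarrow> int" where
  "brow n j = laplacian {1..n} (\<lambda>i l. if {i, l} \<in> cycle_edges n then 1 else 0) j"

definition bvec :: "nat \<Rightarrow> nat set \<Rightarrow> nat \<Rightarrow> int" where
  "bvec n V = (\<lambda>i. \<Sum>j\<in>V. brow n j i)"

definition par_lattice :: "nat \<Rightarrow> nat set set \<Rightarrow> (nat \<Rightarrow> int) set" where
  "par_lattice n \<P> = int_span (bvec n ` \<P>)"


section \<open>The polynomial rings\<close>

text \<open>A polynomial is a finitely supported function from monomials (finitely supported exponent
  functions, the variable \<open>x\<^sub>i\<close> having index \<open>i\<close>) to coefficients. The ring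
  \<open>K[x\<^sub>1,\<dots>,x\<^sub>n]\<close> consists of those involving only variables with index in \<open>{1..n}\<close>,
  and \<open>K[x\<^sub>1,\<dots>,x\<^sub>n][t]\<close> of the univariate polynomials (in \<open>t\<close>) over it.\<close>

type_synonym 'a mpol = "(nat \<Rightarrow>\<^sub>0 nat) \<Rightarrow>\<^sub>0 'a"

definition Rn :: "nat \<Rightarrow> ('a::comm_ring_1) mpol ring" where
  "Rn n = \<lparr>carrier = {p. \<forall>m \<in> Poly_Mapping.keys p. Poly_Mapping.keys m \<subseteq> {1..n}},
    mult = (*), one = 1, zero = 0, add = (+)\<rparr>"

definition Rnt :: "nat \<Rightarrow> ('a::comm_ring_1) mpol poly ring" where
  "Rnt n = \<lparr>carrier = {p. \<forall>i. Polynomial.coeff p i \<in> carrier (Rn n)},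
    mult = (*), one = 1, zero = 0, add = (+)\<rparr>"

definition X :: "nat \<Rightarrow> ('a::comm_ring_1) mpol" where
  "X i = Poly_Mapping.single (Poly_Mapping.single i 1) 1"

definition tvar :: "('a::comm_ring_1) mpol poly" where
  "tvar = [:0, 1:]"

text \<open>Vectors in \<open>\<nat>\<^sup>n\<close> are functions vanishing outside \<open>{1..n}\<close>.\<close>

definition natvecs :: "nat \<Rightarrow> (nat \<Rightarrow> nat) set" where
  "natvecs n = {u. \<forall>i. i \<notin> {1..n} \<longrightarrow> u i = 0}"

definition xmon :: "nat \<Rightarrow> (nat \<Rightarrow> nat) \<Rightarrow> ('a::comm_ring_1) mpol" where
  "xmon n u = (\<Prod>i\<in>{1..n}. X i ^ u i)"

definition wt :: "nat \<Rightarrow> (nat \<Rightarrow> nat) \<Rightarrow> (nat \<Rightarrow> nat) \<Rightarrow> nat" where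
  "wt n lam u = (\<Sum>i\<in>{1..n}. lam i * u i)"


section \<open>Toppling ideal and parking function ideal\<close>

definition toppling_ideal :: "nat \<Rightarrow> nat set set \<Rightarrow> ('a::comm_ring_1) mpol set" where
  "toppling_ideal n \<P> = genideal (Rn n)
    {xmon n u - xmon n v | u v.
      u \<in> natvecs n \<and> v \<in> natvecs n \<and> (\<lambda>i. int (u i) - int (v i)) \<in> par_lattice n \<P>}"

definition cut_exponent :: "nat \<Rightarrow> nat set \<Rightarrow> nat \<Rightarrow> nat" where
  "cut_exponent n S = (\<lambda>i. if i \<in> S then edges_to n i ({1..n} - S) else 0)"

definition parking_ideal :: "nat \<Rightarrow> nat set set \<Rightarrow> nat set \<Rightarrow> ('a::comm_ring_1) mpol set" where
  "parking_ideal n \<P> V = genideal (Rn n)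
    {xmon n (cut_exponent n S) | S. connected_parset n \<P> S \<and> \<not> V \<subseteq> S}"


section \<open>Groebner degenerations\<close>

definition max_wt :: "nat \<Rightarrow> (nat \<Rightarrow> nat) \<Rightarrow> ('a::comm_ring_1) mpol \<Rightarrow> nat" where
  "max_wt n lam g = Max ((\<lambda>u. wt n lam (Poly_Mapping.lookup u)) ` Poly_Mapping.keys g)"

text \<open>For nonzero \<open>g = \<Sum> a\<^sub>u x\<^sup>u\<close> of maximal weight \<open>m\<close>, replacing each \<open>x\<^sub>i\<close> in
  \<open>t\<^sup>m g\<close> by \<open>x\<^sub>i / t ^ lam i\<close> gives \<open>\<Sum> a\<^sub>u t\<^bsup>m - lam\<cdot>u\<^esup> x\<^sup>u\<close>; the subtraction below is
  never truncated.\<close>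

definition homogenize :: "nat \<Rightarrow> (nat \<Rightarrow> nat) \<Rightarrow> ('a::comm_ring_1) mpol \<Rightarrow> 'a mpol poly" where
  "homogenize n lam g = (\<Sum>u\<in>Poly_Mapping.keys g.
     Polynomial.monom (Poly_Mapping.single u (Poly_Mapping.lookup g u))
       (max_wt n lam g - wt n lam (Poly_Mapping.lookup u)))"

definition initial_form :: "nat \<Rightarrow> (nat \<Rightarrow> nat) \<Rightarrow> ('a::comm_ring_1) mpol \<Rightarrow> 'a mpol" where
  "initial_form n lam g =
    (\<Sum>u\<in>{u \<in> Poly_Mapping.keys g. wt n lam (Poly_Mapping.lookup u) = max_wt n lam g}.
       Poly_Mapping.single u (Poly_Mapping.lookup g u))"

definition initial_ideal ::
  "nat \<Rightarrow> (nat \<Rightarrow> nat) \<Rightarrow> ('a::comm_ring_1) mpol set \<Rightarrow> 'a mpol set" where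
  "initial_ideal n lam I = genideal (Rn n) {initial_form n lam g | g. g \<in> I \<and> g \<noteq> 0}"

definition homogenized_ideal ::
  "nat \<Rightarrow> (nat \<Rightarrow> nat) \<Rightarrow> ('a::comm_ring_1) mpol set \<Rightarrow> 'a mpol poly set" where
  "homogenized_ideal n lam I = genideal (Rnt n) {homogenize n lam g | g. g \<in> I \<and> g \<noteq> 0}"

text \<open>The second conjunct says that the surjection \<open>R[t] \<rightarrow> R/M\<close>, which sets \<open>t = 0\<close> and
  reduces modulo \<open>M\<close>, has kernel \<open>I\<^sub>t + \<langle>t\<rangle>\<close>, i.e. \<open>R[t]/(I\<^sub>t + \<langle>t\<rangle>) = R/M\<close>.\<close>

definition groebner_degeneration ::
  "nat \<Rightarrow> (nat \<Rightarrow> nat) \<Rightarrow> ('a::comm_ring_1) mpol set \<Rightarrow> 'a mpol set \<Rightarrow> bool" where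
  "groebner_degeneration n lam I M \<longleftrightarrow>
    initial_ideal n lam I = M \<and>
    set_add (Rnt n) (homogenized_ideal n lam I) (genideal (Rnt n) {tvar}) =
      {p \<in> carrier (Rnt n). Polynomial.coeff p 0 \<in> M}"


section \<open>Acyclic partitions\<close>

text \<open>An acyclic partition is a pair \<open>(Q, D)\<close> of a set \<open>Q\<close> of blocks and a set \<open>D\<close> of directed
  edges; a bundle of parallel edges between two blocks is one directed edge.\<close>

type_synonym block = "nat set"
type_synonym dedge = "block \<times> block"
type_synonym opart = "block set \<times> dedge set"

definition connected_partition :: "nat \<Rightarrow> nat set set \<Rightarrow> block set \<Rightarrow> bool" where
  "connected_partition n \<P> Q \<longleftrightarrow> partition_on {1..n} Q \<and> (\<forall>W\<in>Q. connected_parset n \<P> W)"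

definition orientation :: "nat \<Rightarrow> block set \<Rightarrow> dedge set \<Rightarrow> bool" where
  "orientation n Q D \<longleftrightarrow>
    (\<forall>(U, W)\<in>D. U \<in> Q \<and> W \<in> Q \<and> U \<noteq> W \<and> edges_between n U W > 0) \<and>
    (\<forall>U\<in>Q. \<forall>W\<in>Q. U \<noteq> W \<and> edges_between n U W > 0 \<longrightarrow> ((U, W) \<in> D \<longleftrightarrow> (W, U) \<notin> D))"

definition acyclic_partition :: "nat \<Rightarrow> nat set set \<Rightarrow> opart \<Rightarrow> bool" where
  "acyclic_partition n \<P> C \<longleftrightarrow>
    connected_partition n \<P> (fst C) \<and> orientation n (fst C) (snd C) \<and> acyclic (snd C)"

text \<open>The block containing \<open>V\<close> is a sink, and it is the only one.\<close>

definition sink_acyclic :: "nat set \<Rightarrow> opart \<Rightarrow> bool" where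
  "sink_acyclic V C \<longleftrightarrow> (\<forall>U\<in>fst C. (\<forall>W. (U, W) \<notin> snd C) \<longleftrightarrow> V \<subseteq> U)"

definition outvec :: "nat \<Rightarrow> opart \<Rightarrow> nat \<Rightarrow> nat" where
  "outvec n C i = card {j. {i, j} \<in> cycle_edges n \<and> (\<exists>(U, W)\<in>snd C. i \<in> U \<and> j \<in> W)}"

definition merge_block :: "dedge \<Rightarrow> block \<Rightarrow> block" where
  "merge_block f B = (if B = fst f \<or> B = snd f then fst f \<union> snd f else B)"

text \<open>The edge \<open>g\<close> after contraction of \<open>f\<close>.\<close>

definition merge_edge :: "dedge \<Rightarrow> dedge \<Rightarrow> dedge" where
  "merge_edge f g = (merge_block f (fst g), merge_block f (snd g))"

definition contract :: "opart \<Rightarrow> dedge \<Rightarrow> opart" where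
  "contract C f = (merge_block f ` fst C, {g \<in> merge_edge f ` snd C. fst g \<noteq> snd g})"

definition contractible :: "nat \<Rightarrow> nat set set \<Rightarrow> opart \<Rightarrow> dedge \<Rightarrow> bool" where
  "contractible n \<P> C f \<longleftrightarrow> f \<in> snd C \<and> acyclic_partition n \<P> (contract C f)"


section \<open>Chip firing classes and signs\<close>

definition block_outdeg :: "nat \<Rightarrow> opart \<Rightarrow> block \<Rightarrow> int" where
  "block_outdeg n C U = (\<Sum>W\<in>{W. (U, W) \<in> snd C}. int (edges_between n U W))"

definition chip_rel :: "nat \<Rightarrow> nat set set \<Rightarrow> (opart \<times> opart) set" where
  "chip_rel n \<P> = {(C, C'). acyclic_partition n \<P> C \<and> acyclic_partition n \<P> C' \<and>
     fst C = fst C' \<and>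
     (\<lambda>U. block_outdeg n C U - block_outdeg n C' U)
       \<in> int_span (laplacian (fst C) (edges_between n) ` fst C)}"

definition chip_classes :: "nat \<Rightarrow> nat set set \<Rightarrow> nat \<Rightarrow> opart set set" where
  "chip_classes n \<P> j = {C. acyclic_partition n \<P> C \<and> card (fst C) = j} // chip_rel n \<P>"

definition contractible_edges :: "nat \<Rightarrow> nat set set \<Rightarrow> opart set \<Rightarrow> dedge set" where
  "contractible_edges n \<P> c = {f. \<exists>C\<in>c. contractible n \<P> C f}"

text \<open>The class \<open>c/f\<close>; it does not depend on the chosen representative.\<close>

definition contract_class :: "nat \<Rightarrow> nat set set \<Rightarrow> opart set \<Rightarrow> dedge \<Rightarrow> opart set" where
  "contract_class n \<P> c f =
    chip_rel n \<P> `` {contract (SOME C. C \<in> c \<and> contractible n \<P> C f) f}"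

definition edge_exponent :: "nat \<Rightarrow> dedge \<Rightarrow> nat \<Rightarrow> nat" where
  "edge_exponent n f = (\<lambda>i. if i \<in> fst f then edges_to n i (snd f) else 0)"

text \<open>In the first sign rule \<open>f2\<close> is regarded as an edge of \<open>c/f1\<close>, and \<open>f1\<close> as one of \<open>c/f2\<close>,
  via \<^const>\<open>merge_edge\<close>. If \<open>f2\<close> is the reverse of \<open>f1\<close>, its image is a loop, hence not
  contractible, and the rule does not apply.\<close>

definition valid_signs ::
  "nat \<Rightarrow> nat set set \<Rightarrow> (opart set \<Rightarrow> dedge \<Rightarrow> int) \<Rightarrow> bool" where
  "valid_signs n \<P> sg \<longleftrightarrow> (\<forall>j. \<forall>c\<in>chip_classes n \<P> j.
    (\<forall>f\<in>contractible_edges n \<P> c. sg c f \<in> {1, -1}) \<and>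
    (\<forall>f1\<in>contractible_edges n \<P> c. \<forall>f2\<in>contractible_edges n \<P> c.
       f1 \<noteq> f2 \<and>
       merge_edge f1 f2 \<in> contractible_edges n \<P> (contract_class n \<P> c f1) \<and>
       merge_edge f2 f1 \<in> contractible_edges n \<P> (contract_class n \<P> c f2) \<longrightarrow>
       sg c f1 * sg (contract_class n \<P> c f1) (merge_edge f1 f2) =
       - (sg c f2 * sg (contract_class n \<P> c f2) (merge_edge f2 f1))) \<and>
    (\<forall>U W. (U, W) \<in> contractible_edges n \<P> c \<and> (W, U) \<in> contractible_edges n \<P> c \<longrightarrow>
       sg c (U, W) = - sg c (W, U)))"


section \<open>Modules and free resolutions\<close>

text \<open>Only the additive and scalar structure of a module record is relevant; its fields
  \<^const>\<open>mult\<close> and \<^const>\<open>one\<close> are left unspecified.\<close>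

definition free_module :: "('r, 'm) ring_scheme \<Rightarrow> 'b set \<Rightarrow> ('r, 'b \<Rightarrow> 'r) module" where
  "free_module R B =
    \<lparr>carrier = {v. (\<forall>b\<in>B. v b \<in> carrier R) \<and> (\<forall>b. b \<notin> B \<longrightarrow> v b = \<zero>\<^bsub>R\<^esub>) \<and>
                  finite {b. v b \<noteq> \<zero>\<^bsub>R\<^esub>}},
     mult = undefined, one = undefined,
     zero = (\<lambda>b. \<zero>\<^bsub>R\<^esub>), add = (\<lambda>v w b. v b \<oplus>\<^bsub>R\<^esub> w b),
     smult = (\<lambda>r v b. r \<otimes>\<^bsub>R\<^esub> v b)\<rparr>"

definition basis_vec :: "('r, 'm) ring_scheme \<Rightarrow> 'b \<Rightarrow> 'b \<Rightarrow> 'r" where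
  "basis_vec R b = (\<lambda>b'. if b' = b then \<one>\<^bsub>R\<^esub> else \<zero>\<^bsub>R\<^esub>)"

text \<open>The quotient ring \<open>R/I\<close> as an \<open>R\<close>-module.\<close>

definition quotient_module :: "('r, 'm) ring_scheme \<Rightarrow> 'r set \<Rightarrow> ('r, 'r set) module" where
  "quotient_module R I =
    \<lparr>carrier = carrier (R Quot I), mult = mult (R Quot I), one = one (R Quot I),
     zero = zero (R Quot I), add = add (R Quot I),
     smult = (\<lambda>r A. (I +>\<^bsub>R\<^esub> r) \<otimes>\<^bsub>R Quot I\<^esub> A)\<rparr>"

definition mod_hom ::
  "('r, 'm) ring_scheme \<Rightarrow> ('r, 'b, 'p) module_scheme \<Rightarrow> ('r, 'c, 'q) module_scheme
    \<Rightarrow> ('b \<Rightarrow> 'c) set" where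
  "mod_hom R M N = {h \<in> carrier M \<rightarrow> carrier N.
    (\<forall>x\<in>carrier M. \<forall>y\<in>carrier M. h (x \<oplus>\<^bsub>M\<^esub> y) = h x \<oplus>\<^bsub>N\<^esub> h y) \<and>
    (\<forall>r\<in>carrier R. \<forall>x\<in>carrier M. h (r \<odot>\<^bsub>M\<^esub> x) = r \<odot>\<^bsub>N\<^esub> h x)}"

text \<open>The free modules \<open>F\<^sub>j\<close> on the bases \<open>B j\<close> with differentials \<open>d j : F\<^sub>j \<rightarrow> F\<^sub>j\<^sub>-\<^sub>1\<close> (\<open>j \<ge> 1\<close>) form
  a resolution of \<open>N\<close>: for some augmentation, the sequence
  \<open>\<dots> \<rightarrow> F\<^sub>2 \<rightarrow> F\<^sub>1 \<rightarrow> F\<^sub>0 \<rightarrow> N \<rightarrow> 0\<close> is exact.\<close>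

definition free_resolution ::
  "('r, 'm) ring_scheme \<Rightarrow> (nat \<Rightarrow> 'b set) \<Rightarrow> (nat \<Rightarrow> ('b \<Rightarrow> 'r) \<Rightarrow> ('b \<Rightarrow> 'r))
    \<Rightarrow> ('r, 'c) module \<Rightarrow> bool" where
  "free_resolution R B d N \<longleftrightarrow>
    (\<forall>j\<ge>1. d j \<in> mod_hom R (free_module R (B j)) (free_module R (B (j - 1)))) \<and>
    (\<forall>j\<ge>1. d (j + 1) ` carrier (free_module R (B (j + 1))) =
       a_kernel (free_module R (B j)) (free_module R (B (j - 1))) (d j)) \<and>
    (\<exists>aug \<in> mod_hom R (free_module R (B 0)) N.
       aug ` carrier (free_module R (B 0)) = carrier N \<and>
       d 1 ` carrier (free_module R (B 1)) = a_kernel (free_module R (B 0)) N aug)"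

text \<open>All matrix entries of the differentials lie in the ideal \<open>J\<close>.\<close>

definition minimal_complex ::
  "('r, 'm) ring_scheme \<Rightarrow> 'r set \<Rightarrow> (nat \<Rightarrow> 'b set) \<Rightarrow> (nat \<Rightarrow> ('b \<Rightarrow> 'r) \<Rightarrow> ('b \<Rightarrow> 'r)) \<Rightarrow> bool"
  where
  "minimal_complex R J B d \<longleftrightarrow>
    (\<forall>j\<ge>1. \<forall>b\<in>B j. \<forall>b'\<in>B (j - 1). d j (basis_vec R b) b' \<in> J)"

definition irrelevant_ideal :: "nat \<Rightarrow> ('a::comm_ring_1) mpol poly set" where
  "irrelevant_ideal n = genideal (Rnt n) ({[:X i:] | i. i \<in> {1..n}} \<union> {tvar})"


section \<open>The complex\<close>

definition class_eps :: "nat \<Rightarrow> (nat \<Rightarrow> nat) \<Rightarrow> nat set \<Rightarrow> opart set \<Rightarrow> nat" where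
  "class_eps n lam V c = wt n lam (outvec n (THE C. C \<in> c \<and> sink_acyclic V C))"

text \<open>The basis of \<open>F\<^sub>j\<close>; it is empty for \<open>j \<ge> k\<close>, the number of main vertices.\<close>

definition F_basis :: "nat \<Rightarrow> nat set set \<Rightarrow> nat \<Rightarrow> opart set set" where
  "F_basis n \<P> j = chip_classes n \<P> (j + 1)"

text \<open>The exponent of \<open>t\<close> is nonnegative if \<open>lam\<cdot>b\<^sub>U > 0\<close> for all \<open>U \<noteq> V\<close> in \<open>\<P>\<close>, so \<^const>\<open>nat\<close>
  does not truncate: turning a sink not containing \<open>V\<close> into a source increases the weight of
  \<^const>\<open>outvec\<close>, so the \<open>V\<close>-acyclic element has the largest weight in its class; and the
  \<open>V\<close>-acyclic element of \<open>c/f\<close>, with \<open>f\<close> reinserted, lies in \<open>c\<close>.\<close>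

definition F_coeff ::
  "nat \<Rightarrow> nat set \<Rightarrow> nat set set \<Rightarrow> (opart set \<Rightarrow> dedge \<Rightarrow> int) \<Rightarrow> (nat \<Rightarrow> nat)
    \<Rightarrow> opart set \<Rightarrow> dedge \<Rightarrow> ('a::comm_ring_1) mpol poly" where
  "F_coeff n V \<P> sg lam c f =
    of_int (sg c f)
    * tvar ^ nat (int (class_eps n lam V c) - int (class_eps n lam V (contract_class n \<P> c f))
                  - int (wt n lam (edge_exponent n f)))
    * [:xmon n (edge_exponent n f):]"

text \<open>The linear extension of
  \<open>e\<^sub>c \<mapsto> \<Sum>\<^sub>f F_coeff c f \<cdot> e\<^bsub>c/f\<^esub>\<close>, evaluated at the coordinate \<open>c'\<close>.\<close>

definition F_diff ::
  "nat \<Rightarrow> nat set \<Rightarrow> nat set set \<Rightarrow> (opart set \<Rightarrow> dedge \<Rightarrow> int) \<Rightarrow> (nat \<Rightarrow> nat) \<Rightarrow> nat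
    \<Rightarrow> (opart set \<Rightarrow> ('a::comm_ring_1) mpol poly) \<Rightarrow> (opart set \<Rightarrow> 'a mpol poly)" where
  "F_diff n V \<P> sg lam j v = (\<lambda>c'. \<Sum>c\<in>F_basis n \<P> j. v c *
     (\<Sum>f\<in>contractible_edges n \<P> c.
        F_coeff n V \<P> sg lam c f * basis_vec (Rnt n) (contract_class n \<P> c f) c'))"

end

(*
  Cut the cycle open at a vertex of V and number the vertices clockwise from it. A partition into
  connected sets is a set A of cut edges, and a chip firing class of acyclic orientations is given by A
  and the number p of clockwise cuts, 1 <= p < card A. Contracting a cut q multiplies by the variable
  before or after q, so that the complex has the shape of the Eagon-Northcott complex of a 2-rowed matrix
  whose columns are (x_q, x_(q+1)) for the cut edges q, and the toppling ideal is generated by its 2-minors.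

  The weight q (n - q) of the vertex number q makes the weight differences along the edges strictly
  increasing. Hence the orientation of largest weight in a class is the one where the last p cuts are
  clockwise, which is the V-acyclic one, and each lattice class of monomials has at most one element
  outside the parking function ideal, which is the one of least weight. This gives the Groebner
  degeneration.

  For exactness, expand the complex into cells, the monomials times basis vectors, and pair the cells by
  contracting the least cut dividing the multidegree if it can be contracted, and otherwise the last
  cut that forms a pair with it. The contraction used has no factor t, while all other ones either lower the weight
  of the multidegree or reach a cell of lower rank. So the matching is acyclic, and its critical cells are
  the monomials in degree 0 outside the parking function ideal.
*)
theory Submission
  imports Defs
begin

text \<open>The weight comes from the Laplacian: \<open>lam\<close> vanishes at the root and its
  product with the Laplacian row of any other vertex is 2. Hence its product with
  \<open>bvec n U\<close>, for \<open>U\<close> without the root, is twice the number of vertices of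
  \<open>U\<close>, and a weight difference inside a lattice class is twice the sum of a firing
  script.

  What shapes the statements about contractions is the case of two cuts. Both cuts then join the
  same two blocks and form one directed edge, which has two names, a monomial of degree two, and a
  reverse that is contractible in the same class; contracting it leaves a single block. Sign rule
  (ii) is used only here, to make the entries in degree one homogenised minors up to sign.

  Exactness is shown for vector spaces with infinitely many cells as a basis. Since the rank is a
  natural number, elimination along the pairs still terminates. In degree 0 it gives normal forms
  modulo the image, and functionals constant on lattice classes show that a nonzero normal form is
  never in the homogenised ideal.\<close>

abbreviation "keys \<equiv> Poly_Mapping.keys"
abbreviation "lookup \<equiv> Poly_Mapping.lookup"
abbreviation "single \<equiv> Poly_Mapping.single"

section \<open>Boundaries and acyclic matchings\<close>

lemma poly_mapping_sum_single: "(x :: 'b \<Rightarrow>\<^sub>0 'a::comm_monoid_add) = (\<Sum>k\<in>keys x. single k (lookup x k))"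
proof (rule poly_mapping_eqI)
  fix k
  have "(\<Sum>i\<in>keys x. lookup (single i (lookup x i)) k)
      = (\<Sum>i\<in>keys x. if i = k then lookup x i else 0)"
    by (rule sum.cong) (auto simp: lookup_single when_def)
  then show "lookup x k
      = lookup (\<Sum>k\<in>keys x. single k (lookup x k)) k"
    by (simp add: lookup_sum in_keys_iff)
qed

lemma keys_minus_subset: "keys (x - y :: 'b \<Rightarrow>\<^sub>0 'a::ab_group_add)
   \<subseteq> keys x \<union> keys y"
  by (auto simp: in_keys_iff lookup_minus)

lemma keys_sum_subset: "(\<And>i. i \<in> I \<Longrightarrow> keys (f i) \<subseteq> S)
   \<Longrightarrow> keys (\<Sum>i\<in>I. f i :: 'b \<Rightarrow>\<^sub>0 'a::comm_monoid_add) \<subseteq> S"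
proof (induction I rule: infinite_finite_induct)
  case (insert i I)
  then show ?case using keys_add[of "f i" "sum f I"] by (auto simp: subset_iff)
qed auto

text \<open>Chains are finitely supported functions on cells, so that a free module over the
  polynomial ring becomes a vector space on which elimination works cell by cell. The inner sum runs
  over the terms \<open>f\<close> of \<open>\<tau>\<close> instead of over target cells, so that
  terms can be paired off when two boundaries are composed.\<close>

definition boundary :: "('b \<Rightarrow> 'f set) \<Rightarrow> ('b \<Rightarrow> 'f \<Rightarrow> 'a) \<Rightarrow> ('b \<Rightarrow> 'f \<Rightarrow> 'b) \<Rightarrow> ('b \<Rightarrow>\<^sub>0 'a) \<Rightarrow>
    ('b \<Rightarrow>\<^sub>0 'a::comm_ring_1)" where
  "boundary tm co tg x = (\<Sum>\<tau>\<in>keys x. \<Sum>f\<in>tm \<tau>.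
     single (tg \<tau> f) (lookup x \<tau> * co \<tau> f))"

context
  fixes tm :: "'b \<Rightarrow> 'f set" and co :: "'b \<Rightarrow> 'f \<Rightarrow> 'a::comm_ring_1" and tg :: "'b \<Rightarrow> 'f \<Rightarrow> 'b"
begin

abbreviation "bd \<equiv> boundary tm co tg"

lemma boundary_superset:
  assumes "finite S" "keys x \<subseteq> S"
  shows "bd x = (\<Sum>\<tau>\<in>S. \<Sum>f\<in>tm \<tau>. single (tg \<tau> f) (lookup x \<tau> * co \<tau> f))"
  unfolding boundary_def using assms
  by (intro sum.mono_neutral_left) (auto simp: in_keys_iff)

lemma boundary_single:
  "bd (single \<tau> a) = (\<Sum>f\<in>tm \<tau>. single (tg \<tau> f) (a * co \<tau> f))"
  by (subst boundary_superset[of "{\<tau>}"]) auto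

lemma boundary_add: "bd (x + y) = bd x + bd y"
proof -
  let ?S = "keys x \<union> keys y"
  have "keys (x + y) \<subseteq> ?S" by (rule keys_add)
  then show ?thesis
    by (subst (1 2 3) boundary_superset[of ?S])
      (auto simp: lookup_add distrib_right single_add sum.distrib)
qed

lemma boundary_0 [simp]: "bd 0 = 0"
  by (simp add: boundary_def)

lemma boundary_uminus: "bd (- x) = - bd x"
  using boundary_add[of x "-x"] by (simp add: eq_neg_iff_add_eq_0 add.commute)

lemma boundary_diff: "bd (x - y) = bd x - bd y"
  using boundary_add[of x "-y"] by (simp add: boundary_uminus)

lemma boundary_sum: "bd (\<Sum>i\<in>I. f i) = (\<Sum>i\<in>I. bd (f i))"
  by (induction I rule: infinite_finite_induct) (auto simp: boundary_add)

lemma boundary_keys: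
  assumes "keys x \<subseteq> S" "\<And>\<tau> f. \<tau> \<in> S \<Longrightarrow> f \<in> tm \<tau> \<Longrightarrow> tg \<tau> f \<in> S'"
  shows "keys (bd x) \<subseteq> S'"
  unfolding boundary_def using assms by (intro keys_sum_subset) (auto split: if_splits)

lemma lookup_boundary:
  "lookup (bd x) \<sigma> = (\<Sum>\<tau>\<in>keys x. \<Sum>f\<in>tm \<tau>.
     (if tg \<tau> f = \<sigma> then lookup x \<tau> * co \<tau> f else 0))"
  by (auto simp: boundary_def lookup_sum lookup_single when_def intro!: sum.cong)

end

text \<open>Discrete Morse theory with all critical cells, namely those in \<open>T 0\<close>, in degree 0: for \<open>j \<ge> 1\<close> a tail
  \<open>\<tau> \<in> T j\<close> is paired with the target of its leading term \<open>lf \<tau>\<close>. The rank makes reduction along the pairs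
  terminate.\<close>

locale morse_matching =
  fixes B T :: "nat \<Rightarrow> 'b set" and tm :: "'b \<Rightarrow> 'f set" and co :: "'b \<Rightarrow> 'f \<Rightarrow> 'a::field"
    and tg :: "'b \<Rightarrow> 'f \<Rightarrow> 'b" and lf :: "'b \<Rightarrow> 'f" and rank :: "'b \<Rightarrow> nat"
  assumes fin: "\<And>j \<tau>. \<tau> \<in> B j \<Longrightarrow> finite (tm \<tau>)"
    and tgB: "\<And>j \<tau> f. j \<ge> 1 \<Longrightarrow> \<tau> \<in> B j \<Longrightarrow> f \<in> tm \<tau> \<Longrightarrow> tg \<tau> f \<in> B (j - 1)"
    and TB: "\<And>j. T j \<subseteq> B j"
    and lfT: "\<And>j \<tau>. j \<ge> 1 \<Longrightarrow> \<tau> \<in> T j \<Longrightarrow> lf \<tau> \<in> tm \<tau> \<and> co \<tau> (lf \<tau>) \<noteq> 0"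
    and less: "\<And>j \<tau> f. j \<ge> 1 \<Longrightarrow> \<tau> \<in> T j \<Longrightarrow> f \<in> tm \<tau> \<Longrightarrow> f \<noteq> lf \<tau> \<Longrightarrow> rank (tg \<tau> f) < rank (tg \<tau> (lf \<tau>))"
    and injT: "\<And>j. j \<ge> 1 \<Longrightarrow> inj_on (\<lambda>\<tau>. tg \<tau> (lf \<tau>)) (T j)"
    and headT: "\<And>j \<sigma>. \<sigma> \<in> B j \<Longrightarrow> \<sigma> \<notin> T j \<Longrightarrow> \<exists>\<tau>\<in>T (Suc j). tg \<tau> (lf \<tau>) = \<sigma>"
    and dd: "\<And>j \<tau> a. j \<ge> 2 \<Longrightarrow> \<tau> \<in> B j \<Longrightarrow> boundary tm co tg (boundary tm co tg (single \<tau> a)) = 0"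
begin

abbreviation "bdm \<equiv> boundary tm co tg"

text \<open>Elimination along the pairs: a cell that is not a tail is the leading target of some
  tail \<open>\<tau>\<close>. Subtracting the boundary of a multiple of \<open>\<tau>\<close> trades
  it for the other targets of \<open>\<tau>\<close>, all of smaller rank, which induction reduces
  further.\<close>

lemma reduce_single:
  assumes "\<sigma> \<in> B j"
  shows "\<exists>y. keys y \<subseteq> B (Suc j) \<and> keys (single \<sigma> a - bdm y) \<subseteq> T j"
  using assms
proof (induction "rank \<sigma>" arbitrary: \<sigma> a rule: less_induct)
  case less
  show ?case
  proof (cases "\<sigma> \<in> T j")
    case True
    then show ?thesis by (intro exI[of _ 0]) auto
  next
    case False
    then obtain \<tau> where \<tau>: "\<tau> \<in> T (Suc j)" "tg \<tau> (lf \<tau>) = \<sigma>" using headT less by blast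
    have lf: "lf \<tau> \<in> tm \<tau>" "co \<tau> (lf \<tau>) \<noteq> 0" using lfT[of "Suc j"] \<tau> by auto
    have fin\<tau>: "finite (tm \<tau>)" using fin TB \<tau> by blast
    \<comment> \<open>With this multiple the leading term of the boundary of
      \<open>single \<tau> k\<close> is exactly \<open>single \<sigma> a\<close>.\<close>
    define k where "k = a / co \<tau> (lf \<tau>)"
    have "\<exists>y. keys y \<subseteq> B (Suc j) \<and>
        keys (single (tg \<tau> f) (k * co \<tau> f) - bdm y) \<subseteq> T j"
      if "f \<in> tm \<tau> - {lf \<tau>}" for f
    proof (rule less.hyps)
      show "rank (tg \<tau> f) < rank \<sigma>" using less(1) morse_matching.less[OF morse_matching_axioms, of "Suc j" \<tau>
          f] that \<tau> by auto
      show "tg \<tau> f \<in> B j" using tgB[of "Suc j" \<tau> f] TB[of "Suc j"] that \<tau> by auto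
    qed
    then obtain Y where Y: "\<And>f. f \<in> tm \<tau> - {lf \<tau>} \<Longrightarrow> keys (Y f) \<subseteq> B (Suc j) \<and>
        keys (single (tg \<tau> f) (k * co \<tau> f) - bdm (Y f)) \<subseteq> T j"
      by metis
    define y where "y = single \<tau> k - (\<Sum>f\<in>tm \<tau> - {lf \<tau>}. Y f)"
    have "bdm (single \<tau> k) = single \<sigma> a
       + (\<Sum>f\<in>tm \<tau> - {lf \<tau>}. single (tg \<tau> f) (k * co \<tau> f))"
      using lf by (simp add: boundary_single sum.remove[OF fin\<tau> lf(1)] \<tau> k_def)
    then have "single \<sigma> a - bdm y =
       - (\<Sum>f\<in>tm \<tau> - {lf \<tau>}. single (tg \<tau> f) (k * co \<tau> f) - bdm (Y f))"
      by (simp add: y_def boundary_diff boundary_sum sum_subtractf)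
    then have "keys (single \<sigma> a - bdm y) =
       keys (\<Sum>f\<in>tm \<tau> - {lf \<tau>}. single (tg \<tau> f) (k * co \<tau> f) - bdm (Y f))"
      by (auto simp: in_keys_iff)
    also have "\<dots> \<subseteq> T j" using Y by (intro keys_sum_subset) blast
    finally have 1: "keys (single \<sigma> a - bdm y) \<subseteq> T j" .
    have "keys (\<Sum>f\<in>tm \<tau> - {lf \<tau>}. Y f) \<subseteq> B (Suc j)"
      using Y by (intro keys_sum_subset) blast
    then have "keys y \<subseteq> B (Suc j)"
      unfolding y_def using keys_minus_subset[of "single \<tau> k" "\<Sum>f\<in>tm \<tau> - {lf \<tau>}. Y f"] \<tau> TB[of "Suc j"]
      by (auto split: if_splits)
    with 1 show ?thesis by blast
  qed
qed

lemma reduce: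
  assumes "keys x \<subseteq> B j"
  shows "\<exists>y. keys y \<subseteq> B (Suc j) \<and> keys (x - bdm y) \<subseteq> T j"
proof -
  have "\<forall>k\<in>keys x. \<exists>y. keys y \<subseteq> B (Suc j) \<and>
      keys (single k (lookup x k) - bdm y) \<subseteq> T j"
    using assms by (auto intro!: reduce_single)
  then obtain Y where Y: "\<And>k. k \<in> keys x \<Longrightarrow> keys (Y k) \<subseteq> B (Suc j) \<and>
      keys (single k (lookup x k) - bdm (Y k)) \<subseteq> T j"
    by metis
  let ?y = "\<Sum>k\<in>keys x. Y k"
  have "x - bdm ?y = (\<Sum>k\<in>keys x. single k (lookup x k) - bdm (Y k))"
    by (simp add: sum_subtractf boundary_sum flip: poly_mapping_sum_single)
  also have "keys \<dots> \<subseteq> T j" using Y by (intro keys_sum_subset) blast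
  finally show ?thesis using Y by (intro exI[of _ ?y] conjI keys_sum_subset) auto
qed

text \<open>The boundary is triangular on tails. Among the tails occurring in \<open>x\<close> take
  one whose leading target has the largest rank: no other term of \<open>x\<close> reaches that
  target, since leading targets are distinct and all other terms reach smaller ranks. So its
  coefficient survives in the boundary.\<close>

lemma tail_kernel:
  assumes "keys x \<subseteq> T j" "j \<ge> 1" "bdm x = 0"
  shows "x = 0"
proof (rule ccontr)
  assume "x \<noteq> 0"
  define r where "r \<tau> = rank (tg \<tau> (lf \<tau>))" for \<tau>
  have ne: "keys x \<noteq> {}" using \<open>x \<noteq> 0\<close> by simp
  have "Max (r ` keys x) \<in> r ` keys x" by (rule Max_in) (use ne in auto)
  then obtain \<tau>0 where \<tau>0: "\<tau>0 \<in> keys x" "r \<tau>0 = Max (r ` keys x)" by auto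
  have mx: "r \<tau> \<le> r \<tau>0" if "\<tau> \<in> keys x" for \<tau> using that \<tau>0 by simp
  let ?g = "\<lambda>\<tau> f. (if tg \<tau> f = tg \<tau>0 (lf \<tau>0) then lookup x \<tau> * co \<tau> f else 0)"
  have z: "?g \<tau> f = 0" if "\<tau> \<in> keys x" "f \<in> tm \<tau>" "\<not> (\<tau> = \<tau>0 \<and> f = lf \<tau>0)" for \<tau> f
  proof -
    have "tg \<tau> f \<noteq> tg \<tau>0 (lf \<tau>0)"
    proof (cases "f = lf \<tau>")
      case True
      then show ?thesis using injT[OF assms(2)] that \<tau>0 assms(1) by (auto simp: inj_on_def)
    next
      case False
      then show ?thesis using less[OF assms(2), of \<tau> f] that mx[of \<tau>] assms(1) unfolding r_def by force
    qed
    then show ?thesis by simp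
  qed
  have lf: "lf \<tau>0 \<in> tm \<tau>0" "co \<tau>0 (lf \<tau>0) \<noteq> 0" using lfT assms \<tau>0 by auto
  have fin\<tau>: "finite (tm \<tau>0)" using fin TB \<tau>0(1) assms(1) by blast
  have "0 = (\<Sum>\<tau>\<in>keys x. \<Sum>f\<in>tm \<tau>. ?g \<tau> f)"
    using assms(3) lookup_boundary[of tm co tg x "tg \<tau>0 (lf \<tau>0)"] by simp
  also have "\<dots> = (\<Sum>f\<in>tm \<tau>0. ?g \<tau>0 f)"
    using \<tau>0 z by (subst sum.remove[of _ \<tau>0]) (auto intro!: sum.neutral)
  also have "\<dots> = lookup x \<tau>0 * co \<tau>0 (lf \<tau>0)"
    using \<tau>0 z by (subst sum.remove[OF fin\<tau> lf(1)]) (auto intro!: sum.neutral)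
  finally show False using lf \<tau>0 by (simp add: in_keys_iff)
qed

lemma bdm_bdm:
  assumes "keys x \<subseteq> B j" "j \<ge> 2"
  shows "bdm (bdm x) = 0"
proof -
  have "bdm (bdm x) = (\<Sum>k\<in>keys x. bdm (bdm (single k (lookup x k))))"
    by (subst (1) poly_mapping_sum_single) (simp add: boundary_sum)
  then show ?thesis using dd[OF assms(2)] assms(1) by (auto intro!: sum.neutral)
qed

text \<open>Reduction turns a cycle into a cycle supported on tails, and such a cycle is
  zero.\<close>

lemma exact:
  assumes "keys x \<subseteq> B j" "j \<ge> 1" "bdm x = 0"
  shows "\<exists>y. keys y \<subseteq> B (Suc j) \<and> x = bdm y"
proof -
  obtain y where y: "keys y \<subseteq> B (Suc j)" "keys (x - bdm y) \<subseteq> T j"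
    using reduce[OF assms(1)] by blast
  have "bdm (bdm y) = 0" using bdm_bdm[OF y(1)] assms(2) by simp
  then have "x - bdm y = 0" using tail_kernel[OF y(2) assms(2)] assms(3) by (simp add: boundary_diff)
  then show ?thesis using y by auto
qed

end

section \<open>Polynomial rings, ideals and pairings\<close>

lemma (in cring) ideal_criterion:
  assumes "I \<subseteq> carrier R" "\<zero> \<in> I" "\<And>x y. x \<in> I \<Longrightarrow> y \<in> I \<Longrightarrow> x \<oplus> y \<in> I"
    "\<And>r x. r \<in> carrier R \<Longrightarrow> x \<in> I \<Longrightarrow> r \<otimes> x \<in> I"
  shows "ideal I R"
proof (rule idealI)
  show "ring R" by (rule ring_axioms)
  show "subgroup I (add_monoid R)"
  proof
    show "inv\<^bsub>add_monoid R\<^esub> x \<in> I" if "x \<in> I" for x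
    proof -
      have x: "x \<in> carrier R" using that assms(1) by blast
      have "(\<ominus> \<one>) \<otimes> x \<in> I" using assms(4) that by blast
      moreover have "(\<ominus> \<one>) \<otimes> x = \<ominus> x" using x by (simp add: l_minus)
      ultimately show ?thesis by (simp add: a_inv_def)
    qed
  qed (use assms in auto)
  show "a \<in> I \<Longrightarrow> x \<in> carrier R \<Longrightarrow> x \<otimes> a \<in> I" for a x using assms(4) by blast
  show "a \<in> I \<Longrightarrow> x \<in> carrier R \<Longrightarrow> a \<otimes> x \<in> I" for a x
    using assms(1,4) m_comm[of a x] by auto
qed

definition in_Rn :: "nat \<Rightarrow> 'a::comm_ring_1 mpol \<Rightarrow> bool" where
  "in_Rn n p \<longleftrightarrow> (\<forall>m\<in>keys p. keys m \<subseteq> {1..n})"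

definition in_Rnt :: "nat \<Rightarrow> 'a::comm_ring_1 mpol poly \<Rightarrow> bool" where
  "in_Rnt n p \<longleftrightarrow> (\<forall>i. in_Rn n (Polynomial.coeff p i))"

lemma in_Rn_0 [simp]: "in_Rn n 0" by (simp add: in_Rn_def)

lemma in_Rn_1 [simp]: "in_Rn n 1" by (simp add: in_Rn_def)

lemma in_Rn_uminus [simp]: "in_Rn n (- p) \<longleftrightarrow> in_Rn n p" by (simp add: in_Rn_def)

lemma in_Rn_add: "in_Rn n p \<Longrightarrow> in_Rn n q \<Longrightarrow> in_Rn n (p + q)"
  unfolding in_Rn_def using keys_add[of p q] by blast

lemma in_Rn_mult: "in_Rn n p \<Longrightarrow> in_Rn n q \<Longrightarrow> in_Rn n (p * q)"
  unfolding in_Rn_def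
proof
  fix m assume *: "\<forall>m\<in>keys p. keys m \<subseteq> {1..n}" "\<forall>m\<in>keys q. keys m \<subseteq> {1..n}"
    "m \<in> keys (p * q)"
  then obtain a b where "m = a + b" "a \<in> keys p" "b \<in> keys q" using keys_mult[of p q] by blast
  then show "keys m \<subseteq> {1..n}" using * keys_add[of a b] by blast
qed

lemma in_Rn_sum: "(\<And>i. i \<in> S \<Longrightarrow> in_Rn n (f i)) \<Longrightarrow> in_Rn n (sum f S)"
  by (induction S rule: infinite_finite_induct) (auto intro: in_Rn_add)

lemma in_Rn_single: "keys u \<subseteq> {1..n} \<Longrightarrow> in_Rn n (single u a)"
  by (simp add: in_Rn_def)

lemma Rn_sel [simp]: "carrier (Rn n) = {p. in_Rn n p}" "mult (Rn n) = (*)" "one (Rn n) = 1" "zero (Rn n) =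
    0" "add (Rn n) = (+)"
  by (simp_all add: Rn_def in_Rn_def)

lemma Rnt_sel [simp]: "carrier (Rnt n) = {p. in_Rnt n p}" "mult (Rnt n) = (*)" "one (Rnt n) = 1"
    "zero (Rnt n) = 0" "add (Rnt n) = (+)"
  by (simp_all add: Rnt_def in_Rnt_def)

lemma in_Rnt_0 [simp]: "in_Rnt n 0" by (simp add: in_Rnt_def)

lemma in_Rnt_1 [simp]: "in_Rnt n 1" by (simp add: in_Rnt_def)

lemma in_Rnt_uminus [simp]: "in_Rnt n (- p) \<longleftrightarrow> in_Rnt n p" by (simp add: in_Rnt_def)

lemma in_Rnt_add: "in_Rnt n p \<Longrightarrow> in_Rnt n q \<Longrightarrow> in_Rnt n (p + q)"
  by (simp add: in_Rnt_def in_Rn_add)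

lemma in_Rnt_mult: "in_Rnt n p \<Longrightarrow> in_Rnt n q \<Longrightarrow> in_Rnt n (p * q)"
  unfolding in_Rnt_def coeff_mult by (auto intro!: in_Rn_sum in_Rn_mult)

lemma in_Rnt_sum: "(\<And>i. i \<in> S \<Longrightarrow> in_Rnt n (f i)) \<Longrightarrow> in_Rnt n (sum f S)"
  by (induction S rule: infinite_finite_induct) (auto intro: in_Rnt_add)

lemma in_Rnt_monom: "in_Rn n c \<Longrightarrow> in_Rnt n (Polynomial.monom c s)"
  by (simp add: in_Rnt_def)

lemma in_Rnt_const: "in_Rn n c \<Longrightarrow> in_Rnt n [:c:]"
  using in_Rnt_monom[of n c 0] by (simp add: monom_0)

lemma in_Rnt_tvar [simp]: "in_Rnt n tvar"
  using in_Rnt_monom[of n 1 1] by (simp add: tvar_def monom_Suc monom_0)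

lemma Rn_cring: "cring (Rn n :: 'a::comm_ring_1 mpol ring)"
proof (rule cringI)
  show "abelian_group (Rn n :: 'a mpol ring)"
  proof (rule abelian_groupI)
    show "\<exists>y\<in>carrier (Rn n). y \<oplus>\<^bsub>Rn n\<^esub> x = \<zero>\<^bsub>Rn n\<^esub>" if "x \<in> carrier (Rn n)" for x :: "'a mpol"
      using that by (intro bexI[of _ "- x"]) auto
  qed (auto simp: in_Rn_add add.assoc add.commute)
  show "comm_monoid (Rn n :: 'a mpol ring)"
    by (rule comm_monoidI) (auto simp: in_Rn_mult mult.assoc mult.commute)
qed (auto simp: distrib_right)

lemma Rnt_cring: "cring (Rnt n :: 'a::comm_ring_1 mpol poly ring)"
proof (rule cringI)
  show "abelian_group (Rnt n :: 'a mpol poly ring)"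
  proof (rule abelian_groupI)
    show "\<exists>y\<in>carrier (Rnt n). y \<oplus>\<^bsub>Rnt n\<^esub> x = \<zero>\<^bsub>Rnt n\<^esub>" if "x \<in> carrier (Rnt n)" for x :: "'a mpol poly"
      using that by (intro bexI[of _ "- x"]) auto
  qed (auto simp: in_Rnt_add add.assoc add.commute)
  show "comm_monoid (Rnt n :: 'a mpol poly ring)"
    by (rule comm_monoidI) (auto simp: in_Rnt_mult mult.assoc mult.commute)
qed (auto simp: distrib_right)

lemma Rn_ideal_criterion:
  assumes "I \<subseteq> {p. in_Rn n p}" "0 \<in> I" "\<And>x y. x \<in> I \<Longrightarrow> y \<in> I \<Longrightarrow> x + y \<in> I" "\<And>r x. in_Rn n r \<Longrightarrow> x \<in> I \<Longrightarrow> r * x \<in> I"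
  shows "ideal I (Rn n)"
  by (rule cring.ideal_criterion[OF Rn_cring]) (use assms in auto)

lemma Rnt_ideal_criterion:
  assumes "I \<subseteq> {p. in_Rnt n p}" "0 \<in> I" "\<And>x y. x \<in> I \<Longrightarrow> y \<in> I \<Longrightarrow> x + y \<in> I" "\<And>r x. in_Rnt n r \<Longrightarrow> x \<in> I \<Longrightarrow>
      r * x \<in> I"
  shows "ideal I (Rnt n)"
  by (rule cring.ideal_criterion[OF Rnt_cring]) (use assms in auto)

lemma Rn_idealD:
  assumes "ideal I (Rn n)"
  shows "x \<in> I \<Longrightarrow> in_Rn n x" "0 \<in> I" "x \<in> I \<Longrightarrow> y \<in> I \<Longrightarrow> x + y \<in> I" "in_Rn n r \<Longrightarrow> x \<in> I \<Longrightarrow> r * x \<in> I"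
  using ideal.Icarr[OF assms, of x] additive_subgroup.zero_closed[OF ideal.axioms(1)[OF assms]]
    additive_subgroup.a_closed[OF ideal.axioms(1)[OF assms], of x y] ideal.I_l_closed[OF assms, of x r]
        by auto

lemma Rnt_idealD:
  assumes "ideal I (Rnt n)"
  shows "x \<in> I \<Longrightarrow> in_Rnt n x" "0 \<in> I" "x \<in> I \<Longrightarrow> y \<in> I \<Longrightarrow> x + y \<in> I" "in_Rnt n r \<Longrightarrow> x \<in> I \<Longrightarrow> r * x \<in> I"
  using ideal.Icarr[OF assms, of x] additive_subgroup.zero_closed[OF ideal.axioms(1)[OF assms]]
    additive_subgroup.a_closed[OF ideal.axioms(1)[OF assms], of x y] ideal.I_l_closed[OF assms, of x r]
        by auto

lemma Rn_ideal_sum: "ideal I (Rn n) \<Longrightarrow> (\<And>i. i \<in> S \<Longrightarrow> f i \<in> I) \<Longrightarrow> sum f S \<in> I"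
  by (induction S rule: infinite_finite_induct) (auto intro: Rn_idealD)

lemma Rnt_ideal_sum: "ideal I (Rnt n) \<Longrightarrow> (\<And>i. i \<in> S \<Longrightarrow> f i \<in> I) \<Longrightarrow> sum f S \<in> I"
  by (induction S rule: infinite_finite_induct) (auto intro: Rnt_idealD)

lemma Rn_genideal:
  assumes "S \<subseteq> {p. in_Rn n p}"
  shows "ideal (genideal (Rn n) S) (Rn n)" "S \<subseteq> genideal (Rn n) S"
    "ideal I (Rn n) \<Longrightarrow> S \<subseteq> I \<Longrightarrow> genideal (Rn n) S \<subseteq> I"
  using ring.genideal_ideal[OF cring.axioms(1)[OF Rn_cring], of S n]
      ring.genideal_self[OF cring.axioms(1)[OF Rn_cring], of S n]
    ring.genideal_minimal[OF cring.axioms(1)[OF Rn_cring], of I n S] assms by auto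

lemma Rnt_genideal:
  assumes "S \<subseteq> {p. in_Rnt n p}"
  shows "ideal (genideal (Rnt n) S) (Rnt n)" "S \<subseteq> genideal (Rnt n) S"
    "ideal I (Rnt n) \<Longrightarrow> S \<subseteq> I \<Longrightarrow> genideal (Rnt n) S \<subseteq> I"
  using ring.genideal_ideal[OF cring.axioms(1)[OF Rnt_cring], of S n]
      ring.genideal_self[OF cring.axioms(1)[OF Rnt_cring], of S n]
    ring.genideal_minimal[OF cring.axioms(1)[OF Rnt_cring], of I n S] assms by auto

lemma X_power: "X i ^ k = (single (single i k) 1 :: 'a::comm_ring_1 mpol)"
  by (induction k) (simp_all add: X_def mult_single single_add[symmetric])

lemma prod_single: "finite S \<Longrightarrow> (\<Prod>i\<in>S. single (f i) (1::'a::comm_ring_1)) = single (\<Sum>i\<in>S. f i) 1"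
  for f :: "nat \<Rightarrow> nat \<Rightarrow>\<^sub>0 nat"
  by (induction S rule: finite_induct) (simp_all add: mult_single)

lemma xmon_lookup:
  assumes "keys u \<subseteq> {1..n}"
  shows "xmon n (lookup u) = (single u 1 :: 'a::comm_ring_1 mpol)"
proof -
  have "(\<Sum>i\<in>{1..n}. single i (lookup u i)) = (\<Sum>i\<in>keys u. single i (lookup u i))"
    using assms by (intro sum.mono_neutral_right) (auto simp: in_keys_iff)
  then have "(\<Sum>i\<in>{1..n}. single i (lookup u i)) = u"
    by (simp flip: poly_mapping_sum_single)
  then show ?thesis by (simp add: xmon_def X_power prod_single)
qed

lemma natvecs_poly_mapping:
  assumes "f \<in> natvecs n"
  obtains u where "keys u \<subseteq> {1..n}" "lookup u = f"
proof -
  have s: "{x. f x \<noteq> 0} \<subseteq> {1..n}"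
  proof
    fix x assume "x \<in> {x. f x \<noteq> 0}"
    then show "x \<in> {1..n}" using assms unfolding natvecs_def by (metis (mono_tags, lifting) mem_Collect_eq)
  qed
  then have "finite {x. f x \<noteq> 0}" by (rule finite_subset) simp
  then have l: "lookup (Abs_poly_mapping f) = f" by (rule lookup_Abs_poly_mapping)
  have "keys (Abs_poly_mapping f) \<subseteq> {1..n}" unfolding keys.rep_eq l by (rule s)
  then show thesis using l by (rule that)
qed

text \<open>Linear functionals on the polynomial rings, given by their values on the monomials. An ideal generated
  by differences of monomials lies in the kernel of every functional that is constant on the classes
  of monomials it identifies, which bounds the ideal from above.\<close>

definition pairing :: "'a::comm_ring_1 mpol \<Rightarrow> ((nat \<Rightarrow>\<^sub>0 nat) \<Rightarrow> 'a) \<Rightarrow> 'a" where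
  "pairing g \<psi> = (\<Sum>u\<in>keys g. lookup g u * \<psi> u)"

lemma pairing_superset: "finite S \<Longrightarrow> keys g \<subseteq> S \<Longrightarrow> pairing g \<psi> = (\<Sum>u\<in>S. lookup g u * \<psi> u)"
  unfolding pairing_def by (intro sum.mono_neutral_left) (auto simp: in_keys_iff)

lemma pairing_0 [simp]: "pairing 0 \<psi> = 0" by (simp add: pairing_def)

lemma pairing_single [simp]: "pairing (single u a) \<psi> = a * \<psi> u"
  by (simp add: pairing_def)

lemma pairing_add: "pairing (g + h) \<psi> = pairing g \<psi> + pairing h \<psi>"
proof -
  let ?S = "keys g \<union> keys h"
  show ?thesis using keys_add[of g h]
    by (subst (1 2 3) pairing_superset[of ?S]) (auto simp: lookup_add distrib_right sum.distrib)
qed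

lemma pairing_sum: "pairing (sum f S) \<psi> = (\<Sum>i\<in>S. pairing (f i) \<psi>)"
  by (induction S rule: infinite_finite_induct) (auto simp: pairing_add)

lemma pairing_uminus: "pairing (- g) \<psi> = - pairing g \<psi>"
  by (simp add: pairing_def sum_negf)

text \<open>A product pairs with \<open>\<psi>\<close> as a combination of pairings of
  \<open>g\<close> with translates of \<open>\<psi>\<close>. Hence the common kernel of a family of
  functions that is closed under translation is an ideal, which is how generated ideals are bounded
  from above later.\<close>

lemma pairing_mult: "pairing (h * g) \<psi> = (\<Sum>v\<in>keys h. lookup h v * pairing g (\<lambda>u. \<psi> (v + u)))"
proof -
  have "h * g = (\<Sum>v\<in>keys h. \<Sum>u\<in>keys g. single (v + u) (lookup h v * lookup g u))"
    by (subst (1) poly_mapping_sum_single[of h], subst (1) poly_mapping_sum_single[of g])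
        (simp add: sum_product mult_single)
  then show ?thesis by (simp add: pairing_sum pairing_def[of g] sum_distrib_left mult.assoc)
qed

text \<open>The exponent of t enters \<open>\<phi>\<close> as an integer: the functions that test
  homogenisations are evaluated at the difference between the maximal weight of a polynomial and the
  weight of an arbitrary monomial, and this difference may be negative.\<close>

definition tpairing :: "'a::comm_ring_1 mpol poly \<Rightarrow> ((nat \<Rightarrow>\<^sub>0 nat) \<Rightarrow> int \<Rightarrow> 'a) \<Rightarrow> 'a" where
  "tpairing p \<phi> = (\<Sum>s\<le>Polynomial.degree p. pairing (Polynomial.coeff p s) (\<lambda>u. \<phi> u (int s)))"

lemma tpairing_bound: "Polynomial.degree p \<le> N \<Longrightarrow> tpairing p \<phi> =
    (\<Sum>s\<le>N. pairing (Polynomial.coeff p s) (\<lambda>u. \<phi> u (int s)))"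
  unfolding tpairing_def by (intro sum.mono_neutral_left) (auto simp: coeff_eq_0)

lemma tpairing_0 [simp]: "tpairing 0 \<phi> = 0" by (simp add: tpairing_def)

lemma tpairing_add: "tpairing (p + q) \<phi> = tpairing p \<phi> + tpairing q \<phi>"
proof -
  let ?N = "max (Polynomial.degree p) (Polynomial.degree q)"
  show ?thesis using degree_add_le_max[of p q]
    by (subst (1 2 3) tpairing_bound[of _ ?N]) (auto simp: pairing_add sum.distrib)
qed

lemma tpairing_sum: "tpairing (sum f S) \<phi> = (\<Sum>i\<in>S. tpairing (f i) \<phi>)"
  by (induction S rule: infinite_finite_induct) (auto simp: tpairing_add)

lemma tpairing_monom: "tpairing (Polynomial.monom c s) \<phi> = pairing c (\<lambda>u. \<phi> u (int s))"
proof -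
  have "tpairing (Polynomial.monom c s) \<phi> = (\<Sum>r\<le>s. if r = s then pairing c (\<lambda>u. \<phi> u (int s)) else 0)"
    by (subst tpairing_bound[OF degree_monom_le], rule sum.cong) auto
  then show ?thesis by simp
qed

lemma tpairing_pCons0: "tpairing (pCons 0 p) \<phi> = tpairing p (\<lambda>u s. \<phi> u (s + 1))"
proof -
  have "tpairing (pCons 0 p) \<phi> = (\<Sum>s\<le>Suc (Polynomial.degree p). pairing (Polynomial.coeff (pCons 0 p) s)
      (\<lambda>u. \<phi> u (int s)))"
    by (rule tpairing_bound) (rule degree_pCons_le)
  also have "\<dots> = tpairing p (\<lambda>u s. \<phi> u (s + 1))"
    by (subst sum.atMost_Suc_shift) (simp add: tpairing_def add.commute)
  finally show ?thesis .
qed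

lemma tpairing_smult: "tpairing (Polynomial.smult h p) \<phi> =
    (\<Sum>v\<in>keys h. lookup h v * tpairing p (\<lambda>u s. \<phi> (v + u) s))"
proof -
  have "tpairing (Polynomial.smult h p) \<phi> = (\<Sum>s\<le>Polynomial.degree p. pairing (h * Polynomial.coeff p s)
      (\<lambda>u. \<phi> u (int s)))"
    by (subst tpairing_bound[OF degree_smult_le]) simp
  also have "\<dots> = (\<Sum>v\<in>keys h. lookup h v * tpairing p (\<lambda>u s. \<phi> (v + u) s))"
    unfolding pairing_mult tpairing_def sum_distrib_left by (rule sum.swap)
  finally show ?thesis .
qed

section \<open>The cycle, cut edges and blocks\<close>

lemma cycle_edges_alt:
  assumes "n \<ge> 3"
  shows "cycle_edges n = (\<lambda>i. {i, i mod n + 1}) ` {1..n}"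
proof -
  have "{1..n} = {1..n-1} \<union> {n}" using assms by auto
  then have "(\<lambda>i. {i, i mod n + 1}) ` {1..n} = (\<lambda>i. {i, i mod n + 1}) ` {1..n-1} \<union> {{n, 1}}"
    by (simp add: image_Un)
  also have "(\<lambda>i. {i, i mod n + 1}) ` {1..n-1} = (\<lambda>i. {i, i + 1}) ` {1..n-1}"
    using assms by (intro image_cong) auto
  finally show ?thesis unfolding cycle_edges_def by (auto simp: insert_commute)
qed

locale rooted_cycle =
  fixes n v0 :: nat
  assumes n3: "n \<ge> 3" and v0: "v0 \<in> {1..n}"
begin

text \<open>The vertices are numbered clockwise from the root \<open>v0\<close>; the edge \<open>q\<close> joins the vertices number \<open>q\<close> and
  \<open>q + 1\<close>, the position \<open>n\<close> being again the root. A partition into connected sets is given by the set \<open>A\<close> of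
  edges that it cuts, where \<open>card A \<noteq> 1\<close>.\<close>

definition vtx :: "nat \<Rightarrow> nat" where "vtx q = (v0 - 1 + q) mod n + 1"

definition pos :: "nat \<Rightarrow> nat" where "pos = inv_into {..<n} vtx"

lemma n_pos [simp]: "n > 0" using n3 by simp

lemma vtx_in [simp]: "vtx q \<in> {1..n}"
  using n3 by (auto simp: vtx_def Suc_leI)

lemma vtx_bounds [simp]: "vtx q \<le> n" "Suc 0 \<le> vtx q" "0 < vtx q"
  using vtx_in[of q] by auto


lemma vtx_image: "vtx ` {..<n} = {1..n}"
proof
  show "{1..n} \<subseteq> vtx ` {..<n}"
  proof
    fix i assume i: "i \<in> {1..n}"
    have "(v0 - 1 + (i + n - v0)) = (i - 1) + n" using i v0 by auto
    then have "vtx ((i + n - v0) mod n) = ((i - 1) + n) mod n + 1"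
      unfolding vtx_def by (metis mod_add_right_eq)
    also have "\<dots> = i" by (subst mod_add_self2) (use i in auto)
    finally show "i \<in> vtx ` {..<n}" by (metis image_eqI lessThan_iff mod_less_divisor n_pos)
  qed
qed auto

lemma vtx_inj: "inj_on vtx {..<n}"
  by (rule eq_card_imp_inj_on) (simp_all add: vtx_image)

lemma vtx_n [simp]: "vtx n = vtx 0"
  unfolding vtx_def by (subst mod_add_self2) simp

lemma vtx_0: "vtx 0 = v0"
  using v0 by (auto simp: vtx_def)

lemma vtx_Suc: "vtx (Suc q) = vtx q mod n + 1"
  unfolding vtx_def by (simp add: mod_Suc_eq)

lemma vtx_eq [simp]: "q < n \<Longrightarrow> r < n \<Longrightarrow> vtx q = vtx r \<longleftrightarrow> q = r"
  using vtx_inj by (auto simp: inj_on_def)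

lemma vtx_mod: "vtx (q mod n) = vtx q"
  unfolding vtx_def by (simp add: mod_add_right_eq)

lemma vtx_Suc_eq: "q < n \<Longrightarrow> r < n \<Longrightarrow> vtx (Suc q) = vtx (Suc r) \<longleftrightarrow> q = r"
proof (cases "Suc q = n"; cases "Suc r = n")
  assume "q < n" "r < n" "Suc q = n" "Suc r \<noteq> n"
  then show ?thesis using vtx_eq[of 0 "Suc r"] by auto
next
  assume "q < n" "r < n" "Suc q \<noteq> n" "Suc r = n"
  then show ?thesis using vtx_eq[of "Suc q" 0] by auto
qed auto

lemma pos_vtx [simp]: "q < n \<Longrightarrow> pos (vtx q) = q"
  using vtx_inj by (simp add: pos_def)

lemma vtx_pos [simp]: "i \<in> {1..n} \<Longrightarrow> vtx (pos i) = i" "i \<in> {1..n} \<Longrightarrow> pos i < n"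
  using vtx_image unfolding pos_def by (metis f_inv_into_f, metis inv_into_into lessThan_iff)

lemma cycle_edges_vtx: "cycle_edges n = (\<lambda>q. {vtx q, vtx (Suc q)}) ` {..<n}"
proof -
  have "cycle_edges n = (\<lambda>i. {i, i mod n + 1}) ` (vtx ` {..<n})"
    by (simp add: vtx_image cycle_edges_alt[OF n3])
  then show ?thesis by (simp add: image_image vtx_Suc)
qed

lemma edge_cases:
  assumes "{i, j} \<in> cycle_edges n"
  obtains q where "q < n" "i = vtx q" "j = vtx (Suc q)" | q where "q < n" "j = vtx q" "i = vtx (Suc q)"
  using assms unfolding cycle_edges_vtx by (auto simp: doubleton_eq_iff)

lemma edgeI [simp]: "{vtx q, vtx (Suc q)} \<in> cycle_edges n" "{vtx (Suc q), vtx q} \<in> cycle_edges n"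
proof -
  have "{vtx (q mod n), vtx (Suc (q mod n))} \<in> cycle_edges n" unfolding cycle_edges_vtx by auto
  then show "{vtx q, vtx (Suc q)} \<in> cycle_edges n" by (simp add: vtx_Suc vtx_mod)
  then show "{vtx (Suc q), vtx q} \<in> cycle_edges n" by (simp add: insert_commute)
qed

text \<open>Induction along a path inside \<open>S\<close>. The condition \<open>G n = G 0\<close>
  makes \<open>G\<close> a function of the vertices, position \<open>n\<close> being the root again.
  All later uses of the connectedness of a set go through this invariance.\<close>

lemma connected_const:
  assumes "induces_connected n S"
    and step: "\<And>q. q < n \<Longrightarrow> vtx q \<in> S \<Longrightarrow> vtx (Suc q) \<in> S \<Longrightarrow> G (Suc q) = G q"
    and per: "G n = G 0"
    and "q < n" "r < n" "vtx q \<in> S" "vtx r \<in> S"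
  shows "G q = G r"
proof -
  have S: "G (pos (vtx (Suc q))) = G (Suc q)" if "q < n" for q
    using that per by (cases "Suc q = n") auto
  have "(vtx q, vtx r) \<in> {(a, b). a \<in> S \<and> b \<in> S \<and> {a, b} \<in> cycle_edges n}\<^sup>*"
    using assms by (auto simp: induces_connected_def)
  then have "G (pos (vtx q)) = G (pos (vtx r))"
  proof (induction rule: rtrancl_induct)
    case (step y z)
    then have "y \<in> S" "z \<in> S" "{y, z} \<in> cycle_edges n" by auto
    then have "G (pos y) = G (pos z)"
      by (elim edge_cases) (use S assms(2) in auto)
    with step show ?case by simp
  qed simp
  then show ?thesis using assms by simp
qed

text \<open>The cyclic index of the block containing the vertex number \<open>r\<close>: the remainder identifies the part after
  the last cut with the part before the first one.\<close>

definition key :: "nat set \<Rightarrow> nat \<Rightarrow> nat" where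
  "key A r = card {a \<in> A. a < r} mod card A"

definition blk :: "nat set \<Rightarrow> nat \<Rightarrow> nat set" where
  "blk A r = vtx ` {r'. r' < n \<and> key A r' = key A r}"

context
  fixes A :: "nat set"
  assumes A: "A \<subseteq> {..<n}"
begin

lemma finA: "finite A" using A finite_subset by blast

lemma key_n [simp]: "key A n = key A 0"
proof -
  have "{a \<in> A. a < n} = A" using A by auto
  then show ?thesis by (simp add: key_def)
qed

lemma key_0: "key A 0 = 0"
  by (simp add: key_def)

lemma key_less: "A \<noteq> {} \<Longrightarrow> key A r < card A"
  using finA by (simp add: key_def card_gt_0_iff)

lemma key_Suc_notin: "q \<notin> A \<Longrightarrow> key A (Suc q) = key A q"
  unfolding key_def by (rule arg_cong[of _ _ "\<lambda>x. card x mod _"]) (auto simp: less_Suc_eq)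

lemma key_Suc_in: "q \<in> A \<Longrightarrow> key A (Suc q) = Suc (key A q) mod card A"
proof -
  assume "q \<in> A"
  then have "{a \<in> A. a < Suc q} = insert q {a \<in> A. a < q}" by auto
  then have "card {a \<in> A. a < Suc q} = Suc (card {a \<in> A. a < q})" using finA by simp
  then show ?thesis by (simp add: key_def mod_Suc_eq)
qed

lemma key_in: "q \<in> A \<Longrightarrow> key A q = card {a \<in> A. a < q}"
proof -
  assume "q \<in> A"
  then have "{a \<in> A. a < q} \<subset> A" by auto
  then have "card {a \<in> A. a < q} < card A" using finA by (intro psubset_card_mono)
  then show ?thesis by (simp add: key_def)
qed

lemma key_inj: "q \<in> A \<Longrightarrow> q' \<in> A \<Longrightarrow> key A q = key A q' \<Longrightarrow> q = q'"
proof -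
  have *: "key A q \<noteq> key A q'" if "q \<in> A" "q' \<in> A" "q < q'" for q q'
  proof -
    have "{a \<in> A. a < q} \<subset> {a \<in> A. a < q'}" using that by auto
    then have "card {a \<in> A. a < q} < card {a \<in> A. a < q'}" using finA by (intro psubset_card_mono) auto
    then show ?thesis using that by (simp add: key_in)
  qed
  assume "q \<in> A" "q' \<in> A" "key A q = key A q'"
  then show "q = q'" using *[of q q'] *[of q' q] by (metis linorder_less_linear)
qed

lemma key_Suc_if: "q \<in> A \<Longrightarrow> key A (Suc q) = (if Suc (key A q) = card A then 0 else Suc (key A q))"
proof -
  assume q: "q \<in> A"
  then have "key A q < card A" by (intro key_less) auto
  then show ?thesis unfolding key_Suc_in[OF q] by (simp add: mod_Suc)
qed

lemma key_neq: "card A \<ge> 2 \<Longrightarrow> q \<in> A \<Longrightarrow> key A (Suc q) \<noteq> key A q"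
  by (simp add: key_Suc_if)

lemma key_Suc_inj: "q \<in> A \<Longrightarrow> q' \<in> A \<Longrightarrow> key A (Suc q) = key A (Suc q') \<Longrightarrow> q = q'"
  by (rule key_inj) (auto simp: key_Suc_if split: if_splits)

text \<open>Each of the two cuts leads from a block to the next one. If each leads to the start of
  the other, two steps return to the first block, so there are at most two blocks.\<close>

lemma key_swap: "q \<in> A \<Longrightarrow> q' \<in> A \<Longrightarrow> key A q = key A (Suc q') \<Longrightarrow> key A q' = key A (Suc q) \<Longrightarrow> card A \<le> 2"
proof -
  assume "q \<in> A" "q' \<in> A"
  then have *: "key A (Suc q) = (if Suc (key A q) = card A then 0 else Suc (key A q))"
    "key A (Suc q') = (if Suc (key A q') = card A then 0 else Suc (key A q'))"
    by (simp_all add: key_Suc_if)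
  assume "key A q = key A (Suc q')" "key A q' = key A (Suc q)"
  moreover have "a = b' \<Longrightarrow> b = a' \<Longrightarrow> a' = (if Suc a = m then 0 else Suc a) \<Longrightarrow>
      b' = (if Suc b = m then 0 else Suc b) \<Longrightarrow> m \<le> 2" for a b a' b' m :: nat
    by (cases "Suc a = m"; cases "Suc b = m") simp_all
  ultimately show "card A \<le> 2" using * by blast
qed

text \<open>Equal keys mean that the number of cuts between \<open>r\<close> and \<open>r'\<close>
  is a multiple of \<open>card A\<close>, hence 0 or \<open>card A\<close>. With no cut in between,
  walk from \<open>r\<close> to \<open>r'\<close>; with all cuts in between, walk the other way
  round through the root, where \<open>G n = G 0\<close> is used.\<close>

lemma key_const:
  assumes step: "\<And>q. q < n \<Longrightarrow> q \<notin> A \<Longrightarrow> G (Suc q) = G q" and per: "G n = G 0"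
    and "key A r = key A r'" "r \<le> n" "r' \<le> n"
  shows "G r = G r'"
proof -
  have seg: "G r = G r'" if "r \<le> r'" "r' \<le> n" "A \<inter> {r..<r'} = {}" for r r'
    using that
  proof (induction rule: dec_induct)
    case (step m)
    then show ?case using assms(1)[of m] by (force simp: disjoint_iff)
  qed simp
  have *: "G r = G r'" if k: "key A r = key A r'" and "r \<le> r'" "r' \<le> n" for r r'
  proof -
    have "{a \<in> A. a < r'} = {a \<in> A. a < r} \<union> (A \<inter> {r..<r'})" using that by auto
    then have c: "card {a \<in> A. a < r'} = card {a \<in> A. a < r} + card (A \<inter> {r..<r'})"
      using finA by (simp add: card_Un_disjoint disjoint_iff)
    have "card (A \<inter> {r..<r'}) \<le> card A" using finA by (intro card_mono) auto
    moreover have "card A dvd card (A \<inter> {r..<r'})"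
      using k unfolding key_def c by (metis add_diff_cancel_left' le_add1 mod_eq_dvd_iff_nat)
    ultimately have "card (A \<inter> {r..<r'}) = 0 \<or> card (A \<inter> {r..<r'}) = card A"
      by (metis dvd_imp_le le_antisym not_gr_zero)
    then show ?thesis
    proof
      assume "card (A \<inter> {r..<r'}) = 0"
      then show ?thesis using seg[of r r'] that finA by simp
    next
      assume "card (A \<inter> {r..<r'}) = card A"
      then have "A \<inter> {r..<r'} = A" using finA by (intro card_subset_eq) auto
      then have "A \<subseteq> {r..<r'}" by blast
      then have "A \<inter> {0..<r} = {}" "A \<inter> {r'..<n} = {}" by auto
      then have "G 0 = G r" "G r' = G n" using that by (auto intro!: seg)
      then show ?thesis using per by simp
    qed
  qed
  show ?thesis using *[of r r'] *[of r' r] assms(3-) by (metis linorder_linear)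
qed

lemma blk_n [simp]: "blk A n = blk A 0"
  by (simp add: blk_def)

lemma vtx_in_blk: "r \<le> n \<Longrightarrow> vtx r \<in> blk A r"
  by (cases "r = n") (auto simp: blk_def )

lemma in_blk_iff: "q \<le> n \<Longrightarrow> vtx q \<in> blk A r \<longleftrightarrow> key A q = key A r"
proof -
  have *: "vtx q \<in> blk A r \<longleftrightarrow> key A q = key A r" if "q < n" for q
    using that vtx_eq unfolding blk_def by blast
  assume "q \<le> n"
  then show ?thesis using *[of q] *[of 0] by (cases "q = n") auto
qed

lemma blk_subset: "blk A r \<subseteq> {1..n}"
  unfolding blk_def by (auto simp: Suc_leI)

lemma blk_eq_iff: "q \<le> n \<Longrightarrow> blk A q = blk A r \<longleftrightarrow> key A q = key A r"
proof
  assume "q \<le> n" "blk A q = blk A r"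
  then show "key A q = key A r" using vtx_in_blk in_blk_iff by blast
qed (simp add: blk_def)

lemma blk_disjoint: "q \<le> n \<Longrightarrow> vtx q \<in> blk A r \<Longrightarrow> blk A q = blk A r"
  by (simp add: in_blk_iff blk_eq_iff)

end

text \<open>Potentials on the cycle are built as functions of the position. This turns one that
  changes only at cuts into a function of the blocks.\<close>

lemma key_factor:
  assumes A: "A \<subseteq> {..<n}"
    and step: "\<And>q. q < n \<Longrightarrow> q \<notin> A \<Longrightarrow> G (Suc q) = G q" and per: "G n = G 0"
  obtains H where "\<And>r. r \<le> n \<Longrightarrow> H (blk A r) = G r"
proof
  fix r assume r: "r \<le> n"
  let ?r = "SOME r'. r' \<le> n \<and> blk A r' = blk A r"
  have "?r \<le> n \<and> blk A ?r = blk A r" by (rule someI[of _ r]) (use r in simp)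
  then show "G ?r = G r"
    by (intro key_const[OF A step per]) (use r blk_eq_iff[OF A, of ?r r] in auto)
qed

definition blocks :: "nat set \<Rightarrow> nat set set" where "blocks A = blk A ` {..<n}"

lemma blk_in_blocks: "A \<subseteq> {..<n} \<Longrightarrow> q \<le> n \<Longrightarrow> blk A q \<in> blocks A"
  by (cases "q = n") (auto simp: blocks_def)

text \<open>The cuts in \<open>P\<close> point clockwise and the other ones counterclockwise. The inequalities only matter for
  \<open>card A = 1\<close>.\<close>

definition cut_dedges :: "nat set \<Rightarrow> nat set \<Rightarrow> dedge set" where
  "cut_dedges A P = {(blk A q, blk A (Suc q)) | q. q \<in> P \<and> blk A q \<noteq> blk A (Suc q)} \<union>
     {(blk A (Suc q), blk A q) | q. q \<in> A - P \<and> blk A q \<noteq> blk A (Suc q)}"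

definition cut_opart :: "nat set \<Rightarrow> nat set \<Rightarrow> opart" where "cut_opart A P = (blocks A, cut_dedges A P)"

text \<open>Deleting the cut \<open>q\<close> joins the two blocks on its sides and no others. The
  new numbering of the blocks is never computed: each direction applies \<open>key_const\<close>,
  once to the new keys with respect to \<open>A\<close>, and once to the old keys, with the two
  joined blocks identified, with respect to \<open>A - {q}\<close>.\<close>

lemma key_remove:
  assumes A: "A \<subseteq> {..<n}" and q: "q \<in> A" and r: "r \<le> n" "r' \<le> n"
  shows "key (A - {q}) r = key (A - {q}) r' \<longleftrightarrow>
    key A r = key A r' \<or> key A r \<in> {key A q, key A (Suc q)} \<and> key A r' \<in> {key A q, key A (Suc q)}"
proof
  have A': "A - {q} \<subseteq> {..<n}" using A by auto
  have qn: "q < n" "Suc q \<le> n" using A q by auto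
  have 1: "key (A - {q}) r = key (A - {q}) r'" if "key A r = key A r'" "r \<le> n" "r' \<le> n" for r r'
    by (rule key_const[OF A _ _ that]) (use key_Suc_notin[OF A'] key_n[OF A'] in auto)
  have 2: "key (A - {q}) (Suc q) = key (A - {q}) q" by (rule key_Suc_notin[OF A']) simp
  assume *: "key A r = key A r' \<or> key A r \<in> {key A q, key A (Suc q)} \<and> key A r' \<in> {key A q, key A (Suc q)}"
  have "key (A - {q}) r = key (A - {q}) q" if "key A r \<in> {key A q, key A (Suc q)}" "r \<le> n" for r
    using that 1[of r q] 1[of r "Suc q"] 2 qn by auto
  then show "key (A - {q}) r = key (A - {q}) r'" using * 1 r by metis
next
  have A': "A - {q} \<subseteq> {..<n}" using A by auto
  assume k: "key (A - {q}) r = key (A - {q}) r'"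
  define G where "G x = (if key A x \<in> {key A q, key A (Suc q)} then None else Some (key A x))" for x
  have "G r = G r'"
  proof (rule key_const[OF A' _ _ k r])
    show "G (Suc x) = G x" if "x < n" "x \<notin> A - {q}" for x
      using that key_Suc_notin[OF A, of x] by (cases "x = q") (auto simp: G_def)
    show "G n = G 0" using A by (simp add: G_def)
  qed
  then show "key A r = key A r' \<or> key A r \<in> {key A q, key A (Suc q)} \<and> key A r' \<in> {key A q, key A (Suc q)}"
    by (auto simp: G_def split: if_splits)
qed

end

section \<open>Contraction of cuts and acyclic orientations of the cycle of blocks\<close>

lemma acyclic_if_decreasing:
  fixes H :: "'a \<Rightarrow> int"
  assumes "\<And>x y. (x, y) \<in> r \<Longrightarrow> H y < H x"
  shows "acyclic r"
proof -
  have "H y < H x" if "(x, y) \<in> r\<^sup>+" for x y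
    using that by (induction rule: trancl_induct) (auto dest: assms intro: less_trans)
  then show ?thesis by (force simp: acyclic_def)
qed

lemma prefix_sum_Suc:
  fixes A :: "nat set" and g :: "nat \<Rightarrow> 'a::comm_monoid_add"
  assumes "finite A"
  shows "(\<Sum>x\<in>{x \<in> A. x < Suc q}. g x) = (\<Sum>x\<in>{x \<in> A. x < q}. g x) + (if q \<in> A then g q else 0)"
proof -
  have "{x \<in> A. x < Suc q} = (if q \<in> A then insert q {x \<in> A. x < q} else {x \<in> A. x < q})"
    by (auto simp: less_Suc_eq)
  then show ?thesis using assms by (simp add: add.commute)
qed

context rooted_cycle
begin

lemma finite_cycle_edges: "finite (cycle_edges n)"
  by (simp add: cycle_edges_vtx)

lemma edges_between_pos:
  "edges_between n U W > 0 \<longleftrightarrow>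
    (\<exists>q<n. vtx q \<in> U \<and> vtx (Suc q) \<in> W \<or> vtx (Suc q) \<in> U \<and> vtx q \<in> W)"
proof -
  have "edges_between n U W > 0 \<longleftrightarrow> (\<exists>e\<in>cycle_edges n. \<exists>i\<in>U. \<exists>j\<in>W. e = {i, j})"
    unfolding edges_between_def using finite_cycle_edges by (auto simp: card_gt_0_iff)
  also have "\<dots> \<longleftrightarrow> (\<exists>q<n. vtx q \<in> U \<and> vtx (Suc q) \<in> W \<or> vtx (Suc q) \<in> U \<and> vtx q \<in> W)"
    unfolding cycle_edges_vtx by (auto simp: doubleton_eq_iff) (blast+)?
  finally show ?thesis .
qed

lemma blocks_partition: "A \<subseteq> {..<n} \<Longrightarrow> partition_on {1..n} (blocks A)"
proof (rule partition_onI)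
  assume A: "A \<subseteq> {..<n}"
  have "i \<in> \<Union> (blocks A)" if "i \<in> {1..n}" for i
    using vtx_in_blk[OF A, of "pos i"] vtx_pos[OF that] by (auto simp: blocks_def)
  then show "\<Union> (blocks A) = {1..n}" using blk_subset[OF A] by (fastforce simp: blocks_def)
  show "disjnt p p'" if p: "p \<in> blocks A" "p' \<in> blocks A" "p \<noteq> p'" for p p'
  proof -
    obtain r r' where r: "p = blk A r" "p' = blk A r'" "r < n" "r' < n" using p by (auto simp: blocks_def)
    have "False" if "i \<in> p" "i \<in> p'" for i
    proof -
      have "i \<in> {1..n}" using that r blk_subset[OF A] by blast
      then have "blk A (pos i) = blk A r" "blk A (pos i) = blk A r'"
        using vtx_pos[of i] that r blk_disjoint[OF A, of "pos i"] by (metis less_imp_le_nat)+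
      then show False using p r by simp
    qed
    then show ?thesis by (auto simp: disjnt_def)
  qed
  show "{} \<notin> blocks A"
    using vtx_in_blk[OF A] unfolding blocks_def by (metis (no_types) emptyE imageE lessThan_iff
        less_imp_le_nat)
qed

text \<open>A directed edge is named by a cut and a direction, where \<open>True\<close> is
  clockwise. From three cuts on the name is unique; with two cuts every directed edge has two
  names.\<close>

definition cut_edge :: "nat set \<Rightarrow> nat \<Rightarrow> bool \<Rightarrow> dedge" where
  "cut_edge A q d = (if d then (blk A q, blk A (Suc q)) else (blk A (Suc q), blk A q))"

lemma merge_blk:
  assumes A: "A \<subseteq> {..<n}" and q: "q \<in> A" and r: "r \<le> n"
  shows "merge_block (cut_edge A q d) (blk A r) = blk (A - {q}) r"
proof -
  have qn: "q \<le> n" "Suc q \<le> n" using A q by auto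
  have m: "merge_block (cut_edge A q d) B = (if B = blk A q \<or> B = blk A (Suc q) then blk A q \<union> blk A (Suc q)
      else B)" for B
    by (auto simp: merge_block_def cut_edge_def)
  show ?thesis
  proof (cases "key A r \<in> {key A q, key A (Suc q)}")
    case True
    then have "merge_block (cut_edge A q d) (blk A r) = blk A q \<union> blk A (Suc q)"
      unfolding m using A r by (auto simp: blk_eq_iff)
    moreover have "key (A - {q}) r' = key (A - {q}) r \<longleftrightarrow> key A r' = key A q \<or> key A r' = key A (Suc q)" if
        "r' < n" for r'
      using key_remove[OF A q, of r' r] that r True by auto
    ultimately show ?thesis by (auto simp: blk_def)
  next
    case False
    then have "merge_block (cut_edge A q d) (blk A r) = blk A r"
      unfolding m using A r by (auto simp: blk_eq_iff)
    moreover have "key (A - {q}) r' = key (A - {q}) r \<longleftrightarrow> key A r' = key A r" if "r' < n" for r'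
      using key_remove[OF A q, of r' r] that r False by auto
    ultimately show ?thesis by (auto simp: blk_def)
  qed
qed

lemma merge_cut_edge:
  assumes A: "A \<subseteq> {..<n}" and q: "q \<in> A" and r: "r < n"
  shows "merge_edge (cut_edge A q d) (cut_edge A r d') = cut_edge (A - {q}) r d'"
  using merge_blk[OF A q, of r] merge_blk[OF A q, of "Suc r"] r by (simp add: merge_edge_def cut_edge_def)

lemma cut_dedges_alt: "cut_dedges A P = {g. (\<exists>q\<in>P. g = cut_edge A q True) \<or>
    (\<exists>q\<in>A - P. g = cut_edge A q False)} \<inter> {g. fst g \<noteq> snd g}"
  unfolding cut_dedges_def cut_edge_def by auto

text \<open>Merging turns the name of an edge over \<open>A\<close> into the same name over
  \<open>A - {q}\<close>. The edge at \<open>q\<close> becomes a loop, which \<open>contract\<close>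
  discards. If only one cut remains, all edges are loops and both sides have no edge left.\<close>

lemma contract_cut_opart:
  assumes A: "A \<subseteq> {..<n}" and q: "q \<in> A" and P: "P \<subseteq> A"
  shows "contract (cut_opart A P) (cut_edge A q d) = cut_opart (A - {q}) (P - {q})"
proof -
  let ?f = "cut_edge A q d"
  have "merge_block ?f ` blocks A = blocks (A - {q})"
    unfolding blocks_def image_image using merge_blk[OF A q] by (intro image_cong) auto
  moreover have "{g \<in> merge_edge ?f ` cut_dedges A P. fst g \<noteq> snd g} = cut_dedges (A - {q}) (P - {q})"
  proof -
    have m: "merge_edge ?f (cut_edge A r e) = cut_edge (A - {q}) r e" if "r \<in> A" for r e
      using merge_cut_edge[OF A q] that A by auto
    have loop: "fst (cut_edge (A - {q}) q e) = snd (cut_edge (A - {q}) q e)" for e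
    proof -
      have "key (A - {q}) (Suc q) = key (A - {q}) q" using A by (intro key_Suc_notin) auto
      then show ?thesis by (simp add: cut_edge_def blk_def)
    qed
    have ne: "fst (cut_edge A r e) \<noteq> snd (cut_edge A r e)" if "fst (cut_edge (A - {q}) r e) \<noteq> snd
        (cut_edge (A - {q}) r e)" "r \<in> A" for r e
      using that m[OF that(2), of e] unfolding merge_edge_def by (metis fst_conv snd_conv)
    show ?thesis
    proof (intro equalityI subsetI)
      fix g assume "g \<in> {g \<in> merge_edge ?f ` cut_dedges A P. fst g \<noteq> snd g}"
      then obtain g' where g': "g' \<in> cut_dedges A P" "g = merge_edge ?f g'" "fst g \<noteq> snd g" by auto
      then obtain r e where r: "g' = cut_edge A r e" "e \<longrightarrow> r \<in> P" "\<not> e \<longrightarrow> r \<in> A - P" unfolding cut_dedges_alt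
          by auto
      then have "r \<in> A" using P by (cases e) auto
      then have "g = cut_edge (A - {q}) r e" using g' r m by simp
      moreover have "r \<noteq> q" using g'(3) calculation loop by metis
      ultimately show "g \<in> cut_dedges (A - {q}) (P - {q})" unfolding cut_dedges_alt using r g'(3)
          by (cases e) auto
    next
      fix g assume "g \<in> cut_dedges (A - {q}) (P - {q})"
      then obtain r e where r: "g = cut_edge (A - {q}) r e" "e \<longrightarrow> r \<in> P - {q}" "\<not> e \<longrightarrow> r \<in> (A - {q})
          - (P - {q})"
        "fst g \<noteq> snd g" unfolding cut_dedges_alt by auto
      then have rA: "r \<in> A" using P by (cases e) auto
      have "cut_edge A r e \<in> cut_dedges A P" unfolding cut_dedges_alt using r ne[OF _ rA, of e] by (cases e)
          auto
      then show "g \<in> {g \<in> merge_edge ?f ` cut_dedges A P. fst g \<noteq> snd g}"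
        using r m[OF rA, of e] by (auto intro!: image_eqI[of _ _ "cut_edge A r e"])
    qed
  qed
  ultimately show ?thesis by (simp add: contract_def cut_opart_def)
qed

text \<open>An orientation of a cycle of at least two blocks is acyclic exactly if its cuts do not
  all turn the same way. With two cuts this also expresses that parallel edges have the same
  direction, because running from one block to the other is clockwise at one cut and
  counterclockwise at the other.\<close>

definition proper :: "nat set \<Rightarrow> nat set \<Rightarrow> bool" where
  "proper A P \<longleftrightarrow> A \<subseteq> {..<n} \<and> 2 \<le> card A \<and> P \<subset> A \<and> P \<noteq> {}"

lemma blk_Suc_neq: "A \<subseteq> {..<n} \<Longrightarrow> 2 \<le> card A \<Longrightarrow> q < n \<Longrightarrow> blk A q = blk A (Suc q) \<longleftrightarrow> q \<notin> A"
  using key_neq[of A q] key_Suc_notin[of A q] by (auto simp: blk_eq_iff)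

lemma cut_edge_inj:
  assumes A: "A \<subseteq> {..<n}" "q \<in> A" "q' \<in> A" and eq: "cut_edge A q d = cut_edge A q' d'"
  shows "card A \<le> 2 \<or> (q = q' \<and> d = d')"
proof -
  have n: "q < n" "q' < n" using A by auto
  show ?thesis
  proof (cases "d = d'")
    case True
    then show ?thesis using eq key_inj[OF A] n A(1) by (cases d) (auto simp: cut_edge_def blk_eq_iff)
  next
    case False
    then have "key A q = key A (Suc q')" "key A q' = key A (Suc q)"
      using eq n A(1) by (cases d; auto simp: cut_edge_def blk_eq_iff Suc_leI)+
    then show ?thesis using key_swap[OF A] by auto
  qed
qed

lemma cut_edge_dir_inj:
  assumes A: "A \<subseteq> {..<n}" "q \<in> A" "q' \<in> A" and eq: "cut_edge A q d = cut_edge A q' d"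
  shows "q = q'"
proof -
  have n: "q < n" "q' < n" using A by auto
  show ?thesis using eq key_inj[OF A] n A(1) by (cases d) (auto simp: cut_edge_def blk_eq_iff)
qed

lemma cut_edge_two:
  assumes A: "A \<subseteq> {..<n}" "A = {q, q'}" "q \<noteq> q'"
  shows "cut_edge A q d = cut_edge A q' (\<not> d)"
proof -
  have n: "q < n" "q' < n" using A by auto
  have c: "card A = 2" using A by simp
  have qA: "q \<in> A" "q' \<in> A" using A by auto
  have l: "key A q < 2" "key A q' < 2" using key_less[OF A(1)] qA c by auto
  have ne: "key A q \<noteq> key A q'" using key_inj[OF A(1) qA] A(3) by auto
  then have "key A (Suc q) = key A q'" "key A (Suc q') = key A q"
    using l c by (auto simp: key_Suc_if[OF A(1)] qA split: if_splits)
  then show ?thesis using n A(1) by (auto simp: cut_edge_def blk_eq_iff Suc_leI)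
qed

lemma cut_edge_neq: "A \<subseteq> {..<n} \<Longrightarrow> 2 \<le> card A \<Longrightarrow> q \<in> A \<Longrightarrow> fst (cut_edge A q d) \<noteq> snd (cut_edge A q d)"
proof -
  assume A: "A \<subseteq> {..<n}" "2 \<le> card A" "q \<in> A"
  then have "q < n" by auto
  then show ?thesis using blk_Suc_neq[of A q] A by (auto simp: cut_edge_def)
qed

text \<open>The delicate case is that of two cuts, where the edge may also be listed under the other
  cut in the opposite direction. Since exactly one of the two cuts is in \<open>P\<close>, both
  names give the same answer.\<close>

lemma cut_edge_in_cut_dedges:
  assumes "proper A P" "q \<in> A"
  shows "cut_edge A q d \<in> cut_dedges A P \<longleftrightarrow> (d \<longleftrightarrow> q \<in> P)"
proof -
  have A: "A \<subseteq> {..<n}" "2 \<le> card A" "P \<subset> A" "P \<noteq> {}" using assms by (auto simp: proper_def)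
  have nl: "fst (cut_edge A q d) \<noteq> snd (cut_edge A q d)" for d using cut_edge_neq A assms by auto
  have "d \<longleftrightarrow> q \<in> P" if f: "cut_edge A q d = cut_edge A q' d'" and d': "d' \<longleftrightarrow> q' \<in> P" and q': "q' \<in> A" for q' d'
  proof (cases "q = q'")
    case True
    have "fst (cut_edge A q d) = snd (cut_edge A q (\<not> d))" by (simp add: cut_edge_def)
    then have "cut_edge A q d \<noteq> cut_edge A q (\<not> d)" using nl[of d] by metis
    moreover have "cut_edge A q d' = cut_edge A q (\<not> d)" if "d \<noteq> d'" using that by (cases d; cases d')
        simp_all
    ultimately have "d = d'" using f True by metis
    then show ?thesis using True d' by simp
  next
    case False
    then have "card A = 2" using cut_edge_inj[OF A(1) assms(2) q' f] A(2) by auto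
    moreover have "d \<noteq> d'" using False cut_edge_dir_inj[OF A(1) assms(2) q', of d] f by (cases d; cases d')
        auto
    ultimately have c: "card A = 2" "d \<noteq> d'" by auto
    then have "A = {q, q'}" using assms(2) q' False by (auto simp: card_2_iff)
    then have "q \<in> P \<longleftrightarrow> q' \<notin> P" using A(3,4) by auto
    then show ?thesis using c d' by auto
  qed
  note key = this
  show ?thesis
  proof
    assume "cut_edge A q d \<in> cut_dedges A P"
    then have "(\<exists>q'\<in>P. cut_edge A q d = cut_edge A q' True) \<or>
        (\<exists>q'\<in>A - P. cut_edge A q d = cut_edge A q' False)"
      unfolding cut_dedges_alt by auto
    then show "d \<longleftrightarrow> q \<in> P"
    proof (elim disjE bexE)
      fix q' assume "q' \<in> P" "cut_edge A q d = cut_edge A q' True"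
      then show ?thesis using key[of q' True] A(3) by blast
    next
      fix q' assume "q' \<in> A - P" "cut_edge A q d = cut_edge A q' False"
      then show ?thesis using key[of q' False] by blast
    qed
  next
    assume "d \<longleftrightarrow> q \<in> P"
    then show "cut_edge A q d \<in> cut_dedges A P" using nl[of d] assms(2) unfolding cut_dedges_alt
        by (cases d) auto
  qed
qed

text \<open>The height drops by \<open>card (A - P)\<close> along each clockwise cut and rises by \<open>card P\<close> across each
  counterclockwise one, so that it is well defined on the cycle and decreases along all arrows.\<close>

lemma acyclic_cut_dedges:
  assumes "proper A P"
  shows "acyclic (cut_dedges A P)"
proof -
  have A: "A \<subseteq> {..<n}" "2 \<le> card A" "P \<subset> A" "P \<noteq> {}" using assms by (auto simp: proper_def)
  have fA: "finite A" using A finite_subset by blast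
  have fP: "finite P" using A fA finite_subset by blast
  define h :: "nat \<Rightarrow> int" where
    "h r = (\<Sum>x\<in>{x\<in>A. x < r}. if x \<in> P then - int (card (A - P)) else int (card P))" for r
  have hS: "h (Suc q) = h q + (if q \<in> P then - int (card (A - P)) else int (card P))" if "q \<in> A" for q
    unfolding h_def prefix_sum_Suc[OF fA] using that by simp
  have hN: "h (Suc q) = h q" if "q \<notin> A" for q
    unfolding h_def prefix_sum_Suc[OF fA] using that by simp
  have h0: "h n = h 0"
  proof -
    have "{x\<in>A. x < n} = A" using A by auto
    then have "h n = (\<Sum>x\<in>P \<union> (A - P). if x \<in> P then - int (card (A - P)) else int (card P))"
      unfolding h_def using A by (simp add: Un_absorb1)
    also have "\<dots> = (\<Sum>x\<in>P. - int (card (A - P))) + (\<Sum>x\<in>A-P. int (card P))"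
      using fA fP by (subst sum.union_disjoint) auto
    finally show ?thesis by (simp add: h_def mult.commute)
  qed
  obtain H where HB: "\<And>r. r \<le> n \<Longrightarrow> H (blk A r) = h r"
    using key_factor[of A h] A(1) hN h0 by blast
  have c: "card (A - P) > 0" "card P > 0" using A fA fP by (auto simp: card_gt_0_iff)
  show ?thesis
  proof (rule acyclic_if_decreasing)
    fix U W assume "(U, W) \<in> cut_dedges A P"
    then have "(\<exists>q\<in>P. (U, W) = cut_edge A q True) \<or> (\<exists>q\<in>A - P. (U, W) = cut_edge A q False)"
      unfolding cut_dedges_alt by auto
    then obtain q d where q: "(U, W) = cut_edge A q d" "q \<in> A" "d \<longleftrightarrow> q \<in> P" using A(3) by blast
    have "q < n" using q A by auto
    then show "H W < H U" using q hS[OF q(2)] c HB[of q] HB[of "Suc q"]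
        by (auto simp: cut_edge_def split: if_splits)
  qed
qed

text \<open>If all cuts are clockwise, the walk once around the cycle leads from a block back to
  itself; the other case is the converse relation.\<close>

lemma cyclic_cut_dedges:
  assumes A: "A \<subseteq> {..<n}" "2 \<le> card A"
  shows "\<not> acyclic (cut_dedges A A)" "\<not> acyclic (cut_dedges A {})"
proof -
  have path: "(blk A a, blk A b) \<in> (cut_dedges A A)\<^sup>*" if "a \<le> b" "b \<le> n" for a b
    using that
  proof (induction rule: dec_induct)
    case (step m)
    then have m: "m < n" by simp
    have "blk A m = blk A (Suc m) \<or> (blk A m, blk A (Suc m)) \<in> cut_dedges A A"
      using blk_Suc_neq[OF A m] by (auto simp: cut_dedges_def)
    then show ?case using step by (metis Suc_leD rtrancl.rtrancl_into_rtrancl)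
  qed simp
  obtain q where q: "q \<in> A" using A by fastforce
  then have qn: "q < n" using A by auto
  have "(blk A q, blk A (Suc q)) \<in> cut_dedges A A" using q blk_Suc_neq[OF A qn] by (auto simp: cut_dedges_def)
  moreover have "(blk A (Suc q), blk A n) \<in> (cut_dedges A A)\<^sup>*" "(blk A 0, blk A q) \<in> (cut_dedges A A)\<^sup>*"
    using path qn by auto
  ultimately have "(blk A q, blk A q) \<in> (cut_dedges A A)\<^sup>+"
    using A(1) by (metis blk_n r_into_trancl rtrancl_trancl_trancl trancl_rtrancl_trancl rtrancl_into_trancl2)
  then show *: "\<not> acyclic (cut_dedges A A)" by (auto simp: acyclic_def)
  have "cut_dedges A {} = (cut_dedges A A)\<inverse>" by (auto simp: cut_dedges_def)
  then show "\<not> acyclic (cut_dedges A {})" using * by (simp add: acyclic_converse)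
qed

lemma edges_between_blocks:
  assumes A: "A \<subseteq> {..<n}" "2 \<le> card A" and "U \<in> blocks A" "W \<in> blocks A" "U \<noteq> W"
  shows "edges_between n U W > 0 \<longleftrightarrow> (\<exists>q\<in>A. \<exists>d. (U, W) = cut_edge A q d)"
proof
  obtain r r' where r: "U = blk A r" "W = blk A r'" "r < n" "r' < n" using assms by (auto simp: blocks_def)
  assume "edges_between n U W > 0"
  then obtain q where q: "q < n" "vtx q \<in> U \<and> vtx (Suc q) \<in> W \<or> vtx (Suc q) \<in> U \<and> vtx q \<in> W"
    by (auto simp: edges_between_pos)
  then have *: "blk A q = U \<and> blk A (Suc q) = W \<or> blk A (Suc q) = U \<and> blk A q = W"
    using r blk_disjoint[OF A(1), of q] blk_disjoint[OF A(1), of "Suc q"] by (metis Suc_leI less_imp_le_nat)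
  then have "q \<in> A" using blk_Suc_neq[OF A q(1)] assms(5) by auto
  moreover have "(U, W) = cut_edge A q True \<or> (U, W) = cut_edge A q False" using
      * by (auto simp: cut_edge_def)
  ultimately show "\<exists>q\<in>A. \<exists>d. (U, W) = cut_edge A q d" by blast
next
  assume "\<exists>q\<in>A. \<exists>d. (U, W) = cut_edge A q d"
  then obtain q d where q: "q \<in> A" "(U, W) = cut_edge A q d" by blast
  then have "q < n" using A by auto
  then show "edges_between n U W > 0" unfolding edges_between_pos using q A(1)
    by (intro exI[of _ q]) (cases d; auto simp: cut_edge_def vtx_in_blk Suc_leI)
qed

lemma cut_edge_blocks: "A \<subseteq> {..<n} \<Longrightarrow> q \<in> A \<Longrightarrow> fst (cut_edge A q d) \<in> blocks A \<and> snd (cut_edge A q d) \<in> blocks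
    A"
proof -
  assume A: "A \<subseteq> {..<n}" "q \<in> A"
  then have "q < n" by auto
  then have "blk A q \<in> blocks A" "blk A (Suc q) \<in> blocks A" using blk_in_blocks[OF A(1)] by simp_all
  then show ?thesis by (simp add: cut_edge_def)
qed

lemma orientation_cut_opart:
  assumes "proper A P"
  shows "orientation n (blocks A) (cut_dedges A P)"
proof -
  have A: "A \<subseteq> {..<n}" "2 \<le> card A" "P \<subset> A" "P \<noteq> {}" using assms by (auto simp: proper_def)
  show ?thesis
  unfolding orientation_def
  proof (intro conjI ballI impI)
    fix g assume g: "g \<in> cut_dedges A P"
    obtain U W where UW: "g = (U, W)" by force
    from g obtain q d where q: "g = cut_edge A q d" "q \<in> A" unfolding cut_dedges_alt using A by auto
    have "U \<in> blocks A" "W \<in> blocks A" "U \<noteq> W" using cut_edge_blocks[OF A(1) q(2), of d]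
        cut_edge_neq[OF A(1,2) q(2), of d] q UW
      by (metis fst_conv snd_conv)+
    moreover have "edges_between n U W > 0" using edges_between_blocks[OF A(1,2) calculation] q UW by auto
    ultimately show "case g of (U, W) \<Rightarrow> U \<in> blocks A \<and> W \<in> blocks A \<and> U \<noteq> W \<and> 0 < edges_between n U W"
      using UW by simp
  next
    fix U W assume *: "U \<in> blocks A" "W \<in> blocks A" "U \<noteq> W \<and> 0 < edges_between n U W"
    then obtain q d where q: "q \<in> A" "(U, W) = cut_edge A q d" using edges_between_blocks[OF A(1,2) *(1,2)]
        by auto
    then have "(W, U) = cut_edge A q (\<not> d)" by (auto simp: cut_edge_def split: if_splits)
    then show "((U, W) \<in> cut_dedges A P) = ((W, U) \<notin> cut_dedges A P)" using q
        cut_edge_in_cut_dedges[OF assms q(1)] by auto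
  qed
qed

lemma cut_opart_small:
  assumes A: "A \<subseteq> {..<n}" "card A \<le> 1"
  shows "cut_opart A P = ({{1..n}}, {})"
proof -
  have k: "key A r = 0" for r
    using key_less[OF A(1), of r] A(2) by (cases "A = {}") (auto simp: key_def)
  have "blk A r = {1..n}" for r using vtx_image unfolding blk_def k by (auto simp: image_def)
  note b = this
  have "blocks A = {{1..n}}" unfolding blocks_def b by (rule image_constant[of 0]) simp
  moreover have "cut_dedges A P = {}" unfolding cut_dedges_def b by simp
  ultimately show ?thesis by (simp add: cut_opart_def)
qed

text \<open>The cuts are the edges whose ends share no block of \<open>Q\<close>. A block of
  \<open>Q\<close> is connected without crossing a cut, so it lies in a block of \<open>A\<close>;
  conversely, the block of \<open>Q\<close> around a vertex does not change at uncut edges. A single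
  cut is impossible: it would leave only one block, and then no edge is cut.\<close>

lemma partition_is_blocks:
  assumes Q: "partition_on {1..n} Q" "\<And>W. W \<in> Q \<Longrightarrow> induces_connected n W"
  defines "A \<equiv> {q. q < n \<and> \<not> (\<exists>W\<in>Q. vtx q \<in> W \<and> vtx (Suc q) \<in> W)}"
  shows "A \<subseteq> {..<n} \<and> Q = blocks A \<and> card A \<noteq> 1"
proof -
  have A: "A \<subseteq> {..<n}" by (auto simp: A_def)
  have ex1: "\<exists>!W. W \<in> Q \<and> vtx r \<in> W" for r
    using Q(1) vtx_in[of r] partition_onD2[OF Q(1)] partition_onD1[OF Q(1)] by (auto simp: disjoint_def)
  define b where "b r = (THE W. W \<in> Q \<and> vtx r \<in> W)" for r
  have b: "b r \<in> Q" "vtx r \<in> b r" for r using theI'[OF ex1[of r]] by (auto simp: b_def)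
  have bu: "W = b r" if "W \<in> Q" "vtx r \<in> W" for W r using ex1[of r] that b[of r] by auto
  have bS: "b (Suc q) = b q" if "q < n" "q \<notin> A" for q
    using that by (auto simp: A_def dest: bu)
  have bn: "b n = b 0" by (simp add: b_def)
  have bb: "b r = blk A r" if "r < n" for r
  proof (intro equalityI subsetI)
    fix i assume i: "i \<in> b r"
    have "b r \<subseteq> {1..n}" using b(1) partition_onD1[OF Q(1)] by auto
    then obtain r' where r': "r' < n" "i = vtx r'" using i vtx_pos[of i] by (metis subsetD)
    have "key A r' = key A r"
    proof (rule connected_const[of "b r" "key A"])
      show "induces_connected n (b r)" using Q b by auto
      show "key A (Suc q) = key A q" if "q < n" "vtx q \<in> b r" "vtx (Suc q) \<in> b r" for q
        using that b[of r] by (intro key_Suc_notin[OF A]) (auto simp: A_def)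
      show "key A n = key A 0" using A by simp
    qed (use r' i that b in auto)
    then show "i \<in> blk A r" using r' by (auto simp: blk_def)
  next
    fix i assume i: "i \<in> blk A r"
    then obtain r' where r': "i = vtx r'" "r' < n" "key A r' = key A r" by (auto simp: blk_def)
    have "b r' = b r" by (rule key_const[OF A _ _ r'(3)]) (use bS bn that r' in auto)
    then show "i \<in> b r" using b[of r'] r' by simp
  qed
  have "W \<in> blocks A" if "W \<in> Q" for W
  proof -
    have "W \<noteq> {}" "W \<subseteq> {1..n}" using that partition_onD3[OF Q(1)] partition_onD1[OF Q(1)] by auto
    then obtain i where i: "i \<in> W" "i \<in> {1..n}" by blast
    then have "W = b (pos i)" using bu[OF that, of "pos i"] by auto
    then show ?thesis using bb[of "pos i"] i by (auto simp: blocks_def)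
  qed
  moreover have "W \<in> Q" if "W \<in> blocks A" for W using that bb b by (auto simp: blocks_def) metis
  ultimately have QA: "Q = blocks A" by auto
  have "card A \<noteq> 1"
  proof
    assume c: "card A = 1"
    then obtain q where q: "A = {q}" by (auto simp: card_1_singleton_iff)
    have "blocks A = {{1..n}}" using cut_opart_small[OF A, of "{}"] c by (simp add: cut_opart_def)
    then have "{1..n} \<in> Q" using QA by simp
    then have "q \<notin> A" unfolding A_def using vtx_in by blast
    then show False using q by simp
  qed
  then show ?thesis using A QA by simp
qed

lemma orientation_is_cut_dedges:
  assumes A: "A \<subseteq> {..<n}" "2 \<le> card A" and D: "orientation n (blocks A) D" "acyclic D"
  shows "\<exists>P. proper A P \<and> D = cut_dedges A P"
proof -
  define P where "P = {q\<in>A. cut_edge A q True \<in> D}"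
  have flip: "cut_edge A q True \<in> D \<longleftrightarrow> cut_edge A q False \<notin> D" if "q \<in> A" for q
  proof -
    obtain U W where UW: "cut_edge A q True = (U, W)" by force
    then have "cut_edge A q False = (W, U)" by (auto simp: cut_edge_def)
    moreover have "U \<in> blocks A" "W \<in> blocks A" "U \<noteq> W"
      using cut_edge_blocks[OF A(1) that, of True] cut_edge_neq[OF A that, of True] UW
          by (metis fst_conv snd_conv)+
    moreover have "edges_between n U W > 0" using edges_between_blocks[OF A calculation(2-4)] UW that by metis
    ultimately show ?thesis using D(1) UW unfolding orientation_def by auto
  qed
  have "D = cut_dedges A P"
  proof (intro equalityI subsetI)
    fix g assume g: "g \<in> D"
    obtain U W where UW: "g = (U, W)" by force
    then have "U \<in> blocks A" "W \<in> blocks A" "U \<noteq> W" "edges_between n U W > 0"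
      using D(1) g unfolding orientation_def by auto
    then obtain q d where q: "q \<in> A" "g = cut_edge A q d" using edges_between_blocks[OF A] UW by metis
    then show "g \<in> cut_dedges A P" unfolding cut_dedges_alt P_def using g flip cut_edge_neq[OF A q(1), of d]
        by (cases d) auto
  next
    fix g assume "g \<in> cut_dedges A P"
    then show "g \<in> D" unfolding cut_dedges_alt P_def using flip by auto
  qed
  moreover have "P \<noteq> A" "P \<noteq> {}" using cyclic_cut_dedges[OF A] D(2) calculation by auto
  moreover have "P \<subseteq> A" by (auto simp: P_def)
  ultimately show ?thesis using A by (auto simp: proper_def)
qed

text \<open>The set of vertices reachable without leaving the current block is itself a function of
  the position that does not change at uncut edges. So \<open>key_const\<close> proves connectedness
  without the construction of a path, also for the block around the root.\<close>

lemma blk_connected: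
  assumes A: "A \<subseteq> {..<n}"
  shows "induces_connected n (blk A r)"
  unfolding induces_connected_def
proof (intro ballI)
  fix u v assume uv: "u \<in> blk A r" "v \<in> blk A r"
  define R where "R = {(a, b). a \<in> {1..n} \<and> b \<in> {1..n} \<and> {a, b} \<in> cycle_edges n \<and> blk A (pos a) =
      blk A (pos b)}"
  have sR: "sym R" by (auto simp: R_def sym_def insert_commute)
  define G where "G r = {x. (vtx r, x) \<in> R\<^sup>*}" for r
  have bp: "blk A (pos (vtx q)) = blk A q" if "q \<le> n" for q
  proof (cases "q = n")
    case True
    then show ?thesis using A blk_n[OF A] by simp
  qed (use that in auto)
  have GS: "G (Suc q) = G q" if "q < n" "q \<notin> A" for q
  proof -
    have "blk A q = blk A (Suc q)" using key_Suc_notin[OF A that(2)] by (simp add: blk_def)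
    then have "(vtx q, vtx (Suc q)) \<in> R" "(vtx (Suc q), vtx q) \<in> R" using that bp[of q] bp[of "Suc q"]
      by (auto simp: R_def Suc_leI)
    then show ?thesis unfolding G_def by (auto intro: converse_rtrancl_into_rtrancl)
  qed
  have Gn: "G n = G 0" by (simp add: G_def)
  obtain a b where ab: "u = vtx a" "v = vtx b" "a < n" "b < n" "key A a = key A r" "key A b = key A r"
    using uv by (auto simp: blk_def)
  have "G a = G b" by (rule key_const[OF A GS Gn]) (use ab in auto)
  moreover have "v \<in> G b" unfolding G_def ab(2) by simp
  ultimately have "v \<in> G a" by simp
  then have "(u, v) \<in> R\<^sup>*" unfolding G_def ab(1) by simp
  then have "v \<in> blk A r \<and> (u, v) \<in> {(a, b). a \<in> blk A r \<and> b \<in> blk A r \<and> {a, b} \<in> cycle_edges n}\<^sup>*"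
  proof (induction rule: rtrancl_induct)
    case (step y z)
    then have yz: "y \<in> {1..n}" "z \<in> {1..n}" "{y, z} \<in> cycle_edges n" "blk A (pos y) = blk A (pos z)"
      unfolding R_def by auto
    have "blk A (pos y) = blk A r"
      using blk_disjoint[OF A, of "pos y" r] vtx_pos[OF yz(1)] step.IH by simp
    then have "z \<in> blk A r" using vtx_in_blk[OF A, of "pos z"] vtx_pos[OF yz(2)] yz(4) by simp
    then show ?case using step.IH yz(3) by (auto intro: rtrancl_into_rtrancl)
  qed (use uv in simp)
  then show "(u, v) \<in> {(a, b). a \<in> blk A r \<and> b \<in> blk A r \<and> {a, b} \<in> cycle_edges n}\<^sup>*" ..
qed

end

section \<open>Laplacian lattices\<close>

text \<open>\<open>int_span\<close> attaches one coefficient to each vector, while the generators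
  here come indexed. A vector hit by several indices gives its coefficient to one chosen index;
  conversely, the coefficients of indices with the same vector are added.\<close>

lemma int_span_image:
  assumes "finite I"
  shows "int_span (f ` I) = {u. \<exists>c. u = (\<lambda>x. \<Sum>i\<in>I. c i * f i x)}"
proof (intro equalityI subsetI)
  fix u assume "u \<in> int_span (f ` I)"
  then obtain c where u: "u = (\<lambda>x. \<Sum>b\<in>f ` I. c b * b x)" by (auto simp: int_span_def)
  define k where "k b = card {i \<in> I. f i = b}" for b
  define r where "r b = (SOME i. i \<in> I \<and> f i = b)" for b
  have r: "r b \<in> I" "f (r b) = b" if "b \<in> f ` I" for b
    using someI_ex[of "\<lambda>i. i \<in> I \<and> f i = b"] that by (auto simp: r_def)
  have "u x = (\<Sum>i\<in>I. (if r (f i) = i then c (f i) else 0) * f i x)" for x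
  proof -
    have "(\<Sum>i\<in>I. (if r (f i) = i then c (f i) else 0) * f i x)
      = (\<Sum>b\<in>f ` I. \<Sum>i\<in>{i \<in> I. f i = b}. (if r (f i) = i then c (f i) else 0) * f i x)"
      using assms by (rule sum.image_gen)
    also have "\<dots> = (\<Sum>b\<in>f ` I. c b * b x)"
    proof (rule sum.cong)
      fix b assume b: "b \<in> f ` I"
      have "(\<Sum>i\<in>{i \<in> I. f i = b}. (if r (f i) = i then c (f i) else 0) * f i x)
        = (\<Sum>i\<in>{i \<in> I. f i = b}. if i = r b then c b * b x else 0)"
        by (intro sum.cong) auto
      also have "\<dots> = c b * b x" using r[OF b] assms by (subst sum.delta) auto
      finally show "(\<Sum>i\<in>{i \<in> I. f i = b}. (if r (f i) = i then c (f i) else 0) * f i x) = c b * b x" .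
    qed simp
    finally show ?thesis using u by simp
  qed
  then show "u \<in> {u. \<exists>c. u = (\<lambda>x. \<Sum>i\<in>I. c i * f i x)}"
    by (intro CollectI exI[of _ "\<lambda>i. if r (f i) = i then c (f i) else 0"]) (auto simp: fun_eq_iff)
next
  fix u assume "u \<in> {u. \<exists>c. u = (\<lambda>x. \<Sum>i\<in>I. c i * f i x)}"
  then obtain c where u: "u = (\<lambda>x. \<Sum>i\<in>I. c i * f i x)" by auto
  have "u x = (\<Sum>b\<in>f ` I. (\<Sum>i\<in>{i \<in> I. f i = b}. c i) * b x)" for x
    unfolding u using assms by (subst sum.image_gen[of I _ f]) (auto simp: sum_distrib_right intro!: sum.cong)
  then show "u \<in> int_span (f ` I)" unfolding int_span_def
    by (intro CollectI exI[of _ "\<lambda>b. (\<Sum>i\<in>{i \<in> I. f i = b}. c i)"]) (auto simp: fun_eq_iff)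
qed

lemma card_of_bool: "finite S \<Longrightarrow> int (card {q \<in> S. Q q}) = (\<Sum>q\<in>S. of_bool (Q q))"
proof -
  have "S \<inter> {q. Q q} = {q \<in> S. Q q}" by auto
  then show "finite S \<Longrightarrow> int (card {q \<in> S. Q q}) = (\<Sum>q\<in>S. of_bool (Q q))" by simp
qed

context rooted_cycle
begin

text \<open>Two different positions with the same edge would be successors of each other, which only
  happens on a cycle of length two; \<open>n \<ge> 3\<close> excludes it.\<close>

lemma edge_inj: "inj_on (\<lambda>q. {vtx q, vtx (Suc q)}) {..<n}"
proof (rule inj_onI, rule ccontr)
  fix q r assume *: "q \<in> {..<n}" "r \<in> {..<n}" "{vtx q, vtx (Suc q)} = {vtx r, vtx (Suc r)}" "q \<noteq> r"
  then have "vtx q \<noteq> vtx r" by simp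
  with *(3) have **: "vtx q = vtx (Suc r)" "vtx r = vtx (Suc q)"
    unfolding doubleton_eq_iff by metis+
  define s where "s q = (if Suc q = n then 0 else Suc q)" for q
  have s: "vtx (Suc q) = vtx (s q)" "q < n \<Longrightarrow> s q < n" for q by (auto simp: s_def)
  have "q = s r" "r = s q" using ** s(2)[of q] s(2)[of r] *(1,2) unfolding s(1) by simp_all
  then show False using n3 by (auto simp: s_def split: if_splits)
qed

lemma vtx_Suc_neq [simp]: "q < n \<Longrightarrow> vtx q \<noteq> vtx (Suc q)"
proof (cases "Suc q = n")
  assume "q < n" "Suc q = n"
  then show ?thesis using n3 vtx_eq[of q 0] by auto
qed auto

lemmas vtx_Suc_neq' [simp] = vtx_Suc_neq[symmetric]

abbreviation vtx_ind :: "nat \<Rightarrow> nat set \<Rightarrow> int" where "vtx_ind q W \<equiv> of_bool (vtx q \<in> W)"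

text \<open>Counting edges by products of indicators, position by position, makes Laplacian entries
  and outdegrees bilinear expressions, so that identities between them can be checked at a single
  edge.\<close>

lemma edges_between_sum:
  assumes "U \<inter> W = {}"
  shows "int (edges_between n U W) = (\<Sum>q<n. vtx_ind q U * vtx_ind (Suc q) W + vtx_ind (Suc q) U * vtx_ind q
      W)"
proof -
  have "{e \<in> cycle_edges n. \<exists>i\<in>U. \<exists>j\<in>W. e = {i, j}} = (\<lambda>q. {vtx q, vtx (Suc q)}) `
      {q \<in> {..<n}. vtx q \<in> U \<and> vtx (Suc q) \<in> W \<or> vtx (Suc q) \<in> U \<and> vtx q \<in> W}"
    (is "?L = ?R")
  proof (intro equalityI subsetI)
    fix e assume "e \<in> ?L"
    then obtain i j where e: "e \<in> cycle_edges n" "i \<in> U" "j \<in> W" "e = {i, j}" by blast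
    then have "{i, j} \<in> cycle_edges n" by simp
    then show "e \<in> ?R" by (elim edge_cases) (use e in \<open>auto simp: insert_commute\<close>)
  next
    fix e assume "e \<in> ?R"
    then obtain q where q: "q < n" "e = {vtx q, vtx (Suc q)}"
      "vtx q \<in> U \<and> vtx (Suc q) \<in> W \<or> vtx (Suc q) \<in> U \<and> vtx q \<in> W" by auto
    then have "\<exists>i\<in>U. \<exists>j\<in>W. e = {i, j}" by (metis insert_commute)
    then show "e \<in> ?L" using q by simp
  qed
  then have "int (edges_between n U W) = int (card {q \<in> {..<n}. vtx q \<in> U \<and> vtx (Suc q) \<in> W \<or> vtx (Suc q)
      \<in> U \<and> vtx q \<in> W})"
    unfolding edges_between_def by (simp add: card_image inj_on_subset[OF edge_inj] subset_iff)
  also have "\<dots> = (\<Sum>q<n. of_bool (vtx q \<in> U \<and> vtx (Suc q) \<in> W \<or> vtx (Suc q) \<in> U \<and> vtx q \<in> W))"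
    by (rule card_of_bool) simp
  also have "\<dots> = (\<Sum>q<n. vtx_ind q U * vtx_ind (Suc q) W + vtx_ind (Suc q) U * vtx_ind q W)"
  proof (intro sum.cong refl)
    fix q
    have "\<not> (vtx q \<in> U \<and> vtx q \<in> W)" using assms by blast
    then show "of_bool (vtx q \<in> U \<and> vtx (Suc q) \<in> W \<or> vtx (Suc q) \<in> U \<and> vtx q \<in> W) =
        vtx_ind q U * vtx_ind (Suc q) W + vtx_ind (Suc q) U * vtx_ind q W"
      by (cases "vtx q \<in> U"; cases "vtx q \<in> W"; simp)
  qed
  finally show ?thesis .
qed

lemma sum_block_ind:
  assumes A: "A \<subseteq> {..<n}" and "q \<le> n"
  shows "(\<Sum>W\<in>blocks A. c W * vtx_ind q W) = c (blk A q)"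
proof -
  have q: "blk A q \<in> blocks A" using blk_in_blocks[OF assms] .
  have "(\<Sum>W\<in>blocks A. c W * vtx_ind q W) = (\<Sum>W\<in>blocks A. if W = blk A q then c W else 0)"
  proof (rule sum.cong)
    fix W assume "W \<in> blocks A"
    then obtain r where "W = blk A r" by (auto simp: blocks_def)
    then have "vtx q \<in> W \<longleftrightarrow> W = blk A q" using A assms vtx_in_blk[OF A] blk_disjoint[OF A] by metis
    then show "c W * vtx_ind q W = (if W = blk A q then c W else 0)" by auto
  qed simp
  then show ?thesis using q by (simp add: blocks_def)
qed

text \<open>Coefficients \<open>c\<close> of the blocks combine the rows to the differences
  \<open>c (blk A q) - c (blk A (Suc q))\<close> at the edges, which vanish off the cuts and sum to
  zero around the cycle. Conversely, coefficients on the cuts with sum zero are differences of their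
  prefix sums. With different \<open>\<eta>\<close> this covers the lattice of the parcycle and the
  Laplacian lattice of a partition.\<close>

lemma row_lattice:
  assumes A: "A \<subseteq> {..<n}"
    and \<rho>: "\<And>W x. W \<in> blocks A \<Longrightarrow> \<rho> W x = (\<Sum>q<n. (vtx_ind q W - vtx_ind (Suc q) W) * \<eta> q x)"
  shows "int_span (\<rho> ` blocks A) = {u. \<exists>g. (\<Sum>q\<in>A. g q) = 0 \<and> u = (\<lambda>x. \<Sum>q\<in>A. g q * \<eta> q x)}"
proof -
  have fb: "finite (blocks A)" by (simp add: blocks_def)
  have fA: "finite A" using A finite_subset by blast
  have eq: "(\<Sum>W\<in>blocks A. c W * \<rho> W x) = (\<Sum>q\<in>A. (c (blk A q) - c (blk A (Suc q))) * \<eta> q x)" for c x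
  proof -
    have "(\<Sum>W\<in>blocks A. c W * \<rho> W x) = (\<Sum>W\<in>blocks A. \<Sum>q<n. (c W * vtx_ind q W - c W * vtx_ind (Suc q) W)
        * \<eta> q x)"
      by (intro sum.cong) (auto simp: \<rho> sum_distrib_left algebra_simps)
    also have "\<dots> = (\<Sum>q<n. \<Sum>W\<in>blocks A. (c W * vtx_ind q W - c W * vtx_ind (Suc q) W) * \<eta> q x)"
      by (rule sum.swap)
    also have "\<dots> = (\<Sum>q<n. (c (blk A q) - c (blk A (Suc q))) * \<eta> q x)"
      using sum_block_ind[OF A, of _ c]
      by (intro sum.cong) (auto simp: sum_subtractf simp flip: sum_distrib_right)
    also have "\<dots> = (\<Sum>q\<in>A. (c (blk A q) - c (blk A (Suc q))) * \<eta> q x)"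
      using A key_Suc_notin[OF A] by (intro sum.mono_neutral_right) (auto simp: blk_def)
    finally show ?thesis .
  qed
  have z: "(\<Sum>q\<in>A. c (blk A q) - c (blk A (Suc q))) = (0::int)" for c
  proof -
    have "(\<Sum>q\<in>A. c (blk A q) - c (blk A (Suc q))) = (\<Sum>q<n. c (blk A q) - c (blk A (Suc q)))"
      using A key_Suc_notin[OF A] by (intro sum.mono_neutral_left) (auto simp: blk_def)
    also have "\<dots> = c (blk A 0) - c (blk A n)" by (rule sum_lessThan_telescope')
    finally show ?thesis using A by simp
  qed
  have wit: "\<exists>c. \<forall>q\<in>A. g q = c (blk A q) - c (blk A (Suc q))" if g: "(\<Sum>q\<in>A. g q) = 0" for g :: "nat \<Rightarrow> int"
  proof -
    define h where "h r = - (\<Sum>x\<in>{x\<in>A. x < r}. g x)" for r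
    have hS: "h (Suc q) = h q - g q" if "q \<in> A" for q
      unfolding h_def prefix_sum_Suc[OF fA] using that by simp
    have hN: "h (Suc q) = h q" if "q \<notin> A" for q
      unfolding h_def prefix_sum_Suc[OF fA] using that by simp
    have h0: "h n = h 0"
    proof -
      have "{x\<in>A. x < n} = A" using A by auto
      then show ?thesis using g by (simp add: h_def)
    qed
    obtain H where HB: "\<And>r. r \<le> n \<Longrightarrow> H (blk A r) = h r"
      using key_factor[of A h] A hN h0 by blast
    have "g q = H (blk A q) - H (blk A (Suc q))" if "q \<in> A" for q
    proof -
      have "q < n" using that A by auto
      then show ?thesis using HB[of q] HB[of "Suc q"] hS[OF that] by simp
    qed
    then show ?thesis by blast
  qed
  show ?thesis unfolding int_span_image[OF fb] eq
  proof (intro equalityI subsetI)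
    fix u assume "u \<in> {u. \<exists>c. u = (\<lambda>x. \<Sum>q\<in>A. (c (blk A q) - c (blk A (Suc q))) * \<eta> q x)}"
    then show "u \<in> {u. \<exists>g. (\<Sum>q\<in>A. g q) = 0 \<and> u = (\<lambda>x. \<Sum>q\<in>A. g q * \<eta> q x)}"
      using z by blast
  next
    fix u assume "u \<in> {u. \<exists>g. (\<Sum>q\<in>A. g q) = 0 \<and> u = (\<lambda>x. \<Sum>q\<in>A. g q * \<eta> q x)}"
    then obtain g where g: "(\<Sum>q\<in>A. g q) = 0" "u = (\<lambda>x. \<Sum>q\<in>A. g q * \<eta> q x)" by blast
    from wit[OF g(1)] obtain c where "\<forall>q\<in>A. g q = c (blk A q) - c (blk A (Suc q))" by blast
    then show "u \<in> {u. \<exists>c. u = (\<lambda>x. \<Sum>q\<in>A. (c (blk A q) - c (blk A (Suc q))) * \<eta> q x)}"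
      using g(2) by (intro CollectI exI[of _ c]) auto
  qed
qed

text \<open>The Laplacian is the incidence matrix, with one column for each position, times its
  transpose; edges inside a block contribute zero columns.\<close>

lemma laplacian_blocks:
  assumes A: "A \<subseteq> {..<n}" and W: "W \<in> blocks A"
  shows "laplacian (blocks A) (edges_between n) W x =
     (\<Sum>q<n. (vtx_ind q W - vtx_ind (Suc q) W) * (of_bool (x = blk A q) - of_bool (x = blk A (Suc q))))"
proof (cases "x \<in> blocks A")
  case False
  have "blk A q \<in> blocks A" if "q \<le> n" for q using blk_in_blocks[OF A that] .
  then have "x \<noteq> blk A q" if "q \<le> n" for q using False that by auto
  then show ?thesis using False by (auto simp: laplacian_def intro!: sum.neutral[symmetric])
next
  case True
  have dis: "U \<inter> U' = {}" if "U \<in> blocks A" "U' \<in> blocks A" "U \<noteq> U'" for U U'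
    using partition_onD2[OF blocks_partition[OF A]] that by (auto simp: disjoint_def)
  have xq: "x = blk A q \<longleftrightarrow> vtx q \<in> x" if "q \<le> n" for q
  proof -
    obtain r where "x = blk A r" using True by (auto simp: blocks_def)
    then show ?thesis using blk_disjoint[OF A that, of r] vtx_in_blk[OF A that] by metis
  qed
  have R: "(\<Sum>q<n. (vtx_ind q W - vtx_ind (Suc q) W) * (of_bool (x = blk A q) - of_bool (x = blk A (Suc q))))
     = (\<Sum>q<n. (vtx_ind q W - vtx_ind (Suc q) W) * (vtx_ind q x - vtx_ind (Suc q) x))"
    using xq by (intro sum.cong) auto
  show ?thesis
  proof (cases "x = W")
    case False
    have "laplacian (blocks A) (edges_between n) W x = - int (edges_between n W x)"
      using False True W by (auto simp: laplacian_def)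
    also have "\<dots> = (\<Sum>q<n. (vtx_ind q W - vtx_ind (Suc q) W) * (vtx_ind q x - vtx_ind (Suc q) x))"
    proof -
      have d: "W \<inter> x = {}" using dis[OF W True] False by simp
      have "- (vtx_ind q W * vtx_ind (Suc q) x + vtx_ind (Suc q) W * vtx_ind q x) =
        (vtx_ind q W - vtx_ind (Suc q) W) * (vtx_ind q x - vtx_ind (Suc q) x)" for q
      proof -
        have "\<not> (vtx q \<in> W \<and> vtx q \<in> x)" "\<not> (vtx (Suc q) \<in> W \<and> vtx (Suc q) \<in> x)" using d by blast+
        then show ?thesis by (cases "vtx q \<in> W"; cases "vtx (Suc q) \<in> W") simp_all
      qed
      then show ?thesis unfolding edges_between_sum[OF d] by (simp add: sum_negf[symmetric]
          del: sum_of_bool_eq sum_of_bool_mult_eq sum_mult_of_bool_eq)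
    qed
    finally show ?thesis using R by simp
  next
    case xW: True
    have "laplacian (blocks A) (edges_between n) W x = (\<Sum>U\<in>blocks A - {W}. int (edges_between n W U))"
      using xW W by (auto simp: laplacian_def)
    also have "\<dots> = (\<Sum>U\<in>blocks A - {W}. \<Sum>q<n. vtx_ind q W * vtx_ind (Suc q) U + vtx_ind (Suc q) W * vtx_ind q
        U)"
      using dis[OF W] by (intro sum.cong edges_between_sum) auto
    also have "\<dots> = (\<Sum>q<n. \<Sum>U\<in>blocks A - {W}. vtx_ind q W * vtx_ind (Suc q) U + vtx_ind (Suc q) W * vtx_ind q
        U)"
      by (rule sum.swap)
    also have "\<dots> = (\<Sum>q<n. vtx_ind q W * (1 - vtx_ind (Suc q) W) + vtx_ind (Suc q) W * (1 - vtx_ind q W))"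
    proof (rule sum.cong)
      fix q assume "q \<in> {..<n}"
      have s: "(\<Sum>U\<in>blocks A - {W}. vtx_ind q U) = 1 - vtx_ind q W" if "q \<le> n" for q
        using sum_block_ind[OF A that, of "\<lambda>_. 1"] W by (simp add: sum_diff1 blocks_def del: sum_of_bool_eq)
      show "(\<Sum>U\<in>blocks A - {W}. vtx_ind q W * vtx_ind (Suc q) U + vtx_ind (Suc q) W * vtx_ind q U)
         = vtx_ind q W * (1 - vtx_ind (Suc q) W) + vtx_ind (Suc q) W * (1 - vtx_ind q W)"
        using s[of q] s[of "Suc q"] \<open>q \<in> {..<n}\<close> by (simp add: sum.distrib flip: sum_distrib_left)
    qed simp
    also have "\<dots> = (\<Sum>q<n. (vtx_ind q W - vtx_ind (Suc q) W) * (vtx_ind q x - vtx_ind (Suc q) x))"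
      unfolding xW by (intro sum.cong) (auto simp: of_bool_def)
    finally show ?thesis using R by simp
  qed
qed

text \<open>The same factorisation of the Laplacian for the cycle itself. A diagonal entry counts
  the two positions at which the vertex is an end.\<close>

lemma brow_sum:
  assumes j: "j \<in> {1..n}"
  shows "brow n j i = (\<Sum>q<n. (of_bool (vtx q = j) - of_bool (vtx (Suc q) = j)) *
     (of_bool (i = vtx q) - of_bool (i = vtx (Suc q))))"
proof (cases "i \<in> {1..n}")
  case False
  then have "i \<noteq> vtx q" for q using vtx_in[of q] by auto
  then show ?thesis using False by (auto simp: brow_def laplacian_def)
next
  case True
  have cnt: "(\<Sum>q<n. of_bool ({vtx q, vtx (Suc q)} = {a, b})) = (of_bool ({a, b} \<in> cycle_edges n) :: int)"
      for a b
  proof -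
    have "(\<Sum>q<n. of_bool ({vtx q, vtx (Suc q)} = {a, b}) :: int) =
        (\<Sum>e\<in>(\<lambda>q. {vtx q, vtx (Suc q)}) ` {..<n}. of_bool (e = {a, b}))"
      by (simp add: sum.reindex[OF edge_inj])
    also have "\<dots> = of_bool ({a, b} \<in> cycle_edges n)"
      by (simp add: cycle_edges_vtx[symmetric] finite_cycle_edges of_bool_def sum.delta)
    finally show ?thesis .
  qed
  have one: "(\<Sum>q<n. of_bool (vtx q = a) :: int) = 1" if "a \<in> {1..n}" for a
  proof -
    have "(\<Sum>q<n. of_bool (vtx q = a) :: int) = (\<Sum>e\<in>vtx ` {..<n}. of_bool (e = a))"
      by (simp add: sum.reindex[OF vtx_inj])
    then show ?thesis using that by (simp add: vtx_image of_bool_def sum.delta)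
  qed
  have oneS: "(\<Sum>q<n. of_bool (vtx (Suc q) = a) :: int) = 1" if "a \<in> {1..n}" for a
  proof -
    obtain m where m: "n = Suc m" using n3 by (cases n) auto
    have "(\<Sum>q<n. of_bool (vtx (Suc q) = a) :: int) = (\<Sum>q<m. of_bool (vtx (Suc q) = a)) + of_bool (vtx 0 = a)"
      using vtx_n by (simp add: m)
    also have "\<dots> = (\<Sum>q<n. of_bool (vtx q = a))"
      unfolding m by (subst sum.lessThan_Suc_shift) simp
    finally show ?thesis using one[OF that] by simp
  qed
  show ?thesis
  proof (cases "i = j")
    case False
    then have "brow n j i = - of_bool ({j, i} \<in> cycle_edges n)"
      using True j by (auto simp: brow_def laplacian_def)
    also have "\<dots> = (\<Sum>q<n. - of_bool ({vtx q, vtx (Suc q)} = {j, i}))"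
      unfolding cnt[symmetric] by (simp add: sum_negf)
    also have "\<dots> = (\<Sum>q<n. (of_bool (vtx q = j) - of_bool (vtx (Suc q) = j)) *
      (of_bool (i = vtx q) - of_bool (i = vtx (Suc q))))"
      using False by (intro sum.cong) (auto simp: doubleton_eq_iff)
    finally show ?thesis .
  next
    case ij: True
    have "brow n j i = (\<Sum>u\<in>{1..n} - {j}. of_bool ({j, u} \<in> cycle_edges n))"
      using j ij by (auto simp: brow_def laplacian_def of_bool_def if_distrib[of int] cong: if_cong
          intro!: sum.cong)
    also have "\<dots> = (\<Sum>q<n. \<Sum>u\<in>{1..n} - {j}. of_bool ({vtx q, vtx (Suc q)} = {j, u}))"
      unfolding cnt[symmetric] by (rule sum.swap)
    also have "\<dots> = (\<Sum>q<n. of_bool (vtx q = j) + of_bool (vtx (Suc q) = j))"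
    proof (rule sum.cong)
      fix q assume q: "q \<in> {..<n}"
      have "(\<Sum>u\<in>{1..n} - {j}. of_bool ({vtx q, vtx (Suc q)} = {j, u})) =
        (\<Sum>u\<in>{1..n} - {j}. (if u = vtx (Suc q) then of_bool (vtx q = j) else 0)
            + (if u = vtx q then of_bool (vtx (Suc q) = j) else (0::int)))"
        using q by (intro sum.cong) (auto simp: doubleton_eq_iff)
      also have "\<dots> = of_bool (vtx q = j) + of_bool (vtx (Suc q) = j)"
        using q by (auto simp: sum.distrib sum.delta)
      finally show "(\<Sum>u\<in>{1..n} - {j}. of_bool ({vtx q, vtx (Suc q)} = {j, u})) =
          (of_bool (vtx q = j) + of_bool (vtx (Suc q) = j) :: int)" .
    qed simp
    also have "\<dots> = (\<Sum>q<n. (of_bool (vtx q = j) - of_bool (vtx (Suc q) = j)) *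
      (of_bool (i = vtx q) - of_bool (i = vtx (Suc q))))"
      unfolding ij by (intro sum.cong) auto
    finally show ?thesis .
  qed
qed

lemma bvec_sum:
  assumes W: "W \<subseteq> {1..n}"
  shows "bvec n W i = (\<Sum>q<n. (vtx_ind q W - vtx_ind (Suc q) W)
      * (of_bool (i = vtx q) - of_bool (i = vtx (Suc q))))"
proof -
  have fW: "finite W" using W finite_subset by blast
  have s: "(\<Sum>j\<in>W. of_bool (vtx q = j)) = vtx_ind q W" for q
    using fW by (simp add: of_bool_def)
  have "bvec n W i = (\<Sum>j\<in>W. \<Sum>q<n. (of_bool (vtx q = j) - of_bool (vtx (Suc q) = j)) *
     (of_bool (i = vtx q) - of_bool (i = vtx (Suc q))))"
    unfolding bvec_def using W by (intro sum.cong brow_sum) auto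
  also have "\<dots> = (\<Sum>q<n. \<Sum>j\<in>W. (of_bool (vtx q = j) - of_bool (vtx (Suc q) = j)) *
     (of_bool (i = vtx q) - of_bool (i = vtx (Suc q))))" by (rule sum.swap)
  also have "\<dots> = (\<Sum>q<n. (vtx_ind q W - vtx_ind (Suc q) W)
      * (of_bool (i = vtx q) - of_bool (i = vtx (Suc q))))"
    by (simp add: sum_subtractf s flip: sum_distrib_right)
  finally show ?thesis .
qed

lemma key_bij:
  assumes "A \<subseteq> {..<n}"
  shows "bij_betw (key A) A {..<card A}"
  unfolding bij_betw_def
proof
  show inj: "inj_on (key A) A" using key_inj[OF assms] by (auto simp: inj_on_def)
  show "key A ` A = {..<card A}"
  proof (rule card_subset_eq)
    show "key A ` A \<subseteq> {..<card A}" using key_less[OF assms] by auto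
    show "card (key A ` A) = card {..<card A}" using inj by (simp add: card_image)
  qed simp
qed

end

section \<open>Classes of acyclic partitions\<close>

locale rooted_parcycle = rooted_cycle +
  fixes \<P> :: "nat set set" and V :: "nat set"
  assumes parcycle: "parcycle n \<P>" and VP: "V \<in> \<P>" and v0V: "v0 \<in> V"
begin

definition cuts :: "nat set" where
  "cuts = {q. q < n \<and> \<not> (\<exists>W\<in>\<P>. vtx q \<in> W \<and> vtx (Suc q) \<in> W)}"

lemma cuts_facts: "cuts \<subseteq> {..<n}" "\<P> = blocks cuts" "card cuts \<noteq> 1"
  using partition_is_blocks[of \<P>] parcycle by (auto simp: parcycle_def cuts_def)

lemma cuts_sub_lt: "A \<subseteq> cuts \<Longrightarrow> A \<subseteq> {..<n}"
  using cuts_facts by blast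

text \<open>Coefficients with sum zero are spanned by differences of two unit vectors, so the
  lattice is spanned by the exponent differences of the 2-minors.\<close>

lemma par_lattice_eq:
  "par_lattice n \<P> = {u. \<exists>g. (\<Sum>q\<in>cuts. g q) = 0 \<and>
     u = (\<lambda>x. \<Sum>q\<in>cuts. g q * (of_bool (x = vtx q) - of_bool (x = vtx (Suc q))))}"
proof -
  have "int_span (bvec n ` blocks cuts) = {u. \<exists>g. (\<Sum>q\<in>cuts. g q) = 0 \<and>
     u = (\<lambda>x. \<Sum>q\<in>cuts. g q * (of_bool (x = vtx q) - of_bool (x = vtx (Suc q))))}"
  proof (rule row_lattice[OF cuts_facts(1)])
    fix W x assume "W \<in> blocks cuts"
    then have "W \<subseteq> {1..n}" using blk_subset[OF cuts_facts(1)] by (auto simp: blocks_def)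
    then show "bvec n W x = (\<Sum>q<n. (vtx_ind q W - vtx_ind (Suc q) W)
        * (of_bool (x = vtx q) - of_bool (x = vtx (Suc q))))"
      by (rule bvec_sum)
  qed
  then show ?thesis using cuts_facts(2) by (simp add: par_lattice_def)
qed

lemma P_key: "A \<subseteq> cuts \<Longrightarrow> U \<in> \<P> \<Longrightarrow> vtx q \<in> U \<Longrightarrow> vtx r \<in> U \<Longrightarrow> q < n \<Longrightarrow> r < n \<Longrightarrow> key A q = key A r"
proof -
  assume A: "A \<subseteq> cuts" and U: "U \<in> \<P>" "vtx q \<in> U" "vtx r \<in> U" "q < n" "r < n"
  have c: "induces_connected n U" using U parcycle by (auto simp: parcycle_def)
  show "key A q = key A r"
  proof (rule connected_const[OF c, of "key A"])
    show "key A (Suc q) = key A q" if "q < n" "vtx q \<in> U" "vtx (Suc q) \<in> U" for q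
      using that A U key_Suc_notin[OF cuts_sub_lt[OF A], of q] by (auto simp: cuts_def)
    show "key A n = key A 0" using cuts_sub_lt[OF A] by simp
  qed (use U in auto)
qed

lemma P_in_blk:
  assumes "A \<subseteq> cuts" "U \<in> \<P>" "q \<le> n" "vtx q \<in> U"
  shows "U \<subseteq> blk A q"
proof
  fix i assume i: "i \<in> U"
  have A: "A \<subseteq> {..<n}" using assms cuts_sub_lt by auto
  have "U \<subseteq> {1..n}" using assms(2) cuts_facts(2) blk_subset[OF cuts_facts(1)] by (auto simp: blocks_def)
  then have i': "i \<in> {1..n}" using i by auto
  have k: "key A (pos i) = key A q'" if "q' < n" "vtx q' \<in> U" for q'
    using P_key[OF assms(1,2), of "pos i" q'] i vtx_pos[OF i'] that by simp
  have "key A (pos i) = key A q"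
  proof (cases "q = n")
    case True
    then have "vtx 0 \<in> U" using assms(4) by simp
    then show ?thesis using k[of 0] True A by simp
  next
    case False
    then show ?thesis using k[of q] assms by simp
  qed
  then have "vtx (pos i) \<in> blk A q" using in_blk_iff[OF A, of "pos i"] vtx_pos[OF i'] by simp
  then show "i \<in> blk A q" using i' by simp
qed

lemma P_cover: "i \<in> {1..n} \<Longrightarrow> \<exists>U\<in>\<P>. i \<in> U"
  using parcycle partition_onD1[of "{1..n}" \<P>] unfolding parcycle_def by blast

lemma blk_parset:
  assumes "A \<subseteq> cuts" "r \<le> n"
  shows "connected_parset n \<P> (blk A r)"
proof -
  have A: "A \<subseteq> {..<n}" using assms cuts_sub_lt by auto
  have "blk A r \<subseteq> \<Union>{U \<in> \<P>. U \<subseteq> blk A r}"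
  proof
    fix i assume i: "i \<in> blk A r"
    then have i': "i \<in> {1..n}" using blk_subset[OF A] by blast
    then obtain U where U: "U \<in> \<P>" "i \<in> U" using P_cover by blast
    have p: "pos i \<le> n" "vtx (pos i) = i" using vtx_pos[OF i'] by auto
    then have "blk A (pos i) = blk A r" using blk_disjoint[OF A, of "pos i" r] i by simp
    then have "U \<subseteq> blk A r" using P_in_blk[OF assms(1) U(1) p(1)] U p by simp
    then show "i \<in> \<Union>{U \<in> \<P>. U \<subseteq> blk A r}" using U by blast
  qed
  then have "blk A r = \<Union>{U \<in> \<P>. U \<subseteq> blk A r}" by blast
  moreover have "{U \<in> \<P>. U \<subseteq> blk A r} \<subseteq> \<P>" by blast
  moreover have "blk A r \<noteq> {}" using vtx_in_blk[OF A assms(2)] by blast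
  ultimately show ?thesis using blk_connected[OF A] unfolding connected_parset_def by blast
qed

lemma connected_partition_blocks: "A \<subseteq> cuts \<Longrightarrow> connected_partition n \<P> (blocks A)"
  unfolding connected_partition_def
  using blocks_partition cuts_sub_lt blk_parset by (auto simp: blocks_def)

definition triv_opart :: opart where "triv_opart = cut_opart {} {}"

lemma triv_opart_eq: "triv_opart = ({{1..n}}, {})"
  by (simp add: triv_opart_def cut_opart_small)

lemma cut_opart_triv_opart: "A \<subseteq> {..<n} \<Longrightarrow> card A \<le> 1 \<Longrightarrow> cut_opart A R = triv_opart"
  by (simp add: triv_opart_eq cut_opart_small)

text \<open>A block contains every main vertex that it meets, so an edge inside a main vertex is
  never cut and the cuts are among \<open>cuts\<close>. The orientations are then classified by
  their clockwise cuts. The partition with one block is kept apart, as it has no cuts instead of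
  one.\<close>

lemma acyclic_partition_iff:
  "acyclic_partition n \<P> C \<longleftrightarrow> C = triv_opart \<or> (\<exists>A R. A \<subseteq> cuts \<and> proper A R \<and> C = cut_opart A R)"
proof
  assume C: "acyclic_partition n \<P> C"
  define A where "A = {q. q < n \<and> \<not> (\<exists>W\<in>fst C. vtx q \<in> W \<and> vtx (Suc q) \<in> W)}"
  have cp: "partition_on {1..n} (fst C)" "\<And>W. W \<in> fst C \<Longrightarrow> connected_parset n \<P> W"
    using C by (auto simp: acyclic_partition_def connected_partition_def)
  have A: "A \<subseteq> {..<n}" "fst C = blocks A" "card A \<noteq> 1"
    using partition_is_blocks[OF cp(1)] cp(2) unfolding A_def connected_parset_def by auto
  have AE: "A \<subseteq> cuts"
  proof
    fix q assume q: "q \<in> A"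
    then have qn: "q < n" using A by auto
    have False if U: "U \<in> \<P>" "vtx q \<in> U" "vtx (Suc q) \<in> U" for U
    proof -
      obtain W where W: "W \<in> fst C" "vtx q \<in> W" using partition_onD1[OF cp(1)] vtx_in[of q] by blast
      obtain \<B> where B: "\<B> \<subseteq> \<P>" "W = \<Union>\<B>" using cp(2)[OF W(1)] by (auto simp: connected_parset_def)
      then obtain U' where "U' \<in> \<B>" "vtx q \<in> U'" using W by auto
      then have "U' = U" using U B partition_onD2[of "{1..n}" \<P>] parcycle
        unfolding parcycle_def disjoint_def by blast
      then have "vtx (Suc q) \<in> W" using U B \<open>U' \<in> \<B>\<close> by auto
      then show False using q W by (auto simp: A_def)
    qed
    then show "q \<in> cuts" using qn by (auto simp: cuts_def)
  qed
  show "C = triv_opart \<or> (\<exists>A R. A \<subseteq> cuts \<and> proper A R \<and> C = cut_opart A R)"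
  proof (cases "card A \<ge> 2")
    case True
    then obtain R where "proper A R" "snd C = cut_dedges A R"
      using orientation_is_cut_dedges[OF A(1) True, of "snd C"] C A(2) by (auto simp: acyclic_partition_def)
    then have "C = cut_opart A R" using A(2) by (simp add: cut_opart_def prod_eq_iff)
    then show ?thesis using AE \<open>proper A R\<close> by blast
  next
    case False
    then have "cut_opart A {} = triv_opart" using A by (intro cut_opart_triv_opart) auto
    then have "fst C = {{1..n}}" using A(2) by (simp add: cut_opart_def triv_opart_eq)
    moreover have "snd C = {}" using C calculation by (auto simp: acyclic_partition_def orientation_def)
    ultimately show ?thesis by (simp add: triv_opart_eq prod_eq_iff)
  qed
next
  assume "C = triv_opart \<or> (\<exists>A R. A \<subseteq> cuts \<and> proper A R \<and> C = cut_opart A R)"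
  then show "acyclic_partition n \<P> C"
  proof
    assume C: "C = triv_opart"
    have "connected_partition n \<P> (fst triv_opart)" using connected_partition_blocks[of "{}"]
        by (simp add: triv_opart_def cut_opart_def)
    then show ?thesis using C by (auto simp: acyclic_partition_def triv_opart_eq orientation_def acyclic_def)
  next
    assume "\<exists>A R. A \<subseteq> cuts \<and> proper A R \<and> C = cut_opart A R"
    then obtain A R where C: "A \<subseteq> cuts" "proper A R" "C = cut_opart A R" by blast
    then show ?thesis using connected_partition_blocks orientation_cut_opart acyclic_cut_dedges
      by (simp add: acyclic_partition_def cut_opart_def)
  qed
qed

lemma blocks_recover:
  assumes "A \<subseteq> {..<n}" "2 \<le> card A"
  shows "A = {q. q < n \<and> \<not> (\<exists>W\<in>blocks A. vtx q \<in> W \<and> vtx (Suc q) \<in> W)}"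
proof (intro equalityI subsetI)
  fix q assume q: "q \<in> A"
  then have qn: "q < n" using assms by auto
  have "False" if W: "W \<in> blocks A" "vtx q \<in> W" "vtx (Suc q) \<in> W" for W
  proof -
    obtain r where r: "W = blk A r" using W(1) by (auto simp: blocks_def)
    then have "blk A q = blk A (Suc q)"
      using W blk_disjoint[OF assms(1), of q r] blk_disjoint[OF assms(1), of "Suc q" r] qn
          by (metis Suc_leI less_imp_le_nat)
    then show False using blk_Suc_neq[OF assms qn] q by simp
  qed
  then show "q \<in> {q. q < n \<and> \<not> (\<exists>W\<in>blocks A. vtx q \<in> W \<and> vtx (Suc q) \<in> W)}" using qn by blast
next
  fix q assume q: "q \<in> {q. q < n \<and> \<not> (\<exists>W\<in>blocks A. vtx q \<in> W \<and> vtx (Suc q) \<in> W)}"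
  then have qn: "q < n" by simp
  show "q \<in> A"
  proof (rule ccontr)
    assume "q \<notin> A"
    then have "blk A q = blk A (Suc q)" using blk_Suc_neq[OF assms qn] by simp
    moreover have "vtx q \<in> blk A q" "vtx (Suc q) \<in> blk A (Suc q)" "blk A q \<in> blocks A"
      using vtx_in_blk[OF assms(1), of q] vtx_in_blk[OF assms(1), of "Suc q"] qn by (simp_all add: blocks_def)
    ultimately have "vtx q \<in> blk A q" "vtx (Suc q) \<in> blk A q" "blk A q \<in> blocks A" by metis+
    then show False using q by blast
  qed
qed

lemma blocks_inj: "A \<subseteq> {..<n} \<Longrightarrow> 2 \<le> card A \<Longrightarrow> A' \<subseteq> {..<n} \<Longrightarrow> 2 \<le> card A' \<Longrightarrow> blocks A = blocks A' \<Longrightarrow> A = A'"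
  by (rule trans[OF blocks_recover trans[OF _ blocks_recover[symmetric]]]) simp_all

lemma card_blocks:
  assumes "A \<subseteq> {..<n}" "2 \<le> card A"
  shows "card (blocks A) = card A"
proof -
  have fA: "finite A" using assms finite_subset by blast
  have kA: "key A ` A = {..<card A}" using key_bij[OF assms(1)] by (simp add: bij_betw_def)
  have "blocks A = blk A ` A"
  proof (intro equalityI subsetI)
    fix W assume "W \<in> blocks A"
    then obtain r where r: "W = blk A r" "r < n" by (auto simp: blocks_def)
    have "key A r \<in> key A ` A" using kA key_less[OF assms(1), of r] assms(2) by force
    then obtain q where "q \<in> A" "key A r = key A q" by auto
    then show "W \<in> blk A ` A" using r by (auto simp: blk_def)
  qed (use assms in \<open>auto simp: blocks_def\<close>)
  moreover have "inj_on (blk A) A"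
  proof (rule inj_onI)
    fix x y assume "x \<in> A" "y \<in> A" "blk A x = blk A y"
    then show "x = y" using key_inj[OF assms(1), of x y] blk_eq_iff[OF assms(1), of x y] assms(1) by auto
  qed
  ultimately show ?thesis by (simp add: card_image)
qed

lemma cut_dedges_blocks: "A \<subseteq> {..<n} \<Longrightarrow> R \<subseteq> A \<Longrightarrow> (U, W) \<in> cut_dedges A R \<Longrightarrow> U \<in> blocks A \<and> W \<in> blocks A \<and> U \<noteq> W"
proof -
  assume A: "A \<subseteq> {..<n}" "R \<subseteq> A" "(U, W) \<in> cut_dedges A R"
  then obtain q d where "(U, W) = cut_edge A q d" "q \<in> A" unfolding cut_dedges_alt by blast
  moreover have "U \<noteq> W" using A(3) unfolding cut_dedges_alt by auto
  ultimately show ?thesis using cut_edge_blocks[OF A(1)] by (metis fst_conv snd_conv)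
qed

text \<open>Each cut adds one to the outdegree of the block at its tail; two parallel edges are
  counted as two cuts.\<close>

lemma block_outdeg_cut_opart:
  assumes "proper A R"
  shows "block_outdeg n (cut_opart A R) U =
    (\<Sum>q\<in>A. if q \<in> R then of_bool (U = blk A q) else of_bool (U = blk A (Suc q)))"
proof -
  have A: "A \<subseteq> {..<n}" "2 \<le> card A" "R \<subset> A" "R \<noteq> {}" using assms by (auto simp: proper_def)
  have bl: "blk A q \<in> blocks A" if "q \<le> n" for q using blk_in_blocks[OF A(1) that] .
  show ?thesis
  proof (cases "U \<in> blocks A")
    case False
    then have "{W. (U, W) \<in> cut_dedges A R} = {}" using cut_dedges_blocks[OF A(1)] A(3) by blast
    moreover have "(\<Sum>q\<in>A. if q \<in> R then of_bool (U = blk A q) else of_bool (U = blk A (Suc q)) :: int) = 0"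
    proof (rule sum.neutral, rule ballI)
      fix q assume "q \<in> A"
      then have "q < n" using A by auto
      then have "U \<noteq> blk A q" "U \<noteq> blk A (Suc q)" using False bl[of q] bl[of "Suc q"] by auto
      then show "(if q \<in> R then of_bool (U = blk A q) else of_bool (U = blk A (Suc q)) :: int) = 0" by simp
    qed
    ultimately show ?thesis by (simp add: block_outdeg_def cut_opart_def)
  next
    case True
    then obtain r where Ur: "U = blk A r" by (auto simp: blocks_def)
    have inU: "vtx q \<in> U \<longleftrightarrow> U = blk A q" if "q \<le> n" for q
      unfolding Ur using blk_disjoint[OF A(1) that, of r] vtx_in_blk[OF A(1) that] by metis
    define S where "S = {W. (U, W) \<in> cut_dedges A R}"
    have S: "S \<subseteq> blocks A" "U \<notin> S" using cut_dedges_blocks[OF A(1)] A(3) unfolding S_def by blast+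
    have fS: "finite S" by (rule finite_subset[OF S(1)]) (simp add: blocks_def)
    have dis: "U \<inter> W = {}" if "W \<in> S" for W
    proof -
      have "W \<in> blocks A" "U \<noteq> W" using that S by auto
      then show ?thesis using disjointD[OF partition_onD2[OF blocks_partition[OF A(1)]] True] by simp
    qed
    have sS: "(\<Sum>W\<in>S. vtx_ind q W) = of_bool ((U, blk A q) \<in> cut_dedges A R)" if "q \<le> n" for q
    proof -
      have "(\<Sum>W\<in>S. vtx_ind q W) = (\<Sum>W\<in>blocks A. of_bool (W \<in> S) * vtx_ind q W)"
        using S(1) by (intro sum.mono_neutral_cong_left) (auto simp: blocks_def)
      also have "\<dots> = of_bool (blk A q \<in> S)" using sum_block_ind[OF A(1) that, of "\<lambda>W. of_bool (W \<in> S)"] .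
      finally show ?thesis by (simp add: S_def)
    qed
    have "block_outdeg n (cut_opart A R) U = (\<Sum>W\<in>S. int (edges_between n U W))"
      by (simp add: block_outdeg_def cut_opart_def S_def)
    also have "\<dots> = (\<Sum>W\<in>S. \<Sum>q<n. vtx_ind q U * vtx_ind (Suc q) W + vtx_ind (Suc q) U * vtx_ind q W)"
      using dis by (intro sum.cong edges_between_sum) auto
    also have "\<dots> = (\<Sum>q<n. \<Sum>W\<in>S. vtx_ind q U * vtx_ind (Suc q) W + vtx_ind (Suc q) U * vtx_ind q W)"
      by (rule sum.swap)
    also have "\<dots> = (\<Sum>q<n. vtx_ind q U * of_bool ((U, blk A (Suc q)) \<in> cut_dedges A R) + vtx_ind (Suc q) U
        * of_bool ((U, blk A q) \<in> cut_dedges A R))"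
    proof (rule sum.cong)
      fix q assume "q \<in> {..<n}"
      then show "(\<Sum>W\<in>S. vtx_ind q U * vtx_ind (Suc q) W + vtx_ind (Suc q) U * vtx_ind q W) =
        vtx_ind q U * of_bool ((U, blk A (Suc q)) \<in> cut_dedges A R) + vtx_ind (Suc q) U * of_bool
            ((U, blk A q) \<in> cut_dedges A R)"
        using sS[of q] sS[of "Suc q"] unfolding sum.distrib sum_distrib_left[symmetric] by simp
    qed simp
    also have "\<dots> = (\<Sum>q<n. if q \<in> A then (if q \<in> R then of_bool (U = blk A q) else of_bool
        (U = blk A (Suc q))) else 0)"
    proof (rule sum.cong)
      fix q assume "q \<in> {..<n}"
      then have q: "q < n" by simp
      have iU: "vtx_ind q U = of_bool (U = blk A q)" "vtx_ind (Suc q) U = of_bool (U = blk A (Suc q))"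
        using inU[of q] inU[of "Suc q"] q by simp_all
      have lp: "(blk A q, blk A q) \<notin> cut_dedges A R" for q unfolding cut_dedges_alt by auto
      show "vtx_ind q U * of_bool ((U, blk A (Suc q)) \<in> cut_dedges A R) + vtx_ind (Suc q) U * of_bool
          ((U, blk A q) \<in> cut_dedges A R) =
        (if q \<in> A then (if q \<in> R then of_bool (U = blk A q) else of_bool (U = blk A (Suc q))) else 0)"
      proof (cases "q \<in> A")
        case True
        have "(blk A q, blk A (Suc q)) \<in> cut_dedges A R \<longleftrightarrow> q \<in> R" "(blk A (Suc q), blk A q) \<in> cut_dedges A R
            \<longleftrightarrow> q \<notin> R"
          using cut_edge_in_cut_dedges[OF assms True, of True] cut_edge_in_cut_dedges[OF assms True,
              of False] by (simp_all add: cut_edge_def)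
        then show ?thesis unfolding iU using True by (cases "U = blk A q"; cases "U = blk A (Suc q)"; cases
            "q \<in> R") auto
      next
        case False
        then have "blk A (Suc q) = blk A q" using blk_Suc_neq[OF A(1,2) q] by simp
        then show ?thesis unfolding iU using False lp[of q] by auto
      qed
    qed simp
    also have "\<dots> = (\<Sum>q\<in>A. if q \<in> R then of_bool (U = blk A q) else of_bool (U = blk A (Suc q)))"
      using A(1) by (simp add: sum.inter_restrict[symmetric] Int_absorb1)
    finally show ?thesis .
  qed
qed

text \<open>A class is determined by the cuts and the number of clockwise ones: modulo the number of blocks, the
  sum of the block indices weighted by the outdegrees is invariant under chip firing and
  recovers this number.\<close>

lemma chip_rel_iff:
  assumes "proper A R" "proper A' R'" "A \<subseteq> cuts" "A' \<subseteq> cuts"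
  shows "(cut_opart A R, cut_opart A' R') \<in> chip_rel n \<P> \<longleftrightarrow> A = A' \<and> card R = card R'"
proof (cases "A = A'")
  case False
  then show ?thesis using assms blocks_inj[of A A'] by (auto simp: chip_rel_def cut_opart_def proper_def)
next
  case True
  have A: "A \<subseteq> {..<n}" "2 \<le> card A" "R \<subset> A" "R \<noteq> {}" "R' \<subset> A" "R' \<noteq> {}"
    using assms True by (auto simp: proper_def)
  have fA: "finite A" using A finite_subset by blast
  define d :: "nat \<Rightarrow> int" where "d q = of_bool (q \<in> R) - of_bool (q \<in> R')" for q
  define \<eta> :: "nat \<Rightarrow> nat set \<Rightarrow> int" where "\<eta> q x = of_bool (x = blk A q) - of_bool (x = blk A (Suc q))" for
      q x
  have card: "(\<Sum>q\<in>A. d q) = int (card R) - int (card R')"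
    using fA A by (simp add: d_def sum_subtractf Int_absorb1 psubset_imp_subset)
  have diff: "(\<lambda>U. block_outdeg n (cut_opart A R) U - block_outdeg n (cut_opart A R') U) =
      (\<lambda>U. \<Sum>q\<in>A. d q * \<eta> q U)"
  proof
    fix U
    show "block_outdeg n (cut_opart A R) U - block_outdeg n (cut_opart A R') U = (\<Sum>q\<in>A. d q * \<eta> q U)"
      unfolding block_outdeg_cut_opart[OF assms(1)] block_outdeg_cut_opart[OF assms(2)[folded True]]
          sum_subtractf[symmetric]
      by (intro sum.cong) (auto simp: d_def \<eta>_def)
  qed
  have span: "int_span (laplacian (blocks A) (edges_between n) ` blocks A) =
     {u. \<exists>g. (\<Sum>q\<in>A. g q) = 0 \<and> u = (\<lambda>x. \<Sum>q\<in>A. g q * \<eta> q x)}"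
    by (rule row_lattice[OF A(1)]) (simp add: \<eta>_def laplacian_blocks[OF A(1)])
  have rel: "(cut_opart A R, cut_opart A' R') \<in> chip_rel n \<P> \<longleftrightarrow>
     (\<exists>g. (\<Sum>q\<in>A. g q) = 0 \<and> (\<lambda>U. \<Sum>q\<in>A. d q * \<eta> q U) = (\<lambda>x. \<Sum>q\<in>A. g q * \<eta> q x))"
  proof -
    have "acyclic_partition n \<P> (cut_opart A R)" "acyclic_partition n \<P> (cut_opart A R')"
      using assms True unfolding acyclic_partition_iff by blast+
    then show ?thesis unfolding chip_rel_def True[symmetric] using diff span by (simp add: cut_opart_def)
  qed
  have "card R = card R'" if g: "(\<Sum>q\<in>A. g q) = 0" "(\<lambda>U. \<Sum>q\<in>A. d q * \<eta> q U) = (\<lambda>x. \<Sum>q\<in>A. g q * \<eta> q x)" for g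
  proof -
    obtain c where c: "\<And>r. r \<le> n \<Longrightarrow> c (blk A r) = int (key A r)"
      using key_factor[of A "\<lambda>r. int (key A r)"] A(1) key_Suc_notin[OF A(1)] key_n[OF A(1)] by auto
    have bl: "blk A q \<in> blocks A" if "q \<le> n" for q using blk_in_blocks[OF A(1) that] .
    \<comment> \<open>The block index rises by one at every cut except the one leading back to index
      0, where it drops by \<open>card A - 1\<close>; modulo \<open>card A\<close> both changes
      agree.\<close>
    have ce: "(\<Sum>W\<in>blocks A. c W * \<eta> q W) = -1 + int (card A) * of_bool (Suc (key A q) = card A)" if "q \<in> A"
        for q
    proof -
      have q: "q < n" using that A by auto
      have fb: "finite (blocks A)" by (simp add: blocks_def)
      have "(\<Sum>W\<in>blocks A. c W * \<eta> q W) = (\<Sum>W\<in>blocks A. (if W = blk A q then c W else 0)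
          - (if W = blk A (Suc q) then c W else 0))"
        by (intro sum.cong) (auto simp: \<eta>_def)
      also have "\<dots> = c (blk A q) - c (blk A (Suc q))"
        using bl[of q] bl[of "Suc q"] q fb by (simp add: sum_subtractf sum.delta)
      also have "\<dots> = int (key A q) - int (key A (Suc q))" using c q by simp
      also have "\<dots> = -1 + int (card A) * of_bool (Suc (key A q) = card A)"
        using key_Suc_if[OF A(1) that] by (simp split: if_splits)
      finally show ?thesis .
    qed
    have "(\<Sum>W\<in>blocks A. c W * (\<Sum>q\<in>A. (d q - g q) * \<eta> q W)) = 0"
    proof (rule sum.neutral, rule ballI)
      fix W
      have "(\<Sum>q\<in>A. d q * \<eta> q W) = (\<Sum>q\<in>A. g q * \<eta> q W)" using g(2) by metis
      then show "c W * (\<Sum>q\<in>A. (d q - g q) * \<eta> q W) = 0" by (simp add: left_diff_distrib sum_subtractf)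
    qed
    moreover have "(\<Sum>W\<in>blocks A. c W * (\<Sum>q\<in>A. (d q - g q) * \<eta> q W)) =
        (\<Sum>q\<in>A. (d q - g q) * (\<Sum>W\<in>blocks A. c W * \<eta> q W))"
      unfolding sum_distrib_left by (subst sum.swap) (simp add: mult.left_commute)
    ultimately have "(\<Sum>q\<in>A. (d q - g q) * (-1 + int (card A) * of_bool (Suc (key A q) = card A))) = 0"
      using ce by simp
    then have "(\<Sum>q\<in>A. d q - g q) = int (card A) * (\<Sum>q\<in>A. (d q - g q) * of_bool (Suc (key A q) = card A))"
      by (simp add: algebra_simps sum.distrib sum_subtractf sum_distrib_left del: sum_mult_of_bool_eq
          sum_of_bool_mult_eq)
    then have "int (card A) dvd int (card R) - int (card R')"
      using card g(1) by (simp add: sum_subtractf del: sum_mult_of_bool_eq sum_of_bool_mult_eq)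
    \<comment> \<open>Both counts are smaller than \<open>card A\<close>, so congruent means
      equal.\<close>
    moreover have "card R < card A" "card R' < card A" using A fA by (auto intro: psubset_card_mono)
    ultimately show ?thesis
      using zdvd_imp_le[of "int (card A)" "int (card R) - int (card R')"]
        zdvd_imp_le[of "int (card A)" "int (card R') - int (card R)"] dvd_diff_commute[of "int (card A)"
            "int (card R)" "int (card R')"]
      by linarith
  qed
  moreover have "\<exists>g. (\<Sum>q\<in>A. g q) = 0 \<and> (\<lambda>U. \<Sum>q\<in>A. d q * \<eta> q U) = (\<lambda>x. \<Sum>q\<in>A. g q * \<eta> q x)" if "card R =
      card R'"
    using card that by (intro exI[of _ d]) simp
  ultimately show ?thesis using rel True by blast
qed

end

section \<open>Upper sets of cuts and the monomials of orientations\<close>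

definition top_cuts :: "nat set \<Rightarrow> nat \<Rightarrow> nat set" where
  "top_cuts A p = {q \<in> A. card {a \<in> A. q < a} < p}"

definition up_closed :: "nat set \<Rightarrow> nat set \<Rightarrow> bool" where
  "up_closed A R \<longleftrightarrow> R \<subseteq> A \<and> (\<forall>x\<in>R. \<forall>y\<in>A. x \<le> y \<longrightarrow> y \<in> R)"

lemma top_cuts_subset: "top_cuts A p \<subseteq> A" by (auto simp: top_cuts_def)

lemma top_cuts_up_closed: "finite A \<Longrightarrow> up_closed A (top_cuts A p)"
  unfolding up_closed_def
proof (intro conjI ballI impI top_cuts_subset)
  fix x y assume *: "finite A" "x \<in> top_cuts A p" "y \<in> A" "x \<le> y"
  have "card {a \<in> A. y < a} \<le> card {a \<in> A. x < a}" using * by (intro card_mono) auto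
  then show "y \<in> top_cuts A p" using * by (auto simp: top_cuts_def)
qed

text \<open>Counting the larger elements numbers \<open>A\<close> downwards from 0,
  bijectively.\<close>

lemma top_cuts_card: "finite A \<Longrightarrow> p \<le> card A \<Longrightarrow> card (top_cuts A p) = p"
proof -
  assume A: "finite A" "p \<le> card A"
  define g where "g q = card {a \<in> A. q < a}" for q
  have gl: "g q < g r" if "r < q" "q \<in> A" for q r
    unfolding g_def using that A by (intro psubset_card_mono) auto
  have inj: "inj_on g A" by (rule linorder_inj_onI) (use gl in force)+
  have im: "g ` A = {..<card A}"
  proof (rule card_subset_eq)
    have "g q < card A" if "q \<in> A" for q unfolding g_def using that A by (intro psubset_card_mono) auto
    then show "g ` A \<subseteq> {..<card A}" by auto
    show "card (g ` A) = card {..<card A}" using inj by (simp add: card_image)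
  qed simp
  have "g ` top_cuts A p = {..<p}"
  proof (intro equalityI subsetI)
    fix x assume x: "x \<in> {..<p}"
    then have "x \<in> g ` A" using im A by auto
    then show "x \<in> g ` top_cuts A p" using x by (auto simp: top_cuts_def g_def)
  qed (auto simp: top_cuts_def g_def)
  moreover have "inj_on g (top_cuts A p)" using inj top_cuts_subset by (rule inj_on_subset)
  ultimately show ?thesis by (metis card_image card_lessThan)
qed

text \<open>Upper sets of a chain are nested, so their size determines them.\<close>

lemma up_closed_unique:
  assumes "finite A" "up_closed A R" "up_closed A R'" "card R = card R'"
  shows "R = R'"
proof -
  have f: "finite R" "finite R'" using assms finite_subset unfolding up_closed_def by blast+
  have "R \<subseteq> R' \<or> R' \<subseteq> R"
  proof (rule ccontr)
    assume "\<not> (R \<subseteq> R' \<or> R' \<subseteq> R)"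
    then obtain x y where "x \<in> R" "x \<notin> R'" "y \<in> R'" "y \<notin> R" by blast
    then show False using assms(2,3) unfolding up_closed_def by (metis nat_le_linear subsetD)
  qed
  then show ?thesis using f assms(4) by (metis card_subset_eq)
qed

lemma top_cuts_unique: "finite A \<Longrightarrow> up_closed A R \<Longrightarrow> R = top_cuts A (card R)"
proof -
  assume A: "finite A" "up_closed A R"
  then have "card R \<le> card A" unfolding up_closed_def by (simp add: card_mono)
  then show ?thesis using A top_cuts_up_closed top_cuts_card by (intro up_closed_unique[of A]) auto
qed

context rooted_cycle
begin

text \<open>A neighbour of \<open>i\<close> is the far end or the near end of an edge at which
  \<open>i\<close> is the other end. The two families of neighbours do not overlap, because two
  positions never carry the same edge.\<close>

lemma edge_count:
  "card {j. {i, j} \<in> cycle_edges n \<and> Q i j} =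
    (\<Sum>q<n. of_bool (i = vtx q \<and> Q (vtx q) (vtx (Suc q))) + of_bool (i = vtx (Suc q) \<and> Q (vtx (Suc q))
        (vtx q)))"
proof -
  let ?S1 = "{q \<in> {..<n}. i = vtx q \<and> Q (vtx q) (vtx (Suc q))}"
  let ?S2 = "{q \<in> {..<n}. i = vtx (Suc q) \<and> Q (vtx (Suc q)) (vtx q)}"
  have eq: "{j. {i, j} \<in> cycle_edges n \<and> Q i j} = (\<lambda>q. vtx (Suc q)) ` ?S1 \<union> vtx ` ?S2"
  proof (intro equalityI subsetI)
    fix j assume "j \<in> {j. {i, j} \<in> cycle_edges n \<and> Q i j}"
    then have j: "{i, j} \<in> cycle_edges n" "Q i j" by auto
    from j(1) show "j \<in> (\<lambda>q. vtx (Suc q)) ` ?S1 \<union> vtx ` ?S2"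
    proof (rule edge_cases)
      fix q assume "q < n" "i = vtx q" "j = vtx (Suc q)"
      then show ?thesis using j by blast
    next
      fix q assume "q < n" "j = vtx q" "i = vtx (Suc q)"
      then show ?thesis using j by blast
    qed
  next
    fix j assume "j \<in> (\<lambda>q. vtx (Suc q)) ` ?S1 \<union> vtx ` ?S2"
    then show "j \<in> {j. {i, j} \<in> cycle_edges n \<and> Q i j}" using edgeI by blast
  qed
  have i1: "inj_on (\<lambda>q. vtx (Suc q)) ?S1" by (rule inj_onI) (use vtx_Suc_eq in auto)
  have i2: "inj_on vtx ?S2" by (rule inj_onI) (use vtx_eq in auto)
  have dis: "(\<lambda>q. vtx (Suc q)) ` ?S1 \<inter> vtx ` ?S2 = {}"
  proof -
    have False if "q < n" "r < n" "i = vtx q" "i = vtx (Suc r)" "vtx (Suc q) = vtx r" for q r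
    proof -
      have "{vtx q, vtx (Suc q)} = {vtx r, vtx (Suc r)}" using that by (metis insert_commute)
      then have "q = r" using that edge_inj unfolding inj_on_def by simp
      then show False using that by simp
    qed
    then show ?thesis by blast
  qed
  have "card {j. {i, j} \<in> cycle_edges n \<and> Q i j} = card ?S1 + card ?S2"
    unfolding eq using i1 i2 dis by (subst card_Un_disjoint) (auto simp: card_image)
  also have "\<dots> = (\<Sum>q<n. of_bool (i = vtx q \<and> Q (vtx q) (vtx (Suc q))))
      + (\<Sum>q<n. of_bool (i = vtx (Suc q) \<and> Q (vtx (Suc q)) (vtx q)))"
    by (rule arg_cong2[of _ _ _ _ "(+)"]) (simp_all only: of_nat_eq_iff[where 'a = int, symmetric]
        card_of_bool[OF finite_lessThan] of_nat_sum of_nat_of_bool)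
  finally show ?thesis by (simp only: sum.distrib)
qed

definition cut_exp_fun :: "nat set \<Rightarrow> nat set \<Rightarrow> nat \<Rightarrow> nat" where
  "cut_exp_fun A R i = (\<Sum>q\<in>A. if q \<in> R then of_bool (i = vtx q) else of_bool (i = vtx (Suc q)))"

text \<open>A directed edge consists of a single edge of the cycle unless there are two cuts. Then
  it consists of both of them, and its monomial is that of the whole orientation, of degree
  two.\<close>

lemma edge_exponent_cut_edge:
  assumes A: "A \<subseteq> {..<n}" "2 \<le> card A" and q: "q \<in> A"
  shows "edge_exponent n (cut_edge A q d) =
    (if card A = 2 then cut_exp_fun A (if d then {q} else A - {q}) else
        (\<lambda>i. of_bool (i = (if d then vtx q else vtx (Suc q)))))"
proof
  fix i
  obtain U W where UW: "cut_edge A q d = (U, W)" by force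
  have fA: "finite A" using A finite_subset by blast
  have UWb: "U \<in> blocks A" "W \<in> blocks A" "U \<noteq> W"
    using cut_edge_blocks[OF A(1) q, of d] cut_edge_neq[OF A q, of d] UW by (metis fst_conv snd_conv)+
  then obtain a b where ab: "U = blk A a" "W = blk A b" by (auto simp: blocks_def)
  have inb: "vtx r \<in> blk A a \<longleftrightarrow> blk A r = blk A a" if "r \<le> n" for r a
    using blk_disjoint[OF A(1) that, of a] vtx_in_blk[OF A(1) that] by metis
  have "edge_exponent n (cut_edge A q d) i = card {j. {i, j} \<in> cycle_edges n \<and> i \<in> U \<and> j \<in> W}"
    unfolding edge_exponent_def edges_to_def UW by (auto intro!: arg_cong[of _ _ card])
  also have "\<dots> = (\<Sum>q<n. of_bool (i = vtx q \<and> vtx q \<in> U \<and> vtx (Suc q) \<in> W) + of_bool (i = vtx (Suc q) \<and>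
      vtx (Suc q) \<in> U \<and> vtx q \<in> W))"
    by (rule edge_count)
  also have "\<dots> = (\<Sum>r<n. if r \<in> A then of_bool (i = vtx r \<and> cut_edge A r True = (U, W)) + of_bool
      (i = vtx (Suc r) \<and> cut_edge A r False = (U, W)) else 0)"
  proof (rule sum.cong)
    fix r assume "r \<in> {..<n}"
    then have r: "r < n" by simp
    have "vtx r \<in> U \<longleftrightarrow> blk A r = U" "vtx r \<in> W \<longleftrightarrow> blk A r = W"
      "vtx (Suc r) \<in> U \<longleftrightarrow> blk A (Suc r) = U" "vtx (Suc r) \<in> W \<longleftrightarrow> blk A (Suc r) = W"
      using inb[of r] inb[of "Suc r"] r ab by simp_all
    then show "of_bool (i = vtx r \<and> vtx r \<in> U \<and> vtx (Suc r) \<in> W) + of_bool (i = vtx (Suc r) \<and> vtx (Suc r)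
        \<in> U \<and> vtx r \<in> W)
      = (if r \<in> A then of_bool (i = vtx r \<and> cut_edge A r True = (U, W)) + of_bool
          (i = vtx (Suc r) \<and> cut_edge A r False = (U, W)) else (0::nat))"
      using blk_Suc_neq[OF A r] UWb(3) by (auto simp: cut_edge_def)
  qed simp
  also have "\<dots> = (\<Sum>r\<in>A. of_bool (i = vtx r \<and> cut_edge A r True = cut_edge A q d) + of_bool
      (i = vtx (Suc r) \<and> cut_edge A r False = cut_edge A q d))"
    using A(1) UW by (simp add: sum.inter_restrict[symmetric] Int_absorb1)
  also have "\<dots> = (if card A = 2 then cut_exp_fun A (if d then {q} else A - {q}) i else of_bool
      (i = (if d then vtx q else vtx (Suc q))))"
  proof (cases "card A = 2")
    case True
    then obtain q' where q': "A = {q, q'}" "q \<noteq> q'" using q by (auto simp: card_2_iff)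
    have f: "cut_edge A q e = cut_edge A q d \<longleftrightarrow> e = d" for e
      using cut_edge_neq[OF A q, of d] by (cases e; cases d) (auto simp: cut_edge_def)
    have f': "cut_edge A q' e = cut_edge A q d \<longleftrightarrow> e = (\<not> d)" for e
      using f[of "\<not> e"] cut_edge_two[OF A(1) q', of "\<not> e"] by auto
    have s: "sum g A = g q + g q'" for g :: "nat \<Rightarrow> nat" using q' by simp
    show ?thesis unfolding cut_exp_fun_def s f f' using q' True by (cases d) simp_all
  next
    case False
    then have f: "cut_edge A r e = cut_edge A q d \<longleftrightarrow> r = q \<and> e = d" if "r \<in> A" for r e
      using cut_edge_inj[OF A(1) that q, of e d] A(2) by auto
    have "(\<Sum>r\<in>A. of_bool (i = vtx r \<and> cut_edge A r True = cut_edge A q d) + of_bool (i = vtx (Suc r) \<and>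
        cut_edge A r False = cut_edge A q d))
      = (\<Sum>r\<in>A. if r = q then of_bool (i = (if d then vtx q else vtx (Suc q))) else (0::nat))"
      by (rule sum.cong) (auto simp: f)
    then show ?thesis using False fA q by (simp add: sum.delta)
  qed
  finally show "edge_exponent n (cut_edge A q d) i =
    (if card A = 2 then cut_exp_fun A (if d then {q} else A - {q}) else
        (\<lambda>i. of_bool (i = (if d then vtx q else vtx (Suc q))))) i"
    by simp
qed

lemma key_mono:
  assumes "A \<subseteq> {..<n}" "x \<in> A" "y \<in> A"
  shows "key A x \<le> key A y \<longleftrightarrow> x \<le> y"
proof -
  have f: "finite A" using assms finite_subset by blast
  have *: "key A x \<le> key A y" if "x \<le> y" "x \<in> A" "y \<in> A" for x y
    using that key_in[OF assms(1)] f by (auto intro!: card_mono)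
  then show ?thesis using assms key_inj[OF assms(1), of x y] by (metis nat_le_linear order_antisym)
qed

end

context rooted_parcycle
begin

lemma outvec_cut_opart:
  assumes "proper A R"
  shows "outvec n (cut_opart A R) = cut_exp_fun A R"
proof
  fix i
  have A: "A \<subseteq> {..<n}" "2 \<le> card A" "R \<subset> A" "R \<noteq> {}" using assms by (auto simp: proper_def)
  define Q where "Q i j \<longleftrightarrow> (\<exists>(U, W)\<in>cut_dedges A R. i \<in> U \<and> j \<in> W)" for i j
  have Q: "Q (vtx r) (vtx s) \<longleftrightarrow> (blk A r, blk A s) \<in> cut_dedges A R" if "r \<le> n" "s \<le> n" for r s
  proof
    assume "Q (vtx r) (vtx s)"
    then obtain U W where UW: "(U, W) \<in> cut_dedges A R" "vtx r \<in> U" "vtx s \<in> W" by (auto simp: Q_def)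
    then have "U \<in> blocks A" "W \<in> blocks A" using cut_dedges_blocks[OF A(1)] A(3) by blast+
    then obtain a b where "U = blk A a" "W = blk A b" by (auto simp: blocks_def)
    then have "blk A r = U" "blk A s = W" using UW blk_disjoint[OF A(1)] that by metis+
    then show "(blk A r, blk A s) \<in> cut_dedges A R" using UW by simp
  next
    assume "(blk A r, blk A s) \<in> cut_dedges A R"
    then show "Q (vtx r) (vtx s)" unfolding Q_def using vtx_in_blk[OF A(1)] that by blast
  qed
  have "outvec n (cut_opart A R) i = card {j. {i, j} \<in> cycle_edges n \<and> Q i j}"
    by (simp add: outvec_def cut_opart_def Q_def)
  also have "\<dots> = (\<Sum>q<n. of_bool (i = vtx q \<and> Q (vtx q) (vtx (Suc q))) + of_bool (i = vtx (Suc q) \<and>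
      Q (vtx (Suc q)) (vtx q)))"
    by (rule edge_count)
  also have "\<dots> = (\<Sum>q<n. if q \<in> A then (if q \<in> R then of_bool (i = vtx q) else of_bool (i = vtx (Suc q)))
      else 0)"
  proof (rule sum.cong)
    fix q assume "q \<in> {..<n}"
    then have q: "q < n" by simp
    show "of_bool (i = vtx q \<and> Q (vtx q) (vtx (Suc q))) + of_bool (i = vtx (Suc q) \<and>
        Q (vtx (Suc q)) (vtx q)) =
      (if q \<in> A then (if q \<in> R then of_bool (i = vtx q) else of_bool (i = vtx (Suc q))) else (0::nat))"
    proof (cases "q \<in> A")
      case True
      have "Q (vtx q) (vtx (Suc q)) \<longleftrightarrow> q \<in> R" "Q (vtx (Suc q)) (vtx q) \<longleftrightarrow> q \<notin> R"
        using cut_edge_in_cut_dedges[OF assms True, of True] cut_edge_in_cut_dedges[OF assms True, of False]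
            Q[of q "Suc q"] Q[of "Suc q" q] q
        by (simp_all add: cut_edge_def)
      then show ?thesis using True by simp
    next
      case False
      then have "blk A (Suc q) = blk A q" using blk_Suc_neq[OF A(1,2) q] by simp
      then have "\<not> Q (vtx q) (vtx (Suc q))" "\<not> Q (vtx (Suc q)) (vtx q)"
        using Q[of q "Suc q"] Q[of "Suc q" q] q unfolding cut_dedges_alt by auto
      then show ?thesis using False by simp
    qed
  qed simp
  also have "\<dots> = cut_exp_fun A R i"
    using A(1) by (simp add: cut_exp_fun_def sum.inter_restrict[symmetric] Int_absorb1)
  finally show "outvec n (cut_opart A R) i = cut_exp_fun A R i" .
qed

lemma V_blk:
  assumes "A \<subseteq> cuts" "r \<le> n"
  shows "V \<subseteq> blk A r \<longleftrightarrow> key A r = 0"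
proof -
  have A: "A \<subseteq> {..<n}" using assms cuts_sub_lt by auto
  have v: "vtx 0 \<in> V" using v0V by (simp add: vtx_0)
  have "V \<subseteq> blk A 0" using P_in_blk[OF assms(1) VP _ v] by simp
  moreover have "blk A r = blk A 0" if "V \<subseteq> blk A r"
    using blk_disjoint[OF A, of 0 r] v that by auto
  ultimately show ?thesis using blk_eq_iff[OF A assms(2), of 0] key_0[OF A] by auto
qed

text \<open>A block is a sink if the cut at its end is counterclockwise and the one at its start is
  clockwise. The block of the root has key 0, so the absence of other sinks means that a clockwise
  cut is followed, up to the root, only by clockwise ones. For a proper \<open>R\<close> this makes
  the root block a sink as well.\<close>

lemma sink_top_cuts:
  assumes AE: "A \<subseteq> cuts" and R: "proper A R"
  shows "sink_acyclic V (cut_opart A R) \<longleftrightarrow> up_closed A R"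
proof -
  have A: "A \<subseteq> {..<n}" "2 \<le> card A" "R \<subset> A" "R \<noteq> {}" using R by (auto simp: proper_def)
  have fA: "finite A" using A finite_subset by blast
  have noout: "(\<forall>W. (blk A r, W) \<notin> cut_dedges A R) \<longleftrightarrow>
      (\<forall>q\<in>A. key A q = key A r \<longrightarrow> q \<notin> R) \<and> (\<forall>q\<in>A. key A (Suc q) = key A r \<longrightarrow> q \<in> R)" if "r \<le> n" for r
  proof -
    have b: "blk A q = blk A r \<longleftrightarrow> key A q = key A r" "blk A (Suc q) = blk A r \<longleftrightarrow> key A (Suc q) = key A r" if
        "q \<in> A" for q
      using that blk_eq_iff[OF A(1), of q r] blk_eq_iff[OF A(1), of "Suc q" r] A(1) by auto
    have "(\<exists>W. (blk A r, W) \<in> cut_dedges A R) \<longleftrightarrow> (\<exists>q\<in>A. blk A q = blk A r \<and> q \<in> R) \<or>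
        (\<exists>q\<in>A. blk A (Suc q) = blk A r \<and> q \<notin> R)"
    proof
      assume "\<exists>W. (blk A r, W) \<in> cut_dedges A R"
      then obtain W where W: "(blk A r, W) \<in> cut_dedges A R" ..
      then have "(\<exists>q\<in>R. (blk A r, W) = cut_edge A q True) \<or> (\<exists>q\<in>A - R. (blk A r, W) = cut_edge A q False)"
        unfolding cut_dedges_alt by blast
      then show "(\<exists>q\<in>A. blk A q = blk A r \<and> q \<in> R) \<or> (\<exists>q\<in>A. blk A (Suc q) = blk A r \<and> q \<notin> R)"
        using A(3) unfolding cut_edge_def by auto
    next
      assume "(\<exists>q\<in>A. blk A q = blk A r \<and> q \<in> R) \<or> (\<exists>q\<in>A. blk A (Suc q) = blk A r \<and> q \<notin> R)"
      then show "\<exists>W. (blk A r, W) \<in> cut_dedges A R"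
      proof (elim disjE bexE conjE)
        fix q assume "q \<in> A" "blk A q = blk A r" "q \<in> R"
        then show ?thesis using cut_edge_in_cut_dedges[OF R, of q True] by (metis cut_edge_def)
      next
        fix q assume "q \<in> A" "blk A (Suc q) = blk A r" "q \<notin> R"
        then show ?thesis using cut_edge_in_cut_dedges[OF R, of q False] by (metis cut_edge_def)
      qed
    qed
    then show ?thesis using b by metis
  qed
  have sink: "sink_acyclic V (cut_opart A R) \<longleftrightarrow>
      (\<forall>r<n. ((\<forall>q\<in>A. key A q = key A r \<longrightarrow> q \<notin> R) \<and> (\<forall>q\<in>A. key A (Suc q) = key A r \<longrightarrow> q \<in> R)) \<longleftrightarrow> key A r = 0)"
    unfolding sink_acyclic_def cut_opart_def blocks_def using noout V_blk[OF AE] by auto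
  have byk: "\<exists>q\<in>A. key A q = k" if "k < card A" for k
    using key_bij[OF A(1)] that unfolding bij_betw_def by (metis imageE lessThan_iff)
  show ?thesis
  proof
    assume s: "sink_acyclic V (cut_opart A R)"
    have step: "y \<in> R" if "x \<in> R" "y \<in> A" "key A y = Suc (key A x)" for x y
    proof (rule ccontr)
      assume y: "y \<notin> R"
      have x: "x \<in> A" using that A by auto
      have yn: "y < n" using that A by auto
      have "key A y < card A" using A(2) by (intro key_less[OF A(1)]) auto
      then have k: "key A (Suc x) = key A y" using key_Suc_if[OF A(1) x] that by simp
      have "\<forall>q\<in>A. key A q = key A y \<longrightarrow> q \<notin> R" using key_inj[OF A(1)] that y by metis
      moreover have "\<forall>q\<in>A. key A (Suc q) = key A y \<longrightarrow> q \<in> R" using key_Suc_inj[OF A(1)] x k that by metis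
      ultimately have "key A y = 0" using s sink yn by blast
      then show False using that by simp
    qed
    have "y \<in> R" if "x \<in> R" "y \<in> A" "key A y = key A x + d" for x y d
      using that
    proof (induction d arbitrary: y)
      case 0
      then show ?case using key_inj[OF A(1), of x y] A by auto
    next
      case (Suc d)
      have "key A x + d < card A" using Suc.prems key_less[OF A(1), of y] A(2) by (cases "A = {}") auto
      then obtain z where "z \<in> A" "key A z = key A x + d" using byk by blast
      then show ?case using Suc step[of z y] by simp
    qed
    then show "up_closed A R" unfolding up_closed_def using A(3) key_mono[OF A(1)]
      by (metis le_Suc_ex psubset_imp_subset subsetD)
  next
    assume pair_exp: "up_closed A R"
    have "((\<forall>q\<in>A. key A q = key A r \<longrightarrow> q \<notin> R) \<and> (\<forall>q\<in>A. key A (Suc q) = key A r \<longrightarrow> q \<in> R)) \<longleftrightarrow> key A r = 0" if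
        r: "r < n" for r
    proof
      assume k: "key A r = 0"
      have "q \<notin> R" if "q \<in> A" "key A q = 0" for q
      proof
        assume "q \<in> R"
        moreover have "q \<le> y" if "y \<in> A" for y using key_mono[OF A(1) \<open>q \<in> A\<close> that] \<open>key A q = 0\<close> by simp
        ultimately have "A \<subseteq> R" using pair_exp unfolding up_closed_def by blast
        then show False using A(3) by auto
      qed
      moreover have "q \<in> R" if "q \<in> A" "key A (Suc q) = 0" for q
      proof -
        have l: "Suc (key A q) = card A" using key_Suc_if[OF A(1) that(1)] that(2) by (auto split: if_splits)
        obtain x where x: "x \<in> R" using A by auto
        then have "x \<in> A" using A by auto
        then have "x \<le> q" using key_mono[OF A(1) _ that(1), of x] l key_less[OF A(1), of x] by fastforce
        then show ?thesis using pair_exp x that unfolding up_closed_def by blast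
      qed
      ultimately show "(\<forall>q\<in>A. key A q = key A r \<longrightarrow> q \<notin> R) \<and> (\<forall>q\<in>A. key A (Suc q) = key A r \<longrightarrow> q \<in> R)"
        using k by simp
    next
      assume *: "(\<forall>q\<in>A. key A q = key A r \<longrightarrow> q \<notin> R) \<and> (\<forall>q\<in>A. key A (Suc q) = key A r \<longrightarrow> q \<in> R)"
      show "key A r = 0"
      proof (rule ccontr)
        assume k: "key A r \<noteq> 0"
        have kl: "key A r < card A" using A(2) by (intro key_less[OF A(1)]) auto
        obtain q where q: "q \<in> A" "key A q = key A r" using byk[OF kl] by blast
        obtain q' where q': "q' \<in> A" "key A q' = key A r - 1" using byk[OF less_imp_diff_less[OF kl]] by blast
        have "key A (Suc q') = key A r" using key_Suc_if[OF A(1) q'(1)] q' k kl by auto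
        then have "q' \<in> R" "q \<notin> R" using * q q' by auto
        moreover have "q' \<le> q" using key_mono[OF A(1) q'(1) q(1)] q q' by simp
        ultimately show False using pair_exp q unfolding up_closed_def by blast
      qed
    qed
    then show "sink_acyclic V (cut_opart A R)" using sink by blast
  qed
qed

end

context rooted_parcycle
begin

section \<open>The classes, indexed by their cuts and their numbers of clockwise cuts\<close>

definition chip_class :: "nat set \<Rightarrow> nat \<Rightarrow> opart set" where
  "chip_class A p = chip_rel n \<P> `` {cut_opart A (top_cuts A p)}"

text \<open>In degree \<open>j \<ge> 1\<close> there are \<open>j\<close> classes for every set of
  \<open>j + 1\<close> cuts, as in the Eagon-Northcott complex of a matrix with two rows. Degree 0
  has only the partition into one block, which has no cuts.\<close>

definition indices :: "nat \<Rightarrow> (nat set \<times> nat) set" where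
  "indices j = (if j = 0 then {({}, 0)} else {(A, p). A \<subseteq> cuts \<and> card A = Suc j \<and> 1 \<le> p \<and> p \<le> j})"

lemma finite_subset_cuts: "A \<subseteq> cuts \<Longrightarrow> finite A"
  using cuts_sub_lt finite_subset by blast

lemma proper_top_cuts: "A \<subseteq> cuts \<Longrightarrow> 1 \<le> p \<Longrightarrow> p < card A \<Longrightarrow> proper A (top_cuts A p) \<and> card (top_cuts A p) = p"
proof -
  assume A: "A \<subseteq> cuts" "1 \<le> p" "p < card A"
  have c: "card (top_cuts A p) = p" using top_cuts_card[OF finite_subset_cuts[OF A(1)], of p] A by simp
  then have "top_cuts A p \<noteq> A" "top_cuts A p \<noteq> {}" using A by auto
  then show ?thesis using c A top_cuts_subset[of A p] cuts_sub_lt[OF A(1)] by (auto simp: proper_def)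
qed

lemma triv_opart_neq: "proper A R \<Longrightarrow> fst (cut_opart A R) \<noteq> fst triv_opart"
proof
  assume R: "proper A R" and eq: "fst (cut_opart A R) = fst triv_opart"
  have "card (blocks A) = card A" using R by (intro card_blocks) (auto simp: proper_def)
  moreover have "card (blocks A) = 1" using eq by (simp add: cut_opart_def triv_opart_eq)
  ultimately show False using R by (auto simp: proper_def)
qed

lemma chip_rel_triv_opart: "(triv_opart, C) \<in> chip_rel n \<P> \<longleftrightarrow> C = triv_opart"
proof
  assume "(triv_opart, C) \<in> chip_rel n \<P>"
  then have "acyclic_partition n \<P> C" "fst C = fst triv_opart" by (auto simp: chip_rel_def)
  then show "C = triv_opart" using triv_opart_neq unfolding acyclic_partition_iff by metis
next
  have "(\<lambda>x. 0) \<in> int_span B" for B :: "('b \<Rightarrow> int) set"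
    unfolding int_span_def by (intro CollectI exI[of _ "\<lambda>_. 0"]) simp
  moreover have "acyclic_partition n \<P> triv_opart" using acyclic_partition_iff by blast
  moreover assume "C = triv_opart"
  ultimately show "(triv_opart, C) \<in> chip_rel n \<P>" by (simp add: chip_rel_def)
qed

lemma chip_class_triv_opart: "chip_class {} 0 = {triv_opart}"
  using chip_rel_triv_opart by (auto simp: chip_class_def triv_opart_def[symmetric] top_cuts_def)

lemma class_mem:
  assumes "A \<subseteq> cuts" "proper A R"
  shows "C \<in> chip_rel n \<P> `` {cut_opart A R} \<longleftrightarrow> (\<exists>R'. proper A R' \<and> card R' = card R \<and> C = cut_opart A R')"
proof
  assume "C \<in> chip_rel n \<P> `` {cut_opart A R}"
  then have r: "(cut_opart A R, C) \<in> chip_rel n \<P>" by simp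
  then have "acyclic_partition n \<P> C" "fst C = fst (cut_opart A R)" by (auto simp: chip_rel_def)
  then obtain A' R' where "A' \<subseteq> cuts" "proper A' R'" "C = cut_opart A' R'"
    unfolding acyclic_partition_iff using triv_opart_neq[OF assms(2)] by metis
  then show "\<exists>R'. proper A R' \<and> card R' = card R \<and> C = cut_opart A R'"
    using chip_rel_iff[OF assms(2) _ assms(1)] r by metis
next
  assume "\<exists>R'. proper A R' \<and> card R' = card R \<and> C = cut_opart A R'"
  then show "C \<in> chip_rel n \<P> `` {cut_opart A R}" using chip_rel_iff[OF assms(2) _ assms(1) assms(1)] by auto
qed

lemma chip_class_mem:
  assumes "A \<subseteq> cuts" "1 \<le> p" "p < card A"
  shows "C \<in> chip_class A p \<longleftrightarrow> (\<exists>R. proper A R \<and> card R = p \<and> C = cut_opart A R)"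
  unfolding chip_class_def using class_mem[OF assms(1), of "top_cuts A p"] proper_top_cuts[OF assms] by simp

lemma proper_card:
  assumes "proper A R" "A \<subseteq> cuts"
  shows "1 \<le> card R" "card R < card A"
proof -
  have "finite A" using assms finite_subset_cuts by auto
  then show "1 \<le> card R" "card R < card A" using assms finite_subset[of R A]
    by (auto simp: proper_def Suc_le_eq card_gt_0_iff intro: psubset_card_mono)
qed

lemma class_of:
  assumes "A \<subseteq> cuts" "proper A R"
  shows "chip_rel n \<P> `` {cut_opart A R} = chip_class A (card R)"
  using class_mem[OF assms] chip_class_mem[OF assms(1) proper_card[OF assms(2,1)]] by blast

lemma chip_class_inj:
  assumes "A \<subseteq> cuts" "1 \<le> p" "p < card A" "A' \<subseteq> cuts" "1 \<le> p'" "p' < card A'" "chip_class A p =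
      chip_class A' p'"
  shows "A = A' \<and> p = p'"
proof -
  have "cut_opart A' (top_cuts A' p') \<in> chip_class A p" unfolding assms(7) using
      chip_class_mem[OF assms(4-6)] proper_top_cuts[OF assms(4-6)] by blast
  then have "(cut_opart A (top_cuts A p), cut_opart A' (top_cuts A' p')) \<in> chip_rel n \<P>" unfolding
      chip_class_def by simp
  then show ?thesis using chip_rel_iff[of A "top_cuts A p" A' "top_cuts A' p'"]
      proper_top_cuts[OF assms(1-3)] proper_top_cuts[OF assms(4-6)] assms by auto
qed

lemma indicesD: "(A, p) \<in> indices j \<Longrightarrow> j \<ge> 1 \<Longrightarrow> A \<subseteq> cuts \<and> 1 \<le> p \<and> p < card A \<and> card A = Suc j"
  by (auto simp: indices_def)

lemma chip_class_inj_on: "inj_on (\<lambda>(A, p). chip_class A p) (indices j)"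
proof (cases "j = 0")
  case False
  have "A = A' \<and> p = p'" if "(A, p) \<in> indices j" "(A', p') \<in> indices j" "chip_class A p = chip_class A' p'"
      for A p A' p'
    using chip_class_inj[of A p A' p'] indicesD[OF that(1)] indicesD[OF that(2)] that(3) False by auto
  then show ?thesis unfolding inj_on_def by auto
qed (auto simp: indices_def)

lemma chip_classes_eq: "chip_classes n \<P> (Suc j) = (\<lambda>(A, p). chip_class A p) ` indices j"
proof (cases "j = 0")
  case True
  have "{C. acyclic_partition n \<P> C \<and> card (fst C) = Suc 0} = {triv_opart}"
  proof (intro equalityI subsetI)
    fix C assume C: "C \<in> {C. acyclic_partition n \<P> C \<and> card (fst C) = Suc 0}"
    have "card (fst (cut_opart A R)) \<noteq> Suc 0" if "proper A R" for A R
      using that card_blocks[of A] by (auto simp: cut_opart_def proper_def)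
    then show "C \<in> {triv_opart}" using C unfolding acyclic_partition_iff by auto
  next
    fix C assume "C \<in> {triv_opart}"
    then show "C \<in> {C. acyclic_partition n \<P> C \<and> card (fst C) = Suc 0}"
      using acyclic_partition_iff by (auto simp: triv_opart_eq)
  qed
  then show ?thesis using True chip_rel_triv_opart unfolding chip_classes_def quotient_def
      by (auto simp: indices_def chip_class_triv_opart)
next
  case False
  have S: "{C. acyclic_partition n \<P> C \<and> card (fst C) = Suc j} = {cut_opart A R | A R. A \<subseteq> cuts \<and> proper A R
      \<and> card A = Suc j}"
  proof (intro equalityI subsetI)
    fix C assume C: "C \<in> {C. acyclic_partition n \<P> C \<and> card (fst C) = Suc j}"
    have "card (fst triv_opart) \<noteq> Suc j" using False by (simp add: triv_opart_eq)
    moreover have "card (fst (cut_opart A R)) = card A" if "proper A R" for A R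
      using that card_blocks[of A] by (auto simp: cut_opart_def proper_def)
    ultimately show "C \<in> {cut_opart A R | A R. A \<subseteq> cuts \<and> proper A R \<and> card A = Suc j}"
      using C unfolding acyclic_partition_iff by (smt (verit) mem_Collect_eq)
  next
    fix C assume "C \<in> {cut_opart A R | A R. A \<subseteq> cuts \<and> proper A R \<and> card A = Suc j}"
    then obtain A R where C: "C = cut_opart A R" "A \<subseteq> cuts" "proper A R" "card A = Suc j" by blast
    then have "card (fst C) = Suc j" using card_blocks[of A] by (auto simp: cut_opart_def proper_def)
    then show "C \<in> {C. acyclic_partition n \<P> C \<and> card (fst C) = Suc j}"
      using C unfolding acyclic_partition_iff by blast
  qed
  show ?thesis
  proof (intro equalityI subsetI)
    fix c assume "c \<in> chip_classes n \<P> (Suc j)"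
    then obtain A R where c: "A \<subseteq> cuts" "proper A R" "card A = Suc j" "c = chip_rel n \<P> `` {cut_opart A R}"
      unfolding chip_classes_def quotient_def S by blast
    then have "c = chip_class A (card R)" "(A, card R) \<in> indices j"
      using class_of proper_card[OF c(2,1)] False by (auto simp: indices_def)
    then show "c \<in> (\<lambda>(A, p). chip_class A p) ` indices j" by force
  next
    fix c assume "c \<in> (\<lambda>(A, p). chip_class A p) ` indices j"
    then obtain A p where c: "(A, p) \<in> indices j" "c = chip_class A p" by auto
    have A: "A \<subseteq> cuts" "1 \<le> p" "p < card A" "card A = Suc j" using indicesD[OF c(1)] False by auto
    then have "cut_opart A (top_cuts A p) \<in> {C. acyclic_partition n \<P> C \<and> card (fst C) = Suc j}"
      unfolding S using proper_top_cuts[OF A(1-3)] by blast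
    then show "c \<in> chip_classes n \<P> (Suc j)"
      unfolding chip_classes_def quotient_def c(2) chip_class_def by blast
  qed
qed

lemma F_basis_eq: "F_basis n \<P> j = (\<lambda>(A, p). chip_class A p) ` indices j"
  by (simp add: F_basis_def chip_classes_eq)

section \<open>Contractible edges of a class and the contracted classes\<close>

lemma acyclic_cut_opart:
  assumes "A \<subseteq> cuts" "2 \<le> card A" "R \<subseteq> A"
  shows "acyclic_partition n \<P> (cut_opart A R) \<longleftrightarrow> R \<noteq> {} \<and> R \<noteq> A"
proof
  assume "acyclic_partition n \<P> (cut_opart A R)"
  then have "acyclic (cut_dedges A R)" by (simp add: acyclic_partition_def cut_opart_def)
  then show "R \<noteq> {} \<and> R \<noteq> A" using cyclic_cut_dedges[OF cuts_sub_lt[OF assms(1)] assms(2)] by auto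
next
  assume "R \<noteq> {} \<and> R \<noteq> A"
  then have "proper A R" using assms cuts_sub_lt by (auto simp: proper_def)
  then show "acyclic_partition n \<P> (cut_opart A R)" using assms unfolding acyclic_partition_iff by blast
qed

text \<open>Contraction must leave a clockwise and a counterclockwise cut. With two cuts it leaves
  one block, whose only orientation is empty and acyclic.\<close>

definition may_contract :: "nat set \<Rightarrow> nat \<Rightarrow> bool \<Rightarrow> bool" where
  "may_contract A p d \<longleftrightarrow> card A = 2 \<or> (if d then 2 \<le> p else p + 2 \<le> card A)"

lemma contractible_cut_opart:
  assumes A: "A \<subseteq> cuts" and R: "proper A R"
  shows "contractible n \<P> (cut_opart A R) f \<longleftrightarrow> (\<exists>q\<in>A. \<exists>d. f = cut_edge A q d \<and> (d \<longleftrightarrow> q \<in> R) \<and>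
      may_contract A (card R) d)"
proof -
  have A': "A \<subseteq> {..<n}" "2 \<le> card A" "R \<subset> A" "R \<noteq> {}" using R by (auto simp: proper_def)
  have fA: "finite A" "finite R" using finite_subset_cuts[OF A] A'(3) finite_subset by blast+
  have D: "f \<in> cut_dedges A R \<longleftrightarrow> (\<exists>q\<in>A. \<exists>d. f = cut_edge A q d \<and> (d \<longleftrightarrow> q \<in> R))"
  proof
    assume "f \<in> cut_dedges A R"
    then have "(\<exists>q\<in>R. f = cut_edge A q True) \<or> (\<exists>q\<in>A - R. f = cut_edge A q False)" unfolding cut_dedges_alt
        by blast
    then show "\<exists>q\<in>A. \<exists>d. f = cut_edge A q d \<and> (d \<longleftrightarrow> q \<in> R)" using A'(3) by blast
  next
    assume "\<exists>q\<in>A. \<exists>d. f = cut_edge A q d \<and> (d \<longleftrightarrow> q \<in> R)"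
    then show "f \<in> cut_dedges A R" using cut_edge_in_cut_dedges[OF R] by blast
  qed
  have ac: "acyclic_partition n \<P> (contract (cut_opart A R) (cut_edge A q d)) \<longleftrightarrow> may_contract A (card R) d"
    if q: "q \<in> A" "d \<longleftrightarrow> q \<in> R" for q d
  proof -
    have c: "contract (cut_opart A R) (cut_edge A q d) = cut_opart (A - {q}) (R - {q})"
      using A' q by (intro contract_cut_opart) auto
    have cA: "card (A - {q}) = card A - 1" using q fA by simp
    show ?thesis
    proof (cases "card A = 2")
      case True
      then have "cut_opart (A - {q}) (R - {q}) = triv_opart" using A'(1) cA by (intro cut_opart_triv_opart)
          auto
      then show ?thesis using True c acyclic_partition_iff by (auto simp: may_contract_def)
    next
      case False
      then have "2 \<le> card (A - {q})" using cA A' by auto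
      then have "acyclic_partition n \<P> (contract (cut_opart A R) (cut_edge A q d)) \<longleftrightarrow> R - {q} \<noteq> {} \<and>
          R - {q} \<noteq> A - {q}"
        unfolding c using A A' by (intro acyclic_cut_opart) auto
      also have "\<dots> \<longleftrightarrow> may_contract A (card R) d"
      proof (cases d)
        case True
        then have "q \<in> R" using q by simp
        then have "R - {q} \<noteq> A - {q}" using A'(3) by auto
        moreover have "R - {q} \<noteq> {} \<longleftrightarrow> 2 \<le> card R"
        proof -
          have "card (R - {q}) = card R - 1" using \<open>q \<in> R\<close> fA by simp
          moreover have "R - {q} \<noteq> {} \<longleftrightarrow> card (R - {q}) \<noteq> 0" using fA by simp
          ultimately show ?thesis by linarith
        qed
        moreover have "may_contract A (card R) d \<longleftrightarrow> 2 \<le> card R" unfolding may_contract_def using True False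
            by simp
        ultimately show ?thesis by blast
      next
        case nd: False
        then have "q \<notin> R" using q by simp
        then have e: "R - {q} = R" by simp
        have "R \<subseteq> A - {q}" using \<open>q \<notin> R\<close> A' by auto
        then have "R = A - {q} \<longleftrightarrow> card R = card (A - {q})" using fA(1) card_subset_eq[of "A - {q}" R]
            by (metis finite_Diff)
        moreover have "card R \<le> card (A - {q})" using \<open>R \<subseteq> A - {q}\<close> fA by (intro card_mono) auto
        ultimately have "R \<noteq> A - {q} \<longleftrightarrow> card R + 2 \<le> card A" using cA A'(2) by linarith
        moreover have "may_contract A (card R) d \<longleftrightarrow> card R + 2 \<le> card A" unfolding may_contract_def using nd
            False by simp
        ultimately show ?thesis unfolding e using A'(4) by blast
      qed
      finally show ?thesis .
    qed
  qed
  show ?thesis unfolding contractible_def using D ac by (auto simp: cut_opart_def)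
qed

text \<open>Whether a cut can be contracted in a given direction depends only on the counts, and
  some orientation in the class gives the cut this direction: the remaining clockwise cuts can be
  chosen freely among the other cuts.\<close>

lemma contractible_edges_chip_class:
  assumes A: "A \<subseteq> cuts" and p: "1 \<le> p" "p < card A"
  shows "contractible_edges n \<P> (chip_class A p) = {cut_edge A q d | q d. q \<in> A \<and> may_contract A p d}"
proof (intro equalityI subsetI)
  fix f assume "f \<in> contractible_edges n \<P> (chip_class A p)"
  then obtain R where "proper A R" "card R = p" "contractible n \<P> (cut_opart A R) f"
    unfolding contractible_edges_def using chip_class_mem[OF assms] by auto
  then show "f \<in> {cut_edge A q d | q d. q \<in> A \<and> may_contract A p d}" using contractible_cut_opart[OF A]
      by blast
next
  fix f assume "f \<in> {cut_edge A q d | q d. q \<in> A \<and> may_contract A p d}"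
  then obtain q d where f: "f = cut_edge A q d" "q \<in> A" "may_contract A p d" by blast
  have fA: "finite A" using finite_subset_cuts[OF A] .
  have cA: "card (A - {q}) = card A - 1" using f fA by simp
  have "\<exists>R. R \<subseteq> A \<and> card R = p \<and> (d \<longleftrightarrow> q \<in> R)"
  proof (cases d)
    case True
    obtain S where S: "S \<subseteq> A - {q}" "card S = p - 1" using obtain_subset_with_card_n[of "p - 1" "A - {q}"]
        unfolding cA using p by (metis diff_le_mono less_imp_le_nat)
    then have "finite S" "q \<notin> S" using fA finite_subset by blast+
    then show ?thesis using S p f True by (intro exI[of _ "insert q S"]) auto
  next
    case False
    obtain S where S: "S \<subseteq> A - {q}" "card S = p" using obtain_subset_with_card_n[of p "A - {q}"] unfolding
        cA using p by (metis Suc_diff_1 Suc_leI less_Suc_eq_le less_zeroE zero_less_iff_neq_zero)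
    then show ?thesis using False by (intro exI[of _ S]) auto
  qed
  then obtain R where R: "R \<subseteq> A" "card R = p" "d \<longleftrightarrow> q \<in> R" by blast
  then have pairing: "proper A R" using p cuts_sub_lt[OF A] by (auto simp: proper_def)
  then have "contractible n \<P> (cut_opart A R) f" using contractible_cut_opart[OF A pairing] f R by blast
  moreover have "cut_opart A R \<in> chip_class A p" using chip_class_mem[OF assms] pairing R by blast
  ultimately show "f \<in> contractible_edges n \<P> (chip_class A p)" unfolding contractible_edges_def by blast
qed

definition target_index :: "nat set \<Rightarrow> nat \<Rightarrow> nat \<Rightarrow> bool \<Rightarrow> nat set \<times> nat" where
  "target_index A p q d = (if card A = 2 then ({}, 0) else (A - {q}, if d then p - 1 else p))"

lemma contract_class_chip_class:
  assumes A: "A \<subseteq> cuts" and p: "1 \<le> p" "p < card A" and q: "q \<in> A" and d: "may_contract A p d"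
  shows "contract_class n \<P> (chip_class A p) (cut_edge A q d) = (\<lambda>(A, p). chip_class A p)
      (target_index A p q d)"
proof -
  let ?f = "cut_edge A q d"
  have "?f \<in> contractible_edges n \<P> (chip_class A p)" using contractible_edges_chip_class[OF A p] q d by blast
  then have wit: "\<exists>C. C \<in> chip_class A p \<and> contractible n \<P> C ?f" by (auto simp: contractible_edges_def)
  define C where "C = (SOME C. C \<in> chip_class A p \<and> contractible n \<P> C ?f)"
  have C: "C \<in> chip_class A p" "contractible n \<P> C ?f" using someI_ex[OF wit] by (auto simp: C_def)
  then obtain R where R: "proper A R" "card R = p" "C = cut_opart A R" using chip_class_mem[OF A p] by blast
  \<comment> \<open>The chosen representative may name the edge by the other cut if there are two
    cuts; the contracted class is then trivial for either name.\<close>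
  obtain q' d' where q': "q' \<in> A" "cut_edge A q d = cut_edge A q' d'" "d' \<longleftrightarrow> q' \<in> R" using C(2) R
      contractible_cut_opart[OF A] by blast
  have A': "A \<subseteq> {..<n}" "2 \<le> card A" "R \<subset> A" "R \<noteq> {}" using R by (auto simp: proper_def)
  have fA: "finite A" "finite R" using finite_subset_cuts[OF A] A'(3) finite_subset by blast+
  have c: "contract C ?f = cut_opart (A - {q'}) (R - {q'})" unfolding R(3) q'(2) using A' q'
      by (intro contract_cut_opart) auto
  show ?thesis
  proof (cases "card A = 2")
    case True
    then have "cut_opart (A - {q'}) (R - {q'}) = triv_opart" using A'(1) q' fA
        by (intro cut_opart_triv_opart) auto
    then have "contract_class n \<P> (chip_class A p) ?f = {triv_opart}"
      unfolding contract_class_def C_def[symmetric] c using chip_rel_triv_opart by auto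
    then show ?thesis using True by (simp add: target_index_def chip_class_triv_opart)
  next
    case False
    then have qq: "q' = q" "d' = d" using cut_edge_inj[OF A'(1) q q'(1,2)] A' by auto
    have "acyclic_partition n \<P> (contract C ?f)" using C(2) by (simp add: contractible_def)
    moreover have "2 \<le> card (A - {q})" using q fA False A' by simp
    ultimately have "proper (A - {q}) (R - {q})"
      using acyclic_cut_opart[of "A - {q}" "R - {q}"] A A' unfolding c qq(1) by (auto simp: proper_def)
    then have "contract_class n \<P> (chip_class A p) ?f = chip_class (A - {q}) (card (R - {q}))"
      unfolding contract_class_def C_def[symmetric] c qq(1) using A by (intro class_of) auto
    moreover have "card (R - {q}) = (if d then p - 1 else p)" using R(2) fA q' qq by auto
    ultimately show ?thesis using False by (simp add: target_index_def)
  qed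
qed

lemma class_eps_chip_class:
  assumes A: "A \<subseteq> cuts" and p: "1 \<le> p" "p < card A"
  shows "class_eps n lam V (chip_class A p) = wt n lam (cut_exp_fun A (top_cuts A p))"
proof -
  have fA: "finite A" using finite_subset_cuts[OF A] .
  have h: "proper A (top_cuts A p)" "card (top_cuts A p) = p" using proper_top_cuts[OF assms] by auto
  have "(THE C. C \<in> chip_class A p \<and> sink_acyclic V C) = cut_opart A (top_cuts A p)"
  proof (rule the_equality)
    show "cut_opart A (top_cuts A p) \<in> chip_class A p \<and> sink_acyclic V (cut_opart A (top_cuts A p))"
      using chip_class_mem[OF assms] h sink_top_cuts[OF A h(1)] top_cuts_up_closed[OF fA] by blast
  next
    fix C assume "C \<in> chip_class A p \<and> sink_acyclic V C"
    then obtain R where R: "proper A R" "card R = p" "C = cut_opart A R" "sink_acyclic V C" using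
        chip_class_mem[OF assms] by blast
    then have "up_closed A R" using sink_top_cuts[OF A R(1)] by simp
    then have "R = top_cuts A p" using top_cuts_unique[OF fA, of R] R by simp
    then show "C = cut_opart A (top_cuts A p)" using R by simp
  qed
  then show ?thesis using outvec_cut_opart[OF h(1)] by (simp add: class_eps_def)
qed

lemma class_eps_triv_opart: "class_eps n lam V (chip_class {} 0) = 0"
proof -
  have "V \<subseteq> {1..n}" using VP cuts_facts(2) blk_subset[OF cuts_facts(1)] by (auto simp: blocks_def)
  then have "sink_acyclic V triv_opart" by (auto simp: sink_acyclic_def triv_opart_eq)
  then have "(THE C. C \<in> chip_class {} 0 \<and> sink_acyclic V C) = triv_opart"
    unfolding chip_class_triv_opart by (intro the_equality) auto
  then show ?thesis by (simp add: class_eps_def outvec_def triv_opart_eq wt_def)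
qed

end

section \<open>Weights and contraction terms\<close>

text \<open>Exchange argument: \<open>R - H\<close> and \<open>H - R\<close> have the same size, and
  every element of the former lies below every element of the latter.\<close>

lemma up_closed_sum_less:
  assumes "finite A" "up_closed A H" "R \<subseteq> A" "card R = card H" "R \<noteq> H"
  shows "\<Sum>R < \<Sum>H"
proof -
  have f: "finite R" "finite H" using assms finite_subset unfolding up_closed_def by blast+
  have c: "card (R - H) = card (H - R)"
    using f assms(4) by (simp add: card_Diff_subset_Int Int_commute)
  have ne: "R - H \<noteq> {}"
  proof
    assume "R - H = {}"
    then have "R \<subseteq> H" by auto
    then show False using card_subset_eq[of H R] f assms by auto
  qed
  have lt: "x < y" if "x \<in> R - H" "y \<in> H - R" for x y
    using that assms(2,3) unfolding up_closed_def by (metis DiffD1 DiffD2 not_le_imp_less subsetD)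
  define m where "m = Max (R - H)"
  have m: "m \<in> R - H" "x \<in> R - H \<Longrightarrow> x \<le> m" for x using Max_in[OF _ ne] f by (simp_all add: m_def)
  have "\<Sum>(R - H) \<le> card (R - H) * m" using sum_bounded_above[of "R - H" "\<lambda>x. x" m] m by simp
  also have "\<dots> < card (H - R) * Suc m"
  proof -
    have "card (R - H) > 0" using ne f by (simp only: card_gt_0_iff finite_Diff simp_thms)
    then show ?thesis unfolding c by simp
  qed
  also have "\<dots> \<le> \<Sum>(H - R)" using sum_bounded_below[of "H - R" "Suc m" "\<lambda>x. x"] lt[OF m(1)]
      by (simp add: Suc_le_eq)
  finally have "\<Sum>(R - H) < \<Sum>(H - R)" .
  moreover have "\<Sum>R = \<Sum>(R - H) + \<Sum>(R \<inter> H)" "\<Sum>H = \<Sum>(H - R) + \<Sum>(R \<inter> H)"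
    using f sum.Int_Diff[of R "\<lambda>x. x" H] sum.Int_Diff[of H "\<lambda>x. x" R] by (simp_all add: Int_commute)
  ultimately show ?thesis by simp
qed

context rooted_cycle
begin

text \<open>At a cut \<open>q\<close>, choosing the vertex before it rather than the vertex after it changes the weight by
  \<open>2 q + 1 - n\<close>, which is strictly increasing in \<open>q\<close>. So among the orientations in a class the weight is
  largest exactly when the clockwise cuts are the last ones, which is the sink-acyclic orientation.\<close>

definition lam :: "nat \<Rightarrow> nat" where
  "lam i = (if i \<in> {1..n} then pos i * (n - pos i) else 0)"

lemma lam_vtx: "q < n \<Longrightarrow> lam (vtx q) = q * (n - q)"
  by (simp add: lam_def)

lemma lam_vtx_Suc: "q < n \<Longrightarrow> lam (vtx (Suc q)) = Suc q * (n - Suc q)"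
proof (cases "Suc q = n")
  case True
  then have "vtx (Suc q) = vtx 0" by simp
  then show ?thesis using True lam_vtx[of 0] by simp
qed (simp add: lam_vtx)

lemma lam_diff: "q < n \<Longrightarrow> int (lam (vtx q)) = int (lam (vtx (Suc q))) + (2 * int q + 1 - int n)"
proof -
  assume q: "q < n"
  then obtain k where k: "n = Suc (q + k)" using less_imp_Suc_add by blast
  have "lam (vtx q) = q * Suc k" "lam (vtx (Suc q)) = Suc q * k"
    using lam_vtx[OF q] lam_vtx_Suc[OF q] by (simp_all add: k)
  then show ?thesis by (simp add: k algebra_simps)
qed

lemma lam_natvec: "lam \<in> natvecs n"
  by (auto simp: natvecs_def lam_def)

lemma lam_edge_sum:
  "(\<Sum>i\<in>{1..n}. int (lam i) * (\<Sum>q<n. g q * (of_bool (i = vtx q) - of_bool (i = vtx (Suc q)))))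
    = (\<Sum>q<n. g q * (2 * int q + 1 - int n))"
proof -
  have l: "(\<Sum>i\<in>{1..n}. int (lam i) * of_bool (i = vtx q)) = int (lam (vtx q))" for q
  proof -
    have "{1..n} \<inter> {i. i = vtx q} = {vtx q}" using vtx_in by blast
    then show ?thesis by simp
  qed
  have "(\<Sum>i\<in>{1..n}. int (lam i) * (\<Sum>q<n. g q * (of_bool (i = vtx q) - of_bool (i = vtx (Suc q))))) =
     (\<Sum>i\<in>{1..n}. \<Sum>q<n. g q * (int (lam i) * of_bool (i = vtx q) - int (lam i) * of_bool (i = vtx (Suc q))))"
    unfolding sum_distrib_left by (intro sum.cong refl) (simp add: algebra_simps)
  also have "\<dots> = (\<Sum>q<n. \<Sum>i\<in>{1..n}. g q * (int (lam i) * of_bool (i = vtx q) - int (lam i) * of_bool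
      (i = vtx (Suc q))))"
    by (rule sum.swap)
  also have "\<dots> = (\<Sum>q<n. g q * (int (lam (vtx q)) - int (lam (vtx (Suc q)))))"
    unfolding sum_distrib_left[symmetric] sum_subtractf l ..
  also have "\<dots> = (\<Sum>q<n. g q * (2 * int q + 1 - int n))"
    using lam_diff by (intro sum.cong) auto
  finally show ?thesis .
qed

text \<open>The slopes \<open>2 * int q + 1 - k\<close> grow by 2 at each step, which produces the
  factor 2. Where this is applied, \<open>f\<close> vanishes at both ends, so only the sum of its
  values remains.\<close>

lemma sum_by_parts:
  fixes f :: "nat \<Rightarrow> int"
  assumes "f 0 = 0"
  shows "(\<Sum>q<m. (f q - f (Suc q)) * (2 * int q + 1 - k)) = 2 * (\<Sum>q<m. f q) - f m * (2 * int m - 1 - k)"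
  by (induction m) (simp_all add: assms algebra_simps)

text \<open>The value is twice the number of vertices of \<open>U\<close>, because
  \<open>lam\<close> has Laplacian 2 at every vertex except the root.\<close>

lemma lam_bvec:
  assumes "U \<subseteq> {1..n}" "U \<noteq> {}" "vtx 0 \<notin> U"
  shows "(\<Sum>i\<in>{1..n}. int (lam i) * bvec n U i) > 0"
proof -
  have "(\<Sum>i\<in>{1..n}. int (lam i) * bvec n U i) = 2 * (\<Sum>q<n. vtx_ind q U)"
    unfolding bvec_sum[OF assms(1)] lam_edge_sum
    by (subst sum_by_parts) (use assms(3) in simp_all)
  also have "\<dots> > 0"
  proof -
    obtain i where i: "i \<in> U" "i \<in> {1..n}" using assms by blast
    have "vtx_ind (pos i) U \<le> (\<Sum>q<n. vtx_ind q U)" using vtx_pos[OF i(2)] by (intro member_le_sum) auto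
    then show ?thesis using i vtx_pos[OF i(2)] by simp
  qed
  finally show ?thesis .
qed

definition weight :: "(nat \<Rightarrow>\<^sub>0 nat) \<Rightarrow> nat" where "weight u = wt n lam (lookup u)"

lemma weight_add [simp]: "weight (u + v) = weight u + weight v"
  by (simp add: weight_def wt_def lookup_add distrib_left sum.distrib)

lemma weight_0 [simp]: "weight 0 = 0"
  by (simp add: weight_def wt_def)

definition unit_exp :: "nat \<Rightarrow> nat \<Rightarrow>\<^sub>0 nat" where "unit_exp i = single i 1"

lemma lookup_unit_exp: "lookup (unit_exp i) x = of_bool (x = i)"
  by (simp add: unit_exp_def lookup_single when_def)

lemma keys_unit_exp [simp]: "keys (unit_exp i) = {i}"
  by (simp add: unit_exp_def)

lemma weight_unit_exp: "weight (unit_exp (vtx q)) = lam (vtx q)"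
proof -
  have "{1..n} \<inter> {x. x = vtx q} = {vtx q}" using vtx_in by blast
  then show ?thesis by (simp add: weight_def wt_def lookup_unit_exp)
qed

lemma weight_sum: "weight (sum f S) = (\<Sum>x\<in>S. weight (f x))"
  by (induction S rule: infinite_finite_induct) auto

definition cut_exp :: "nat set \<Rightarrow> nat set \<Rightarrow> nat \<Rightarrow>\<^sub>0 nat" where
  "cut_exp A R = (\<Sum>q\<in>A. unit_exp (if q \<in> R then vtx q else vtx (Suc q)))"

lemma lookup_cut_exp: "lookup (cut_exp A R) = cut_exp_fun A R"
  by (rule ext) (auto simp: cut_exp_def cut_exp_fun_def lookup_sum lookup_unit_exp intro!: sum.cong)

lemma cut_exp_empty [simp]: "cut_exp {} R = 0" by (simp add: cut_exp_def)

lemma keys_cut_exp: "keys (cut_exp A R) \<subseteq> {1..n}"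
  unfolding cut_exp_def by (intro keys_sum_subset) (auto split: if_splits)

lemma cut_exp_remove:
  assumes "finite A" "q \<in> A"
  shows "cut_exp A R = unit_exp (if q \<in> R then vtx q else vtx (Suc q)) + cut_exp (A - {q}) (R - {q})"
proof -
  have "cut_exp A R = unit_exp (if q \<in> R then vtx q else vtx (Suc q))
      + (\<Sum>x\<in>A - {q}. unit_exp (if x \<in> R then vtx x else vtx (Suc x)))"
    unfolding cut_exp_def using assms by (simp add: sum.remove)
  also have "(\<Sum>x\<in>A - {q}. unit_exp (if x \<in> R then vtx x else vtx (Suc x))) = cut_exp (A - {q}) (R - {q})"
    unfolding cut_exp_def by (intro sum.cong) auto
  finally show ?thesis .
qed

text \<open>Isolates the dependence on \<open>R\<close>: at a fixed number of clockwise cuts,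
  comparing weights is comparing the sums of their positions.\<close>

lemma weight_cut_exp:
  assumes "A \<subseteq> {..<n}" "R \<subseteq> A"
  shows "int (weight (cut_exp A R)) = (\<Sum>q\<in>A. int (lam (vtx (Suc q)))) + 2 * int (\<Sum>R) + int (card R)
      * (1 - int n)"
proof -
  have fA: "finite A" by (rule finite_subset[OF assms(1)]) simp
  have fR: "finite R" by (rule finite_subset[OF assms(2) fA])
  have "int (weight (cut_exp A R)) = (\<Sum>q\<in>A. int (lam (vtx (Suc q)))
      + (if q \<in> R then 2 * int q + 1 - int n else 0))"
    unfolding cut_exp_def weight_sum of_nat_sum
  proof (rule sum.cong)
    fix q assume "q \<in> A"
    then have "q < n" using assms by auto
    then show "int (weight (unit_exp (if q \<in> R then vtx q else vtx (Suc q)))) =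
        int (lam (vtx (Suc q))) + (if q \<in> R then 2 * int q + 1 - int n else 0)"
      using lam_diff[of q] weight_unit_exp[of q] weight_unit_exp[of "Suc q"] by (cases "q \<in> R") simp_all
  qed simp
  also have "\<dots> = (\<Sum>q\<in>A. int (lam (vtx (Suc q)))) + (\<Sum>q\<in>R. 2 * int q + 1 - int n)"
    using assms fA by (simp add: sum.distrib sum.inter_restrict[symmetric] Int_absorb1)
  also have "(\<Sum>q\<in>R. 2 * int q + 1 - int n) = 2 * int (\<Sum>R) + int (card R) * (1 - int n)"
    unfolding sum_subtractf sum.distrib sum_distrib_left[symmetric] of_nat_sum by (simp add: algebra_simps)
  finally show ?thesis by simp
qed

lemma weight_max:
  assumes "A \<subseteq> {..<n}" "R \<subseteq> A" "p \<le> card A" "card R = p"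
  shows "weight (cut_exp A R) \<le> weight (cut_exp A (top_cuts A p))" "R \<noteq> top_cuts A p \<Longrightarrow> weight (cut_exp A R)
      < weight (cut_exp A (top_cuts A p))"
proof -
  have fA: "finite A" using assms finite_subset by blast
  have c: "card (top_cuts A p) = p" using top_cuts_card[OF fA assms(3)] .
  have "weight (cut_exp A R) < weight (cut_exp A (top_cuts A p))" if "R \<noteq> top_cuts A p"
  proof -
    have "int (\<Sum>R) < int (\<Sum>(top_cuts A p))"
      unfolding of_nat_less_iff using up_closed_sum_less[OF fA top_cuts_up_closed[OF fA] assms(2), of p]
          that c assms(4) by simp
    then show ?thesis
      using weight_cut_exp[OF assms(1,2)] weight_cut_exp[OF assms(1) top_cuts_subset, of p] unfolding c
          assms(4) by linarith
  qed
  then show "R \<noteq> top_cuts A p \<Longrightarrow> weight (cut_exp A R) < weight (cut_exp A (top_cuts A p))"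
      "weight (cut_exp A R) \<le> weight (cut_exp A (top_cuts A p))"
    by (cases "R = top_cuts A p"; auto)+
qed

end

context rooted_parcycle
begin

text \<open>With two cuts every edge of the class has two names; only the clockwise one is listed,
  so that each edge occurs once.\<close>

definition contractions :: "nat set \<times> nat \<Rightarrow> (nat \<times> bool) set" where
  "contractions = (\<lambda>(A, p). {(q, d). q \<in> A \<and> (if card A = 2 then d else may_contract A p d)})"

definition edge_exp :: "nat set \<Rightarrow> nat \<Rightarrow> bool \<Rightarrow> nat \<Rightarrow>\<^sub>0 nat" where
  "edge_exp A q d = (if card A = 2 then cut_exp A (if d then {q} else A - {q}) else unit_exp
      (if d then vtx q else vtx (Suc q)))"

text \<open>The clockwise cuts of the orientation obtained from the sink-acyclic orientation of the
  contracted class by reinserting the edge. It lies in the class of \<open>(A, p)\<close> but need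
  not be its heaviest member; the missing weight is \<open>t_exp\<close>.\<close>

definition reached_set :: "nat set \<Rightarrow> nat \<Rightarrow> nat \<Rightarrow> bool \<Rightarrow> nat set" where
  "reached_set A p q d = (if card A = 2 then (if d then {q} else A - {q})
     else if d then insert q (top_cuts (A - {q}) (p - 1)) else top_cuts (A - {q}) p)"

definition t_exp :: "nat set \<Rightarrow> nat \<Rightarrow> nat \<Rightarrow> bool \<Rightarrow> nat" where
  "t_exp A p q d = weight (cut_exp A (top_cuts A p)) - weight (cut_exp A (reached_set A p q d))"

text \<open>The multidegree given to a basis vector: the outdegrees of its sink-acyclic orientation.
  With it the differential is homogeneous for the weight in which t has weight 1.\<close>

definition index_exp :: "nat set \<times> nat \<Rightarrow> nat \<Rightarrow>\<^sub>0 nat" where "index_exp = (\<lambda>(A, p). cut_exp A (top_cuts A p))"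

lemma keys_edge_exp: "keys (edge_exp A q d) \<subseteq> {1..n}"
  using keys_cut_exp by (auto simp: edge_exp_def split: if_splits)

lemma lookup_edge_exp:
  assumes "A \<subseteq> cuts" "2 \<le> card A" "q \<in> A"
  shows "lookup (edge_exp A q d) = edge_exponent n (cut_edge A q d)"
  unfolding edge_exponent_cut_edge[OF cuts_sub_lt[OF assms(1)] assms(2,3)] edge_exp_def
  by (auto simp: lookup_cut_exp lookup_unit_exp fun_eq_iff)

text \<open>Splitting off the summand of the cut \<open>q\<close> shows how a contraction changes
  the multidegree: the sink-acyclic orientation is replaced by the one reached.\<close>

lemma reached_set_props:
  assumes A: "A \<subseteq> cuts" and p: "1 \<le> p" "p < card A" and q: "q \<in> A" and d: "may_contract A p d"
  shows "reached_set A p q d \<subseteq> A" "card (reached_set A p q d) = p" "edge_exp A q d + index_exp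
      (target_index A p q d) = cut_exp A (reached_set A p q d)"
proof -
  have fA: "finite A" using finite_subset_cuts[OF A] .
  have cA: "card (A - {q}) = card A - 1" using fA q by simp
  show "reached_set A p q d \<subseteq> A" using q top_cuts_subset[of "A - {q}"] by (auto simp: reached_set_def)
  have q1: "q \<notin> top_cuts (A - {q}) x" for x using top_cuts_subset[of "A - {q}" x] by auto
  show "card (reached_set A p q d) = p"
  proof (cases "card A = 2")
    case True
    then show ?thesis using p cA by (auto simp: reached_set_def)
  next
    case False
    have "card (top_cuts (A - {q}) (p - 1)) = p - 1" using fA cA p by (intro top_cuts_card) auto
    moreover have "card (top_cuts (A - {q}) p) = p" using fA cA p by (intro top_cuts_card) auto
    moreover have "finite (top_cuts (A - {q}) x)" for x using top_cuts_subset[of "A - {q}" x] fA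
        finite_subset by blast
    ultimately show ?thesis using False q1 p by (auto simp: reached_set_def)
  qed
  show "edge_exp A q d + index_exp (target_index A p q d) = cut_exp A (reached_set A p q d)"
  proof (cases "card A = 2")
    case True
    then show ?thesis by (simp add: edge_exp_def index_exp_def target_index_def reached_set_def)
  next
    case False
    show ?thesis unfolding cut_exp_remove[OF fA q, of "reached_set A p q d"]
      using False q1 by (auto simp: edge_exp_def index_exp_def target_index_def reached_set_def)
  qed
qed

lemma contractions_may_contract: "(q, d) \<in> contractions (A, p) \<Longrightarrow> q \<in> A \<and> may_contract A p d"
  by (auto simp: contractions_def may_contract_def split: if_splits)

text \<open>\<open>weight_max\<close> makes the subtraction in \<open>t_exp\<close> exact, and the
  formula is then the one for the exponent of t in \<open>F_coeff\<close>.\<close>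

lemma t_exp_weight:
  assumes A: "A \<subseteq> cuts" and p: "1 \<le> p" "p < card A" and q: "q \<in> A" and d: "may_contract A p d"
  shows "weight (edge_exp A q d) + weight (index_exp (target_index A p q d)) + t_exp A p q d =
      weight (index_exp (A, p))"
proof -
  note R = reached_set_props[OF assms]
  have w: "weight (edge_exp A q d) + weight (index_exp (target_index A p q d)) =
      weight (cut_exp A (reached_set A p q d))"
    using arg_cong[OF R(3), of weight] by simp
  have "p \<le> card A" using p by simp
  note M = weight_max[OF cuts_sub_lt[OF A] R(1) this R(2)]
  show "weight (edge_exp A q d) + weight (index_exp (target_index A p q d)) + t_exp A p q d =
      weight (index_exp (A, p))"
    using w M(1) by (simp add: t_exp_def index_exp_def)
qed

lemma target_index_indices:
  assumes "(A, p) \<in> indices j" "j \<ge> 1" "q \<in> A" "may_contract A p d"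
  shows "target_index A p q d \<in> indices (j - 1)"
proof -
  have A: "A \<subseteq> cuts" "1 \<le> p" "p < card A" "card A = Suc j" using indicesD[OF assms(1,2)] by auto
  have "card (A - {q}) = j" using A finite_subset_cuts[OF A(1)] assms(3) by simp
  then show ?thesis using A assms by (auto simp: target_index_def indices_def may_contract_def
      split: if_splits)
qed

lemma contractions_contractible:
  assumes A: "A \<subseteq> cuts" and p: "1 \<le> p" "p < card A"
  shows "contractible_edges n \<P> (chip_class A p) = (\<lambda>(q, d). cut_edge A q d) ` contractions (A, p)"
    "inj_on (\<lambda>(q, d). cut_edge A q d) (contractions (A, p))"
proof -
  have A': "A \<subseteq> {..<n}" using A cuts_sub_lt by auto
  show "contractible_edges n \<P> (chip_class A p) = (\<lambda>(q, d). cut_edge A q d) ` contractions (A, p)"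
    unfolding contractible_edges_chip_class[OF assms]
  proof (intro equalityI subsetI)
    fix f assume "f \<in> {cut_edge A q d | q d. q \<in> A \<and> may_contract A p d}"
    then obtain q d where f: "f = cut_edge A q d" "q \<in> A" "may_contract A p d" by blast
    show "f \<in> (\<lambda>(q, d). cut_edge A q d) ` contractions (A, p)"
    proof (cases "card A = 2 \<and> \<not> d")
      case True
      then obtain q' where q': "A = {q, q'}" "q \<noteq> q'" using f(2) by (auto simp: card_2_iff)
      then have "f = cut_edge A q' True" using cut_edge_two[OF A' q', of d] f True by simp
      moreover have "(q', True) \<in> contractions (A, p)" using True q' by (auto simp: contractions_def)
      ultimately show ?thesis by force
    next
      case False
      then have "(q, d) \<in> contractions (A, p)" using f by (auto simp: contractions_def)
      then show ?thesis using f(1) by force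
    qed
  next
    fix f assume "f \<in> (\<lambda>(q, d). cut_edge A q d) ` contractions (A, p)"
    then obtain q d where "f = cut_edge A q d" "(q, d) \<in> contractions (A, p)" by auto
    then show "f \<in> {cut_edge A q d | q d. q \<in> A \<and> may_contract A p d}" using contractions_may_contract
        by blast
  qed
  have "q = q' \<and> d = d'" if t: "(q, d) \<in> contractions (A, p)" "(q', d') \<in> contractions (A, p)"
      "cut_edge A q d = cut_edge A q' d'" for q d q' d'
  proof (cases "card A = 2")
    case True
    then have "d" "d'" using t by (auto simp: contractions_def)
    then show ?thesis using cut_edge_dir_inj[OF A', of q q' True] t contractions_may_contract[OF t(1)]
        contractions_may_contract[OF t(2)] by auto
  next
    case False
    then show ?thesis using cut_edge_inj[OF A' _ _ t(3)] contractions_may_contract[OF t(1)]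
        contractions_may_contract[OF t(2)] p by auto
  qed
  then show "inj_on (\<lambda>(q, d). cut_edge A q d) (contractions (A, p))" unfolding inj_on_def by auto
qed

end

section \<open>The acyclic matching\<close>

context rooted_parcycle
begin

text \<open>A cell \<open>((A, p), u, s)\<close> is the monomial \<open>x\<^sup>u t\<^sup>s\<close> times the basis vector of the class with cuts
  \<open>A\<close> of which \<open>p\<close> are clockwise.\<close>

type_synonym cell = "(nat set \<times> nat) \<times> (nat \<Rightarrow>\<^sub>0 nat) \<times> nat"

text \<open>Divisibility by the leading term of the 2-minor of the columns \<open>i < j\<close>, a
  generator of the parking function ideal. The indicators are added because for
  \<open>j = Suc i\<close> both variables are the same one and its square is meant.\<close>

definition pair_divides :: "(nat \<Rightarrow>\<^sub>0 nat) \<Rightarrow> nat \<Rightarrow> nat \<Rightarrow> bool" where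
  "pair_divides w i j \<longleftrightarrow> i \<in> cuts \<and> j \<in> cuts \<and> i < j \<and>
     (\<forall>x. of_bool (x = vtx (Suc i)) + of_bool (x = vtx j) \<le> lookup w x)"

definition in_parking :: "(nat \<Rightarrow>\<^sub>0 nat) \<Rightarrow> bool" where "in_parking w \<longleftrightarrow> (\<exists>i j. pair_divides w i j)"

text \<open>The minimum and the maximum below are junk unless some cut pair divides \<open>w\<close>, as is the case for the
  exponents of all cells in positive degree.\<close>

definition first_cut :: "(nat \<Rightarrow>\<^sub>0 nat) \<Rightarrow> nat" where
  "first_cut w = Min {i \<in> cuts. 1 \<le> lookup w (vtx (Suc i))}"

definition last_cut :: "(nat \<Rightarrow>\<^sub>0 nat) \<Rightarrow> nat" where
  "last_cut w = Max {j. pair_divides w (first_cut w) j}"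

definition cell_exp :: "cell \<Rightarrow> (nat \<Rightarrow>\<^sub>0 nat)" where "cell_exp = (\<lambda>(I, u, s). u + index_exp I)"

definition cells :: "nat \<Rightarrow> cell set" where
  "cells j = {(I, u, s). I \<in> indices j \<and> keys u \<subseteq> {1..n}}"

text \<open>In degree 0 these are the critical cells. In positive degree a cell is a tail if the cut
  selected by \<open>lead\<close> is present and gets removed. In all other cells a cut is missing,
  the first one or, if that is the only counterclockwise cut present, the last one, and inserting it
  gives the matching tail.\<close>

definition tails :: "nat \<Rightarrow> cell set" where
  "tails j = (if j = 0 then {(I, u, s). I \<in> indices j \<and> keys u \<subseteq> {1..n} \<and> \<not> in_parking u}
     else {((A, p), u, s). (A, p) \<in> indices j \<and> keys u \<subseteq> {1..n} \<and>
       (let w = u + cut_exp A (top_cuts A p) in first_cut w \<in> A \<and> (p + 2 \<le> card A \<or> p + 1 = card A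
           \<and> last_cut w \<in> A))})"

definition cell_contractions :: "cell \<Rightarrow> (nat \<times> bool) set" where "cell_contractions =
    (\<lambda>(I, u, s). contractions I)"

definition cell_target :: "cell \<Rightarrow> nat \<times> bool \<Rightarrow> cell" where
  "cell_target = (\<lambda>((A, p), u, s) (q, d). (target_index A p q d, u + edge_exp A q d, s + t_exp A p q d))"

definition lead :: "cell \<Rightarrow> nat \<times> bool" where
  "lead = (\<lambda>((A, p), u, s). let w = u + cut_exp A (top_cuts A p) in
     if p + 2 \<le> card A then (first_cut w, False) else (last_cut w, True))"

text \<open>A contraction without a factor \<open>t\<close> preserves the exponent, one with such a factor lowers its weight. The
  last two summands, at most 3 together, order the contractions that preserve the exponent.\<close>

definition cell_rank :: "cell \<Rightarrow> nat" where
  "cell_rank c = 4 * weight (cell_exp c) + (if first_cut (cell_exp c) \<notin> fst (fst c) then 2 else 0)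
     + (if last_cut (cell_exp c) \<notin> fst (fst c) then 1 else 0)"

section \<open>The first and the last cut of a multidegree\<close>

lemma finite_cuts: "finite cuts" using finite_subset_cuts by blast

lemma cuts_lt: "i \<in> cuts \<Longrightarrow> i < n" using cuts_facts(1) by auto

lemma first_cut_props:
  assumes "i \<in> cuts" "1 \<le> lookup w (vtx (Suc i))"
  shows "first_cut w \<in> cuts" "1 \<le> lookup w (vtx (Suc (first_cut w)))" "first_cut w \<le> i"
proof -
  let ?S = "{i \<in> cuts. 1 \<le> lookup w (vtx (Suc i))}"
  have "finite ?S" "i \<in> ?S" using finite_cuts assms by auto
  then have "first_cut w \<in> ?S" "first_cut w \<le> i" unfolding first_cut_def using Min_in[of ?S] Min_le[of ?S i]
      by auto
  then show "first_cut w \<in> cuts" "1 \<le> lookup w (vtx (Suc (first_cut w)))" "first_cut w \<le> i" by auto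
qed

lemma pair_divides_lookup: "pair_divides w i j \<Longrightarrow> 1 \<le> lookup w (vtx (Suc i))" "pair_divides w i j \<Longrightarrow>
    1 \<le> lookup w (vtx j)"
proof -
  assume "pair_divides w i j"
  then have l: "of_bool (x = vtx (Suc i)) + of_bool (x = vtx j) \<le> lookup w x" for x
      by (auto simp: pair_divides_def)
  show "1 \<le> lookup w (vtx (Suc i))" using l[of "vtx (Suc i)"] by simp
  show "1 \<le> lookup w (vtx j)" using l[of "vtx j"] by simp
qed

lemma last_cut_props:
  assumes "pair_divides w (first_cut w) j"
  shows "pair_divides w (first_cut w) (last_cut w)" "j \<le> last_cut w"
proof -
  let ?S = "{j. pair_divides w (first_cut w) j}"
  have "finite ?S" by (rule finite_subset[OF _ finite_cuts]) (auto simp: pair_divides_def)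
  then show "pair_divides w (first_cut w) (last_cut w)" "j \<le> last_cut w"
    unfolding last_cut_def using Max_in[of ?S] Max_ge[of ?S j] assms by auto
qed

text \<open>If \<open>first_cut w\<close> is smaller than \<open>i\<close>, the variable after it
  differs from the one before \<open>j\<close>, so the two divisibility conditions combine without
  asking for a square.\<close>

lemma pair_divides_first_cut:
  assumes "pair_divides w i j"
  shows "pair_divides w (first_cut w) j" "first_cut w \<le> i"
proof -
  have ij: "i \<in> cuts" "j \<in> cuts" "i < j" using assms by (auto simp: pair_divides_def)
  note c = first_cut_props[OF ij(1) pair_divides_lookup(1)[OF assms]]
  show "first_cut w \<le> i" using c by simp
  show "pair_divides w (first_cut w) j"
  proof (cases "first_cut w = i")
    case False
    then have lt: "Suc (first_cut w) < j" using c ij by simp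
    then have "vtx (Suc (first_cut w)) \<noteq> vtx j" using cuts_lt[OF ij(2)] by simp
    then have "of_bool (x = vtx (Suc (first_cut w))) + of_bool (x = vtx j) \<le> lookup w x" for x
      using c(2) pair_divides_lookup(2)[OF assms]
          by (cases "x = vtx j"; cases "x = vtx (Suc (first_cut w))") auto
    then show ?thesis using c(1) ij lt by (auto simp: pair_divides_def)
  qed (use assms in auto)
qed

lemma cut_exp_ge:
  assumes "finite A" "i \<in> A" "i \<notin> R" "j \<in> A" "j \<in> R"
  shows "of_bool (x = vtx (Suc i)) + of_bool (x = vtx j) \<le> lookup (cut_exp A R) x"
proof -
  have "i \<noteq> j" using assms by auto
  have "cut_exp A R = unit_exp (vtx (Suc i)) + cut_exp (A - {i}) (R - {i})" using
      cut_exp_remove[OF assms(1,2), of R] assms by simp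
  also have "cut_exp (A - {i}) (R - {i}) = unit_exp (vtx j) + cut_exp (A - {i} - {j}) (R - {i} - {j})"
    using cut_exp_remove[of "A - {i}" j "R - {i}"] assms \<open>i \<noteq> j\<close> by simp
  finally show ?thesis by (simp add: lookup_add lookup_unit_exp)
qed

text \<open>A counterclockwise cut of \<open>A\<close> contributes the variable after it to the
  index exponent, and the clockwise cuts lie above it. So the first cut of the multidegree is below
  all cuts of \<open>A\<close> or is the least of them, and inserting or deleting it as a
  counterclockwise cut keeps the clockwise ones an upper set.\<close>

lemma cell_props:
  fixes u :: "nat \<Rightarrow>\<^sub>0 nat"
  assumes "(A, p) \<in> indices j" "j \<ge> 1"
  defines "w \<equiv> u + cut_exp A (top_cuts A p)"
  shows "first_cut w \<in> cuts" "\<And>a. a \<in> A \<Longrightarrow> first_cut w \<le> a" "1 \<le> lookup w (vtx (Suc (first_cut w)))"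
    "first_cut w \<notin> top_cuts A p" "\<And>x y. x \<in> A - top_cuts A p \<Longrightarrow> y \<in> top_cuts A p \<Longrightarrow> pair_divides w x y \<and> x < y"
proof -
  have A: "A \<subseteq> cuts" "1 \<le> p" "p < card A" using indicesD[OF assms(1,2)] by auto
  have fA: "finite A" using finite_subset_cuts[OF A(1)] .
  have h: "proper A (top_cuts A p)" using proper_top_cuts[OF A] by simp
  have pair_exp: "up_closed A (top_cuts A p)" using top_cuts_up_closed[OF fA] .
  show lh: "pair_divides w x y \<and> x < y" if "x \<in> A - top_cuts A p" "y \<in> top_cuts A p" for x y
  proof -
    have yA: "y \<in> A" using that top_cuts_subset[of A p] by auto
    have "x < y"
    proof (rule ccontr)
      assume "\<not> x < y"
      then have "x \<in> top_cuts A p" using pair_exp that unfolding up_closed_def by auto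
      then show False using that by auto
    qed
    moreover have "of_bool (z = vtx (Suc x)) + of_bool (z = vtx y) \<le> lookup w z" for z
      using cut_exp_ge[OF fA _ _ yA that(2), of x z] that(1) unfolding w_def lookup_add by simp
    ultimately show ?thesis using that A(1) yA by (auto simp: pair_divides_def)
  qed
  obtain l where l: "l \<in> A - top_cuts A p" using h by (auto simp: proper_def)
  obtain m where m: "m \<in> top_cuts A p" using h by (auto simp: proper_def)
  have lw: "1 \<le> lookup w (vtx (Suc x))" if "x \<in> A - top_cuts A p" for x
    using pair_divides_lookup(1) lh[OF that m] by blast
  note c = first_cut_props[OF _ lw[OF l]]
  have lE: "l \<in> cuts" using l A by auto
  show "first_cut w \<in> cuts" "1 \<le> lookup w (vtx (Suc (first_cut w)))" using c[OF lE] by auto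
  have lc: "first_cut w \<le> x" if "x \<in> A - top_cuts A p" for x using first_cut_props(3)[OF _ lw[OF that]] that
      A by auto
  show "first_cut w \<le> a" if "a \<in> A" for a
  proof (cases "a \<in> top_cuts A p")
    case True
    then show ?thesis using lh[OF l True] lc[OF l] by simp
  qed (use lc that in auto)
  show "first_cut w \<notin> top_cuts A p" using lh[OF l] lc[OF l] by force
qed

section \<open>The leading term of a tail and its inverse\<close>

lemma top_cuts_insert_min: "finite A \<Longrightarrow> p \<le> card A \<Longrightarrow> (\<And>a. a \<in> A \<Longrightarrow> c < a) \<Longrightarrow> top_cuts (insert c A) p =
    top_cuts A p"
proof -
  assume A: "finite A" "p \<le> card A" "\<And>a. a \<in> A \<Longrightarrow> c < a"
  have "up_closed (insert c A) (top_cuts A p)"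
    using top_cuts_up_closed[OF A(1), of p] A(3) unfolding up_closed_def by force
  then have "top_cuts A p = top_cuts (insert c A) (card (top_cuts A p))" using A by (intro top_cuts_unique)
      auto
  then show ?thesis using top_cuts_card[OF A(1,2)] by simp
qed

lemma top_cuts_insert_max: "finite A \<Longrightarrow> p \<le> card A \<Longrightarrow> (\<And>a. a \<in> A \<Longrightarrow> a < b) \<Longrightarrow> top_cuts (insert b A) (Suc p) =
    insert b (top_cuts A p)"
proof -
  assume A: "finite A" "p \<le> card A" "\<And>a. a \<in> A \<Longrightarrow> a < b"
  have "up_closed (insert b A) (insert b (top_cuts A p))"
    using top_cuts_up_closed[OF A(1), of p] A(3) unfolding up_closed_def by force
  then have "insert b (top_cuts A p) = top_cuts (insert b A) (card (insert b (top_cuts A p)))" using A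
      by (intro top_cuts_unique) auto
  moreover have "b \<notin> top_cuts A p" "finite (top_cuts A p)" using A top_cuts_subset[of A p] finite_subset
      by blast+
  ultimately show ?thesis using top_cuts_card[OF A(1,2)] by simp
qed

lemma top_cuts_remove_lo: "finite A \<Longrightarrow> p \<le> card A \<Longrightarrow> c \<in> A - top_cuts A p \<Longrightarrow> top_cuts (A - {c}) p = top_cuts A p"
proof -
  assume A: "finite A" "p \<le> card A" "c \<in> A - top_cuts A p"
  have "up_closed (A - {c}) (top_cuts A p)" using top_cuts_up_closed[OF A(1), of p] A(3) unfolding
      up_closed_def by blast
  then show ?thesis using top_cuts_unique[of "A - {c}" "top_cuts A p"] top_cuts_card[OF A(1,2)] A(1) by simp
qed

lemma top_cuts_remove_top_cuts: "finite A \<Longrightarrow> p \<le> card A \<Longrightarrow> b \<in> top_cuts A p \<Longrightarrow> top_cuts (A - {b}) (p - 1) =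
    top_cuts A p - {b}"
proof -
  assume A: "finite A" "p \<le> card A" "b \<in> top_cuts A p"
  have "up_closed (A - {b}) (top_cuts A p - {b})" using top_cuts_up_closed[OF A(1), of p] unfolding
      up_closed_def by blast
  moreover have "card (top_cuts A p - {b}) = p - 1" using A top_cuts_card[OF A(1,2)] by simp
  ultimately show ?thesis using top_cuts_unique[of "A - {b}" "top_cuts A p - {b}"] A(1) by simp
qed

lemma low_cuts_card: "finite A \<Longrightarrow> p \<le> card A \<Longrightarrow> card (A - top_cuts A p) = card A - p"
  using top_cuts_card[of A p] top_cuts_subset[of A p] finite_subset[of "top_cuts A p" A]
      by (simp add: card_Diff_subset)

text \<open>The leading term contracts the least cut, or, when that one is the only counterclockwise cut, the last
  cut that forms a dividing pair with it.\<close>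

lemma tail_lead:
  assumes t: "((A, p), u, s) \<in> tails j" and j: "j \<ge> 1"
  defines "w \<equiv> u + cut_exp A (top_cuts A p)"
  obtains (c) "j \<ge> 2" "p + 2 \<le> card A" "first_cut w \<in> A - top_cuts A p" "lead ((A, p), u, s) =
      (first_cut w, False)"
      "cell_target ((A, p), u, s) (lead ((A, p), u, s)) =
          ((A - {first_cut w}, p), u + unit_exp (vtx (Suc (first_cut w))), s)"
  | (b) "j \<ge> 2" "p + 1 = card A" "A - top_cuts A p = {first_cut w}" "last_cut w \<in> top_cuts A p"
      "lead ((A, p), u, s) = (last_cut w, True)"
      "cell_target ((A, p), u, s) (lead ((A, p), u, s)) =
          ((A - {last_cut w}, p - 1), u + unit_exp (vtx (last_cut w)), s)"
  | (e) "j = 1" "A = {first_cut w, last_cut w}" "p = 1" "top_cuts A p = {last_cut w}"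
      "first_cut w < last_cut w" "lead ((A, p), u, s) = (last_cut w, True)"
      "cell_target ((A, p), u, s) (lead ((A, p), u, s)) = (({}, 0), w, s)"
proof -
  have I: "(A, p) \<in> indices j" and T: "first_cut w \<in> A" "p + 2 \<le> card A \<or> p + 1 = card A \<and> last_cut w \<in> A"
    using t j by (auto simp: tails_def Let_def w_def)
  have A: "A \<subseteq> cuts" "1 \<le> p" "p < card A" "card A = Suc j" using indicesD[OF I j] by auto
  have fA: "finite A" using finite_subset_cuts[OF A(1)] .
  have pA: "p \<le> card A" using A by simp
  note cp = cell_props[OF I j, where u = u, folded w_def]
  have cA: "first_cut w \<in> A - top_cuts A p" using T(1) cp(4) by simp
  have te0: "t_exp A p q d = 0" if "reached_set A p q d = top_cuts A p" for q d using that
      by (simp add: t_exp_def)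
  show thesis
  proof (cases "p + 2 \<le> card A")
    case True
    have l: "lead ((A, p), u, s) = (first_cut w, False)" using True by (simp add: lead_def Let_def w_def)
    have c2: "card A \<noteq> 2" using True A by simp
    then have "reached_set A p (first_cut w) False = top_cuts A p" using top_cuts_remove_lo[OF fA pA cA]
        by (simp add: reached_set_def)
    then have tg: "cell_target ((A, p), u, s) (lead ((A, p), u, s)) =
        ((A - {first_cut w}, p), u + unit_exp (vtx (Suc (first_cut w))), s)"
      unfolding l using c2 by (simp add: cell_target_def target_index_def edge_exp_def te0)
    have j2: "j \<ge> 2" using True A(2,4) by linarith
    show thesis by (rule c[OF j2 True cA l tg])
  next
    case False
    then have b: "p + 1 = card A" "last_cut w \<in> A" using T by auto
    have l: "lead ((A, p), u, s) = (last_cut w, True)" using False by (simp add: lead_def Let_def w_def)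
    have "card (A - top_cuts A p) = 1" using low_cuts_card[OF fA pA] b by simp
    then have lo: "A - top_cuts A p = {first_cut w}" using cA by (metis card_1_singletonE singletonD)
    obtain y where y: "y \<in> top_cuts A p" using A proper_top_cuts[OF A(1-3)] by (auto simp: proper_def)
    have "pair_divides w (first_cut w) y" using cp(5)[OF cA y] by simp
    then have cb: "first_cut w < last_cut w" using last_cut_props(1) by (auto simp: pair_divides_def)
    then have "last_cut w \<notin> A - top_cuts A p" unfolding lo by simp
    then have bh: "last_cut w \<in> top_cuts A p" using b(2) by blast
    show thesis
    proof (cases "card A = 2")
      case True
      then have "card (top_cuts A p) = 1" using top_cuts_card[OF fA pA] b by simp
      then have h: "top_cuts A p = {last_cut w}" using bh by (metis card_1_singletonE singletonD)
      have A2: "A = {first_cut w, last_cut w}" using lo h top_cuts_subset[of A p] by blast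
      have R: "reached_set A p (last_cut w) True = top_cuts A p" using True h by (simp add: reached_set_def)
      have tg: "cell_target ((A, p), u, s) (lead ((A, p), u, s)) = (({}, 0), w, s)"
      proof -
        have "edge_exp A (last_cut w) True = cut_exp A (top_cuts A p)" unfolding h using True
            by (simp add: edge_exp_def)
        then show ?thesis unfolding l using te0[OF R] True by (simp add: cell_target_def target_index_def
            w_def[symmetric])
      qed
      have j1: "j = 1" and p1: "p = 1" using A(4) True b(1) by simp_all
      show thesis by (rule e[OF j1 A2 p1 h cb l tg])
    next
      case False
      have "reached_set A p (last_cut w) True = top_cuts A p"
        using False top_cuts_remove_top_cuts[OF fA pA bh] bh by (auto simp: reached_set_def)
      then have tg: "cell_target ((A, p), u, s) (lead ((A, p), u, s)) =
          ((A - {last_cut w}, p - 1), u + unit_exp (vtx (last_cut w)), s)"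
        unfolding l using False by (simp add: cell_target_def target_index_def edge_exp_def te0)
      have j2: "j \<ge> 2" using False A(2,4) b(1) by linarith
      show thesis by (rule that(2)[OF j2 b(1) lo bh l tg])
    qed
  qed
qed

lemma cell_exp_cell_target:
  assumes "(A, p) \<in> indices j" "j \<ge> 1" "(q, d) \<in> contractions (A, p)"
  shows "cell_exp (cell_target ((A, p), u, s) (q, d)) = u + cut_exp A (reached_set A p q d)"
proof -
  have A: "A \<subseteq> cuts" "1 \<le> p" "p < card A" using indicesD[OF assms(1,2)] by auto
  show ?thesis using reached_set_props(3)[OF A, of q d] contractions_may_contract[OF assms(3)]
    by (simp add: cell_exp_def cell_target_def add.assoc)
qed

text \<open>Reinserting the cut contracted by the leading term restores the sink-acyclic
  orientation, so this term has no factor t and keeps the multidegree.\<close>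

lemma lead_in: 
  assumes t: "((A, p), u, s) \<in> tails j" and j: "j \<ge> 1"
  shows "lead ((A, p), u, s) \<in> contractions (A, p)" "reached_set A p (fst (lead ((A, p), u, s)))
      (snd (lead ((A, p), u, s))) = top_cuts A p"
proof -
  define w where "w = u + cut_exp A (top_cuts A p)"
  have I: "(A, p) \<in> indices j" using t j by (auto simp: tails_def Let_def)
  have A: "A \<subseteq> cuts" "1 \<le> p" "p < card A" "card A = Suc j" using indicesD[OF I j] by auto
  have fA: "finite A" using finite_subset_cuts[OF A(1)] .
  have pA: "p \<le> card A" using A by simp
  have "lead ((A, p), u, s) \<in> contractions (A, p) \<and> reached_set A p (fst (lead ((A, p), u, s)))
      (snd (lead ((A, p), u, s))) = top_cuts A p"
    using t j
  proof (cases rule: tail_lead)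
    case c
    then show ?thesis using A top_cuts_remove_lo[OF fA pA, of "first_cut w"]
        by (auto simp: w_def contractions_def may_contract_def reached_set_def)
  next
    case b
    then show ?thesis using A top_cuts_remove_top_cuts[OF fA pA, of "last_cut w"] top_cuts_subset[of A p]
      by (auto simp: w_def contractions_def may_contract_def reached_set_def)
  next
    case e
    then have "card A = 2" "lead ((A, p), u, s) = (last_cut w, True)" using A by (simp_all add: w_def)
    moreover have "last_cut w \<in> A" using e(2) unfolding w_def by blast
    ultimately show ?thesis using e(4) by (simp add: w_def[symmetric] contractions_def reached_set_def)
  qed
  then show "lead ((A, p), u, s) \<in> contractions (A, p)" "reached_set A p (fst (lead ((A, p), u, s)))
      (snd (lead ((A, p), u, s))) = top_cuts A p" by auto
qed

text \<open>A term that reaches another orientation has a factor t and lowers the weight, which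
  outweighs the two small summands. A term that keeps the multidegree removes a different cut. If
  the leading term removes the first cut, only its target lacks that cut; if it removes the last
  cut, the first one cannot be contracted, and only its target lacks the last cut. With two cuts the
  only other term has a factor t.\<close>

lemma rank_less:
  assumes t: "((A, p), u, s) \<in> tails j" and j: "j \<ge> 1" and f: "(q, d) \<in> contractions (A, p)"
      "(q, d) \<noteq> lead ((A, p), u, s)"
  shows "cell_rank (cell_target ((A, p), u, s) (q, d)) < cell_rank
      (cell_target ((A, p), u, s) (lead ((A, p), u, s)))"
proof -
  define w where "w = u + cut_exp A (top_cuts A p)"
  have I: "(A, p) \<in> indices j" using t j by (auto simp: tails_def Let_def)
  have A: "A \<subseteq> cuts" "1 \<le> p" "p < card A" "card A = Suc j" using indicesD[OF I j] by auto
  have fA: "finite A" using finite_subset_cuts[OF A(1)] .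
  have pA: "p \<le> card A" using A by simp
  have qd: "q \<in> A" "may_contract A p d" using contractions_may_contract[OF f(1)] by auto
  note R = reached_set_props[OF A(1-3) qd]
  let ?t = "cell_target ((A, p), u, s) (q, d)" and ?l = "cell_target ((A, p), u, s) (lead ((A, p), u, s))"
  have wl: "cell_exp ?l = w"
    using cell_exp_cell_target[OF I j, of "fst (lead ((A, p), u, s))" "snd (lead ((A, p), u, s))"]
        lead_in[OF t j] by (simp add: w_def)
  have wt: "cell_exp ?t = u + cut_exp A (reached_set A p q d)" using cell_exp_cell_target[OF I j f(1)] .
  show ?thesis
  proof (cases "reached_set A p q d = top_cuts A p")
    case False
    then have "weight (cell_exp ?t) < weight (cell_exp ?l)"
      using weight_max(2)[OF cuts_sub_lt[OF A(1)] R(1) pA R(2)] unfolding wl wt w_def by simp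
    then show ?thesis unfolding cell_rank_def by (simp split: if_splits)
  next
    case Rh: True
    then have wt: "cell_exp ?t = w" using wt by (simp add: w_def)
    have fst_t: "fst (fst ?t) = (if card A = 2 then {} else A - {q})"
        by (simp add: cell_target_def target_index_def)
    have qhi: "q \<in> top_cuts A p \<longleftrightarrow> d" if "card A \<noteq> 2"
    proof (cases d)
      case True
      then show ?thesis using Rh that by (auto simp: reached_set_def)
    next
      case False
      then show ?thesis using Rh that top_cuts_subset[of "A - {q}" p] by (auto simp: reached_set_def)
    qed
    show ?thesis using t j
    proof (cases rule: tail_lead)
      case c
      then have c2: "card A \<noteq> 2" using A by simp
      have "q \<noteq> first_cut w" using c f(2) qhi[OF c2] by (cases d) (auto simp: w_def)
      moreover have "fst (fst ?l) = A - {first_cut w}" unfolding c(5) by (simp add: w_def)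
      ultimately show ?thesis unfolding cell_rank_def wl wt fst_t using c2 c(3) by (simp add: w_def)
    next
      case b
      then have c2: "card A \<noteq> 2" using A by simp
      have d: d using f(1) b c2 by (auto simp: contractions_def may_contract_def split: if_splits)
      have "q \<noteq> last_cut w" using b f(2) d by (auto simp: w_def)
      moreover have "q \<noteq> first_cut w" using qhi[OF c2] d b by (auto simp: w_def)
      moreover have "first_cut w \<in> A" "last_cut w \<in> A" "first_cut w \<noteq> last_cut w" using b
          top_cuts_subset[of A p] by (auto simp: w_def)
      moreover have "fst (fst ?l) = A - {last_cut w}" unfolding b(6) by (simp add: w_def)
      ultimately show ?thesis unfolding cell_rank_def wl wt fst_t using c2 by simp
    next
      case e
      then have c2: "card A = 2" using A by simp
      then have d: d using f(1) by (auto simp: contractions_def)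
      then have "{q} = top_cuts A p" using Rh c2 by (simp add: reached_set_def)
      then have "q = last_cut w" using e(4) unfolding w_def[symmetric] by (metis singleton_inject)
      then have "(q, d) = lead ((A, p), u, s)" using e(6) d by (simp add: w_def)
      then show ?thesis using f(2) by simp
    qed
  qed
qed

text \<open>Leading terms keep the multidegree \<open>w\<close>, so the target determines
  \<open>first_cut w\<close> and \<open>last_cut w\<close>, and with them the removed cut: a target
  that lacks the first cut arose by removing it, one that contains it by removing the last one. In
  degree 1 the cuts are just these two.\<close>

lemma lead_inj:
  assumes "j \<ge> 1"
  shows "inj_on (\<lambda>\<tau>. cell_target \<tau> (lead \<tau>)) (tails j)"
proof (rule inj_onI)
  fix \<tau> \<tau>' assume T: "\<tau> \<in> tails j" "\<tau>' \<in> tails j" and eq: "cell_target \<tau> (lead \<tau>) = cell_target \<tau>' (lead \<tau>')"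
  obtain A p u s where \<tau>: "\<tau> = ((A, p), u, s)" by (metis prod.exhaust)
  obtain A' p' u' s' where \<tau>': "\<tau>' = ((A', p'), u', s')" by (metis prod.exhaust)
  note t = T(1)[unfolded \<tau>] and t' = T(2)[unfolded \<tau>']
  define w where "w = u + cut_exp A (top_cuts A p)"
  have I: "(A, p) \<in> indices j" "(A', p') \<in> indices j" using t t' assms by (auto simp: tails_def Let_def)
  have A: "A \<subseteq> cuts" "1 \<le> p" "p < card A" "card A = Suc j" using indicesD[OF I(1) assms] by auto
  have A': "A' \<subseteq> cuts" "1 \<le> p'" "p' < card A'" "card A' = Suc j" using indicesD[OF I(2) assms] by auto
  have "cell_exp (cell_target \<tau> (lead \<tau>)) = w"
    using cell_exp_cell_target[OF I(1) assms, of "fst (lead \<tau>)" "snd (lead \<tau>)"] lead_in[OF t assms]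
        by (simp add: w_def \<tau>)
  moreover have "cell_exp (cell_target \<tau>' (lead \<tau>')) = u' + cut_exp A' (top_cuts A' p')"
    using cell_exp_cell_target[OF I(2) assms, of "fst (lead \<tau>')" "snd (lead \<tau>')"] lead_in[OF t' assms]
        by (simp add: \<tau>')
  ultimately have w': "u' + cut_exp A' (top_cuts A' p') = w" using eq by simp
  have "A = A' \<and> p = p' \<and> s = s'"
    using t assms
  proof (cases rule: tail_lead)
    case c: c
    show ?thesis using t' assms
    proof (cases rule: tail_lead)
      case c': c
      have "A - {first_cut w} = A' - {first_cut w}" "p = p'" "s = s'" using eq unfolding \<tau> \<tau>' c(5) c'(5) w'
          w_def[symmetric] by auto
      moreover have "first_cut w \<in> A" "first_cut w \<in> A'" using c(3) c'(3) unfolding w' w_def[symmetric]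
          by blast+
      ultimately show ?thesis by blast
    next
      case b': b
      have "A - {first_cut w} = A' - {last_cut w}" using eq unfolding \<tau> \<tau>' c(5) b'(6) w' w_def[symmetric]
          by auto
      moreover have "first_cut w \<in> A' - top_cuts A' p'" "last_cut w \<in> top_cuts A' p'" using b'(3,4)
          unfolding w' by simp_all
      then have "first_cut w \<in> A' - {last_cut w}" by (metis DiffD1 DiffD2 DiffI singletonD)
      ultimately have False by (metis DiffD2 singletonI)
      then show ?thesis ..
    qed (use c in auto)
  next
    case b: b
    show ?thesis using t' assms
    proof (cases rule: tail_lead)
      case c': c
      have "A - {last_cut w} = A' - {first_cut w}" using eq unfolding \<tau> \<tau>' b(6) c'(5) w' w_def[symmetric]
          by auto
      moreover have "first_cut w \<in> A - top_cuts A p" "last_cut w \<in> top_cuts A p" using b(3,4) unfolding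
          w_def[symmetric] by simp_all
      then have "first_cut w \<in> A - {last_cut w}" by (metis DiffD1 DiffD2 DiffI singletonD)
      ultimately have False by (metis DiffD2 singletonI)
      then show ?thesis ..
    next
      case b': b
      have "A - {last_cut w} = A' - {last_cut w}" "p - 1 = p' - 1" "s = s'" using eq unfolding \<tau> \<tau>' b(6)
          b'(6) w' w_def[symmetric] by auto
      moreover have "last_cut w \<in> A" "last_cut w \<in> A'" using b(4) b'(4) top_cuts_subset[of A p]
          top_cuts_subset[of A' p']
        unfolding w' w_def[symmetric] by blast+
      moreover have "p = p'" using calculation(2) A(2) A'(2) by linarith
      ultimately show ?thesis by blast
    qed (use b in auto)
  next
    case e: e
    show ?thesis using t' assms
    proof (cases rule: tail_lead)
      case e': e
      have "s = s'" using eq unfolding \<tau> \<tau>' e(7) e'(7) by simp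
      then show ?thesis using e(2,3) e'(2,3) unfolding w' w_def[symmetric] by blast
    qed (use e in auto)
  qed
  moreover have "u = u'" using calculation w' by (simp add: w_def)
  ultimately show "\<tau> = \<tau>'" by (simp add: \<tau> \<tau>')
qed

lemma unit_exp_diff:
  assumes "1 \<le> lookup u i"
  shows "u - unit_exp i + unit_exp i = u"
  by (rule poly_mapping_eqI) (use assms in \<open>auto simp: lookup_add lookup_minus lookup_unit_exp\<close>)

lemma keys_diff_unit_exp: "keys (u - v :: nat \<Rightarrow>\<^sub>0 nat) \<subseteq> keys u"
  by (auto simp: in_keys_iff lookup_minus)

lemma tailsI:
  assumes "(A, p) \<in> indices j" "j \<ge> 1" "keys u \<subseteq> {1..n}" "u + cut_exp A (top_cuts A p) = w" "first_cut w \<in> A"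
    "p + 2 \<le> card A \<or> p + 1 = card A \<and> last_cut w \<in> A"
  shows "((A, p), u, s) \<in> tails j"
  using assms by (auto simp: tails_def Let_def)

text \<open>Inverse of the leading term: insert the missing first cut counterclockwise, or the
  missing last cut clockwise, or both in degree 0. The point to check is that the inserted variable
  divides the coefficient monomial \<open>u\<close> and not only the multidegree. Then the
  multidegree, and with it the two cuts, remains the same.\<close>

lemma head_lead:
  assumes "\<sigma> \<in> cells j" "\<sigma> \<notin> tails j"
  shows "\<exists>\<tau>\<in>tails (Suc j). cell_target \<tau> (lead \<tau>) = \<sigma>"
proof -
  have sj: "1 \<le> Suc j" by simp
  obtain A p u s where \<sigma>: "\<sigma> = ((A, p), u, s)" by (metis prod.exhaust)
  have I: "(A, p) \<in> indices j" and k: "keys u \<subseteq> {1..n}" using assms(1) by (auto simp: \<sigma> cells_def)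
  show ?thesis
  proof (cases "j = 0")
    case True
    then have Ap: "A = {}" "p = 0" using I by (auto simp: indices_def)
    obtain i i' where "pair_divides u i i'" using assms(2) True I k by (auto simp: \<sigma> tails_def in_parking_def)
    then have "pair_divides u (first_cut u) i'" using pair_divides_first_cut by blast
    then have pd: "pair_divides u (first_cut u) (last_cut u)" using last_cut_props by blast
    let ?c = "first_cut u" and ?b = "last_cut u"
    have cb: "?c \<in> cuts" "?b \<in> cuts" "?c < ?b" using pd by (auto simp: pair_divides_def)
    let ?A = "{?c, ?b}"
    have c2: "card ?A = 2" using cb by simp
    have h: "top_cuts ?A 1 = {?b}" using top_cuts_unique[of ?A "{?b}"] cb by (auto simp: up_closed_def)
    have D: "cut_exp ?A (top_cuts ?A 1) = unit_exp (vtx (Suc ?c)) + unit_exp (vtx ?b)"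
      unfolding h cut_exp_def using cb by simp
    define v where "v = u - (unit_exp (vtx (Suc ?c)) + unit_exp (vtx ?b))"
    have w: "v + cut_exp ?A (top_cuts ?A 1) = u"
      unfolding D v_def
    proof (rule poly_mapping_eqI)
      fix x
      have "of_bool (x = vtx (Suc ?c)) + of_bool (x = vtx ?b) \<le> lookup u x" using pd
          by (auto simp: pair_divides_def)
      then show "lookup (u - (unit_exp (vtx (Suc ?c)) + unit_exp (vtx ?b))
          + (unit_exp (vtx (Suc ?c)) + unit_exp (vtx ?b))) x = lookup u x"
        by (simp add: lookup_add lookup_minus lookup_unit_exp)
    qed
    have T: "((?A, 1), v, s) \<in> tails (Suc j)"
      by (rule tailsI[OF _ _ _ w]) (use cb c2 True subset_trans[OF keys_diff_unit_exp k] in \<open>simp_all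
          add: indices_def v_def\<close>)
    have "cell_target ((?A, 1), v, s) (lead ((?A, 1), v, s)) = \<sigma>"
      using T sj
    proof (cases rule: tail_lead)
      case e
      then show ?thesis using w by (simp add: \<sigma> Ap)
    next
      case c
      then show ?thesis using True by simp
    next
      case b
      then show ?thesis using True by simp
    qed
    then show ?thesis using T by blast
  next
    case False
    then have j: "j \<ge> 1" by simp
    have A: "A \<subseteq> cuts" "1 \<le> p" "p < card A" "card A = Suc j" using indicesD[OF I j] by auto
    have fA: "finite A" using finite_subset_cuts[OF A(1)] .
    have pA: "p \<le> card A" using A by simp
    define w where "w = u + cut_exp A (top_cuts A p)"
    let ?c = "first_cut w" and ?b = "last_cut w"
    note cp = cell_props[OF I j, where u = u, folded w_def]
    obtain l where l: "l \<in> A - top_cuts A p" using proper_top_cuts[OF A(1-3)] by (auto simp: proper_def)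
    obtain m where m: "m \<in> top_cuts A p" using proper_top_cuts[OF A(1-3)] by (auto simp: proper_def)
    show ?thesis
    proof (cases "?c \<in> A")
      case cA: False
      have cl: "?c < a" if "a \<in> A" for a using cp(2)[OF that] that cA by (metis le_neq_implies_less)
      have h: "top_cuts (insert ?c A) p = top_cuts A p" by (rule top_cuts_insert_min[OF fA pA cl])
      \<comment> \<open>The variable after the first cut is not in the index exponent: all cuts of
        \<open>A\<close> lie above the first cut, and the clockwise ones lie above a
        counterclockwise one as well, hence beyond the next position.\<close>
      have z: "lookup (cut_exp A (top_cuts A p)) (vtx (Suc ?c)) = 0"
        unfolding lookup_cut_exp cut_exp_fun_def
      proof (rule sum.neutral, rule ballI)
        fix x assume x: "x \<in> A"
        have cn: "?c < n" "x < n" using cuts_lt cp(1) x A by auto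
        show "(if x \<in> top_cuts A p then of_bool (vtx (Suc ?c) = vtx x) else of_bool (vtx (Suc ?c) =
            vtx (Suc x))) = (0::nat)"
        proof (cases "x \<in> top_cuts A p")
          case True
          have "l < x" using cp(5)[OF l True] by simp
          then have "Suc ?c < x" using cl[of l] l by auto
          then show ?thesis using True cn by simp
        next
          case False
          then show ?thesis using vtx_Suc_eq[OF cn] cl[OF x] by simp
        qed
      qed
      define v where "v = u - unit_exp (vtx (Suc ?c))"
      have uv: "v + unit_exp (vtx (Suc ?c)) = u" unfolding v_def
        using cp(3) z by (intro unit_exp_diff) (simp add: w_def lookup_add)
      have rm: "insert ?c A - {?c} = A" using cA by simp
      have ch: "?c \<notin> top_cuts A p" using cA top_cuts_subset[of A p] by auto
      have "cut_exp (insert ?c A) (top_cuts (insert ?c A) p) = unit_exp (vtx (Suc ?c)) + cut_exp A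
          (top_cuts A p)"
        unfolding h using cut_exp_remove[of "insert ?c A" ?c "top_cuts A p"] fA ch rm by simp
      then have w: "v + cut_exp (insert ?c A) (top_cuts (insert ?c A) p) = w" using uv
          by (simp add: w_def add.assoc[symmetric])
      have T: "((insert ?c A, p), v, s) \<in> tails (Suc j)"
        by (rule tailsI[OF _ _ _ w]) (use cp(1) A fA cA subset_trans[OF keys_diff_unit_exp k] j in \<open>simp_all
            add: indices_def v_def\<close>)
      have "cell_target ((insert ?c A, p), v, s) (lead ((insert ?c A, p), v, s)) = \<sigma>"
        using T sj
      proof (cases rule: tail_lead)
        case c
        then show ?thesis unfolding c(5) unfolding w rm uv \<sigma> by simp
      next
        case b
        then show ?thesis using A fA cA by simp
      next
        case e
        then show ?thesis using A j by simp
      qed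
      then show ?thesis using T by blast
    next
      case cA: True
      have nT: "\<not> (first_cut w \<in> A \<and> (p + 2 \<le> card A \<or> p + 1 = card A \<and> last_cut w \<in> A))"
        using tailsI[OF I j k w_def[symmetric]] assms(2) unfolding \<sigma> by blast
      then have p1: "p + 1 = card A" using cA A(3) by linarith
      then have bA: "?b \<notin> A" using nT cA by blast
      have cl: "?c \<in> A - top_cuts A p" using cA cp(4) by simp
      have lo: "A - top_cuts A p = {?c}"
        using low_cuts_card[OF fA pA] p1 cl by (metis add_diff_cancel_left' card_1_singletonE singletonD)
      \<comment> \<open>Each clockwise cut of \<open>A\<close> forms a dividing pair with the first
        cut, so the last cut is at least as large as all of them.\<close>
      have pd: "pair_divides w ?c ?b" and bg: "\<And>y. y \<in> top_cuts A p \<Longrightarrow> y \<le> ?b"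
        using last_cut_props cp(5)[OF cl] m by blast+
      have cb: "?c \<in> cuts" "?b \<in> cuts" "?c < ?b" using pd by (auto simp: pair_divides_def)
      have bl: "a < ?b" if "a \<in> A" for a
      proof (cases "a \<in> top_cuts A p")
        case True
        then show ?thesis using bg[OF True] bA that by (metis le_neq_implies_less)
      next
        case False
        then have "a \<in> A - top_cuts A p" using that by blast
        then have "a = ?c" unfolding lo by simp
        then show ?thesis using cb by simp
      qed
      have h: "top_cuts (insert ?b A) (Suc p) = insert ?b (top_cuts A p)"
          by (rule top_cuts_insert_max[OF fA pA bl])
      \<comment> \<open>If the variable before the last cut is the one after the first cut, the
        index exponent contains it once, but then the pair requires its square in \<open>w\<close>,
        so one factor is left for \<open>u\<close>.\<close>
      have z: "lookup (cut_exp A (top_cuts A p)) (vtx ?b) = of_bool (vtx ?b = vtx (Suc ?c))"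
      proof -
        have "cut_exp A (top_cuts A p) = unit_exp (vtx (Suc ?c)) + cut_exp (A - {?c}) (top_cuts A p - {?c})"
          using cut_exp_remove[OF fA cA, of "top_cuts A p"] cp(4) by simp
        moreover have "lookup (cut_exp (A - {?c}) (top_cuts A p - {?c})) (vtx ?b) = 0"
          unfolding lookup_cut_exp cut_exp_fun_def
        proof (rule sum.neutral, rule ballI)
          fix x assume x: "x \<in> A - {?c}"
          then have "x \<in> top_cuts A p" using lo by auto
          moreover have "x < n" "?b < n" "x \<noteq> ?b" using x bl[of x] cuts_lt cb A by auto
          ultimately show "(if x \<in> top_cuts A p - {?c} then of_bool (vtx ?b = vtx x) else of_bool
              (vtx ?b = vtx (Suc x))) = (0::nat)"
            using x by simp
        qed
        ultimately show ?thesis by (simp add: lookup_add lookup_unit_exp)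
      qed
      define v where "v = u - unit_exp (vtx ?b)"
      have "of_bool (vtx ?b = vtx (Suc ?c)) + of_bool (vtx ?b = vtx ?b) \<le> lookup w (vtx ?b)"
        using pd unfolding pair_divides_def by blast
      then have uv: "v + unit_exp (vtx ?b) = u" unfolding v_def
        using z by (intro unit_exp_diff) (simp add: w_def lookup_add)
      have rm: "insert ?b A - {?b} = A" using bA by simp
      have bh: "?b \<notin> top_cuts A p" using bA top_cuts_subset[of A p] by auto
      have "cut_exp (insert ?b A) (top_cuts (insert ?b A) (Suc p)) = unit_exp (vtx ?b) + cut_exp A
          (top_cuts A p)"
        unfolding h using cut_exp_remove[of "insert ?b A" ?b "insert ?b (top_cuts A p)"] fA bh rm by simp
      then have w: "v + cut_exp (insert ?b A) (top_cuts (insert ?b A) (Suc p)) = w" using uv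
          by (simp add: w_def add.assoc[symmetric])
      have T: "((insert ?b A, Suc p), v, s) \<in> tails (Suc j)"
        by (rule tailsI[OF _ _ _ w]) (use cb(2) A fA bA cA subset_trans[OF keys_diff_unit_exp k] j p1 in
            \<open>simp_all add: indices_def v_def\<close>)
      have "cell_target ((insert ?b A, Suc p), v, s) (lead ((insert ?b A, Suc p), v, s)) = \<sigma>"
        using T sj
      proof (cases rule: tail_lead)
        case c
        then show ?thesis using p1 bA fA by simp
      next
        case b
        then show ?thesis unfolding b(6) unfolding w rm uv \<sigma> by simp
      next
        case e
        then show ?thesis using j by simp
      qed
      then show ?thesis using T by blast
    qed
  qed
qed

end

section \<open>The complex property\<close>

text \<open>The pairs off the diagonal cancel. The diagonal has its own hypothesis, as antisymmetry
  does not make it vanish in characteristic 2.\<close>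

lemma sum_antisym:
  fixes g :: "'x \<Rightarrow> 'x \<Rightarrow> 'y::ab_group_add"
  assumes "finite S" "\<And>x y. x \<in> S \<Longrightarrow> y \<in> S \<Longrightarrow> x \<noteq> y \<Longrightarrow> g x y = - g y x" "\<And>x. x \<in> S \<Longrightarrow> g x x = 0"
  shows "(\<Sum>x\<in>S. \<Sum>y\<in>S. g x y) = 0"
  using assms
proof (induction S rule: finite_induct)
  case (insert a S)
  have "(\<Sum>x\<in>insert a S. \<Sum>y\<in>insert a S. g x y) =
    (g a a + (\<Sum>y\<in>S. g a y)) + ((\<Sum>x\<in>S. g x a) + (\<Sum>x\<in>S. \<Sum>y\<in>S. g x y))"
    using insert.hyps by (simp add: sum.distrib)
  also have "(\<Sum>x\<in>S. g x a) = - (\<Sum>y\<in>S. g a y)"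
    unfolding sum_negf[symmetric]
  proof (rule sum.cong)
    fix x assume "x \<in> S"
    then show "g x a = - g a x" using insert.hyps by (intro insert.prems) auto
  qed simp
  also have "(\<Sum>x\<in>S. \<Sum>y\<in>S. g x y) = 0" 
  proof (rule insert.IH)
    show "g x y = - g y x" if "x \<in> S" "y \<in> S" "x \<noteq> y" for x y using that by (intro insert.prems(1)) auto
    show "g x x = 0" if "x \<in> S" for x using that by (intro insert.prems(2)) auto
  qed
  finally show ?case using insert.prems(2)[of a] by simp
qed simp

locale signed_parcycle = rooted_parcycle +
  fixes sg :: "opart set \<Rightarrow> dedge \<Rightarrow> int"
  assumes signs: "valid_signs n \<P> sg"
begin

definition cell_sign :: "cell \<Rightarrow> nat \<times> bool \<Rightarrow> 'a::field" where
  "cell_sign = (\<lambda>((A, p), u, s) (q, d). of_int (sg (chip_class A p) (cut_edge A q d)))"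

abbreviation target_count :: "nat \<Rightarrow> bool \<Rightarrow> nat" where "target_count p d \<equiv> (if d then p - 1 else p)"

lemma chip_class_in_classes:
  assumes "A \<subseteq> cuts" "1 \<le> p" "p < card A"
  shows "chip_class A p \<in> chip_classes n \<P> (card A)"
proof -
  obtain j where j: "card A = Suc j" using assms by (cases "card A") auto
  then have "(A, p) \<in> indices j" using assms by (auto simp: indices_def)
  then have "chip_class A p \<in> (\<lambda>(A, p). chip_class A p) ` indices j" by force
  then show ?thesis unfolding j chip_classes_eq .
qed

lemma sg_unit:
  assumes "A \<subseteq> cuts" "1 \<le> p" "p < card A" "q \<in> A" "may_contract A p d"
  shows "sg (chip_class A p) (cut_edge A q d) \<in> {1, -1}"
  using signs chip_class_in_classes[OF assms(1-3)] contractible_edges_chip_class[OF assms(1-3)] assms(4,5)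
  unfolding valid_signs_def by blast

text \<open>Sign rule (i) written with cuts. At least three cuts make the two edges distinct, and
  \<open>merge_edge\<close> carries their names over to the contracted partitions.\<close>

lemma sg_anti:
  assumes A: "A \<subseteq> cuts" and p: "1 \<le> p" "p < card A" and m: "3 \<le> card A" and q: "q \<in> A" "q' \<in> A" "q \<noteq> q'"
    and d: "may_contract A p d" "may_contract A p d'" "may_contract (A - {q}) (target_count p d) d'"
        "may_contract (A - {q'}) (target_count p d') d"
  shows "sg (chip_class A p) (cut_edge A q d) * sg (chip_class (A - {q}) (target_count p d))
      (cut_edge (A - {q}) q' d') =
    - (sg (chip_class A p) (cut_edge A q' d') * sg (chip_class (A - {q'}) (target_count p d'))
        (cut_edge (A - {q'}) q d))"
proof -
  let ?f1 = "cut_edge A q d" and ?f2 = "cut_edge A q' d'" and ?c = "chip_class A p"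
  have A': "A \<subseteq> {..<n}" using A cuts_sub_lt by simp
  have fA: "finite A" using finite_subset_cuts[OF A] .
  have qn: "q < n" "q' < n" using A' q by auto
  have ne: "?f1 \<noteq> ?f2" using cut_edge_inj[OF A' q(1,2)] q(3) m by fastforce
  have ce: "?f1 \<in> contractible_edges n \<P> ?c" "?f2 \<in> contractible_edges n \<P> ?c"
    using contractible_edges_chip_class[OF A p] q d by blast+
  have m1: "merge_edge ?f1 ?f2 = cut_edge (A - {q}) q' d'" using merge_cut_edge[OF A' q(1) qn(2)] .
  have m2: "merge_edge ?f2 ?f1 = cut_edge (A - {q'}) q d" using merge_cut_edge[OF A' q(2) qn(1)] .
  have t: "contract_class n \<P> ?c (cut_edge A x e) = chip_class (A - {x}) (target_count p e)" if "x \<in> A"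
      "may_contract A p e" for x e
    using contract_class_chip_class[OF A p that] m by (simp add: target_index_def)
  have np: "1 \<le> target_count p e \<and> target_count p e < card (A - {x})" if "x \<in> A" "may_contract A p e" for x e
    using that m p fA by (auto simp: may_contract_def split: if_splits)
  have s1: "cut_edge (A - {q}) q' d' \<in> contractible_edges n \<P> (chip_class (A - {q}) (target_count p d))"
    using contractible_edges_chip_class[of "A - {q}" "target_count p d"] np[OF q(1) d(1)] A q d(3) by blast
  have s2: "cut_edge (A - {q'}) q d \<in> contractible_edges n \<P> (chip_class (A - {q'}) (target_count p d'))"
    using contractible_edges_chip_class[of "A - {q'}" "target_count p d'"] np[OF q(2) d(2)] A q d(4) by blast
  have "\<forall>f1\<in>contractible_edges n \<P> ?c. \<forall>f2\<in>contractible_edges n \<P> ?c.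
       f1 \<noteq> f2 \<and>
       merge_edge f1 f2 \<in> contractible_edges n \<P> (contract_class n \<P> ?c f1) \<and>
       merge_edge f2 f1 \<in> contractible_edges n \<P> (contract_class n \<P> ?c f2) \<longrightarrow>
       sg ?c f1 * sg (contract_class n \<P> ?c f1) (merge_edge f1 f2) =
       - (sg ?c f2 * sg (contract_class n \<P> ?c f2) (merge_edge f2 f1))"
    using signs chip_class_in_classes[OF A p] unfolding valid_signs_def by blast
  from this[rule_format, OF ce] show ?thesis
    unfolding m1 m2 t[OF q(1) d(1)] t[OF q(2) d(2)] using ne s1 s2 by blast
qed

definition cell_target2 :: "nat set \<Rightarrow> nat \<Rightarrow> (nat \<Rightarrow>\<^sub>0 nat) \<Rightarrow> nat \<Rightarrow> nat \<times> bool \<Rightarrow> nat \<times> bool \<Rightarrow> cell" where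
  "cell_target2 A p u s = (\<lambda>(q, d) (q', d'). cell_target (cell_target ((A, p), u, s) (q, d)) (q', d'))"

text \<open>The equality of the t-exponents follows from homogeneity: in both orders they make up
  the same total weight, since the monomials and the final indices agree. For three cuts the second
  contraction takes place with two cuts, and its monomial includes the variable of the remaining
  cut; the side chosen there is the same in both orders because \<open>d = d'\<close>.\<close>

lemma cell_target2_sym:
  assumes A: "A \<subseteq> cuts" and p: "1 \<le> p" "p < card A" and m: "3 \<le> card A" and q: "q \<in> A" "q' \<in> A" "q \<noteq> q'"
    and d: "may_contract A p d" "may_contract A p d'" "may_contract (A - {q}) (target_count p d) d'"
        "may_contract (A - {q'}) (target_count p d') d"
    and d3: "card A = 3 \<Longrightarrow> d = d'"
  shows "cell_target2 A p u s (q, d) (q', d') = cell_target2 A p u s (q', d') (q, d)"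
proof -
  have fA: "finite A" using finite_subset_cuts[OF A] .
  have m2: "card A \<noteq> 2" using m by simp
  have np: "1 \<le> target_count p e \<and> target_count p e < card (A - {x})" if "x \<in> A" "may_contract A p e" for x e
    using that m p fA by (auto simp: may_contract_def split: if_splits)
  have t: "target_index A p x e = (A - {x}, target_count p e)" for x e using m2
      by (simp add: target_index_def)
  let ?T = "target_index (A - {q}) (target_count p d) q' d'" and ?T'
      = "target_index (A - {q'}) (target_count p d') q d"
  have cq: "card (A - {q}) = card A - 1" "card (A - {q'}) = card A - 1" using fA q by auto
  have TT: "?T = ?T'"
  proof (cases "card A = 3")
    case True
    then show ?thesis using cq by (simp add: target_index_def)
  next
    case False
    have "A - {q} - {q'} = A - {q'} - {q}" by blast
    then show ?thesis using cq False m by (simp add: target_index_def)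
  qed
  have ee: "edge_exp A q d + edge_exp (A - {q}) q' d' = edge_exp A q' d' + edge_exp (A - {q'}) q d"
  proof (cases "card A = 3")
    case True
    then have dd: "d' = d" using d3 by simp
    have c1: "card (A - {q} - {q'}) = 1" using True fA q by simp
    then obtain r where r: "A - {q} - {q'} = {r}" by (metis card_1_singletonE)
    then have A3: "A = {q, q', r}" "r \<noteq> q" "r \<noteq> q'" using q by auto
    have a1: "A - {q} = {q', r}" "A - {q'} = {q, r}" using A3 q(3) by auto
    have x: "edge_exp A y d = unit_exp (if d then vtx y else vtx (Suc y))" for y using m2
        by (simp add: edge_exp_def)
    have y: "edge_exp {y, r} y d = unit_exp (if d then vtx y else vtx (Suc y)) + unit_exp
        (if d then vtx (Suc r) else vtx r)" if "y \<noteq> r" for y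
    proof -
      have "{y, r} - {y} = {r}" using that by auto
      then show ?thesis using that by (cases d) (simp_all add: edge_exp_def cut_exp_def)
    qed
    show ?thesis unfolding dd x a1 using y[of q] y[of q'] A3 by (simp add: ac_simps)
  next
    case False
    then have "card (A - {q}) \<noteq> 2" "card (A - {q'}) \<noteq> 2" using cq m by linarith+
    then show ?thesis using m2 by (simp add: edge_exp_def ac_simps)
  qed
  have w: "weight (edge_exp A x e) + weight (index_exp (A - {x}, target_count p e)) + t_exp A p x e =
      weight (index_exp (A, p))" if "x \<in> A" "may_contract A p e" for x e
    using t_exp_weight[OF A p that] unfolding t .
  have w': "weight (edge_exp (A - {x}) y e') + weight
      (index_exp (target_index (A - {x}) (target_count p e) y e')) + t_exp (A - {x}) (target_count p e) y e'
      = weight (index_exp (A - {x}, target_count p e))"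
    if "x \<in> A" "may_contract A p e" "y \<in> A" "y \<noteq> x" "may_contract (A - {x}) (target_count p e) e'" for x e y
        e'
    using t_exp_weight[of "A - {x}" "target_count p e" y e'] np[OF that(1,2)] that A by blast
  have "t_exp A p q d + t_exp (A - {q}) (target_count p d) q' d' = t_exp A p q' d' + t_exp (A - {q'})
      (target_count p d') q d"
    using w[OF q(1) d(1)] w[OF q(2) d(2)] w'[OF q(1) d(1) q(2) q(3)[symmetric] d(3)]
        w'[OF q(2) d(2) q(1) q(3) d(4)]
      TT arg_cong[OF ee, of weight] by simp
  then show ?thesis using TT ee by (simp add: cell_target2_def cell_target_def t add.assoc)
qed

lemma may_contract_sym:
  assumes "finite A" "4 \<le> card A" "q \<in> A" "q' \<in> A" "may_contract A p d"
      "may_contract (A - {q}) (target_count p d) d'" "1 \<le> p" "p < card A"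
  shows "may_contract A p d' \<and> may_contract (A - {q'}) (target_count p d') d"
  using assms by (cases d; cases d') (auto simp: may_contract_def)

text \<open>Contractions of two different cuts commute up to sign, so the double sum is
  antisymmetric. With three cuts \<open>contractions\<close> names the second edge clockwise
  whatever the first direction was; the sum is rewritten with the name that has the direction of the
  first contraction, and this makes the index relation \<open>C\<close> symmetric.\<close>

lemma boundary_boundary:
  fixes a :: "'a::field"
  assumes "j \<ge> 2" "\<tau> \<in> cells j"
  shows "boundary cell_contractions cell_sign cell_target (boundary cell_contractions cell_sign cell_target
      (single \<tau> a)) = 0"
proof -
  obtain A p u s where \<tau>: "\<tau> = ((A, p), u, s)" by (metis prod.exhaust)
  have I: "(A, p) \<in> indices j" using assms(2) by (auto simp: \<tau> cells_def)
  have A: "A \<subseteq> cuts" "1 \<le> p" "p < card A" "card A = Suc j" using indicesD[OF I] assms(1) by auto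
  have fA: "finite A" using finite_subset_cuts[OF A(1)] .
  have m: "3 \<le> card A" using A assms(1) by simp
  have m2: "card A \<noteq> 2" using m by simp
  have cA1: "card (A - {q}) = card A - 1" if "q \<in> A" for q using fA that by simp
  define G :: "nat \<times> bool \<Rightarrow> nat \<times> bool \<Rightarrow> cell \<Rightarrow>\<^sub>0 'a" where
    "G x y = single (cell_target2 A p u s x y) (a * cell_sign \<tau> x * cell_sign (cell_target \<tau> x) y)" for x y
  define C :: "nat \<times> bool \<Rightarrow> nat \<times> bool \<Rightarrow> bool" where
    "C = (\<lambda>(q, d) (q', d'). q \<noteq> q' \<and> may_contract A p d \<and>
        (if card A = 3 then d' = d else may_contract (A - {q}) (target_count p d) d'))"
  let ?X = "A \<times> (UNIV :: bool set)"
  have t: "cell_target \<tau> (q, d) = ((A - {q}, target_count p d), u + edge_exp A q d, s + t_exp A p q d)" for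
      q d
    using m2 by (simp add: \<tau> cell_target_def target_index_def)
  have tm1: "contractions (A, p) = {(q, d). q \<in> A \<and> may_contract A p d}" using m2
      by (auto simp: contractions_def)
  have inner: "(\<Sum>y\<in>cell_contractions (cell_target \<tau> x). G x y) = (\<Sum>y\<in>?X. if C x y then G x y else 0)" if
      x: "x \<in> contractions (A, p)" for x
  proof -
    obtain q d where qd: "x = (q, d)" by force
    have q: "q \<in> A" "may_contract A p d" using x tm1 qd by auto
    have tmx: "cell_contractions (cell_target \<tau> x) = contractions (A - {q}, target_count p d)" unfolding qd
        t by (simp add: cell_contractions_def)
    show ?thesis
    proof (cases "card A = 3")
      case True
      have c2: "card (A - {q}) = 2" using cA1[OF q(1)] True by simp
      then obtain y z where yz: "A - {q} = {y, z}" "y \<noteq> z" by (auto simp: card_2_iff)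
      have A'n: "{y, z} \<subseteq> {..<n}" using A(1) cuts_sub_lt yz(1) by blast
      have tm2: "contractions (A - {q}, target_count p d) = {(y, True), (z, True)}"
        using c2 yz(2) unfolding contractions_def yz(1) by auto
      \<comment> \<open>Both names of an edge between two blocks give the same sign, monomial and
        target.\<close>
      have sw: "G x (v, True) = G x (w, False)" if vw: "A - {q} = {v, w}" "v \<noteq> w" for v w
      proof -
        have f: "cut_edge {v, w} v True = cut_edge {v, w} w False" using cut_edge_two[of "{v, w}" v w True]
            vw A'n yz by simp
        have dv: "{v, w} - {w} = {v}" using vw by auto
        have cvw: "card {v, w} = 2" using vw by simp
        have T: "cell_target (({v, w}, r), u', s') (v, True) = cell_target (({v, w}, r), u', s') (w, False)"
            for r u' s'
          by (simp add: cell_target_def target_index_def edge_exp_def t_exp_def reached_set_def cvw dv)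
        have K: "cell_sign (({v, w}, r), u', s') (v, True) =
            (cell_sign (({v, w}, r), u', s') (w, False) :: 'a)" for r u' s'
          by (simp add: cell_sign_def f)
        show ?thesis unfolding G_def cell_target2_def qd
          by (simp only: prod.case t[unfolded \<tau>] \<tau> vw(1) T K)
      qed
      have "(\<Sum>e\<in>?X. if C x e then G x e else 0) = (\<Sum>e\<in>{(y, d), (z, d)}. G x e)"
      proof (rule sum.mono_neutral_cong_right)
        show "\<forall>i\<in>?X - {(y, d), (z, d)}. (if C x i then G x i else 0) = 0"
          using yz True by (auto simp: C_def qd)
        show "{(y, d), (z, d)} \<subseteq> ?X" using yz(1) by auto
        have "y \<noteq> q" "z \<noteq> q" using yz(1) by auto
        then show "(if C x i then G x i else 0) = G x i" if "i \<in> {(y, d), (z, d)}" for i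
          using that True q(2) by (auto simp: C_def qd)
      qed (use fA in auto)
      also have "\<dots> = (\<Sum>e\<in>{(y, True), (z, True)}. G x e)"
      proof (cases d)
        case False
        have "A - {q} = {z, y}" using yz(1) by auto
        then show ?thesis using False yz(2) sw[OF yz] sw[of z y] by (simp add: add.commute)
      qed simp
      finally show ?thesis unfolding tmx tm2 by simp
    next
      case False
      then have "card (A - {q}) \<noteq> 2" using cA1[OF q(1)] m by simp
      then have tm2: "contractions (A - {q}, target_count p d) =
          {(q', d'). q' \<in> A - {q} \<and> may_contract (A - {q}) (target_count p d) d'}"
        by (auto simp: contractions_def)
      show ?thesis unfolding tmx tm2
        by (rule sum.mono_neutral_cong_left) (use fA False q in \<open>auto simp: C_def qd\<close>)
    qed
  qed
  have "boundary cell_contractions cell_sign cell_target (boundary cell_contractions cell_sign cell_target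
      (single \<tau> a)) =
     (\<Sum>x\<in>contractions (A, p). \<Sum>y\<in>cell_contractions (cell_target \<tau> x). G x y)"
    by (simp add: boundary_single boundary_sum cell_contractions_def G_def cell_target2_def \<tau>
        split: prod.splits)
  also have "\<dots> = (\<Sum>x\<in>contractions (A, p). \<Sum>y\<in>?X. if C x y then G x y else 0)"
    by (rule sum.cong[OF refl inner])
  also have "\<dots> = (\<Sum>x\<in>?X. \<Sum>y\<in>?X. if C x y then G x y else 0)"
  proof (rule sum.mono_neutral_left)
    have "\<not> C x y" if "x \<in> ?X - contractions (A, p)" for x y
      using that by (cases x; cases y) (simp add: C_def tm1)
    then show "\<forall>x\<in>?X - contractions (A, p). (\<Sum>y\<in>?X. if C x y then G x y else 0) = 0" by simp
  qed (use fA in \<open>auto simp: tm1\<close>)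
  also have "\<dots> = 0"
  proof (rule sum_antisym)
    show "finite ?X" using fA by simp
    show "(if C x x then G x x else 0) = 0" for x by (auto simp: C_def split: prod.splits)
    fix x y assume xy: "x \<in> ?X" "y \<in> ?X"
    obtain q d q' d' where qd: "x = (q, d)" "y = (q', d')" by force
    have q: "q \<in> A" "q' \<in> A" using xy qd by auto
    have *: "may_contract A p d \<and> may_contract A p d' \<and> may_contract (A - {q}) (target_count p d) d' \<and>
        may_contract (A - {q'}) (target_count p d') d \<and> q \<noteq> q' \<and> (card A = 3 \<longrightarrow> d = d') \<and> C y x"
      if "C x y" "x = (q, d)" "y = (q', d')" "q \<in> A" "q' \<in> A" for x y q d q' d'
    proof (cases "card A = 3")
      case True
      then have "card (A - {q}) = 2" "card (A - {q'}) = 2" using cA1 that(4,5) by auto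
      then show ?thesis using that True by (auto simp: C_def may_contract_def)
    next
      case False
      then have "4 \<le> card A" using m by simp
      then show ?thesis using may_contract_sym[OF fA _ that(4,5), of p d d'] that False A
          by (auto simp: C_def)
    qed
    show "(if C x y then G x y else 0) = - (if C y x then G y x else 0)"
    proof (cases "C x y")
      case True
      note c = *[OF True qd q]
      have "cell_target2 A p u s x y = cell_target2 A p u s y x" unfolding qd
        using c by (intro cell_target2_sym[OF A(1-3) m q]) auto
      moreover have "cell_sign \<tau> x * cell_sign (cell_target \<tau> x) y =
          - (cell_sign \<tau> y * cell_sign (cell_target \<tau> y) x :: 'a)"
      proof -
        have "sg (chip_class A p) (cut_edge A q d) * sg (chip_class (A - {q}) (target_count p d))
            (cut_edge (A - {q}) q' d') =
            - (sg (chip_class A p) (cut_edge A q' d') * sg (chip_class (A - {q'}) (target_count p d'))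
                (cut_edge (A - {q'}) q d))"
          using c by (intro sg_anti[OF A(1-3) m q]) auto
        from arg_cong[OF this, of "of_int :: int \<Rightarrow> 'a"] show ?thesis
          unfolding qd t by (simp add: cell_sign_def \<tau>)
      qed
      ultimately show ?thesis using True c by (simp add: G_def mult.assoc single_uminus)
    next
      case False
      then have "\<not> C y x" using *[of y x q' d' q d] qd q by auto
      then show ?thesis using False by simp
    qed
  qed
  finally show ?thesis .
qed

lemma morse: "morse_matching cells tails cell_contractions (cell_sign :: cell \<Rightarrow> nat \<times> bool \<Rightarrow> 'a::field)
    cell_target lead cell_rank"
proof
  fix j \<tau> assume \<tau>B: "\<tau> \<in> cells j"
  obtain A p u s where \<tau>: "\<tau> = ((A, p), u, s)" by (metis prod.exhaust)
  have "A \<subseteq> cuts" using \<tau>B by (auto simp: \<tau> cells_def indices_def split: if_splits)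
  then have "finite (A \<times> (UNIV :: bool set))" using finite_subset_cuts by simp
  then show "finite (cell_contractions \<tau>)" by (rule finite_subset[rotated])
      (auto simp: \<tau> cell_contractions_def contractions_def)
next
  fix j \<tau> f assume *: "1 \<le> j" "\<tau> \<in> cells j" "f \<in> cell_contractions \<tau>"
  obtain A p u s where \<tau>: "\<tau> = ((A, p), u, s)" by (metis prod.exhaust)
  obtain q d where f: "f = (q, d)" by force
  have "target_index A p q d \<in> indices (j - 1)"
    using * target_index_indices[of A p j q d] contractions_may_contract[of q d A p]
        by (auto simp: \<tau> f cells_def cell_contractions_def)
  moreover have "keys (u + edge_exp A q d) \<subseteq> {1..n}"
    using keys_add[of u "edge_exp A q d"] keys_edge_exp[of A q d] * by (auto simp: \<tau> cells_def)
  ultimately show "cell_target \<tau> f \<in> cells (j - 1)" by (simp add: \<tau> f cell_target_def cells_def)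
next
  show "tails j \<subseteq> cells j" for j by (auto simp: tails_def cells_def split: if_splits)
next
  fix j \<tau> assume *: "1 \<le> j" "\<tau> \<in> tails j"
  obtain A p u s where \<tau>: "\<tau> = ((A, p), u, s)" by (metis prod.exhaust)
  obtain q d where f: "lead \<tau> = (q, d)" by force
  have l: "(q, d) \<in> contractions (A, p)" using lead_in(1)[of A p u s j] * f \<tau> by auto
  have I: "(A, p) \<in> indices j" using * by (auto simp: \<tau> tails_def Let_def)
  have "sg (chip_class A p) (cut_edge A q d) \<in> {1, -1}"
    using indicesD[OF I] * contractions_may_contract[OF l] by (intro sg_unit) auto
  then have "(cell_sign \<tau> (lead \<tau>) :: 'a) \<noteq> 0" by (auto simp: \<tau> f[unfolded \<tau>] cell_sign_def)
  then show "lead \<tau> \<in> cell_contractions \<tau> \<and> (cell_sign \<tau> (lead \<tau>) :: 'a) \<noteq> 0" using l f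
      by (simp add: \<tau> cell_contractions_def)
next
  fix j \<tau> f assume *: "1 \<le> j" "\<tau> \<in> tails j" "f \<in> cell_contractions \<tau>" "f \<noteq> lead \<tau>"
  obtain A p u s where \<tau>: "\<tau> = ((A, p), u, s)" by (metis prod.exhaust)
  obtain q d where f: "f = (q, d)" by force
  show "cell_rank (cell_target \<tau> f) < cell_rank (cell_target \<tau> (lead \<tau>))"
    using rank_less[of A p u s j q d] * by (simp add: \<tau> f cell_contractions_def)
next
  show "inj_on (\<lambda>\<tau>. cell_target \<tau> (lead \<tau>)) (tails j)" if "1 \<le> j" for j using lead_inj[OF that] .
next
  show "\<exists>\<tau>\<in>tails (Suc j). cell_target \<tau> (lead \<tau>) = \<sigma>" if "\<sigma> \<in> cells j" "\<sigma> \<notin> tails j" for j \<sigma>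
    using head_lead[OF that] .
next
  show "boundary cell_contractions cell_sign cell_target (boundary cell_contractions cell_sign cell_target
      (single \<tau> a)) = 0" if "2 \<le> j" "\<tau> \<in> cells j" for j \<tau> and a :: 'a
    using boundary_boundary[OF that] .
qed

end

section \<open>The toppling ideal\<close>

context rooted_parcycle
begin

definition lattice_eq :: "(nat \<Rightarrow>\<^sub>0 nat) \<Rightarrow> (nat \<Rightarrow>\<^sub>0 nat) \<Rightarrow> bool" where
  "lattice_eq u v \<longleftrightarrow> keys u \<subseteq> {1..n} \<and> keys v \<subseteq> {1..n} \<and>
     (\<lambda>i. int (lookup u i) - int (lookup v i)) \<in> par_lattice n \<P>"

abbreviation edge_vec :: "nat \<Rightarrow> nat \<Rightarrow> int" where
  "edge_vec q x \<equiv> of_bool (x = vtx q) - of_bool (x = vtx (Suc q))"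

lemma par_latticeI: "(\<Sum>q\<in>cuts. g q) = 0 \<Longrightarrow> (\<And>x. u x = (\<Sum>q\<in>cuts. g q * edge_vec q x)) \<Longrightarrow> u \<in> par_lattice n \<P>"
  unfolding par_lattice_eq by blast

lemma par_latticeD:
  assumes "u \<in> par_lattice n \<P>"
  obtains g where "(\<Sum>q\<in>cuts. g q) = 0" "\<And>x. u x = (\<Sum>q\<in>cuts. g q * edge_vec q x)"
  using assms unfolding par_lattice_eq by blast

lemma par_lattice_diff: "u \<in> par_lattice n \<P> \<Longrightarrow> v \<in> par_lattice n \<P> \<Longrightarrow> (\<lambda>x. u x - v x) \<in> par_lattice n \<P>"
proof (elim par_latticeD)
  fix g h assume *: "(\<Sum>q\<in>cuts. g q) = 0" "\<And>x. u x = (\<Sum>q\<in>cuts. g q * edge_vec q x)"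
    "(\<Sum>q\<in>cuts. h q) = 0" "\<And>x. v x = (\<Sum>q\<in>cuts. h q * edge_vec q x)"
  show ?thesis
  proof (rule par_latticeI[of "\<lambda>q. g q - h q"])
    show "(\<Sum>q\<in>cuts. g q - h q) = 0" using * by (simp add: sum_subtractf)
    show "u x - v x = (\<Sum>q\<in>cuts. (g q - h q) * edge_vec q x)" for x
      unfolding *(2,4) sum_subtractf[symmetric] left_diff_distrib ..
  qed
qed

lemma par_lattice_0: "(\<lambda>x. 0) \<in> par_lattice n \<P>"
  by (rule par_latticeI[of "\<lambda>_. 0"]) auto

lemma lattice_eq_refl: "keys u \<subseteq> {1..n} \<Longrightarrow> lattice_eq u u"
  using par_lattice_0 by (simp add: lattice_eq_def)

lemma lattice_eq_sym: "lattice_eq u v \<Longrightarrow> lattice_eq v u"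
  unfolding lattice_eq_def using par_lattice_diff[OF par_lattice_0] by fastforce

lemma lattice_eq_trans: "lattice_eq u v \<Longrightarrow> lattice_eq v w \<Longrightarrow> lattice_eq u w"
proof -
  assume *: "lattice_eq u v" "lattice_eq v w"
  have "(\<lambda>i. (int (lookup u i) - int (lookup v i)) - (int (lookup w i) - int (lookup v i))) \<in> par_lattice n \<P>"
    using par_lattice_diff[of "\<lambda>i. int (lookup u i) - int (lookup v i)"
      "\<lambda>i. int (lookup w i) - int (lookup v i)"] *(1) lattice_eq_sym[OF *(2)]
    unfolding lattice_eq_def by blast
  then show ?thesis using * by (simp add: lattice_eq_def)
qed

lemma lattice_eq_add: "lattice_eq u v \<Longrightarrow> keys w \<subseteq> {1..n} \<Longrightarrow> lattice_eq (w + u) (w + v)"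
  unfolding lattice_eq_def using keys_add[of w u] keys_add[of w v] by (auto simp: lookup_add)

text \<open>The difference of the exponents is the Laplacian of a firing script \<open>f\<close>
  that vanishes at the root, and the weight difference is twice the sum of \<open>f\<close>. So the
  point is that \<open>f\<close> is nonnegative: a negative minimum would give a cut pair dividing
  \<open>u\<close>. Hence a monomial outside the parking function ideal is the unique lightest one
  in its class.\<close>

lemma std_less:
  assumes "lattice_eq v u" "\<not> in_parking u" "u \<noteq> v"
  shows "weight u < weight v"
proof -
  have ku: "keys u \<subseteq> {1..n}" "keys v \<subseteq> {1..n}" using assms(1) by (auto simp: lattice_eq_def)
  have "(\<lambda>i. int (lookup v i) - int (lookup u i)) \<in> par_lattice n \<P>"
    using assms(1) by (simp add: lattice_eq_def)
  then obtain g0 where g0: "(\<Sum>q\<in>cuts. g0 q) = 0"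
    "\<And>x. int (lookup v x) - int (lookup u x) = (\<Sum>q\<in>cuts. g0 q * edge_vec q x)"
    by (rule par_latticeD) blast
  define g where "g q = (if q \<in> cuts then g0 q else 0)" for q
  have gs: "(\<Sum>q<n. g q) = 0"
    unfolding g_def using g0(1) cuts_facts(1) by (simp add: sum.inter_restrict[symmetric] Int_absorb1)
  have gd: "int (lookup v x) - int (lookup u x) = (\<Sum>q<n. g q * edge_vec q x)" for x
  proof -
    have "(\<Sum>q\<in>cuts. g0 q * edge_vec q x) = (\<Sum>q<n. g q * edge_vec q x)"
      unfolding g_def using cuts_facts(1) by (intro sum.mono_neutral_cong_left) auto
    then show ?thesis using g0(2) by simp
  qed
  define f where "f r = - (\<Sum>q<r. g q)" for r
  have fS: "g q = f q - f (Suc q)" for q by (simp add: f_def)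
  have f0: "f 0 = 0" "f n = 0" using gs by (simp_all add: f_def)
  have at: "int (lookup v (vtx y)) - int (lookup u (vtx y)) = g y - g (y - 1)"
    if y: "1 \<le> y" "y < n" for y
  proof -
    have "vtx y = vtx (Suc q) \<longleftrightarrow> q = y - 1" if "q < n" for q
      using vtx_Suc_eq[of "y - 1" q] y that by auto
    then have "(\<Sum>q<n. g q * edge_vec q (vtx y)) =
        (\<Sum>q<n. (if q = y then g q else 0) - (if q = y - 1 then g q else 0))"
      using y by (intro sum.cong) auto
    also have "\<dots> = g y - g (y - 1)" using y by (simp add: sum_subtractf)
    finally show ?thesis using gd by simp
  qed
  \<comment> \<open>Otherwise the edges \<open>i\<close> and \<open>j\<close> that bound a run where \<open>f\<close> attains its negative minimum form a
    cut pair dividing \<open>u\<close>.\<close>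
  have fpos: "f r \<ge> 0" if "r \<le> n" for r
  proof (rule ccontr)
    assume neg: "\<not> f r \<ge> 0"
    define m0 where "m0 = Min (f ` {..n})"
    have "m0 \<in> f ` {..n}" unfolding m0_def by (rule Min_in) auto
    then obtain r0 where r0: "r0 \<le> n" "f r0 = m0" by auto
    have mle: "m0 \<le> f q" if "q \<le> n" for q using that by (simp add: m0_def)
    have m0: "m0 < 0" using mle[OF that] neg by simp
    have r0': "0 < r0" "r0 < n" using r0 m0 f0 by (metis gr0I less_irrefl, metis le_neq_implies_less
        less_irrefl)
    define i where "i = Max {q. q < r0 \<and> f q > m0}"
    have "0 \<in> {q. q < r0 \<and> f q > m0}" using r0' f0 m0 by simp
    then have "{q. q < r0 \<and> f q > m0} \<noteq> {}" by blast
    then have "i \<in> {q. q < r0 \<and> f q > m0}" unfolding i_def by (rule Max_in[rotated]) simp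
    then have i: "i < r0" "f i > m0" by auto
    have fi: "f (Suc i) = m0"
    proof (cases "Suc i = r0")
      case False
      then have lt: "Suc i < r0" using i by simp
      have "\<not> f (Suc i) > m0"
      proof
        assume "f (Suc i) > m0"
        then have "Suc i \<in> {q. q < r0 \<and> f q > m0}" using lt by simp
        then have "Suc i \<le> Max {q. q < r0 \<and> f q > m0}" by (rule Max_ge[rotated]) simp
        then have "Suc i \<le> i" unfolding i_def[symmetric] .
        then show False by simp
      qed
      then show ?thesis using mle[of "Suc i"] lt r0' by simp
    qed (use r0 in simp)
    define j where "j = Min {q. r0 \<le> q \<and> q < n \<and> f (Suc q) > m0}"
    have "n - 1 \<in> {q. r0 \<le> q \<and> q < n \<and> f (Suc q) > m0}" using r0' f0 m0 by auto
    then have "{q. r0 \<le> q \<and> q < n \<and> f (Suc q) > m0} \<noteq> {}" by blast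
    then have "j \<in> {q. r0 \<le> q \<and> q < n \<and> f (Suc q) > m0}" unfolding j_def by (rule Min_in[rotated]) simp
    then have j: "r0 \<le> j" "j < n" "f (Suc j) > m0" by auto
    have fj: "f j = m0"
    proof (cases "j = r0")
      case False
      then have lt: "r0 \<le> j - 1" "j - 1 < n" "Suc (j - 1) = j" using j by auto
      have "\<not> f j > m0"
      proof
        assume "f j > m0"
        then have "j - 1 \<in> {q. r0 \<le> q \<and> q < n \<and> f (Suc q) > m0}" using lt by simp
        then have "Min {q. r0 \<le> q \<and> q < n \<and> f (Suc q) > m0} \<le> j - 1" by (rule Min_le[rotated]) simp
        then have "j \<le> j - 1" unfolding j_def[symmetric] .
        then show False using lt by simp
      qed
      then show ?thesis using mle[of j] j by simp
    qed (use r0 in simp)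
    have gi: "g i \<ge> 1" and gj: "g j \<le> -1" using fS[of i] fS[of j] i fi j fj by auto
    have ij: "i < j" using i j by simp
    have iE: "i \<in> cuts" "j \<in> cuts" using gi gj by (auto simp: g_def split: if_splits)
    have gSi: "g (Suc i) \<le> 0" using fS[of "Suc i"] fi mle[of "Suc (Suc i)"] ij j by simp
    have gj1: "g (j - 1) \<ge> 0" using fS[of "j - 1"] fj mle[of "j - 1"] ij j by simp
    \<comment> \<open>Exponents of \<open>v\<close> are nonnegative, so the jump of \<open>g\<close>
      bounds the exponent of \<open>u\<close> from below: by 1 at each of the two vertices, and by 2
      if \<open>j = Suc i\<close>, where both jumps meet.\<close>
    have ui: "int (lookup u (vtx (Suc i))) \<ge> g i - g (Suc i)"
      using at[of "Suc i"] ij j by simp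
    have uj: "int (lookup u (vtx j)) \<ge> g (j - 1) - g j"
      using at[of j] ij j by simp
    have "of_bool (x = vtx (Suc i)) + of_bool (x = vtx j) \<le> lookup u x" for x
    proof (cases "x = vtx (Suc i)")
      case True
      show ?thesis
      proof (cases "vtx (Suc i) = vtx j")
        case eq: True
        then have "j = Suc i" using ij j by simp
        then have "int (lookup u x) \<ge> 2" using ui gi gj True by simp
        then show ?thesis using True eq by simp
      next
        case False
        have "int (lookup u x) \<ge> 1" using ui gi gSi True by simp
        then show ?thesis using True False by simp
      qed
    next
      case False
      show ?thesis
      proof (cases "x = vtx j")
        case True
        have "int (lookup u x) \<ge> 1" using uj gj gj1 True by simp
        then show ?thesis using True False by simp
      qed (use False in simp)
    qed
    then have "pair_divides u i j" using iE ij by (auto simp: pair_divides_def)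
    then show False using assms(2) by (auto simp: in_parking_def)
  qed
  have W: "int (weight v) - int (weight u) = 2 * (\<Sum>q<n. f q)"
  proof -
    have "int (weight v) - int (weight u) = (\<Sum>i\<in>{1..n}. int (lam i) * (int (lookup v i) - int (lookup u i)))"
      by (simp add: weight_def wt_def right_diff_distrib sum_subtractf)
    also have "\<dots> = (\<Sum>q<n. (f q - f (Suc q)) * (2 * int q + 1 - int n))"
      unfolding gd lam_edge_sum fS ..
    finally show ?thesis using f0 by (simp add: sum_by_parts)
  qed
  have "(\<Sum>q<n. f q) \<noteq> 0"
  proof
    assume "(\<Sum>q<n. f q) = 0"
    then have z: "f q = 0" if "q < n" for q
      using sum_nonneg_eq_0_iff[of "{..<n}" f] fpos that by auto
    have "g q = 0" if "q < n" for q
      using fS[of q] z[OF that] z[of "Suc q"] f0 that by (cases "Suc q = n") auto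
    then have "int (lookup v x) = int (lookup u x)" for x
      using gd[of x] by simp
    then have "u = v" by (intro poly_mapping_eqI) simp
    then show False using assms(3) by simp
  qed
  moreover have "(\<Sum>q<n. f q) \<ge> 0" using fpos by (intro sum_nonneg) auto
  ultimately show ?thesis using W by simp
qed

section \<open>Invariant functionals on the toppling ideal and on its homogenisation\<close>

definition lattice_inv :: "((nat \<Rightarrow>\<^sub>0 nat) \<Rightarrow> 'a) \<Rightarrow> bool" where
  "lattice_inv \<psi> \<longleftrightarrow> (\<forall>u v. lattice_eq u v \<longrightarrow> \<psi> u = \<psi> v)"

text \<open>Invariance under the relations that hold modulo the homogenised ideal: the monomials
  with exponents \<open>u\<close>, \<open>s\<close> and \<open>v\<close>, \<open>r\<close> are
  identified if \<open>u\<close> and \<open>v\<close> are congruent and the total weights, with t of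
  weight 1, agree.\<close>

definition weight_inv :: "((nat \<Rightarrow>\<^sub>0 nat) \<Rightarrow> int \<Rightarrow> 'a) \<Rightarrow> bool" where
  "weight_inv \<phi> \<longleftrightarrow> (\<forall>u v s r. lattice_eq u v \<and> int (weight u) + s = int (weight v) + r \<longrightarrow> \<phi> u s = \<phi> v r)"

lemma toppling_gens:
  "{xmon n u - xmon n v | u v. u \<in> natvecs n \<and> v \<in> natvecs n \<and> (\<lambda>i. int (u i) - int (v i)) \<in> par_lattice n \<P>}
   = {single u 1 - single v 1 | u v. lattice_eq u v}" (is "?L = ?R")
proof (intro equalityI subsetI)
  fix x assume "x \<in> ?L"
  then obtain u v where x: "x = xmon n u - xmon n v" "u \<in> natvecs n" "v \<in> natvecs n"
      "(\<lambda>i. int (u i) - int (v i)) \<in> par_lattice n \<P>"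
    by blast
  obtain u' v' where u': "keys u' \<subseteq> {1..n}" "lookup u' = u"
    "keys v' \<subseteq> {1..n}" "lookup v' = v"
    using natvecs_poly_mapping x by metis
  then have "lattice_eq u' v'" using x by (simp add: lattice_eq_def)
  moreover have "x = single u' 1 - single v' 1" using x xmon_lookup u' by metis
  ultimately show "x \<in> ?R" by blast
next
  fix x assume "x \<in> ?R"
  then obtain u v where x: "x = single u 1 - single v 1" "lattice_eq u v" by blast
  have nv: "lookup w \<in> natvecs n" if "keys w \<subseteq> {1..n}" for w :: "nat \<Rightarrow>\<^sub>0 nat"
    unfolding natvecs_def
  proof (intro CollectI allI impI)
    fix i assume "i \<notin> {1..n}"
    then have "i \<notin> keys w" using that by (rule contra_subsetD[rotated])
    then show "lookup w i = 0" by (simp add: in_keys_iff)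
  qed
  have uv: "keys u \<subseteq> {1..n}" "keys v \<subseteq> {1..n}"
    "(\<lambda>i. int (lookup u i) - int (lookup v i)) \<in> par_lattice n \<P>"
    using x(2) unfolding lattice_eq_def by blast+
  have "x = xmon n (lookup u) - xmon n (lookup v)"
    unfolding x(1) xmon_lookup[OF uv(1)] xmon_lookup[OF uv(2)] ..
  then show "x \<in> ?L"
    by (intro CollectI exI[of _ "lookup u"] exI[of _ "lookup v"] conjI nv[OF uv(1)] nv[OF uv(2)] uv(3))
qed

lemma toppling_ideal_alt: "toppling_ideal n \<P> = genideal (Rn n) {single u 1 - single v 1 | u v. lattice_eq u
    v}"
  unfolding toppling_ideal_def toppling_gens ..

lemma in_Rn_diff: "in_Rn n p \<Longrightarrow> in_Rn n q \<Longrightarrow> in_Rn n (p - q)"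
  using in_Rn_add[of n p "- q"] by simp

lemma toppling_gens_in_Rn: "{single u 1 - single v 1 | u v. lattice_eq u v} \<subseteq>
    {p :: 'a::comm_ring_1 mpol. in_Rn n p}"
  by (auto intro!: in_Rn_diff in_Rn_single simp: lattice_eq_def)

lemma toppling_ideal: "ideal (toppling_ideal n \<P> :: 'a::comm_ring_1 mpol set) (Rn n)"
  unfolding toppling_ideal_alt by (rule Rn_genideal(1)[OF toppling_gens_in_Rn])

lemma binomial_toppling: "lattice_eq u v \<Longrightarrow> single u 1 - single v 1 \<in> (toppling_ideal n \<P> :: 'a::comm_ring_1
    mpol set)"
  unfolding toppling_ideal_alt using Rn_genideal(2)[OF toppling_gens_in_Rn] by blast

lemma lattice_inv_shift: "lattice_inv \<psi> \<Longrightarrow> keys v \<subseteq> {1..n} \<Longrightarrow> lattice_inv (\<lambda>u. \<psi> (v + u))"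
  unfolding lattice_inv_def using lattice_eq_add by blast

lemma toppling_pairing:
  assumes "g \<in> (toppling_ideal n \<P> :: 'a::comm_ring_1 mpol set)" "lattice_inv \<psi>"
  shows "pairing g \<psi> = 0"
proof -
  let ?K = "{g :: 'a mpol. in_Rn n g \<and> (\<forall>\<psi>. lattice_inv \<psi> \<longrightarrow> pairing g \<psi> = 0)}"
  have "ideal ?K (Rn n)"
  proof (rule Rn_ideal_criterion)
    fix r x :: "'a mpol" assume *: "in_Rn n r" "x \<in> ?K"
    have "pairing (r * x) \<psi> = 0" if "lattice_inv \<psi>" for \<psi>
      unfolding pairing_mult
    proof (rule sum.neutral, rule ballI)
      fix v assume "v \<in> keys r"
      then have "lattice_inv (\<lambda>u. \<psi> (v + u))" using * that by (intro lattice_inv_shift) (auto simp: in_Rn_def)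
      then show "lookup r v * pairing x (\<lambda>u. \<psi> (v + u)) = 0" using * by simp
    qed
    then show "r * x \<in> ?K" using * in_Rn_mult by auto
  qed (auto simp: in_Rn_add pairing_add)
  moreover have "{single u 1 - single v 1 | u v. lattice_eq u v} \<subseteq> ?K"
  proof
    fix x :: "'a mpol" assume x: "x \<in> {single u 1 - single v 1 | u v. lattice_eq u v}"
    then obtain u v where uv: "x = single u 1 - single v 1" "lattice_eq u v" by blast
    have "pairing x \<psi> = 0" if "lattice_inv \<psi>" for \<psi>
      using pairing_add[of "single u 1" "- single v 1" \<psi>] that uv
          by (simp add: pairing_uminus lattice_inv_def)
    then show "x \<in> ?K" using toppling_gens_in_Rn x by blast
  qed
  ultimately have "toppling_ideal n \<P> \<subseteq> ?K"
    unfolding toppling_ideal_alt by (rule Rn_genideal(3)[OF toppling_gens_in_Rn])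
  then show ?thesis using assms by blast
qed

lemma max_wt_eq: "max_wt n lam g = Max (weight ` keys g)"
  by (simp add: max_wt_def weight_def)

lemma weight_le_max: "u \<in> keys g \<Longrightarrow> weight u \<le> max_wt n lam g"
  unfolding max_wt_eq by (intro Max_ge) auto

lemma homogenize_alt: "homogenize n lam g = (\<Sum>u\<in>keys g.
     Polynomial.monom (single u (lookup g u)) (max_wt n lam g - weight u))"
  by (simp add: homogenize_def weight_def)

lemma initial_form_alt: "initial_form n lam g =
    (\<Sum>u\<in>{u \<in> keys g. weight u = max_wt n lam g}. single u (lookup g u))"
  by (simp add: initial_form_def weight_def)

lemma in_Rnt_homogenize: "in_Rn n g \<Longrightarrow> in_Rnt n (homogenize n lam g)"
  unfolding homogenize_alt by (intro in_Rnt_sum in_Rnt_monom in_Rn_single) (auto simp: in_Rn_def)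

lemma in_Rn_initial_form: "in_Rn n g \<Longrightarrow> in_Rn n (initial_form n lam g)"
  unfolding initial_form_alt by (intro in_Rn_sum in_Rn_single) (auto simp: in_Rn_def)

lemma toppling_in_Rn: "g \<in> (toppling_ideal n \<P> :: 'a::comm_ring_1 mpol set) \<Longrightarrow> in_Rn n g"
  using Rn_idealD(1)[OF toppling_ideal] .

lemma homog_gens_in_Rnt: "{homogenize n lam g | g. g \<in> (toppling_ideal n \<P> :: 'a::comm_ring_1 mpol set) \<and>
    g \<noteq> 0} \<subseteq> {p. in_Rnt n p}"
  using in_Rnt_homogenize toppling_in_Rn by blast

abbreviation hom_ideal :: "'a::comm_ring_1 mpol poly set" where
  "hom_ideal \<equiv> homogenized_ideal n lam (toppling_ideal n \<P>)"

lemma hom_ideal_ideal: "ideal (hom_ideal :: 'a::comm_ring_1 mpol poly set) (Rnt n)"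
  unfolding homogenized_ideal_def by (rule Rnt_genideal(1)[OF homog_gens_in_Rnt])

lemma homogenize_in_hom_ideal: "g \<in> toppling_ideal n \<P> \<Longrightarrow> g \<noteq> 0 \<Longrightarrow> homogenize n lam g
    \<in> (hom_ideal :: 'a::comm_ring_1 mpol poly set)"
  unfolding homogenized_ideal_def using Rnt_genideal(2)[OF homog_gens_in_Rnt] by blast

lemma in_Rnt_pCons: "in_Rnt n (pCons a p) \<longleftrightarrow> in_Rn n a \<and> in_Rnt n p"
  unfolding in_Rnt_def
proof (intro iffI allI)
  assume *: "\<forall>i. in_Rn n (Polynomial.coeff (pCons a p) i)"
  have "in_Rn n (Polynomial.coeff (pCons a p) 0)" "\<And>i. in_Rn n (Polynomial.coeff (pCons a p) (Suc i))" using
      * by blast+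
  then show "in_Rn n a \<and> (\<forall>i. in_Rn n (Polynomial.coeff p i))" by simp
qed (auto simp: coeff_pCons split: nat.splits)

text \<open>The invariant functions are closed under translation by monomials and by t, so their
  common kernel is an ideal. Pairing \<open>homogenize n lam g\<close> with \<open>\<phi>\<close>
  amounts to pairing \<open>g\<close> with \<open>\<phi>\<close> evaluated at the complementary
  power of t, and this function is constant on lattice classes.\<close>

lemma hom_ideal_tpairing:
  assumes "p \<in> (hom_ideal :: 'a::comm_ring_1 mpol poly set)" "weight_inv \<phi>"
  shows "tpairing p \<phi> = 0"
proof -
  let ?K = "{p :: 'a mpol poly. in_Rnt n p \<and> (\<forall>\<phi>. weight_inv \<phi> \<longrightarrow> tpairing p \<phi> = 0)}"
  have add: "x + y \<in> ?K" if "x \<in> ?K" "y \<in> ?K" for x y using that by (auto simp: in_Rnt_add tpairing_add)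
  have sm: "Polynomial.smult a x \<in> ?K" if *: "x \<in> ?K" "in_Rn n a" for a x
  proof -
    have "tpairing (Polynomial.smult a x) \<phi> = 0" if "weight_inv \<phi>" for \<phi>
      unfolding tpairing_smult
    proof (rule sum.neutral, rule ballI)
      fix v assume "v \<in> keys a"
      then have kv: "keys v \<subseteq> {1..n}" using * by (auto simp: in_Rn_def)
      have "weight_inv (\<lambda>u s. \<phi> (v + u) s)"
        using that lattice_eq_add[OF _ kv] unfolding weight_inv_def by simp
      then show "lookup a v * tpairing x (\<lambda>u s. \<phi> (v + u) s) = 0" using * by simp
    qed
    then show ?thesis using * in_Rnt_mult[OF in_Rnt_const[of n a], of x] by simp
  qed
  have sh: "pCons 0 x \<in> ?K" if *: "x \<in> ?K" for x
  proof -
    have "weight_inv (\<lambda>u s. \<phi> u (s + 1))" if "weight_inv \<phi>" for \<phi> :: "(nat \<Rightarrow>\<^sub>0 nat) \<Rightarrow> int \<Rightarrow> 'a"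
      using that unfolding weight_inv_def by (simp add: add.assoc[symmetric])
    then show ?thesis using * by (simp add: tpairing_pCons0 in_Rnt_pCons)
  qed
  have mul: "r * x \<in> ?K" if "in_Rnt n r" "x \<in> ?K" for r x
    using that
  proof (induction r)
    case (pCons a r)
    have "pCons a r * x = Polynomial.smult a x + pCons 0 (r * x)" by simp
    moreover have "in_Rn n a" "in_Rnt n r" using pCons.prems(1) by (simp_all add: in_Rnt_pCons)
    ultimately show ?case using add[OF sm[OF pCons.prems(2)] sh[OF pCons.IH]] pCons.prems(2) by simp
  qed simp
  have "ideal ?K (Rnt n)"
    by (rule Rnt_ideal_criterion) (use add mul in auto)
  moreover have "{homogenize n lam g | g. g \<in> (toppling_ideal n \<P> :: 'a mpol set) \<and> g \<noteq> 0} \<subseteq> ?K"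
  proof
    fix p assume p: "p \<in> {homogenize n lam g | g. g \<in> (toppling_ideal n \<P> :: 'a mpol set) \<and> g \<noteq> 0}"
    then obtain g where g: "p = homogenize n lam g" "g \<in> toppling_ideal n \<P>" by blast
    have "tpairing p \<phi> = 0" if "weight_inv \<phi>" for \<phi>
    proof -
      let ?M = "max_wt n lam g"
      have "tpairing p \<phi> = (\<Sum>u\<in>keys g. lookup g u * \<phi> u (int (?M - weight u)))"
        unfolding g homogenize_alt tpairing_sum tpairing_monom pairing_single ..
      also have "\<dots> = pairing g (\<lambda>u. \<phi> u (int ?M - int (weight u)))"
        unfolding pairing_def
      proof (rule sum.cong)
        fix u assume "u \<in> keys g"
        then have "int (?M - weight u) = int ?M - int (weight u)" using weight_le_max[of u g]
            by (simp add: of_nat_diff)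
        then show "lookup g u * \<phi> u (int (?M - weight u)) = lookup g u * \<phi> u (int ?M - int (weight u))"
          by (simp only:)
      qed simp
      also have "\<dots> = 0"
      proof (rule toppling_pairing[OF g(2)])
        show "lattice_inv (\<lambda>u. \<phi> u (int ?M - int (weight u)))" using that unfolding lattice_inv_def
            weight_inv_def by simp
      qed
      finally show ?thesis .
    qed
    then show "p \<in> ?K" using homog_gens_in_Rnt p by blast
  qed
  ultimately have "hom_ideal \<subseteq> ?K"
    unfolding homogenized_ideal_def by (rule Rnt_genideal(3)[OF homog_gens_in_Rnt])
  then show ?thesis using assms by blast
qed

end

section \<open>The Groebner degeneration\<close>

context rooted_parcycle
begin

text \<open>The two terms of the 2-minor of the columns \<open>i\<close> and \<open>j\<close> are
  \<open>pair_exp i j\<close> and \<open>pair_exp j i\<close>; for cuts \<open>i < j\<close> the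
  former is heavier.\<close>

definition pair_exp :: "nat \<Rightarrow> nat \<Rightarrow> nat \<Rightarrow>\<^sub>0 nat" where "pair_exp i j = unit_exp (vtx (Suc i)) + unit_exp
    (vtx j)"

lemma cut_exp_pair: "i \<noteq> j \<Longrightarrow> cut_exp {i, j} {j} = pair_exp i j" "i \<noteq> j \<Longrightarrow> cut_exp {i, j} {i} = pair_exp j i"
  by (auto simp: cut_exp_def pair_exp_def add.commute)

lemma top_cuts_pair: "i < j \<Longrightarrow> top_cuts {i, j} 1 = {j}"
  using top_cuts_unique[of "{i, j}" "{j}"] by (auto simp: up_closed_def)

lemma keys_pair_exp: "keys (pair_exp i j) \<subseteq> {1..n}"
  unfolding pair_exp_def using keys_add[of "unit_exp (vtx (Suc i))" "unit_exp (vtx j)"] by auto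

lemma weight_pair_exp: "i < j \<Longrightarrow> i \<in> cuts \<Longrightarrow> j \<in> cuts \<Longrightarrow> weight (pair_exp j i) < weight (pair_exp i j)"
  using weight_max(2)[of "{i, j}" "{i}" 1] top_cuts_pair[of i j] cut_exp_pair[of i j] cuts_lt by auto

lemma lattice_eq_pair_exp: "i \<in> cuts \<Longrightarrow> j \<in> cuts \<Longrightarrow> i \<noteq> j \<Longrightarrow> lattice_eq (pair_exp i j) (pair_exp j i)"
  unfolding lattice_eq_def
proof (intro conjI keys_pair_exp)
  assume ij: "i \<in> cuts" "j \<in> cuts" "i \<noteq> j"
  show "(\<lambda>x. int (lookup (pair_exp i j) x) - int (lookup (pair_exp j i) x)) \<in> par_lattice n \<P>"
  proof (rule par_latticeI[of "\<lambda>q. (if q = j then 1 else 0) - (if q = i then 1 else 0)"])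
    show "(\<Sum>q\<in>cuts. (if q = j then 1 else 0) - (if q = i then 1 else 0 :: int)) = 0"
      using ij finite_cuts by (simp add: sum_subtractf)
    fix x
    have "(\<Sum>q\<in>cuts. ((if q = j then 1 else 0) - (if q = i then 1 else 0)) * edge_vec q x) =
      (\<Sum>q\<in>cuts. (if q = j then edge_vec q x else 0) - (if q = i then edge_vec q x else 0))"
      by (intro sum.cong) auto
    also have "\<dots> = edge_vec j x - edge_vec i x" using ij finite_cuts by (simp add: sum_subtractf)
    finally show "int (lookup (pair_exp i j) x) - int (lookup (pair_exp j i) x) =
        (\<Sum>q\<in>cuts. ((if q = j then 1 else 0) - (if q = i then 1 else 0)) * edge_vec q x)"
      by (simp add: pair_exp_def lookup_add lookup_unit_exp)
  qed
qed

lemma pair_divides_pair_exp: "pair_divides u i j \<Longrightarrow> u - pair_exp i j + pair_exp i j = u"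
  by (rule poly_mapping_eqI) (simp add: pair_exp_def lookup_add lookup_minus lookup_unit_exp pair_divides_def)

definition minor :: "nat \<Rightarrow> nat \<Rightarrow> 'a::comm_ring_1 mpol" where
  "minor i j = single (pair_exp i j) 1 - single (pair_exp j i) 1"

lemma minor_props:
  assumes "i < j" "i \<in> cuts" "j \<in> cuts"
  shows "minor i j \<in> (toppling_ideal n \<P> :: 'a::field mpol set)" "minor i j \<noteq> (0 :: 'a mpol)"
    "initial_form n lam (minor i j) = (single (pair_exp i j) 1 :: 'a mpol)"
    "homogenize n lam (minor i j) = Polynomial.monom (single (pair_exp i j) (1::'a)) 0 -
       Polynomial.monom (single (pair_exp j i) 1) (weight (pair_exp i j) - weight (pair_exp j i))"
proof -
  show "minor i j \<in> (toppling_ideal n \<P> :: 'a::field mpol set)"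
    unfolding minor_def using assms by (intro binomial_toppling lattice_eq_pair_exp) auto
  have w: "weight (pair_exp j i) < weight (pair_exp i j)" using weight_pair_exp assms by simp
  then have ne: "pair_exp i j \<noteq> pair_exp j i" by auto
  have l: "lookup (minor i j :: 'a mpol) u = (if u = pair_exp i j then 1 else if u = pair_exp j i then -1
      else 0)" for u
    using ne by (auto simp: minor_def lookup_minus lookup_single when_def)
  then have k: "keys (minor i j :: 'a mpol) = {pair_exp i j, pair_exp j i}"
    by (auto simp: in_keys_iff split: if_splits)
  then show "minor i j \<noteq> (0 :: 'a mpol)" by auto
  have M: "max_wt n lam (minor i j :: 'a mpol) = weight (pair_exp i j)"
    unfolding max_wt_eq k using w by simp
  have "{u \<in> keys (minor i j :: 'a mpol). weight u = max_wt n lam (minor i j :: 'a mpol)} = {pair_exp i j}"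
    unfolding M k using w by auto
  then show "initial_form n lam (minor i j) = (single (pair_exp i j) 1 :: 'a mpol)"
    unfolding initial_form_alt by (simp add: l)
  show "homogenize n lam (minor i j) = Polynomial.monom (single (pair_exp i j) (1::'a)) 0 -
       Polynomial.monom (single (pair_exp j i) 1) (weight (pair_exp i j) - weight (pair_exp j i))"
    unfolding homogenize_alt M k using ne w by (simp add: l single_uminus flip: minus_monom)
qed

text \<open>For cuts \<open>i < j\<close> the arc from position \<open>i + 1\<close> to
  \<open>j\<close> is the block with key 1, away from the root. Its boundary monomial is that of the
  directed edge from it to the complement: the variable after \<open>i\<close> times the one before
  \<open>j\<close>.\<close>

lemma cut_block:
  assumes "i < j" "i \<in> cuts" "j \<in> cuts"
  shows "connected_parset n \<P> (blk {i, j} j)" "\<not> V \<subseteq> blk {i, j} j"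
    "cut_exponent n (blk {i, j} j) = lookup (pair_exp i j)"
    "blk {i, j} j = vtx ` {i<..j}"
proof -
  let ?A = "{i, j}"
  have A: "?A \<subseteq> {..<n}" "?A \<subseteq> cuts" using assms cuts_lt by auto
  have c: "card ?A = 2" using assms by simp
  have jn: "j < n" "j \<le> n" using cuts_lt[OF assms(3)] by simp_all
  show "connected_parset n \<P> (blk ?A j)" using blk_parset[OF A(2)] jn by simp
  have k: "key ?A r = (if i < r \<and> r \<le> j then 1 else 0)" for r
  proof -
    have "{a \<in> ?A. a < r} = (if r \<le> i then {} else if r \<le> j then {i} else ?A)" using assms by auto
    then show ?thesis using c by (auto simp: key_def)
  qed
  have kj: "key ?A j = 1" using assms(1) k by simp
  show "\<not> V \<subseteq> blk ?A j" using V_blk[OF A(2) jn(2)] kj by simp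
  show b: "blk ?A j = vtx ` {i<..j}" unfolding blk_def kj
  proof -
    have "{r'. r' < n \<and> key ?A r' = 1} = {i<..j}" unfolding k using jn by auto
    then show "vtx ` {r'. r' < n \<and> key ?A r' = 1} = vtx ` {i<..j}" by simp
  qed
  have "cut_edge ?A j True = cut_edge ?A i False" using cut_edge_two[of ?A i j False] A c assms by simp
  then have S: "blk ?A (Suc j) = blk ?A i" by (simp add: cut_edge_def)
  have comp: "{1..n} - blk ?A j = blk ?A i"
  proof (intro equalityI subsetI)
    fix x assume x: "x \<in> {1..n} - blk ?A j"
    then have p: "pos x < n" "vtx (pos x) = x" by auto
    then have "key ?A (pos x) \<noteq> 1" using x in_blk_iff[OF A(1), of "pos x" j] kj by auto
    then have "key ?A (pos x) = key ?A i" unfolding k by (auto split: if_splits)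
    then show "x \<in> blk ?A i" using in_blk_iff[OF A(1), of "pos x" i] p by simp
  next
    fix x assume x: "x \<in> blk ?A i"
    then have x': "x \<in> {1..n}" using blk_subset[OF A(1)] by blast
    then have p: "pos x < n" "vtx (pos x) = x" by auto
    then have "key ?A (pos x) = 0" using x in_blk_iff[OF A(1), of "pos x" i] k by simp
    then have "x \<notin> blk ?A j" using in_blk_iff[OF A(1), of "pos x" j] p kj by simp
    then show "x \<in> {1..n} - blk ?A j" using x' by simp
  qed
  have "cut_exponent n (blk ?A j) = edge_exponent n (cut_edge ?A j True)"
  proof -
    have "fst (cut_edge ?A j True) = blk ?A j" "snd (cut_edge ?A j True) = blk ?A i"
        by (simp_all add: cut_edge_def S)
    then show ?thesis unfolding cut_exponent_def edge_exponent_def comp by (simp only:)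
  qed
  also have "\<dots> = cut_exp_fun ?A {j}" using edge_exponent_cut_edge[OF A(1), of j True] c by simp
  also have "\<dots> = lookup (pair_exp i j)"
    using lookup_cut_exp[of ?A "{j}"] cut_exp_pair(1)[of i j] assms by simp
  finally show "cut_exponent n (blk ?A j) = lookup (pair_exp i j)" .
qed

text \<open>A connected union of main vertices without the root is an interval of positions, as a
  gap could only be bypassed through the root. The edges at its two ends leave a main vertex, so
  they are cuts.\<close>

lemma cut_parset:
  assumes S: "connected_parset n \<P> S" "\<not> V \<subseteq> S"
  obtains i j where "i < j" "i \<in> cuts" "j \<in> cuts" "S = blk {i, j} j"
proof -
  have conn: "induces_connected n S" and Sne: "S \<noteq> {}" using S by (auto simp: connected_parset_def)
  obtain \<B> where B: "\<B> \<subseteq> \<P>" "S = \<Union>\<B>" using S by (auto simp: connected_parset_def)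
  have dj: "W \<in> \<B>" if W: "W \<in> \<P>" "x \<in> W" "x \<in> S" for W x
  proof -
    obtain W' where W': "W' \<in> \<B>" "x \<in> W'" using B(2) W(3) by blast
    have "W' = W" using W' W B(1) partition_onD2[of "{1..n}" \<P>] parcycle unfolding parcycle_def disjoint_def
        by blast
    then show ?thesis using W' by simp
  qed
  have cut: "q \<in> cuts" if "q < n" "(vtx q \<in> S) \<noteq> (vtx (Suc q) \<in> S)" for q
  proof -
    have False if W: "W \<in> \<P>" "vtx q \<in> W" "vtx (Suc q) \<in> W" for W
      using dj[OF W(1)] W B(2) \<open>(vtx q \<in> S) \<noteq> (vtx (Suc q) \<in> S)\<close> by blast
    then show ?thesis using that by (auto simp: cuts_def)
  qed
  have v0S: "vtx 0 \<notin> S"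
  proof
    assume "vtx 0 \<in> S"
    then have "V \<in> \<B>" using dj[OF VP, of "vtx 0"] v0V by (simp add: vtx_0)
    then show False using S(2) B by blast
  qed
  have Ssub: "S \<subseteq> {1..n}" using B cuts_facts(2) blk_subset[OF cuts_facts(1)] unfolding blocks_def by blast
  define Q where "Q = {q. q < n \<and> vtx q \<in> S}"
  have SQ: "S = vtx ` Q"
  proof (intro equalityI subsetI)
    fix x assume "x \<in> S"
    then show "x \<in> vtx ` Q" unfolding Q_def using Ssub by (intro image_eqI[of _ _ "pos x"]) auto
  qed (auto simp: Q_def)
  have fQ: "finite Q" "Q \<noteq> {}" using SQ Sne by (auto simp: Q_def)
  define l where "l = Min Q"
  define j where "j = Max Q"
  have l: "l \<in> Q" and j: "j \<in> Q" using fQ by (auto simp: l_def j_def)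
  have lj: "l \<le> q" "q \<le> j" if "q \<in> Q" for q using that fQ by (auto simp: l_def j_def)
  have l0: "0 < l" using l v0S by (cases l) (auto simp: Q_def)
  have all: "x \<in> Q" if x: "l \<le> x" "x \<le> j" for x
  proof (rule ccontr)
    assume xQ: "x \<notin> Q"
    have xn: "x < n" using x j by (auto simp: Q_def)
    then have xS: "vtx x \<notin> S" using xQ by (simp add: Q_def)
    \<comment> \<open>If the position \<open>x\<close> were missing, this predicate would be
      constant along the edges inside \<open>S\<close>, but it separates the least from the largest
      position of \<open>S\<close>.\<close>
    define G where "G q \<longleftrightarrow> x < q \<and> q < n" for q
    have "G l = G j"
    proof (rule connected_const[OF conn])
      show "G (Suc q) = G q" if "q < n" "vtx q \<in> S" "vtx (Suc q) \<in> S" for q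
      proof -
        have "q \<noteq> x" using that xS by auto
        moreover have "Suc q \<noteq> n"
        proof
          assume "Suc q = n"
          then show False using that(3) v0S by simp
        qed
        ultimately show ?thesis unfolding G_def using that(1) by linarith
      qed
      show "G n = G 0" by (simp add: G_def)
    qed (use l j in \<open>auto simp: Q_def\<close>)
    moreover have "x \<noteq> j" using xQ j by auto
    ultimately show False using x j l by (auto simp: G_def Q_def)
  qed
  have Qi: "Q = {l - 1<..j}"
  proof (intro equalityI subsetI)
    fix q assume "q \<in> Q"
    then have "l \<le> q" "q \<le> j" using lj by simp_all
    then show "q \<in> {l - 1<..j}" using l0 by simp
  next
    fix q assume "q \<in> {l - 1<..j}"
    then have "l - 1 < q" "q \<le> j" by simp_all
    then have "l \<le> q" "q \<le> j" using l0 by linarith+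
    then show "q \<in> Q" by (rule all)
  qed
  have ij: "l - 1 < j" using lj[OF l] l0 by simp
  have "l - 1 \<in> cuts"
  proof (rule cut)
    show "l - 1 < n" using l by (auto simp: Q_def)
    have "l - 1 \<notin> Q" using lj(1)[of "l - 1"] l0 by auto
    then have "vtx (l - 1) \<notin> S" using \<open>l - 1 < n\<close> by (simp add: Q_def)
    moreover have "vtx (Suc (l - 1)) \<in> S" using l l0 by (simp add: Q_def)
    ultimately show "(vtx (l - 1) \<in> S) \<noteq> (vtx (Suc (l - 1)) \<in> S)" by simp
  qed
  moreover have "j \<in> cuts"
  proof (rule cut)
    show jn: "j < n" using j by (auto simp: Q_def)
    have "vtx (Suc j) \<notin> S"
    proof (cases "Suc j = n")
      case True
      then show ?thesis using v0S by simp
    next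
      case False
      then show ?thesis using lj(2)[of "Suc j"] jn by (auto simp: Q_def)
    qed
    then show "(vtx j \<in> S) \<noteq> (vtx (Suc j) \<in> S)" using j by (simp add: Q_def)
  qed
  ultimately show thesis using that[of "l - 1" j] ij cut_block(4)[of "l - 1" j] SQ Qi by simp
qed

lemma parking_gens: "{xmon n (cut_exponent n S) | S. connected_parset n \<P> S \<and> \<not> V \<subseteq> S} =
  {single (pair_exp i j) (1::'a::comm_ring_1) | i j. i < j \<and> i \<in> cuts \<and> j \<in> cuts}" (is "?L = ?R")
proof (intro equalityI subsetI)
  fix x assume "x \<in> ?L"
  then obtain S where "x = xmon n (cut_exponent n S)" "connected_parset n \<P> S" "\<not> V \<subseteq> S" by blast
  moreover from this(2,3) obtain i j where ij: "i < j" "i \<in> cuts" "j \<in> cuts" "S = blk {i, j} j"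
      by (rule cut_parset)
  ultimately have "x = single (pair_exp i j) 1" by (simp add: cut_block(3)[OF ij(1-3)]
      xmon_lookup[OF keys_pair_exp])
  then show "x \<in> ?R" using ij by blast
next
  fix x assume "x \<in> ?R"
  then obtain i j where ij: "x = single (pair_exp i j) 1" "i < j" "i \<in> cuts" "j \<in> cuts" by blast
  then have "x = xmon n (cut_exponent n (blk {i, j} j))" by (simp add: cut_block(3)[OF ij(2-4)]
      xmon_lookup[OF keys_pair_exp])
  then show "x \<in> ?L" using cut_block(1,2)[OF ij(2-4)] by blast
qed

abbreviation park_ideal :: "'a::comm_ring_1 mpol set" where "park_ideal \<equiv> parking_ideal n \<P> V"

lemma parking_gens_in_Rn: "{single (pair_exp i j) (1::'a::comm_ring_1) | i j. i < j \<and> i \<in> cuts \<and> j \<in> cuts} \<subseteq>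
    {p. in_Rn n p}"
  using in_Rn_single[OF keys_pair_exp] by blast

lemma park_ideal_alt: "park_ideal = genideal (Rn n) {single (pair_exp i j) (1::'a::comm_ring_1) | i j. i < j
    \<and> i \<in> cuts \<and> j \<in> cuts}"
  unfolding parking_ideal_def parking_gens ..

lemma park_ideal_ideal: "ideal (park_ideal :: 'a::comm_ring_1 mpol set) (Rn n)"
  unfolding park_ideal_alt by (rule Rn_genideal(1)[OF parking_gens_in_Rn])

lemma in_parking_park_ideal:
  assumes "in_parking u" "keys u \<subseteq> {1..n}"
  shows "single u a \<in> (park_ideal :: 'a::comm_ring_1 mpol set)"
proof -
  obtain i j where p: "pair_divides u i j" using assms by (auto simp: in_parking_def)
  then have "single (pair_exp i j) 1 \<in> (park_ideal :: 'a mpol set)"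
    unfolding park_ideal_alt using Rn_genideal(2)[OF parking_gens_in_Rn] by (auto simp: pair_divides_def)
  moreover have "in_Rn n (single (u - pair_exp i j) a)"
    using keys_diff_unit_exp[of u "pair_exp i j"] assms by (intro in_Rn_single) auto
  ultimately have "single (u - pair_exp i j) a * single (pair_exp i j) 1 \<in> (park_ideal :: 'a mpol set)"
    by (intro Rn_idealD(4)[OF park_ideal_ideal])
  then show ?thesis using pair_divides_pair_exp[OF p] by (simp add: mult_single)
qed

lemma initial_gens_in_Rn: "{initial_form n lam g | g. g \<in> (toppling_ideal n \<P> :: 'a::comm_ring_1 mpol set) \<and>
    g \<noteq> 0} \<subseteq> {p. in_Rn n p}"
  using in_Rn_initial_form toppling_in_Rn by blast

lemma initial_ideal_eq: "initial_ideal n lam (toppling_ideal n \<P>) = (park_ideal :: 'a::field mpol set)"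
proof
  have "{initial_form n lam g | g. g \<in> (toppling_ideal n \<P> :: 'a mpol set) \<and> g \<noteq> 0} \<subseteq> park_ideal"
  proof
    fix x assume "x \<in> {initial_form n lam g | g. g \<in> (toppling_ideal n \<P> :: 'a mpol set) \<and> g \<noteq> 0}"
    then obtain g where g: "x = initial_form n lam g" "g \<in> (toppling_ideal n \<P> :: 'a mpol set)" by blast
    have kg: "keys u \<subseteq> {1..n}" if "u \<in> keys g" for u
      using toppling_in_Rn[OF g(2)] that by (auto simp: in_Rn_def)
    have M: "in_parking u" if u: "u \<in> keys g" "weight u = max_wt n lam g" for u
    proof (rule ccontr)
      assume nM: "\<not> in_parking u"
      \<comment> \<open>\<open>u\<close> is the only monomial of \<open>g\<close> in its lattice class, because it has the largest weight in \<open>g\<close>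
        but the least one in this class.\<close>
      define \<psi> :: "(nat \<Rightarrow>\<^sub>0 nat) \<Rightarrow> 'a" where "\<psi> v = of_bool (lattice_eq v u)" for v
      have "lattice_eq v u \<longleftrightarrow> lattice_eq w u" if "lattice_eq v w" for v w
        using lattice_eq_trans[OF that, of u] lattice_eq_trans[OF lattice_eq_sym[OF that], of u] by blast
      then have "lattice_inv \<psi>" unfolding lattice_inv_def \<psi>_def by simp
      then have "pairing g \<psi> = 0" by (rule toppling_pairing[OF g(2)])
      moreover have "pairing g \<psi> = (\<Sum>v\<in>keys g. if v = u then lookup g u else 0)"
        unfolding pairing_def
      proof (rule sum.cong)
        fix v assume v: "v \<in> keys g"
        have "\<not> lattice_eq v u" if "v \<noteq> u"
          using std_less[of v u] nM that weight_le_max[OF v] u(2) by fastforce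
        then show "lookup g v * \<psi> v = (if v = u then lookup g u else 0)"
          using lattice_eq_refl[OF kg[OF u(1)]] by (auto simp: \<psi>_def)
      qed simp
      ultimately show False using u(1) by (simp add: in_keys_iff)
    qed
    show "x \<in> park_ideal" unfolding g(1) initial_form_alt
    proof (rule Rn_ideal_sum[OF park_ideal_ideal])
      fix u assume "u \<in> {u \<in> keys g. weight u = max_wt n lam g}"
      then show "single u (lookup g u) \<in> park_ideal" using in_parking_park_ideal[OF M kg] by blast
    qed
  qed
  then show "initial_ideal n lam (toppling_ideal n \<P>) \<subseteq> (park_ideal :: 'a mpol set)"
    unfolding initial_ideal_def by (rule Rn_genideal(3)[OF initial_gens_in_Rn park_ideal_ideal])
  have "{single (pair_exp i j) (1::'a) | i j. i < j \<and> i \<in> cuts \<and> j \<in> cuts} \<subseteq> initial_ideal n lam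
      (toppling_ideal n \<P>)"
  proof
    fix x assume "x \<in> {single (pair_exp i j) (1::'a) | i j. i < j \<and> i \<in> cuts \<and> j \<in> cuts}"
    then obtain i j where ij: "i < j" "i \<in> cuts" "j \<in> cuts" "x = single (pair_exp i j) 1" by blast
    have "x \<in> {initial_form n lam g | g. g \<in> (toppling_ideal n \<P> :: 'a mpol set) \<and> g \<noteq> 0}"
      unfolding ij(4) minor_props(3)[OF ij(1-3), symmetric]
      using minor_props(1,2)[OF ij(1-3)] by blast
    then show "x \<in> initial_ideal n lam (toppling_ideal n \<P>)"
      unfolding initial_ideal_def using Rn_genideal(2)[OF initial_gens_in_Rn] by blast
  qed
  then show "(park_ideal :: 'a mpol set) \<subseteq> initial_ideal n lam (toppling_ideal n \<P>)"
    unfolding park_ideal_alt initial_ideal_def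
        by (rule Rn_genideal(3)[OF parking_gens_in_Rn Rn_genideal(1)[OF initial_gens_in_Rn]])
qed

lemma coeff_homogenize_0: "Polynomial.coeff (homogenize n lam g) 0 = initial_form n lam g"
proof -
  have "Polynomial.coeff (homogenize n lam g) 0 =
    (\<Sum>u\<in>keys g. if weight u = max_wt n lam g then single u (lookup g u) else 0)"
    unfolding homogenize_alt coeff_sum
    by (rule sum.cong) (use weight_le_max in \<open>auto dest: weight_le_max\<close>)
  also have "\<dots> = initial_form n lam g" unfolding initial_form_alt by (simp add: sum.inter_filter)
  finally show ?thesis .
qed

text \<open>Modulo t a homogenisation becomes the initial form, so both sides are determined by
  their constant coefficients, which form the initial ideal.\<close>

lemma groebner: "groebner_degeneration n lam (toppling_ideal n \<P>) (park_ideal :: 'a::field mpol set)"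
proof -
  let ?K = "{p :: 'a mpol poly. in_Rnt n p \<and> Polynomial.coeff p 0 \<in> park_ideal}"
  let ?t = "genideal (Rnt n) {tvar :: 'a mpol poly}"
  have Kid: "ideal ?K (Rnt n)"
  proof (rule Rnt_ideal_criterion)
    show "x + y \<in> ?K" if "x \<in> ?K" "y \<in> ?K" for x y :: "'a mpol poly"
      using that Rn_idealD(3)[OF park_ideal_ideal, of "Polynomial.coeff x 0" "Polynomial.coeff y 0"]
          in_Rnt_add[of n x y] by simp
    show "r * x \<in> ?K" if "in_Rnt n r" "x \<in> ?K" for r x :: "'a mpol poly"
      using that Rn_idealD(4)[OF park_ideal_ideal, of "Polynomial.coeff r 0" "Polynomial.coeff x 0"]
        in_Rnt_mult[of n r x] by (simp add: coeff_mult in_Rnt_def)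
  qed (use Rn_idealD(2)[OF park_ideal_ideal] in auto)
  have tin: "{tvar :: 'a mpol poly} \<subseteq> {p. in_Rnt n p}" by simp
  have "tvar \<in> ?K" using Rn_idealD(2)[OF park_ideal_ideal] in_Rnt_tvar[of n] by (simp add: tvar_def)
  then have tK: "?t \<subseteq> ?K" by (intro Rnt_genideal(3)[OF tin Kid]) simp
  have IK: "hom_ideal \<subseteq> ?K"
    unfolding homogenized_ideal_def
  proof (rule Rnt_genideal(3)[OF homog_gens_in_Rnt Kid], rule subsetI)
    fix x assume x: "x \<in> {homogenize n lam g | g. g \<in> (toppling_ideal n \<P> :: 'a mpol set) \<and> g \<noteq> 0}"
    then obtain g where g: "x = homogenize n lam g" "g \<in> (toppling_ideal n \<P> :: 'a mpol set)" "g \<noteq> 0" by blast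
    have "initial_form n lam g \<in> initial_ideal n lam (toppling_ideal n \<P> :: 'a mpol set)"
      unfolding initial_ideal_def using Rn_genideal(2)[OF initial_gens_in_Rn] g by blast
    then show "x \<in> ?K" using homog_gens_in_Rnt x coeff_homogenize_0[of g] unfolding initial_ideal_eq g(1)
        by auto
  qed
  have tid: "ideal ?t (Rnt n)" by (rule Rnt_genideal(1)[OF tin])
  have tmul: "tvar * q \<in> ?t" if "in_Rnt n q" for q :: "'a mpol poly"
    using Rnt_idealD(4)[OF tid that, of tvar] Rnt_genideal(2)[OF tin] by (simp add: mult.commute)
  let ?S = "set_add (Rnt n) hom_ideal ?t"
  have Sid: "ideal ?S (Rnt n)"
    by (rule ring.add_ideals[OF cring.axioms(1)[OF Rnt_cring] hom_ideal_ideal tid])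
  have Sdef: "x \<in> ?S \<longleftrightarrow> (\<exists>a\<in>hom_ideal. \<exists>b\<in>?t. x = a + b)" for x by (auto simp: set_add_defs)
  have SI: "x \<in> ?S" if "x \<in> hom_ideal" for x
    unfolding Sdef using that Rnt_idealD(2)[OF tid] by (intro bexI[of _ x] bexI[of _ 0]) auto
  have St: "x \<in> ?S" if "x \<in> ?t" for x
    unfolding Sdef using that Rnt_idealD(2)[OF hom_ideal_ideal] by (intro bexI[of _ 0] bexI[of _ x]) auto
  have split0: "\<exists>q. p = [:Polynomial.coeff p 0:] + tvar * q \<and> (in_Rnt n p \<longrightarrow> in_Rnt n q)" for p
      :: "'a mpol poly"
  proof (cases p)
    case (pCons a q)
    then show ?thesis by (intro exI[of _ q]) (simp add: tvar_def in_Rnt_pCons)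
  qed
  \<comment> \<open>The constants contained in the sum: an ideal of \<open>Rn n\<close> that
    contains all initial forms, hence the parking function ideal.\<close>
  let ?N = "{m :: 'a mpol. in_Rn n m \<and> [:m:] \<in> ?S}"
  have Nid: "ideal ?N (Rn n)"
  proof (rule Rn_ideal_criterion)
    show "x + y \<in> ?N" if "x \<in> ?N" "y \<in> ?N" for x y :: "'a mpol"
      using that Rnt_idealD(3)[OF Sid, of "[:x:]" "[:y:]"] in_Rn_add[of n x y] by simp
    show "r * x \<in> ?N" if "in_Rn n r" "x \<in> ?N" for r x :: "'a mpol"
      using that Rnt_idealD(4)[OF Sid in_Rnt_const[OF that(1)], of "[:x:]"] in_Rn_mult[of n r x]
          by (simp add: mult.commute)
  qed (use Rnt_idealD(2)[OF Sid] in auto)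
  have "initial_ideal n lam (toppling_ideal n \<P> :: 'a mpol set) \<subseteq> ?N"
    unfolding initial_ideal_def
  proof (rule Rn_genideal(3)[OF initial_gens_in_Rn Nid], rule subsetI)
    fix x assume x: "x \<in> {initial_form n lam g | g. g \<in> (toppling_ideal n \<P> :: 'a mpol set) \<and> g \<noteq> 0}"
    then obtain g where g: "x = initial_form n lam g" "g \<in> (toppling_ideal n \<P> :: 'a mpol set)" "g \<noteq> 0"
        by blast
    let ?h = "homogenize n lam g"
    have index_class: "?h \<in> hom_ideal" using homogenize_in_hom_ideal g by blast
    have hT: "in_Rnt n ?h" using Rnt_idealD(1)[OF hom_ideal_ideal index_class] .
    obtain q where q: "?h = [:Polynomial.coeff ?h 0:] + tvar * q" "in_Rnt n q" using split0[of ?h] hT by blast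
    have "[:x:] = ?h + tvar * (- q)" using q(1) unfolding g(1) coeff_homogenize_0 by (simp add: algebra_simps)
    moreover have "?h + tvar * (- q) \<in> ?S"
      using q(2) by (intro Rnt_idealD(3)[OF Sid] SI[OF index_class] St tmul) simp
    ultimately show "x \<in> ?N" using initial_gens_in_Rn x by auto
  qed
  then have MN: "park_ideal \<subseteq> ?N" unfolding initial_ideal_eq .
  have "?S = ?K"
  proof (intro equalityI subsetI)
    fix x assume "x \<in> ?S"
    then obtain a b where ab: "a \<in> hom_ideal" "b \<in> ?t" "x = a + b" using Sdef by blast
    then have "a \<in> ?K" "b \<in> ?K" using IK tK by auto
    then show "x \<in> ?K" unfolding ab(3) by (rule Rnt_idealD(3)[OF Kid])
  next
    fix p assume p: "p \<in> ?K"
    then obtain q where q: "p = [:Polynomial.coeff p 0:] + tvar * q" "in_Rnt n q" using split0[of p] by auto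
    have "[:Polynomial.coeff p 0:] \<in> ?S" using p MN by auto
    then have "[:Polynomial.coeff p 0:] + tvar * q \<in> ?S"
      by (rule Rnt_idealD(3)[OF Sid _ St[OF tmul[OF q(2)]]])
    then show "p \<in> ?S" using q(1) by simp
  qed
  then show ?thesis unfolding groebner_degeneration_def using initial_ideal_eq by simp
qed

end

section \<open>The resolution\<close>

lemma tvar_power: "tvar ^ k = Polynomial.monom (1 :: 'a::comm_ring_1 mpol) k"
  by (simp add: tvar_def monom_altdef)

lemma of_int_monom: "(of_int z :: 'a::comm_ring_1 mpol poly) = Polynomial.monom (single 0 (of_int z)) 0"
  by (simp add: of_int_poly monom_0)

lemma free_module_carrier: "carrier (free_module (Rnt n) B) =
    {v. (\<forall>b\<in>B. in_Rnt n (v b)) \<and> (\<forall>b. b \<notin> B \<longrightarrow> v b = 0) \<and> finite {b. v b \<noteq> 0}}"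
  by (simp add: free_module_def)

lemma free_module_sel [simp]: "zero (free_module (Rnt n) B) = (\<lambda>b. 0)" "add (free_module (Rnt n) B) v w =
    (\<lambda>b. v b + w b)"
  "smult (free_module (Rnt n) B) r v = (\<lambda>b. r * v b)"
  by (simp_all add: free_module_def)

lemma basis_vec_eq: "basis_vec (Rnt n) b b' = (if b' = b then 1 else 0)"
  by (simp add: basis_vec_def)

context signed_parcycle
begin

abbreviation index_class :: "nat set \<times> nat \<Rightarrow> opart set" where "index_class \<equiv> (\<lambda>(A, p). chip_class A p)"

text \<open>Identifies chains of cells with elements of the free module: on the chains supported on
  \<open>cells j\<close> it is a bijection, and for \<open>j \<ge> 1\<close> it turns
  \<open>boundary\<close> into \<open>F_diff\<close>.\<close>

definition cell_vector :: "(cell \<Rightarrow>\<^sub>0 'a::field) \<Rightarrow> opart set \<Rightarrow> 'a mpol poly" where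
  "cell_vector x C = (\<Sum>k\<in>keys x. if index_class (fst k) = C
     then Polynomial.monom (single (fst (snd k)) (lookup x k)) (snd (snd k)) else 0)"

lemma cell_vector_superset:
  assumes "finite S" "keys x \<subseteq> S"
  shows "cell_vector x C = (\<Sum>k\<in>S. if index_class (fst k) = C
     then Polynomial.monom (single (fst (snd k)) (lookup x k)) (snd (snd k)) else 0)"
  unfolding cell_vector_def using assms by (intro sum.mono_neutral_left) (auto simp: in_keys_iff)

lemma cell_vector_0 [simp]: "cell_vector 0 C = 0" by (simp add: cell_vector_def)

lemma cell_vector_single: "cell_vector (single k a) C =
   (if index_class (fst k) = C then Polynomial.monom (single (fst (snd k)) a) (snd (snd k)) else 0)"
  by (subst cell_vector_superset[of "{k}"]) auto

lemma cell_vector_add: "cell_vector (x + y) C = cell_vector x C + cell_vector y C"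
proof -
  let ?S = "keys x \<union> keys y"
  have "keys (x + y) \<subseteq> ?S" by (rule keys_add)
  then show ?thesis
    by (subst (1 2 3) cell_vector_superset[of ?S])
      (auto simp: lookup_add single_add add_monom[symmetric] sum.distrib[symmetric] intro!: sum.cong)
qed

lemma cell_vector_sum: "cell_vector (sum f S) C = (\<Sum>i\<in>S. cell_vector (f i) C)"
  by (induction S rule: infinite_finite_induct) (auto simp: cell_vector_add)

lemma finite_indices: "finite (indices j)"
proof (rule finite_subset)
  show "indices j \<subseteq> Pow cuts \<times> {..j}" by (auto simp: indices_def split: if_splits)
  show "finite (Pow cuts \<times> {..j})" using finite_cuts by simp
qed

lemma finite_F_basis: "finite (F_basis n \<P> j)"
  unfolding F_basis_eq using finite_indices by simp

text \<open>Different indices give different classes, so no two cells contribute to the same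
  coefficient.\<close>

lemma cell_vector_coeff:
  assumes "keys x \<subseteq> cells j" "I \<in> indices j"
  shows "lookup (Polynomial.coeff (cell_vector x (index_class I)) s) u = lookup x (I, u, s)"
proof -
  have "lookup (Polynomial.coeff (cell_vector x (index_class I)) s) u =
    (\<Sum>k\<in>keys x. if k = (I, u, s) then lookup x k else 0)"
    unfolding cell_vector_def coeff_sum lookup_sum
  proof (rule sum.cong)
    fix k assume k: "k \<in> keys x"
    obtain J v r where kk: "k = (J, v, r)" by (metis prod.exhaust)
    have "J \<in> indices j" using k assms(1) by (auto simp: kk cells_def)
    then have "index_class J = index_class I \<longleftrightarrow> J = I" using chip_class_inj_on[of j] assms(2)
        by (auto simp only: inj_on_def)
    then show "lookup (Polynomial.coeff (if index_class (fst k) = index_class I then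
        Polynomial.monom (single (fst (snd k)) (lookup x k)) (snd (snd k)) else 0) s) u =
      (if k = (I, u, s) then lookup x k else 0)"
      by (auto simp: kk lookup_single when_def)
  qed simp
  also have "\<dots> = lookup x (I, u, s)" by (simp add: in_keys_iff)
  finally show ?thesis .
qed

lemma cell_vector_outside:
  assumes "keys x \<subseteq> cells j" "C \<notin> F_basis n \<P> j"
  shows "cell_vector x C = 0"
  unfolding cell_vector_def
proof (rule sum.neutral, rule ballI)
  fix k assume "k \<in> keys x"
  then have "fst k \<in> indices j" using assms(1) by (auto simp: cells_def)
  then have "index_class (fst k) \<in> F_basis n \<P> j" unfolding F_basis_eq by (rule imageI)
  then show "(if index_class (fst k) = C then Polynomial.monom (single (fst (snd k)) (lookup x k))
      (snd (snd k)) else 0) = 0"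
    using assms(2) by auto
qed

lemma cell_vector_eq_0:
  assumes "keys x \<subseteq> cells j" "\<And>C. cell_vector x C = 0"
  shows "x = 0"
proof (rule ccontr)
  assume "x \<noteq> 0"
  then obtain k where k: "k \<in> keys x" by (metis keys_eq_empty ex_in_conv)
  obtain I u s where kk: "k = (I, u, s)" by (metis prod.exhaust)
  then have "I \<in> indices j" using k assms(1) by (auto simp: cells_def)
  from cell_vector_coeff[OF assms(1) this, of s u] show False using k assms(2) by (simp add: in_keys_iff kk)
qed

lemma cell_vector_carrier:
  assumes "keys x \<subseteq> cells j"
  shows "cell_vector x \<in> carrier (free_module (Rnt n) (F_basis n \<P> j))"
proof -
  have "in_Rnt n (cell_vector x C)" for C
    unfolding cell_vector_def
  proof (rule in_Rnt_sum)
    fix k assume "k \<in> keys x"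
    then have "k \<in> cells j" using assms by blast
    then have "keys (fst (snd k)) \<subseteq> {1..n}" by (auto simp: cells_def)
    then show "in_Rnt n (if index_class (fst k) = C then Polynomial.monom
        (single (fst (snd k)) (lookup x k)) (snd (snd k)) else 0)"
      by (simp add: in_Rnt_monom in_Rn_single)
  qed
  moreover have "{b. cell_vector x b \<noteq> 0} \<subseteq> F_basis n \<P> j" using cell_vector_outside[OF assms] by blast
  ultimately show ?thesis unfolding free_module_carrier
    using cell_vector_outside[OF assms] finite_subset[OF _ finite_F_basis] by blast
qed

lemma cell_vector_surj:
  assumes v: "v \<in> carrier (free_module (Rnt n) (F_basis n \<P> j))"
  obtains x where "keys x \<subseteq> cells j" "cell_vector x = (v :: opart set \<Rightarrow> 'a::field mpol poly)"
proof -
  have v1: "in_Rnt n (v (index_class I))" if "I \<in> indices j" for I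
  proof -
    have "index_class I \<in> F_basis n \<P> j" unfolding F_basis_eq using that by (rule imageI)
    then show ?thesis using v unfolding free_module_carrier by blast
  qed
  define f :: "cell \<Rightarrow> 'a" where "f k = (if fst k \<in> indices j then
    lookup (Polynomial.coeff (v (index_class (fst k))) (snd (snd k))) (fst (snd k)) else 0)" for k
  let ?S = "\<Union>I\<in>indices j. \<Union>s\<in>{..Polynomial.degree (v (index_class I))}. (\<lambda>u. (I, u, s)) ` keys
      (Polynomial.coeff (v (index_class I)) s)"
  have sub: "{k. f k \<noteq> 0} \<subseteq> ?S"
  proof
    fix k assume k: "k \<in> {k. f k \<noteq> 0}"
    obtain I u s where kk: "k = (I, u, s)" by (metis prod.exhaust)
    have I: "I \<in> indices j" and l: "lookup (Polynomial.coeff (v (index_class I)) s) u \<noteq> 0"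
      using k by (auto simp: f_def kk split: if_splits)
    then have "Polynomial.coeff (v (index_class I)) s \<noteq> 0" by auto
    then have "s \<le> Polynomial.degree (v (index_class I))" by (rule le_degree)
    then show "k \<in> ?S" using I l unfolding kk by (force simp: in_keys_iff)
  qed
  have "finite {k. f k \<noteq> 0}" by (rule finite_subset[OF sub]) (use finite_indices in simp)
  then have l: "lookup (Abs_poly_mapping f) = f" by (rule lookup_Abs_poly_mapping)
  let ?x = "Abs_poly_mapping f"
  have kx: "keys ?x \<subseteq> cells j"
  proof
    fix k assume "k \<in> keys ?x"
    then have "f k \<noteq> 0" by (simp add: in_keys_iff l)
    moreover obtain I u s where kk: "k = (I, u, s)" by (metis prod.exhaust)
    ultimately have I: "I \<in> indices j" and "u \<in> keys (Polynomial.coeff (v (index_class I)) s)"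
      by (auto simp: f_def in_keys_iff split: if_splits)
    then show "k \<in> cells j" using v1[OF I] by (auto simp: kk cells_def in_Rnt_def in_Rn_def)
  qed
  moreover have "cell_vector ?x = v"
  proof
    fix C
    show "cell_vector ?x C = v C"
    proof (cases "C \<in> F_basis n \<P> j")
      case True
      then obtain I where I: "I \<in> indices j" "C = index_class I" unfolding F_basis_eq by blast
      show ?thesis unfolding I(2)
        by (rule poly_eqI, rule poly_mapping_eqI) (simp only: cell_vector_coeff[OF kx I(1)], simp add: l
            f_def I(1))
    next
      case False
      then show ?thesis using cell_vector_outside[OF kx False] v unfolding free_module_carrier by simp
    qed
  qed
  ultimately show thesis by (rule that)
qed

text \<open>The three weights in the exponent of t are those of \<open>t_exp_weight\<close>, so
  \<open>nat\<close> does not truncate and the exponent is \<open>t_exp\<close>.\<close>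

lemma F_coeff_eq:
  assumes I: "(A, p) \<in> indices j" "j \<ge> 1" and q: "q \<in> A" "may_contract A p d"
  shows "F_coeff n V \<P> sg lam (chip_class A p) (cut_edge A q d) =
    Polynomial.monom (single (edge_exp A q d) (of_int (sg (chip_class A p) (cut_edge A q d)) :: 'a::field))
        (t_exp A p q d)"
proof -
  have A: "A \<subseteq> cuts" "1 \<le> p" "p < card A" using indicesD[OF I] by auto
  have e1: "class_eps n lam V (chip_class A p) = weight (index_exp (A, p))"
    using class_eps_chip_class[OF A] by (simp add: weight_def index_exp_def lookup_cut_exp)
  have e2: "class_eps n lam V (contract_class n \<P> (chip_class A p) (cut_edge A q d)) =
      weight (index_exp (target_index A p q d))"
  proof (cases "card A = 2")
    case True
    then show ?thesis unfolding contract_class_chip_class[OF A q] using class_eps_triv_opart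
        by (simp add: target_index_def index_exp_def)
  next
    case False
    have "target_index A p q d \<in> indices (j - 1)" using target_index_indices[OF I q] .
    moreover have "j - 1 \<ge> 1" using indicesD[OF I] False A by auto
    ultimately have "A - {q} \<subseteq> cuts" "1 \<le> (if d then p - 1 else p)" "(if d then p - 1 else p)
        < card (A - {q})"
      using indicesD[of "A - {q}" "if d then p - 1 else p" "j - 1"] False by (auto simp: target_index_def)
    from class_eps_chip_class[OF this, of lam] show ?thesis unfolding contract_class_chip_class[OF A q]
      using False by (simp add: target_index_def weight_def index_exp_def lookup_cut_exp)
  qed
  have c2: "2 \<le> card A" using A by simp
  have e3: "wt n lam (edge_exponent n (cut_edge A q d)) = weight (edge_exp A q d)"
    using lookup_edge_exp[OF A(1) c2 q(1), of d] by (simp add: weight_def)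
  have t: "nat (int (class_eps n lam V (chip_class A p))
      - int (class_eps n lam V (contract_class n \<P> (chip_class A p) (cut_edge A q d)))
                  - int (wt n lam (edge_exponent n (cut_edge A q d)))) = t_exp A p q d"
    unfolding e1 e2 e3 using t_exp_weight[OF A q] by simp
  have x: "xmon n (edge_exponent n (cut_edge A q d)) = (single (edge_exp A q d) 1 :: 'a mpol)"
    unfolding lookup_edge_exp[OF A(1) c2 q(1), symmetric] by (rule xmon_lookup[OF keys_edge_exp])
  have m: "of_int z * Polynomial.monom 1 k * [:single w 1:] =
      Polynomial.monom (single w (of_int z :: 'a)) k" for z k and w :: "nat \<Rightarrow>\<^sub>0 nat"
  proof -
    show ?thesis unfolding of_int_monom monom_0[symmetric] mult_monom mult_1_right mult_single by simp
  qed
  show ?thesis unfolding F_coeff_def t x tvar_power by (rule m)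
qed

lemma F_diff_add: "F_diff n V \<P> sg lam j (\<lambda>c. v c + w c) c' = F_diff n V \<P> sg lam j v c' + F_diff n V \<P> sg
    lam j w c'"
  by (simp add: F_diff_def distrib_right sum.distrib)

lemma F_diff_smult: "F_diff n V \<P> sg lam j (\<lambda>c. r * v c) c' = r * F_diff n V \<P> sg lam j v c'"
  by (simp add: F_diff_def sum_distrib_left mult.assoc)

lemma F_diff_0: "F_diff n V \<P> sg lam j (\<lambda>c. 0) c' = 0"
  by (simp add: F_diff_def)

lemma F_diff_sum: "F_diff n V \<P> sg lam j (\<lambda>c. \<Sum>i\<in>S. v i c) c' = (\<Sum>i\<in>S. F_diff n V \<P> sg lam j (v i) c')"
  by (induction S rule: infinite_finite_induct) (auto simp: F_diff_add F_diff_0)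

lemma F_diff_single:
  assumes k: "((A, p), u, s) \<in> cells j" and j: "j \<ge> 1"
  shows "F_diff n V \<P> sg lam j (cell_vector (single ((A, p), u, s) (a :: 'a::field))) C' =
    cell_vector (boundary cell_contractions cell_sign cell_target (single ((A, p), u, s) a)) C'"
proof -
  have I: "(A, p) \<in> indices j" using k by (auto simp: cells_def)
  have A: "A \<subseteq> cuts" "1 \<le> p" "p < card A" using indicesD[OF I j] by auto
  have b: "chip_class A p \<in> F_basis n \<P> j" unfolding F_basis_eq using I by force
  let ?m = "Polynomial.monom (single u a) s"
  let ?S = "\<lambda>c. (\<Sum>f\<in>contractible_edges n \<P> c. F_coeff n V \<P> sg lam c f * basis_vec (Rnt n)
      (contract_class n \<P> c f) C') :: 'a mpol poly"
  have "F_diff n V \<P> sg lam j (cell_vector (single ((A, p), u, s) a)) C' =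
     (\<Sum>c\<in>F_basis n \<P> j. if c = chip_class A p then ?m * ?S (chip_class A p) else 0)"
    unfolding F_diff_def by (intro sum.cong) (auto simp: cell_vector_single)
  also have "\<dots> = ?m * ?S (chip_class A p)" using b finite_F_basis by (simp add: sum.delta)
  also have "\<dots> = (\<Sum>(q, d)\<in>contractions (A, p). ?m * (F_coeff n V \<P> sg lam (chip_class A p) (cut_edge A q d)
      * basis_vec (Rnt n) (contract_class n \<P> (chip_class A p) (cut_edge A q d)) C'))"
    unfolding contractions_contractible(1)[OF A] sum.reindex[OF contractions_contractible(2)[OF A]]
        sum_distrib_left
    by (simp add: case_prod_unfold)
  also have "\<dots> = (\<Sum>f\<in>contractions (A, p). cell_vector (single (cell_target ((A, p), u, s) f)
      (a * cell_sign ((A, p), u, s) f)) C')"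
  proof (rule sum.cong)
    fix f assume f: "f \<in> contractions (A, p)"
    obtain q d where qd: "f = (q, d)" by force
    then have q: "q \<in> A" "may_contract A p d" using f contractions_may_contract by auto
    show "(case f of (q, d) \<Rightarrow> ?m * (F_coeff n V \<P> sg lam (chip_class A p) (cut_edge A q d) * basis_vec
        (Rnt n) (contract_class n \<P> (chip_class A p) (cut_edge A q d)) C')) =
       cell_vector (single (cell_target ((A, p), u, s) f) (a * cell_sign ((A, p), u, s) f)) C'"
      unfolding qd prod.case F_coeff_eq[OF I j q] contract_class_chip_class[OF A q] cell_vector_single
          basis_vec_eq
      by (auto simp: cell_target_def cell_sign_def mult_monom mult_single)
  qed simp
  also have "\<dots> = cell_vector (boundary cell_contractions cell_sign cell_target (single ((A, p), u, s) a)) C'"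
    by (simp add: boundary_single cell_vector_sum cell_contractions_def)
  finally show ?thesis .
qed

lemma F_diff_cell_vector:
  assumes "keys x \<subseteq> cells j" "j \<ge> 1"
  shows "F_diff n V \<P> sg lam j (cell_vector (x :: cell \<Rightarrow>\<^sub>0 'a::field)) =
      cell_vector (boundary cell_contractions cell_sign cell_target x)"
proof
  fix C'
  let ?s = "\<lambda>k. single k (lookup x k)"
  have "cell_vector x = (\<lambda>C. \<Sum>k\<in>keys x. cell_vector (?s k) C)"
    by (rule ext, subst (1) poly_mapping_sum_single) (rule cell_vector_sum)
  then have "F_diff n V \<P> sg lam j (cell_vector x) C' =
      (\<Sum>k\<in>keys x. F_diff n V \<P> sg lam j (cell_vector (?s k)) C')"
    by (simp only: F_diff_sum)
  also have "\<dots> = (\<Sum>k\<in>keys x. cell_vector (boundary cell_contractions cell_sign cell_target (?s k)) C')"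
  proof (rule sum.cong)
    fix k assume "k \<in> keys x"
    moreover obtain A p u s where "k = ((A, p), u, s)" by (metis prod.exhaust)
    ultimately show "F_diff n V \<P> sg lam j (cell_vector (?s k)) C' =
        cell_vector (boundary cell_contractions cell_sign cell_target (?s k)) C'"
      using F_diff_single[of A p u s j] assms by auto
  qed simp
  also have "\<dots> = cell_vector (boundary cell_contractions cell_sign cell_target x) C'"
    by (subst (4) poly_mapping_sum_single) (simp only: boundary_sum cell_vector_sum)
  finally show "F_diff n V \<P> sg lam j (cell_vector x) C' = cell_vector (boundary cell_contractions cell_sign
      cell_target x) C'" .
qed

end

context signed_parcycle
begin

section \<open>Degree one and its image in the polynomial ring\<close>

definition triv_class :: "opart set" where "triv_class = chip_class {} 0"

lemma F_basis_0: "F_basis n \<P> 0 = {triv_class}"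
  unfolding F_basis_eq by (simp add: indices_def triv_class_def)

lemma pair_class:
  assumes "c \<in> F_basis n \<P> 1"
  obtains i j where "i < j" "i \<in> cuts" "j \<in> cuts" "c = chip_class {i, j} 1" "({i, j}, 1) \<in> indices 1"
proof -
  obtain A p where A: "(A, p) \<in> indices 1" "c = chip_class A p" using assms unfolding F_basis_eq by auto
  then have "A \<subseteq> cuts" "card A = 2" "p = 1" by (auto simp: indices_def)
  moreover from \<open>card A = 2\<close> obtain x y where "A = {x, y}" "x \<noteq> y" by (auto simp: card_2_iff)
  then obtain i j where "A = {i, j}" "i < j" by (metis insert_commute linorder_neqE_nat)
  ultimately show thesis using that[of i j] A by auto
qed

text \<open>With two cuts the class has two contractible edges, reverse to each other, and sign rule
  (ii) gives them opposite signs. The clockwise edge at \<open>j\<close> belongs to the sink-acyclic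
  orientation and carries no t, so the two terms are those of a homogenised minor.\<close>

lemma boundary_pair:
  assumes ij: "i < j" "i \<in> cuts" "j \<in> cuts" and I: "({i, j}, 1) \<in> indices 1"
  shows "(\<Sum>f\<in>contractible_edges n \<P> (chip_class {i, j} 1). F_coeff n V \<P> sg lam (chip_class {i, j} 1) f *
      basis_vec (Rnt n) (contract_class n \<P> (chip_class {i, j} 1) f) triv_class)
    = of_int (sg (chip_class {i, j} 1) (cut_edge {i, j} j True)) * homogenize n lam
        (minor i j :: 'a::field mpol)"
proof -
  let ?A = "{i, j}" and ?c = "chip_class {i, j} 1"
  have A: "?A \<subseteq> cuts" "1 \<le> (1::nat)" "1 < card ?A" using ij by auto
  have An: "?A \<subseteq> {..<n}" using cuts_sub_lt A by blast
  have c2: "card ?A = 2" using ij by simp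
  have ok: "may_contract ?A 1 d" for d using c2 by (simp add: may_contract_def)
  have tm: "contractions (?A, 1) = {(i, True), (j, True)}" using c2 by (auto simp: contractions_def)
  have exi: "edge_exp ?A i True = pair_exp j i" and exj: "edge_exp ?A j True = pair_exp i j"
    using c2 cut_exp_pair[of i j] ij by (simp_all add: edge_exp_def)
  have tei: "t_exp ?A 1 i True = weight (pair_exp i j) - weight (pair_exp j i)" and tej: "t_exp ?A 1 j True
      = 0"
    using c2 cut_exp_pair[of i j] top_cuts_pair[OF ij(1)] ij by (simp_all add: t_exp_def reached_set_def)
  let ?fi = "cut_edge ?A i True" and ?fj = "cut_edge ?A j True"
  have cc: "contract_class n \<P> ?c (cut_edge ?A q True) = triv_class" if "q \<in> ?A" for q
    using contract_class_chip_class[OF A that ok] c2 by (simp add: target_index_def triv_class_def)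
  have ne: "?fi \<noteq> ?fj" using cut_edge_dir_inj[OF An, of i j True] ij by auto
  have CE: "contractible_edges n \<P> ?c = {?fi, ?fj}"
    unfolding contractions_contractible(1)[OF A] tm by simp
  have "?fj = cut_edge ?A i False" using cut_edge_two[OF An, of i j False] ij by auto
  then have sw: "?fj = (snd ?fi, fst ?fi)" by (simp add: cut_edge_def)
  have "\<forall>U W. (U, W) \<in> contractible_edges n \<P> ?c \<and> (W, U) \<in> contractible_edges n \<P> ?c \<longrightarrow> sg ?c (U, W) =
      - sg ?c (W, U)"
    using signs chip_class_in_classes[OF A] unfolding valid_signs_def by blast
  then have si: "sg ?c ?fi = - sg ?c ?fj" using CE sw by (metis insertI1 insertI2 prod.collapse)
  define z where "z = sg ?c ?fj"
  have "(\<Sum>f\<in>contractible_edges n \<P> ?c. F_coeff n V \<P> sg lam ?c f * basis_vec (Rnt n)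
      (contract_class n \<P> ?c f) triv_class)
    = F_coeff n V \<P> sg lam ?c ?fi + F_coeff n V \<P> sg lam ?c ?fj"
    unfolding CE using ne cc by (simp add: basis_vec_eq)
  also have "\<dots> = Polynomial.monom (single (pair_exp j i) (of_int (- z))) (weight (pair_exp i j) - weight
      (pair_exp j i)) +
      Polynomial.monom (single (pair_exp i j) (of_int z :: 'a)) 0"
    using F_coeff_eq[OF I _ _ ok, of i True, where 'a = 'a] F_coeff_eq[OF I _ _ ok, of j True, where 'a = 'a]
    unfolding exi exj tei tej si z_def by simp
  also have "\<dots> = of_int z * homogenize n lam (minor i j :: 'a mpol)"
    unfolding minor_props(4)[OF ij] of_int_monom right_diff_distrib mult_monom mult_single
    by (simp add: single_uminus minus_monom[symmetric])
  finally show ?thesis unfolding z_def .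
qed

lemma in_Rnt_of_int: "in_Rnt n (of_int z :: 'a::comm_ring_1 mpol poly)"
  unfolding of_int_monom by (rule in_Rnt_monom[OF in_Rn_single]) simp

lemma F_diff_hom_ideal:
  assumes "v \<in> carrier (free_module (Rnt n) (F_basis n \<P> 1))"
  shows "F_diff n V \<P> sg lam 1 v triv_class \<in> (hom_ideal :: 'a::field mpol poly set)"
  unfolding F_diff_def
proof (rule Rnt_ideal_sum[OF hom_ideal_ideal])
  fix c assume c: "c \<in> F_basis n \<P> 1"
  then obtain i j where ij: "i < j" "i \<in> cuts" "j \<in> cuts" "c = chip_class {i, j} 1"
      "({i, j}, 1) \<in> indices 1" by (rule pair_class)
  have "in_Rnt n (v c)" using assms c unfolding free_module_carrier by blast
  then show "v c * (\<Sum>f\<in>contractible_edges n \<P> c. F_coeff n V \<P> sg lam c f * basis_vec (Rnt n)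
      (contract_class n \<P> c f) triv_class) \<in> (hom_ideal :: 'a mpol poly set)"
    unfolding ij(4) boundary_pair[OF ij(1-3,5)]
    by (intro Rnt_idealD(4)[OF hom_ideal_ideal] in_Rnt_of_int homogenize_in_hom_ideal
        minor_props(1,2)[OF ij(1-3)])
qed

text \<open>Two congruent monomials outside the parking function ideal are equal, since otherwise
  each would be lighter than the other. So the functional that indicates the class and the total
  weight of one term of \<open>z\<close> picks out its coefficient.\<close>

lemma std_hom_ideal_0:
  assumes z: "keys z \<subseteq> tails 0" and p: "cell_vector z triv_class \<in> (hom_ideal :: 'a::field mpol poly set)"
  shows "z = 0"
proof (rule ccontr)
  assume "z \<noteq> 0"
  then obtain k where k: "k \<in> keys z" by (metis keys_eq_empty ex_in_conv)
  have T: "\<exists>u s. k = (({}, 0), u, s) \<and> keys u \<subseteq> {1..n} \<and> \<not> in_parking u" if "k \<in> keys z" for k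
    using z that by (auto simp: tails_def indices_def)
  obtain u0 s0 where k0: "k = (({}, 0), u0, s0)" "keys u0 \<subseteq> {1..n}" "\<not> in_parking u0" using T[OF k] by blast
  define \<phi> :: "(nat \<Rightarrow>\<^sub>0 nat) \<Rightarrow> int \<Rightarrow> 'a" where "\<phi> u s = of_bool (lattice_eq u u0 \<and> int (weight u) + s =
      int (weight u0) + int s0)" for u s
  have ev: "lattice_eq v u0 \<longleftrightarrow> lattice_eq w u0" if "lattice_eq v w" for v w
    using lattice_eq_trans[OF that, of u0] lattice_eq_trans[OF lattice_eq_sym[OF that], of u0] by blast
  have "weight_inv \<phi>" unfolding weight_inv_def
  proof (intro allI impI)
    fix u v s r assume "lattice_eq u v \<and> int (weight u) + s = int (weight v) + r"
    then show "\<phi> u s = \<phi> v r" using ev[of u v] unfolding \<phi>_def by simp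
  qed
  then have "tpairing (cell_vector z triv_class) \<phi> = 0" by (rule hom_ideal_tpairing[OF p])
  moreover have "tpairing (cell_vector z triv_class) \<phi> = (\<Sum>l\<in>keys z. if l = k then lookup z k else 0)"
    unfolding cell_vector_def tpairing_sum
  proof (rule sum.cong)
    fix l assume l: "l \<in> keys z"
    obtain u s where us: "l = (({}, 0), u, s)" "keys u \<subseteq> {1..n}" "\<not> in_parking u" using T[OF l] by blast
    have "\<phi> u (int s) = of_bool (l = k)"
    proof (cases "lattice_eq u u0")
      case True
      have "u = u0"
      proof (rule ccontr)
        assume "u \<noteq> u0"
        then show False using std_less[OF True k0(3)] std_less[OF lattice_eq_sym[OF True] us(3)] by force
      qed
      then show ?thesis using True by (auto simp: \<phi>_def us k0)
    next
      case False
      then have "u \<noteq> u0" using lattice_eq_refl[OF k0(2)] by auto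
      then show ?thesis using False by (simp add: \<phi>_def us k0)
    qed
    then show "tpairing (if index_class (fst l) = triv_class then Polynomial.monom
        (single (fst (snd l)) (lookup z l)) (snd (snd l)) else 0) \<phi>
      = (if l = k then lookup z k else 0)"
      by (auto simp: us(1) triv_class_def tpairing_monom)
  qed simp
  ultimately show False using k by (simp add: in_keys_iff)
qed

text \<open>Reducing an element of the ideal modulo boundaries leaves a combination of monomials
  outside the parking function ideal times powers of t, still in the homogenised ideal and hence
  zero. In particular the homogenised minors generate this ideal.\<close>

lemma image_F1:
  "(\<lambda>v. F_diff n V \<P> sg lam 1 v triv_class) ` carrier (free_module (Rnt n) (F_basis n \<P> 1)) =
      (hom_ideal :: 'a::field mpol poly set)"
proof (intro equalityI subsetI)
  fix p :: "'a mpol poly" assume "p \<in> (\<lambda>v. F_diff n V \<P> sg lam 1 v triv_class) ` carrier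
      (free_module (Rnt n) (F_basis n \<P> 1))"
  then show "p \<in> (hom_ideal :: 'a mpol poly set)" using F_diff_hom_ideal by blast
next
  interpret M: morse_matching cells tails cell_contractions "cell_sign :: cell \<Rightarrow> nat \<times> bool \<Rightarrow> 'a"
      cell_target lead cell_rank by (rule morse)
  fix p :: "'a mpol poly" assume p: "p \<in> hom_ideal"
  then have pT: "in_Rnt n p" by (rule Rnt_idealD(1)[OF hom_ideal_ideal])
  have "(\<lambda>C. if C = triv_class then p else 0) \<in> carrier (free_module (Rnt n) (F_basis n \<P> 0))"
    unfolding free_module_carrier F_basis_0 using pT by auto
  then obtain x where x: "keys x \<subseteq> cells 0" "cell_vector x = (\<lambda>C. if C = triv_class then p else 0)"
      by (rule cell_vector_surj)
  obtain y where y: "keys y \<subseteq> cells 1" "keys (x - boundary cell_contractions cell_sign cell_target y) \<subseteq>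
      tails 0"
    using M.reduce[OF x(1)] by auto
  let ?z = "x - boundary cell_contractions cell_sign cell_target y"
  have Fy: "F_diff n V \<P> sg lam 1 (cell_vector y) = cell_vector (boundary cell_contractions cell_sign
      cell_target y)" using F_diff_cell_vector[OF y(1)] by simp
  have yc: "cell_vector y \<in> carrier (free_module (Rnt n) (F_basis n \<P> 1))"
      by (rule cell_vector_carrier[OF y(1)])
  have "cell_vector ?z triv_class + cell_vector (boundary cell_contractions cell_sign cell_target y)
      triv_class = p"
    unfolding cell_vector_add[symmetric] using x(2) by simp
  then have e: "cell_vector ?z triv_class = p + (- 1) * F_diff n V \<P> sg lam 1 (cell_vector y) triv_class"
      unfolding Fy by (simp add: algebra_simps)
  have "cell_vector ?z triv_class \<in> hom_ideal" unfolding e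
    by (intro Rnt_idealD(3)[OF hom_ideal_ideal p] Rnt_idealD(4)[OF hom_ideal_ideal _
        F_diff_hom_ideal[OF yc]]) simp
  then have "?z = 0" by (rule std_hom_ideal_0[OF y(2)])
  then have "cell_vector (boundary cell_contractions cell_sign cell_target y) triv_class = p" using x(2)
      by (simp add: fun_eq_iff)
  then show "p \<in> (\<lambda>v. F_diff n V \<P> sg lam 1 v triv_class) ` carrier (free_module (Rnt n) (F_basis n \<P> 1))"
    using yc Fy by (metis image_eqI)
qed

lemma F_diff_carrier:
  assumes "j \<ge> 1" "v \<in> carrier (free_module (Rnt n) (F_basis n \<P> j))"
  shows "F_diff n V \<P> sg lam j v \<in> carrier (free_module (Rnt n) (F_basis n \<P> (j - 1))
      :: (_, _ \<Rightarrow> 'a::field mpol poly) module)"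
proof -
  interpret M: morse_matching cells tails cell_contractions "cell_sign :: cell \<Rightarrow> nat \<times> bool \<Rightarrow> 'a"
      cell_target lead cell_rank by (rule morse)
  obtain x where x: "keys x \<subseteq> cells j" "cell_vector x = v" using assms(2) by (rule cell_vector_surj)
  have "keys (boundary cell_contractions cell_sign cell_target x :: cell \<Rightarrow>\<^sub>0 'a) \<subseteq> cells (j - 1)"
    by (rule boundary_keys[OF x(1)]) (use M.tgB[OF assms(1)] in blast)
  from cell_vector_carrier[OF this] show ?thesis using F_diff_cell_vector[OF x(1) assms(1)] unfolding x(2)
      by simp
qed

lemma F_diff_hom:
  assumes "j \<ge> 1"
  shows "F_diff n V \<P> sg lam j \<in> mod_hom (Rnt n :: 'a::field mpol poly ring)
      (free_module (Rnt n) (F_basis n \<P> j)) (free_module (Rnt n) (F_basis n \<P> (j - 1)))"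
  unfolding mod_hom_def using F_diff_carrier[OF assms] by (auto simp: F_diff_add F_diff_smult fun_eq_iff)

lemma F_exact:
  assumes j: "j \<ge> 1"
  shows "F_diff n V \<P> sg lam (j + 1) ` carrier (free_module (Rnt n :: 'a::field mpol poly ring)
      (F_basis n \<P> (j + 1))) =
       a_kernel (free_module (Rnt n) (F_basis n \<P> j)) (free_module (Rnt n) (F_basis n \<P> (j - 1)))
           (F_diff n V \<P> sg lam j)"
proof (intro equalityI subsetI)
  interpret M: morse_matching cells tails cell_contractions "cell_sign :: cell \<Rightarrow> nat \<times> bool \<Rightarrow> 'a"
      cell_target lead cell_rank by (rule morse)
  note tg = M.tgB[of "j + 1", simplified]
  fix w assume "w \<in> F_diff n V \<P> sg lam (j + 1) ` carrier (free_module (Rnt n :: 'a mpol poly ring)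
      (F_basis n \<P> (j + 1)))"
  then obtain v where v: "v \<in> carrier (free_module (Rnt n :: 'a mpol poly ring) (F_basis n \<P> (j + 1)))"
      "w = F_diff n V \<P> sg lam (j + 1) v" by blast
  obtain x where x: "keys x \<subseteq> cells (j + 1)" "cell_vector x = v" using v(1) by (rule cell_vector_surj)
  have w: "w = cell_vector (boundary cell_contractions cell_sign cell_target x)" using
      F_diff_cell_vector[OF x(1)] v(2) x(2) by simp
  have k: "keys (boundary cell_contractions cell_sign cell_target x :: cell \<Rightarrow>\<^sub>0 'a) \<subseteq> cells j"
    by (rule boundary_keys[OF x(1)]) (use tg in auto)
  have "F_diff n V \<P> sg lam j w = cell_vector (boundary cell_contractions cell_sign cell_target
      (boundary cell_contractions cell_sign cell_target x))"
    unfolding w by (rule F_diff_cell_vector[OF k j])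
  also have "boundary cell_contractions cell_sign cell_target (boundary cell_contractions cell_sign
      cell_target x) = 0" using M.bdm_bdm[OF x(1)] j by simp
  finally have "F_diff n V \<P> sg lam j w = (\<lambda>b. 0)" by (simp add: fun_eq_iff)
  then show "w \<in> a_kernel (free_module (Rnt n) (F_basis n \<P> j)) (free_module (Rnt n) (F_basis n \<P> (j - 1)))
      (F_diff n V \<P> sg lam j)"
    unfolding a_kernel_def' using cell_vector_carrier[OF k] w by simp
next
  interpret M: morse_matching cells tails cell_contractions "cell_sign :: cell \<Rightarrow> nat \<times> bool \<Rightarrow> 'a"
      cell_target lead cell_rank by (rule morse)
  fix w assume "w \<in> a_kernel (free_module (Rnt n :: 'a mpol poly ring) (F_basis n \<P> j))
      (free_module (Rnt n) (F_basis n \<P> (j - 1))) (F_diff n V \<P> sg lam j)"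
  then have w: "w \<in> carrier (free_module (Rnt n :: 'a mpol poly ring) (F_basis n \<P> j))"
      "F_diff n V \<P> sg lam j w = (\<lambda>b. 0)"
    unfolding a_kernel_def' by simp_all
  obtain x where x: "keys x \<subseteq> cells j" "cell_vector x = w" using w(1) by (rule cell_vector_surj)
  have k: "keys (boundary cell_contractions cell_sign cell_target x :: cell \<Rightarrow>\<^sub>0 'a) \<subseteq> cells (j - 1)"
    by (rule boundary_keys[OF x(1)]) (use M.tgB[OF j] in blast)
  have "cell_vector (boundary cell_contractions cell_sign cell_target x) = (\<lambda>b. 0)" using
      F_diff_cell_vector[OF x(1) j] x(2) w(2) by simp
  then have "boundary cell_contractions cell_sign cell_target x = 0" by (intro cell_vector_eq_0[OF k])
      (simp add: fun_eq_iff)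
  then obtain y where y: "keys y \<subseteq> cells (Suc j)" "x = boundary cell_contractions cell_sign cell_target y"
      using M.exact[OF x(1) j] by blast
  then have "w = F_diff n V \<P> sg lam (j + 1) (cell_vector y)" using F_diff_cell_vector[of y "Suc j"] x(2)
      by simp
  then show "w \<in> F_diff n V \<P> sg lam (j + 1) ` carrier (free_module (Rnt n :: 'a mpol poly ring)
      (F_basis n \<P> (j + 1)))"
    using cell_vector_carrier[OF y(1)] by auto
qed

text \<open>The free module in degree 0 has rank one, so the augmentation is its only coordinate,
  taken modulo the ideal.\<close>

lemma F_resolution:
  "free_resolution (Rnt n) (F_basis n \<P>) (F_diff n V \<P> sg lam)
      (quotient_module (Rnt n) (hom_ideal :: 'a::field mpol poly set))"
proof -
  interpret I: ideal "hom_ideal :: 'a mpol poly set" "Rnt n" by (rule hom_ideal_ideal)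
  let ?N = "quotient_module (Rnt n) (hom_ideal :: 'a mpol poly set)"
  let ?F = "\<lambda>j. free_module (Rnt n :: 'a mpol poly ring) (F_basis n \<P> j)"
  define aug where "aug v = hom_ideal +>\<^bsub>Rnt n\<^esub> v triv_class" for v :: "opart set \<Rightarrow> 'a mpol poly"
  note hom = I.rcos_ring_hom
  have vc: "v triv_class \<in> carrier (Rnt n)" if "v \<in> carrier (?F 0)" for v
    using that unfolding free_module_carrier F_basis_0 by simp
  have Nsel: "carrier ?N = carrier (Rnt n Quot hom_ideal)" "add ?N = add (Rnt n Quot hom_ideal)" "zero ?N =
      zero (Rnt n Quot hom_ideal)"
    "smult ?N = (\<lambda>r A. (hom_ideal +>\<^bsub>Rnt n\<^esub> r) \<otimes>\<^bsub>Rnt n Quot hom_ideal\<^esub> A)"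
    by (simp_all add: quotient_module_def)
  have augh: "aug \<in> mod_hom (Rnt n) (?F 0) ?N"
    unfolding mod_hom_def
  proof (intro CollectI conjI ballI funcsetI)
    fix x assume x: "x \<in> carrier (?F 0)"
    show "aug x \<in> carrier ?N" unfolding Nsel aug_def using ring_hom_closed[OF hom vc[OF x]] .
    fix y assume y: "y \<in> carrier (?F 0)"
    show "aug (x \<oplus>\<^bsub>?F 0\<^esub> y) = aug x \<oplus>\<^bsub>?N\<^esub> aug y"
      unfolding Nsel aug_def using ring_hom_add[OF hom vc[OF x] vc[OF y]] by simp
  next
    fix r :: "'a mpol poly" and x assume r: "r \<in> carrier (Rnt n)" and x: "x \<in> carrier (?F 0)"
    show "aug (r \<odot>\<^bsub>?F 0\<^esub> x) = r \<odot>\<^bsub>?N\<^esub> aug x"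
      unfolding Nsel aug_def using ring_hom_mult[OF hom r vc[OF x]] by simp
  qed
  have surj: "aug ` carrier (?F 0) = carrier ?N"
  proof (intro equalityI subsetI)
    fix B assume "B \<in> aug ` carrier (?F 0)"
    then show "B \<in> carrier ?N" using augh unfolding mod_hom_def by auto
  next
    fix B assume "B \<in> carrier ?N"
    then obtain r where r: "r \<in> carrier (Rnt n)" "B = hom_ideal +>\<^bsub>Rnt n\<^esub> r"
      unfolding Nsel FactRing_def A_RCOSETS_def' by auto
    have "(\<lambda>C. if C = triv_class then r else 0) \<in> carrier (?F 0)"
      unfolding free_module_carrier F_basis_0 using r by auto
    moreover have "aug (\<lambda>C. if C = triv_class then r else 0) = B" by (simp add: aug_def r(2))
    ultimately show "B \<in> aug ` carrier (?F 0)" by blast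
  qed
  have ker: "F_diff n V \<P> sg lam 1 ` carrier (?F 1) = a_kernel (?F 0) ?N aug"
  proof -
    have K: "a_kernel (?F 0) ?N aug = {v \<in> carrier (?F 0). v triv_class \<in> hom_ideal}"
    proof -
      have "aug v = zero ?N \<longleftrightarrow> v triv_class \<in> hom_ideal" if "v \<in> carrier (?F 0)" for v
        unfolding aug_def Nsel FactRing_def
        using I.rcos_const_imp_mem[OF vc[OF that]] I.a_rcos_zero[OF hom_ideal_ideal, of "v triv_class"]
            by auto
      then show ?thesis unfolding a_kernel_def' by blast
    qed
    show ?thesis unfolding K
    proof (intro equalityI subsetI)
      fix w assume "w \<in> F_diff n V \<P> sg lam 1 ` carrier (?F 1)"
      then show "w \<in> {v \<in> carrier (?F 0). v triv_class \<in> hom_ideal}"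
        using F_diff_carrier[of 1] F_diff_hom_ideal by force
    next
      fix w assume w: "w \<in> {v \<in> carrier (?F 0). v triv_class \<in> hom_ideal}"
      then have "w triv_class \<in> (\<lambda>v. F_diff n V \<P> sg lam 1 v triv_class) ` carrier (?F 1)" unfolding
          image_F1 by simp
      then obtain v where v: "v \<in> carrier (?F 1)" "w triv_class = F_diff n V \<P> sg lam 1 v triv_class" by blast
      have "F_diff n V \<P> sg lam 1 v \<in> carrier (?F 0)" using F_diff_carrier[of 1 v] v(1) by simp
      then have "w = F_diff n V \<P> sg lam 1 v"
      proof (intro ext)
        fix C
        have z: "x C = 0" if "x \<in> carrier (?F 0)" "C \<noteq> triv_class" for x
          using that unfolding free_module_carrier F_basis_0 by simp
        show "w C = F_diff n V \<P> sg lam 1 v C"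
          using v(2) z[of w] z[of "F_diff n V \<P> sg lam 1 v"] w \<open>F_diff n V \<P> sg lam 1 v \<in> carrier (?F 0)\<close>
          by (cases "C = triv_class") simp_all
      qed
      then show "w \<in> F_diff n V \<P> sg lam 1 ` carrier (?F 1)" using v(1) by blast
    qed
  qed
  show ?thesis unfolding free_resolution_def
    using F_diff_hom F_exact augh surj ker by blast
qed

section \<open>Minimality: every matrix entry is a multiple of a variable\<close>

lemma irr_gens: "{[:X i:] | i. i \<in> {1..n}} \<union> {tvar} \<subseteq> {p :: 'a::comm_ring_1 mpol poly. in_Rnt n p}"
  by (auto simp: X_def intro!: in_Rnt_const in_Rn_single)

lemma F_coeff_irr:
  assumes "c \<in> F_basis n \<P> j" "j \<ge> 1" "f \<in> contractible_edges n \<P> c"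
  shows "F_coeff n V \<P> sg lam c f \<in> (irrelevant_ideal n :: 'a::field mpol poly set)"
proof -
  have J: "ideal (irrelevant_ideal n :: 'a mpol poly set) (Rnt n)"
    unfolding irrelevant_ideal_def by (rule Rnt_genideal(1)[OF irr_gens])
  obtain A p where I: "(A, p) \<in> indices j" "c = chip_class A p" using assms(1) unfolding F_basis_eq by auto
  have A: "A \<subseteq> cuts" "1 \<le> p" "p < card A" using indicesD[OF I(1) assms(2)] by auto
  obtain q d where q: "f = cut_edge A q d" "q \<in> A" "may_contract A p d"
    using assms(3) unfolding I(2) contractible_edges_chip_class[OF A] by blast
  have "\<exists>x\<in>{1..n}. \<exists>r. edge_exp A q d = r + unit_exp x \<and> keys r \<subseteq> {1..n}"
  proof (cases "card A = 2")
    case True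
    define R where "R = (if d then {q} else A - {q})"
    have e: "edge_exp A q d = unit_exp (if q \<in> R then vtx q else vtx (Suc q)) + cut_exp (A - {q}) (R - {q})"
      unfolding edge_exp_def R_def using True cut_exp_remove[OF finite_subset_cuts[OF A(1)] q(2)] by simp
    define y where "y = (if q \<in> R then q else Suc q)"
    have "edge_exp A q d = cut_exp (A - {q}) (R - {q}) + unit_exp (vtx y)"
      unfolding e y_def by (simp add: add.commute)
    then show ?thesis using vtx_in[of y] keys_cut_exp[of "A - {q}" "R - {q}"] by blast
  next
    case False
    then have "edge_exp A q d = 0 + unit_exp (if d then vtx q else vtx (Suc q))" by (simp add: edge_exp_def)
    moreover have "(if d then vtx q else vtx (Suc q)) \<in> {1..n}" using vtx_in by simp
    moreover have "keys (0 :: nat \<Rightarrow>\<^sub>0 nat) \<subseteq> {1..n}" by simp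
    ultimately show ?thesis by blast
  qed
  then obtain x r where x: "x \<in> {1..n}" "edge_exp A q d = r + unit_exp x" "keys r \<subseteq> {1..n}" by blast
  let ?z = "of_int (sg (chip_class A p) (cut_edge A q d)) :: 'a"
  have "F_coeff n V \<P> sg lam c f = Polynomial.monom (single r ?z) (t_exp A p q d) * [:X x:]"
    unfolding I(2) q(1) F_coeff_eq[OF I(1) assms(2) q(2,3)] x(2) X_def
    by (simp only: monom_0[symmetric] mult_monom mult_single unit_exp_def) simp
  moreover have "[:X x:] \<in> (irrelevant_ideal n :: 'a mpol poly set)"
    unfolding irrelevant_ideal_def using Rnt_genideal(2)[OF irr_gens] x(1) by blast
  ultimately show ?thesis using Rnt_idealD(4)[OF J in_Rnt_monom[OF in_Rn_single[OF x(3)]]] by metis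
qed

lemma F_minimal: "minimal_complex (Rnt n) (irrelevant_ideal n :: 'a::field mpol poly set) (F_basis n \<P>)
    (F_diff n V \<P> sg lam)"
  unfolding minimal_complex_def
proof (intro allI impI ballI)
  fix j :: nat and b b' assume j: "1 \<le> j"
  have J: "ideal (irrelevant_ideal n :: 'a mpol poly set) (Rnt n)"
    unfolding irrelevant_ideal_def by (rule Rnt_genideal(1)[OF irr_gens])
  have bT: "in_Rnt n (basis_vec (Rnt n) c c' :: 'a mpol poly)" for c c' by (simp add: basis_vec_eq)
  show "F_diff n V \<P> sg lam j (basis_vec (Rnt n) b) b' \<in> (irrelevant_ideal n :: 'a mpol poly set)"
    unfolding F_diff_def
  proof (rule Rnt_ideal_sum[OF J], rule Rnt_idealD(4)[OF J bT], rule Rnt_ideal_sum[OF J])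
    fix c f assume "c \<in> F_basis n \<P> j" "f \<in> contractible_edges n \<P> c"
    from Rnt_idealD(4)[OF J bT F_coeff_irr[OF this(1) j this(2)]]
    show "F_coeff n V \<P> sg lam c f * basis_vec (Rnt n) (contract_class n \<P> c f) b'
        \<in> (irrelevant_ideal n :: 'a mpol poly set)"
      by (simp only: mult.commute)
  qed
qed

end

theorem theorem1p2:
  fixes n :: nat and \<P> :: "nat set set" and V :: "nat set"
    and sg :: "opart set \<Rightarrow> dedge \<Rightarrow> int"
  assumes "parcycle n \<P>" and "V \<in> \<P>" and "valid_signs n \<P> sg"
  shows "\<exists>lam \<in> natvecs n.
    (\<forall>U\<in>\<P> - {V}. (\<Sum>i\<in>{1..n}. int (lam i) * bvec n U i) > 0) \<and>
    groebner_degeneration n lam (toppling_ideal n \<P> :: ('a::field) mpol set)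
      (parking_ideal n \<P> V) \<and>
    free_resolution (Rnt n) (F_basis n \<P>) (F_diff n V \<P> sg lam)
      (quotient_module (Rnt n) (homogenized_ideal n lam (toppling_ideal n \<P> :: 'a mpol set))) \<and>
    minimal_complex (Rnt n) (irrelevant_ideal n :: 'a mpol poly set) (F_basis n \<P>)
      (F_diff n V \<P> sg lam)"
proof -
  have P: "n \<ge> 3" "partition_on {1..n} \<P>" using assms(1) by (auto simp: parcycle_def)
  \<comment> \<open>Any vertex of \<open>V\<close> can serve as the root; the weight vector depends
    on this choice.\<close>
  obtain v0 where v0: "v0 \<in> V" using partition_onD3[OF P(2)] assms(2) by fastforce
  have "v0 \<in> {1..n}" using v0 assms(2) partition_onD1[OF P(2)] by blast
  then interpret signed_parcycle n v0 \<P> V sg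
    by unfold_locales (use P assms v0 in auto)
  have "(\<Sum>i\<in>{1..n}. int (lam i) * bvec n U i) > 0" if U: "U \<in> \<P> - {V}" for U
  proof (rule lam_bvec)
    show "U \<subseteq> {1..n}" using U partition_onD1[OF P(2)] by blast
    show "U \<noteq> {}" using U partition_onD3[OF P(2)] by auto
    have "U \<in> \<P>" "U \<noteq> V" using U by simp_all
    then have "U \<inter> V = {}" by (rule disjointD[OF partition_onD2[OF P(2)] _ assms(2)])
    then have "v0 \<notin> U" using v0V by blast
    then show "vtx 0 \<notin> U" by (simp only: vtx_0 not_False_eq_True)
  qed
  then have "\<forall>U\<in>\<P> - {V}. (\<Sum>i\<in>{1..n}. int (lam i) * bvec n U i) > 0" by simp
  then show ?thesis by (intro bexI[of _ lam] conjI lam_natvec groebner F_resolution F_minimal)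
qed

end
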